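(* Fix $\mu\ge 0$. Problem (FLQ), i.e. the problem of minimizing $\bar J(\mu)$ over $u=(u^L_{0:N},u^R_{0:N})\in\mathcal U_{ad}$, has a unique solution if and only if $M_k>0$, $\Upsilon_k>0$ and $\Lambda_k>0$ for $k=N,\dots,0$. In this case, the optimal controllers of Problem (FLQ) are $$u_k^{R*}=-[0\ \ I]\big(K_k\hat x^{R*}_{k|k}+\bar K_k\mathbb E\hat x^{R*}_{k|k}\big),$$ $$u_k^{L*}=-[I\ \ 0]\big(K_k\hat x^{R*}_{k|k}+\bar K_k\mathbb E\hat x^{R*}_{k|k}\big)-\Lambda_k^{-1}L_k\big(\hat x^{L*}_{k|k}-\hat x^{R*}_{k|k}\big),$$ where $\hat x^{L*}_{k|k}$ and $\hat x^{R*}_{k|k}$ are the local and remote estimates of the optimal state $x_k^*$. Furthermore, the optimal cost $\bar J^*(\mu)=\min_{u\in\mathcal U_{ad}}\bar J(\mu)$ is $$\bar J^*(\mu)=\mathbb E\Big\{x_0'\big[Z_0\hat x^R_{0|0}+X_0(\hat x^L_{0|0}-\hat x^R_{0|0})+S_0\mathbb E\hat x^R_{0|0}\big]\Big\}+\sum_{k=0}^N C_k,$$ with $$\begin{aligned}C_k=\operatorname{tr}\Big\{&(1-p)\Sigma^L_{k|k}A'Z_{k+1}W_{k+1}CA+(1-p)Q_\omega Z_{k+1}W_{k+1}C+p\,\Sigma^L_{k|k}A'C'W_{k+1}'X_{k+1}W_{k+1}CA\\&+p\,Q_\omega C'W_{k+1}'X_{k+1}W_{k+1}C+p\,Q_v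W_{k+1}'X_{k+1}W_{k+1}+Q_\omega\Sigma^L_{k|k}\Big\}.\end{aligned}$$
   Context: Prime denotes transpose; for a symmetric matrix, $>0$ ($\ge0$) means positive (semi-)definite. System: $x_{k+1}=Ax_k+B^Lu_k^L+B^Ru_k^R+\omega_k$, $k=0,\dots,N$, with state $x_k\in\mathbb R^n$, local control $u_k^L\in\mathbb R^{m_1}$, remote control $u_k^R\in\mathbb R^{m_2}$. The initial state $x_0$ is Gaussian with mean $\bar x_0$ and covariance $\Sigma_{init}$; $\{\omega_k\}$ is i.i.d. Gaussian with mean $0$ and covariance $Q_\omega$. Observations: $y_k^L=Cx_k+v_k\in\mathbb R^n$ (local) and $y_k^R=\eta_k\hat x^L_{k|k}\in\mathbb R^n$ (remote), where $\{v_k\}$ is i.i.d. Gaussian with mean $0$ and covariance $Q_v$, and $\{\eta_k\}$ are i.i.d. Bernoulli variables with $\mathbb P(\eta_k=0)=p$ (channel failure) and $\mathbb P(\eta_k=1)=1-p$ (success). $x_0,\{\omega_k\},\{v_k\},\{\eta_k\}$ are mutually independent. Information: $\mathcal F^L_k=\sigma(y^L_0,\dots,y^L_k,y^R_0,\dots,y^R_k)$, $\mathcal F^R_k=\sigma(y^R_0,\dots,y^R_k)$. Estimates: $\hat x^L_{k|k}=\mathbb E[x_k\mid\mathcal F^L_k]$, $\hat x^R_{k|k}=\mathbb E[x_k\mid\mathcal F^R_k]$. The admissible set $\mathcal U_{ad}$ consists of all $u=(u^L_{0:N},u^R_{0:N})$ such that $u_k^L$ is $\mathcal F^L_k$-measurable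 and $u_k^R$ is $\mathcal F^R_k$-measurable for $k=0,\dots,N$. Cost: $Q,R^L,R^R,G\ge0$, $Q_\mu=Q+\mu Q$, $G_\mu=G+\mu Q$, and $$\begin{aligned}\bar J(\mu)=\mathbb E\Big\{&\sum_{k=0}^N\big[x_k'Q_\mu x_k-\mu\,\mathbb E x_k'\,Q\,\mathbb E x_k+(u_k^L)'R^Lu_k^L+(u_k^R)'R^Ru_k^R\big]\\&+x_{N+1}'G_\mu x_{N+1}-\mu\,\mathbb Ex_{N+1}'\,Q\,\mathbb Ex_{N+1}\Big\}.\end{aligned}$$ Block notation: $B=[B^L\ B^R]$, $R=\operatorname{diag}(R^L,R^R)$; $[I\ 0]$ and $[0\ I]$ extract from a vector of $\mathbb R^{m_1+m_2}$ the first $m_1$ and the last $m_2$ components. Riccati recursions (run backward from $k=N$, as long as the inverses exist), with $Z_{N+1}=X_{N+1}=G_\mu$, $S_{N+1}=-\mu Q$: $Z_k=A'Z_{k+1}A+Q_\mu-K_k'\Upsilon_kK_k$, $X_k=A'\Theta_{k+1}A+Q_\mu-L_k'\Lambda_k^{-1}L_k$, $S_k=A'S_{k+1}A-\mu Q+K_k'\Upsilon_kK_k-N_k'M_k^{-1}N_k$, where $\Upsilon_k=B'Z_{k+1}B+R$, $K_k=\Upsilon_k^{-1}B'Z_{k+1}A$, $M_k=B'Z_{k+1}B+B'S_{k+1}B+R$, $N_k=B'Z_{k+1}A+B'S_{k+1}A$, $\bar K_k=M_k^{-1}N_k-\Upsilon_k^{-1}B'Z_{k+1}A$, $\Theta_k=(1-p)Z_k+pX_k$,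 $\Lambda_k=(B^L)'\Theta_{k+1}B^L+R^L$, $L_k=(B^L)'\Theta_{k+1}A$. Filter quantities: $W_k=\Sigma^L_{k|k-1}C'(C\Sigma^L_{k|k-1}C'+Q_v)^{-1}$, $\Sigma^L_{k|k-1}=A\Sigma^L_{k-1|k-1}A'+Q_\omega$, $\Sigma^L_{k|k}=(I-W_kC)\Sigma^L_{k|k-1}(I-W_kC)'+W_kQ_vW_k'$, $\Sigma^L_{0|-1}=\Sigma_{init}$.
   Formalization: Printed cost is false: last summand of C_k is now Q_μΣ^L_{k|k} (not Q_ωΣ^L_{k|k}) and tr(G_μΣ^L_{N+1|N+1}) is added; cost formula assumes CΣ^L_{k|k-1}C'+Q_v invertible; controls are square integrable; y^R_k sends E[x_k|y^L_{0..k},y^R_{0..k-1}]. *)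

theory Defs
  imports "HOL-Probability.Probability"
begin

definition sym_psd :: "real^'n^'n \<Rightarrow> bool" where
  "sym_psd S \<longleftrightarrow> transpose S = S \<and> (\<forall>x. 0 \<le> x \<bullet> (S *v x))"

definition sym_pd :: "real^'n^'n \<Rightarrow> bool" where
  "sym_pd S \<longleftrightarrow> transpose S = S \<and> (\<forall>x. x \<noteq> 0 \<longrightarrow> 0 < x \<bullet> (S *v x))"

(* Every linear functional is univariate normal; a singular covariance is allowed, hence the
   separate case of a functional with variance zero. *)
definition gaussian_vec :: "'w measure \<Rightarrow> ('w \<Rightarrow> real^'n) \<Rightarrow> real^'n \<Rightarrow> real^'n^'n \<Rightarrow> bool" where
  "gaussian_vec M X m S \<longleftrightarrow>
     X \<in> borel_measurable M \<and> sym_psd S \<and>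
     (\<forall>a. if a \<bullet> (S *v a) = 0 then AE w in M. a \<bullet> X w = a \<bullet> m
          else distributed M lborel (\<lambda>w. a \<bullet> X w)
                 (normal_density (a \<bullet> m) (sqrt (a \<bullet> (S *v a)))))"

definition cond_exp_vec ::
    "'w measure \<Rightarrow> 'w measure \<Rightarrow> ('w \<Rightarrow> real^'n) \<Rightarrow> 'w \<Rightarrow> real^'n" where
  "cond_exp_vec M F X w = (\<chi> i. real_cond_exp M F (\<lambda>w. X w $ i) w)"

definition generated_by :: "'w measure \<Rightarrow> ('w \<Rightarrow> real^'n) set \<Rightarrow> 'w measure" where
  "generated_by M Y = sigma (space M) (\<Union>f\<in>Y. {f -` D \<inter> space M | D. D \<in> sets borel})"

record ('w, 'n, 'l, 'r) flq =
  Om      :: "'w measure"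
  horizon :: nat
  matA    :: "real^('n::finite)^'n"
  matBL   :: "real^('l::finite)^'n"
  matBR   :: "real^('r::finite)^'n"
  matC    :: "real^'n^'n"
  init    :: "'w \<Rightarrow> real^'n"
  procn   :: "nat \<Rightarrow> 'w \<Rightarrow> real^'n"
  measn   :: "nat \<Rightarrow> 'w \<Rightarrow> real^'n"
  chan    :: "nat \<Rightarrow> 'w \<Rightarrow> real"
  mean0   :: "real^'n"
  cov0    :: "real^'n^'n"
  covw    :: "real^'n^'n"
  covv    :: "real^'n^'n"
  loss    :: real
  matQ    :: "real^'n^'n"
  matRL   :: "real^'l^'l"
  matRR   :: "real^'r^'r"
  matG    :: "real^'n^'n"

datatype source = Init | Proc nat | Meas nat | Chan nat

fun source_events :: "('w, 'n::finite, 'l::finite, 'r::finite) flq \<Rightarrow> source \<Rightarrow> 'w set set" where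
  "source_events P Init = sets (vimage_algebra (space (Om P)) (init P) borel)"
| "source_events P (Proc k) = sets (vimage_algebra (space (Om P)) (procn P k) borel)"
| "source_events P (Meas k) = sets (vimage_algebra (space (Om P)) (measn P k) borel)"
| "source_events P (Chan k) = sets (vimage_algebra (space (Om P)) (chan P k) borel)"

definition flq_model :: "('w, 'n::finite, 'l::finite, 'r::finite) flq \<Rightarrow> bool" where
  "flq_model P \<longleftrightarrow>
     prob_space (Om P) \<and>
     gaussian_vec (Om P) (init P) (mean0 P) (cov0 P) \<and>
     (\<forall>k\<le>horizon P. gaussian_vec (Om P) (procn P k) 0 (covw P)) \<and>
     (\<forall>k\<le>horizon P. gaussian_vec (Om P) (measn P k) 0 (covv P)) \<and>
     (\<forall>k\<le>horizon P. chan P k \<in> borel_measurable (Om P) \<and>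
        measure (Om P) {w \<in> space (Om P). chan P k w = 0} = loss P \<and>
        measure (Om P) {w \<in> space (Om P). chan P k w = 1} = 1 - loss P) \<and>
     prob_space.indep_sets (Om P) (source_events P)
       ({Init} \<union> Proc ` {..horizon P} \<union> Meas ` {..horizon P} \<union> Chan ` {..horizon P}) \<and>
     sym_psd (matQ P) \<and> sym_psd (matRL P) \<and> sym_psd (matRR P) \<and> sym_psd (matG P)"

type_synonym ('w, 'l, 'r) control =
  "(nat \<Rightarrow> 'w \<Rightarrow> real^'l) \<times> (nat \<Rightarrow> 'w \<Rightarrow> real^'r)"

primrec state ::
    "('w, 'n::finite, 'l::finite, 'r::finite) flq \<Rightarrow> ('w, 'l, 'r) control \<Rightarrow> nat \<Rightarrow> 'w \<Rightarrow> real^'n" where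
  "state P u 0 = init P"
| "state P u (Suc k) =
     (\<lambda>w. matA P *v state P u k w + matBL P *v fst u k w + matBR P *v snd u k w + procn P k w)"

definition obsL ::
    "('w, 'n::finite, 'l::finite, 'r::finite) flq \<Rightarrow> ('w, 'l, 'r) control \<Rightarrow> nat \<Rightarrow> 'w \<Rightarrow> real^'n" where
  "obsL P u k w = matC P *v state P u k w + measn P k w"

(* The equation  yR_k = eta_k * E[x_k | FL_k]  is circular as it stands, since FL_k contains yR_k.
   The transmitted packet is computed before the channel acts, i.e. from yL_0, ..., yL_k and
   yR_0, ..., yR_(k-1).  As eta_k is independent of x_k and of these observations, the packet is
   almost surely equal to E[x_k | FL_k] for every admissible control. *)
function obsR ::
    "('w, 'n::finite, 'l::finite, 'r::finite) flq \<Rightarrow> ('w, 'l, 'r) control \<Rightarrow> nat \<Rightarrow> 'w \<Rightarrow> real^'n" where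
  "obsR P u k =
     (\<lambda>w. chan P k w *\<^sub>R
        cond_exp_vec (Om P)
          (generated_by (Om P) (obsL P u ` {..k} \<union> (\<lambda>j. obsR P u j) ` {..<k}))
          (state P u k) w)"
  by pat_completeness auto
termination
  by (relation "Wellfounded.measure (\<lambda>(P, u, k). k)") auto

declare obsR.simps [simp del]

definition FL ::
    "('w, 'n::finite, 'l::finite, 'r::finite) flq \<Rightarrow> ('w, 'l, 'r) control \<Rightarrow> nat \<Rightarrow> 'w measure" where
  "FL P u k = generated_by (Om P) (obsL P u ` {..k} \<union> obsR P u ` {..k})"

definition FR ::
    "('w, 'n::finite, 'l::finite, 'r::finite) flq \<Rightarrow> ('w, 'l, 'r) control \<Rightarrow> nat \<Rightarrow> 'w measure" where
  "FR P u k = generated_by (Om P) (obsR P u ` {..k})"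

definition estL ::
    "('w, 'n::finite, 'l::finite, 'r::finite) flq \<Rightarrow> ('w, 'l, 'r) control \<Rightarrow> nat \<Rightarrow> 'w \<Rightarrow> real^'n" where
  "estL P u k = cond_exp_vec (Om P) (FL P u k) (state P u k)"

definition estR ::
    "('w, 'n::finite, 'l::finite, 'r::finite) flq \<Rightarrow> ('w, 'l, 'r) control \<Rightarrow> nat \<Rightarrow> 'w \<Rightarrow> real^'n" where
  "estR P u k = cond_exp_vec (Om P) (FR P u k) (state P u k)"

(* Square integrability makes the means, the conditional expectations and the cost meaningful. *)
definition admissible ::
    "('w, 'n::finite, 'l::finite, 'r::finite) flq \<Rightarrow> ('w, 'l, 'r) control \<Rightarrow> bool" where
  "admissible P u \<longleftrightarrow> (\<forall>k\<le>horizon P.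
     fst u k \<in> borel_measurable (FL P u k) \<and> integrable (Om P) (\<lambda>w. (norm (fst u k w))\<^sup>2) \<and>
     snd u k \<in> borel_measurable (FR P u k) \<and> integrable (Om P) (\<lambda>w. (norm (snd u k w))\<^sup>2))"

definition Qmu :: "('w, 'n::finite, 'l::finite, 'r::finite) flq \<Rightarrow> real \<Rightarrow> real^'n^'n" where
  "Qmu P \<mu> = matQ P + \<mu> *\<^sub>R matQ P"

definition Gmu :: "('w, 'n::finite, 'l::finite, 'r::finite) flq \<Rightarrow> real \<Rightarrow> real^'n^'n" where
  "Gmu P \<mu> = matG P + \<mu> *\<^sub>R matQ P"

definition cost ::
    "('w, 'n::finite, 'l::finite, 'r::finite) flq \<Rightarrow> real \<Rightarrow> ('w, 'l, 'r) control \<Rightarrow> real" where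
  "cost P \<mu> u =
    (let x = state P u; N = horizon P; Ex = (\<lambda>k. integral\<^sup>L (Om P) (x k)) in
     integral\<^sup>L (Om P) (\<lambda>w.
       (\<Sum>k\<le>N. x k w \<bullet> (Qmu P \<mu> *v x k w) - \<mu> * (Ex k \<bullet> (matQ P *v Ex k))
          + fst u k w \<bullet> (matRL P *v fst u k w) + snd u k w \<bullet> (matRR P *v snd u k w))
       + x (Suc N) w \<bullet> (Gmu P \<mu> *v x (Suc N) w)
       - \<mu> * (Ex (Suc N) \<bullet> (matQ P *v Ex (Suc N)))))"

definition is_solution ::
    "('w, 'n::finite, 'l::finite, 'r::finite) flq \<Rightarrow> real \<Rightarrow> ('w, 'l, 'r) control \<Rightarrow> bool" where
  "is_solution P \<mu> u \<longleftrightarrow> admissible P u \<and> (\<forall>u'. admissible P u' \<longrightarrow> cost P \<mu> u \<le> cost P \<mu> u')"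

(* Controls are identified when they agree almost surely at the times 0, ..., N. *)
definition has_unique_solution ::
    "('w, 'n::finite, 'l::finite, 'r::finite) flq \<Rightarrow> real \<Rightarrow> bool" where
  "has_unique_solution P \<mu> \<longleftrightarrow>
     (\<exists>u. is_solution P \<mu> u \<and>
        (\<forall>u'. is_solution P \<mu> u' \<longrightarrow>
           (\<forall>k\<le>horizon P. AE w in Om P. fst u' k w = fst u k w \<and> snd u' k w = snd u k w)))"

definition matB :: "('w, 'n::finite, 'l::finite, 'r::finite) flq \<Rightarrow> real^('l + 'r)^'n" where
  "matB P = (\<chi> i j. case j of Inl a \<Rightarrow> matBL P $ i $ a | Inr b \<Rightarrow> matBR P $ i $ b)"

definition matR :: "('w, 'n::finite, 'l::finite, 'r::finite) flq \<Rightarrow> real^('l + 'r)^('l + 'r)" where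
  "matR P = (\<chi> i j. case (i, j) of
      (Inl a, Inl b) \<Rightarrow> matRL P $ a $ b
    | (Inr a, Inr b) \<Rightarrow> matRR P $ a $ b
    | _ \<Rightarrow> 0)"

definition blockL :: "real^('l::finite + 'r::finite) \<Rightarrow> real^'l" where
  "blockL x = (\<chi> a. x $ Inl a)"

definition blockR :: "real^('l::finite + 'r::finite) \<Rightarrow> real^'r" where
  "blockR x = (\<chi> b. x $ Inr b)"

(* One backward step: the functions with suffix _of take the values at time k+1. If an inverse
   fails to exist at some time, the values at earlier times carry no meaning; the conditions below
   are imposed at all times 0, ..., N and then already fail at that time. *)

definition Upsilon_of ::
    "('w, 'n::finite, 'l::finite, 'r::finite) flq \<Rightarrow> real^'n^'n \<Rightarrow> real^('l + 'r)^('l + 'r)" where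
  "Upsilon_of P Z = transpose (matB P) ** Z ** matB P + matR P"

definition K_of ::
    "('w, 'n::finite, 'l::finite, 'r::finite) flq \<Rightarrow> real^'n^'n \<Rightarrow> real^'n^('l + 'r)" where
  "K_of P Z = matrix_inv (Upsilon_of P Z) ** transpose (matB P) ** Z ** matA P"

definition Lambda_of ::
    "('w, 'n::finite, 'l::finite, 'r::finite) flq \<Rightarrow> real^'n^'n \<Rightarrow> real^'l^'l" where
  "Lambda_of P T = transpose (matBL P) ** T ** matBL P + matRL P"

definition L_of ::
    "('w, 'n::finite, 'l::finite, 'r::finite) flq \<Rightarrow> real^'n^'n \<Rightarrow> real^'n^'l" where
  "L_of P T = transpose (matBL P) ** T ** matA P"

definition M_of ::
    "('w, 'n::finite, 'l::finite, 'r::finite) flq \<Rightarrow> real^'n^'n \<Rightarrow> real^'n^'n \<Rightarrow>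
     real^('l + 'r)^('l + 'r)" where
  "M_of P Z S =
     transpose (matB P) ** Z ** matB P + transpose (matB P) ** S ** matB P + matR P"

definition N_of ::
    "('w, 'n::finite, 'l::finite, 'r::finite) flq \<Rightarrow> real^'n^'n \<Rightarrow> real^'n^'n \<Rightarrow>
     real^'n^('l + 'r)" where
  "N_of P Z S = transpose (matB P) ** Z ** matA P + transpose (matB P) ** S ** matA P"

function ricZ :: "('w, 'n::finite, 'l::finite, 'r::finite) flq \<Rightarrow> real \<Rightarrow> nat \<Rightarrow> real^'n^'n" where
  "ricZ P \<mu> k =
     (if horizon P < k then Gmu P \<mu>
      else let Z = ricZ P \<mu> (Suc k); K = K_of P Z in
        transpose (matA P) ** Z ** matA P + Qmu P \<mu> - transpose K ** Upsilon_of P Z ** K)"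
  by pat_completeness auto
termination
  by (relation "Wellfounded.measure (\<lambda>(P, \<mu>, k). Suc (horizon P) - k)") auto

function ricX :: "('w, 'n::finite, 'l::finite, 'r::finite) flq \<Rightarrow> real \<Rightarrow> nat \<Rightarrow> real^'n^'n" where
  "ricX P \<mu> k =
     (if horizon P < k then Gmu P \<mu>
      else let T = (1 - loss P) *\<^sub>R ricZ P \<mu> (Suc k) + loss P *\<^sub>R ricX P \<mu> (Suc k); L = L_of P T in
        transpose (matA P) ** T ** matA P + Qmu P \<mu>
          - transpose L ** matrix_inv (Lambda_of P T) ** L)"
  by pat_completeness auto
termination
  by (relation "Wellfounded.measure (\<lambda>(P, \<mu>, k). Suc (horizon P) - k)") auto

function ricS :: "('w, 'n::finite, 'l::finite, 'r::finite) flq \<Rightarrow> real \<Rightarrow> nat \<Rightarrow> real^'n^'n" where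
  "ricS P \<mu> k =
     (if horizon P < k then - (\<mu> *\<^sub>R matQ P)
      else let Z = ricZ P \<mu> (Suc k); S = ricS P \<mu> (Suc k); K = K_of P Z; N = N_of P Z S in
        transpose (matA P) ** S ** matA P - \<mu> *\<^sub>R matQ P
          + transpose K ** Upsilon_of P Z ** K
          - transpose N ** matrix_inv (M_of P Z S) ** N)"
  by pat_completeness auto
termination
  by (relation "Wellfounded.measure (\<lambda>(P, \<mu>, k). Suc (horizon P) - k)") auto

declare ricZ.simps [simp del] ricX.simps [simp del] ricS.simps [simp del]

definition Theta :: "('w, 'n::finite, 'l::finite, 'r::finite) flq \<Rightarrow> real \<Rightarrow> nat \<Rightarrow> real^'n^'n" where
  "Theta P \<mu> k = (1 - loss P) *\<^sub>R ricZ P \<mu> k + loss P *\<^sub>R ricX P \<mu> k"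

definition Upsilon ::
    "('w, 'n::finite, 'l::finite, 'r::finite) flq \<Rightarrow> real \<Rightarrow> nat \<Rightarrow> real^('l + 'r)^('l + 'r)" where
  "Upsilon P \<mu> k = Upsilon_of P (ricZ P \<mu> (Suc k))"

definition gainK ::
    "('w, 'n::finite, 'l::finite, 'r::finite) flq \<Rightarrow> real \<Rightarrow> nat \<Rightarrow> real^'n^('l + 'r)" where
  "gainK P \<mu> k = K_of P (ricZ P \<mu> (Suc k))"

definition Mmat ::
    "('w, 'n::finite, 'l::finite, 'r::finite) flq \<Rightarrow> real \<Rightarrow> nat \<Rightarrow> real^('l + 'r)^('l + 'r)" where
  "Mmat P \<mu> k = M_of P (ricZ P \<mu> (Suc k)) (ricS P \<mu> (Suc k))"

definition Nmat ::
    "('w, 'n::finite, 'l::finite, 'r::finite) flq \<Rightarrow> real \<Rightarrow> nat \<Rightarrow> real^'n^('l + 'r)" where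
  "Nmat P \<mu> k = N_of P (ricZ P \<mu> (Suc k)) (ricS P \<mu> (Suc k))"

definition gainKbar ::
    "('w, 'n::finite, 'l::finite, 'r::finite) flq \<Rightarrow> real \<Rightarrow> nat \<Rightarrow> real^'n^('l + 'r)" where
  "gainKbar P \<mu> k =
     matrix_inv (Mmat P \<mu> k) ** Nmat P \<mu> k
     - matrix_inv (Upsilon P \<mu> k) ** transpose (matB P) ** ricZ P \<mu> (Suc k) ** matA P"

definition Lambda ::
    "('w, 'n::finite, 'l::finite, 'r::finite) flq \<Rightarrow> real \<Rightarrow> nat \<Rightarrow> real^'l^'l" where
  "Lambda P \<mu> k = Lambda_of P (Theta P \<mu> (Suc k))"

definition gainL ::
    "('w, 'n::finite, 'l::finite, 'r::finite) flq \<Rightarrow> real \<Rightarrow> nat \<Rightarrow> real^'n^'l" where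
  "gainL P \<mu> k = L_of P (Theta P \<mu> (Suc k))"

definition innov_cov ::
    "('w, 'n::finite, 'l::finite, 'r::finite) flq \<Rightarrow> real^'n^'n \<Rightarrow> real^'n^'n" where
  "innov_cov P S = matC P ** S ** transpose (matC P) + covv P"

definition W_of :: "('w, 'n::finite, 'l::finite, 'r::finite) flq \<Rightarrow> real^'n^'n \<Rightarrow> real^'n^'n" where
  "W_of P S = S ** transpose (matC P) ** matrix_inv (innov_cov P S)"

definition filt_of :: "('w, 'n::finite, 'l::finite, 'r::finite) flq \<Rightarrow> real^'n^'n \<Rightarrow> real^'n^'n" where
  "filt_of P S =
     (mat 1 - W_of P S ** matC P) ** S ** transpose (mat 1 - W_of P S ** matC P)
     + W_of P S ** covv P ** transpose (W_of P S)"

primrec cov_pred ::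
    "('w, 'n::finite, 'l::finite, 'r::finite) flq \<Rightarrow> nat \<Rightarrow> real^'n^'n" where
  "cov_pred P 0 = cov0 P"
| "cov_pred P (Suc k) = matA P ** filt_of P (cov_pred P k) ** transpose (matA P) + covw P"

definition cov_filt ::
    "('w, 'n::finite, 'l::finite, 'r::finite) flq \<Rightarrow> nat \<Rightarrow> real^'n^'n" where
  "cov_filt P k = filt_of P (cov_pred P k)"

definition gainW ::
    "('w, 'n::finite, 'l::finite, 'r::finite) flq \<Rightarrow> nat \<Rightarrow> real^'n^'n" where
  "gainW P k = W_of P (cov_pred P k)"

(* The last summand is E[(x_k - xL_k)' Q_mu (x_k - xL_k)], with xL_k the local estimate of x_k.
   The published formula has the noise covariance covw in place of Q_mu there, and it has no
   counterpart of terminal_term below. Without them it fails already for one scalar stage with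
   A = B = C = Q = 0, R = G = 1 and unit noise covariances: the optimal cost is E[(w_0)^2] = 1,
   while the published expression equals the variance of x_0. *)
definition cost_term ::
    "('w, 'n::finite, 'l::finite, 'r::finite) flq \<Rightarrow> real \<Rightarrow> nat \<Rightarrow> real" where
  "cost_term P \<mu> k =
    (let A = matA P; C = matC P; p = loss P; Sig = cov_filt P k; W = gainW P (Suc k);
         Z = ricZ P \<mu> (Suc k); X = ricX P \<mu> (Suc k) in
     trace
       ((1 - p) *\<^sub>R (Sig ** transpose A ** Z ** W ** C ** A)
        + (1 - p) *\<^sub>R (covw P ** Z ** W ** C)
        + p *\<^sub>R (Sig ** transpose A ** transpose C ** transpose W ** X ** W ** C ** A)
        + p *\<^sub>R (covw P ** transpose C ** transpose W ** X ** W ** C)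
        + p *\<^sub>R (covv P ** transpose W ** X ** W)
        + Qmu P \<mu> ** Sig))"

(* E[(x - xL)' G_mu (x - xL)] at time N+1, the terminal counterpart of that summand: the local
   estimation error at time N+1 does not vanish and is not covered by the ricZ, ricX terms. *)
definition terminal_term ::
    "('w, 'n::finite, 'l::finite, 'r::finite) flq \<Rightarrow> real \<Rightarrow> real" where
  "terminal_term P \<mu> = trace (Gmu P \<mu> ** cov_filt P (Suc (horizon P)))"

end

theory Submission
  imports Defs
begin

text \<open>
  Write the state as an uncontrolled part \<open>\<xi>\<close> plus a controlled part \<open>c\<close>. The packets are almost surely
  \<open>\<zeta> + c\<close>, where \<open>\<zeta>\<close> is the Kalman filter of \<open>\<xi>\<close>, so the local estimation error does not depend on the
  control. The only Gaussian input is that an uncorrelated Gaussian functional is orthogonal to the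
  sigma-algebra of the innovations and the channel; it is obtained from characteristic functions.

  The three definiteness conditions reduce to \<open>M\<^sub>k > 0\<close>, because \<open>0 \<le> Z + S \<le> Z \<le> X\<close> as quadratic forms,
  and \<open>M\<^sub>k > 0\<close> for all \<open>k\<close> means that the deterministic quadratic cost with weights \<open>Q\<close>, \<open>R\<close>, \<open>G\<close>
  is positive definite in the controls.

  Sufficiency: the estimates under the candidate feedback obey an explicit linear recursion driven by the
  innovations and the channel, and the gap between the two estimates is orthogonal to the remote
  information of every admissible control. Hence the first variation of the cost at the candidate telescopes to
  zero, while the second variation dominates the expected deterministic cost. The candidate is
  implementable although a received \<open>0\<close> is ambiguous: conditionally on the channel the packet is Gaussian, so
  either it almost never vanishes or it coincides with its prediction.

  Necessity: a deterministic direction of zero cost could be added to the optimal control. For all but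
  countably many amplitudes this loses no information, so uniqueness fails.
\<close>

text \<open>The information of both controllers depends on the control, so two admissible controls
  cannot be compared on a filtration of their own. \<open>GG a b\<close>, generated by the first
  \<open>a\<close> innovations and the first \<open>b\<close> channel states, is free of any control
  and contains, as \<open>GG (Suc k) (Suc k)\<close>, the information of every admissible control at
  time \<open>k\<close>; orthogonality of errors, innovations and channel states is proved once, for
  \<open>GG\<close>. The generated sigma-algebras are not completed, whereas the filter identities
  hold only almost surely. Hence a control is constructed by conditioning a target process on the
  information that this very control generates. The estimate gap is orthogonal to the remote
  information because it carries the factor \<open>1 - chan P k\<close>, and a failure at time
  \<open>k\<close> tells the remote side nothing new. This removes the one term of the first
  variation that the Riccati equations leave over, the pairing of the gap with the remote variation:
  the gap can be steered by the local control alone.\<close>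

context prob_space
begin

section \<open>Vanishing Fourier transforms and integrals over generated sigma-algebras\<close>

lemma integral_indicator_eq_of_char_eq:
  fixes h Y :: "'a \<Rightarrow> real"
  assumes h: "integrable M h" and Y [measurable]: "Y \<in> borel_measurable M"
    and char0: "\<And>t. (CLINT w|M. complex_of_real (h w) * iexp (t * Y w)) = 0"
    and D [measurable]: "D \<in> sets borel"
  shows "(LINT w|M. h w * indicator D (Y w)) = 0"
proof -
  have [measurable]: "h \<in> borel_measurable M" using h by auto
  \<comment> \<open>Levy's uniqueness theorem speaks of probability measures, so the signed weight
    is split into its two parts; \<open>char0\<close> at frequency 0 shows that both have the same
    mass \<open>c\<close>.\<close>
  define hp where "hp w = max 0 (h w)" for w
  define hn where "hn w = max 0 (- h w)" for w
  have [measurable]: "hp \<in> borel_measurable M" "hn \<in> borel_measurable M"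
    unfolding hp_def hn_def by measurable
  have ih: "integrable M hp" "integrable M hn"
    using integrable_max[OF _ h, of "\<lambda>_. 0"] integrable_max[of M "\<lambda>_. 0" "\<lambda>w. - h w"] h
    unfolding hp_def hn_def by auto
  have diff: "h w = hp w - hn w" and pos: "0 \<le> hp w" "0 \<le> hn w" for w
    by (auto simp: hp_def hn_def)
  have cint: "integrable M (\<lambda>w. complex_of_real (f w) * iexp (t * Y w))" if "integrable M f" for f t
    by (rule Bochner_Integration.integrable_bound[OF that])
      (use that in \<open>auto simp: norm_mult intro!: measurable_compose[OF borel_measurable_integrable]\<close>)
  have bint: "integrable M (\<lambda>w. f w * indicator D (Y w))" if "integrable M f" for f :: "'a \<Rightarrow> real"
    by (rule Bochner_Integration.integrable_bound[OF that])
      (use that in \<open>auto simp: indicator_def\<close>)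
  have eqc: "(CLINT w|M. complex_of_real (hp w) * iexp (t * Y w)) = (CLINT w|M. complex_of_real (hn w) * iexp (t * Y w))" for t
    using char0[of t] Bochner_Integration.integral_diff[OF cint[OF ih(1), of t] cint[OF ih(2), of t]]
    by (simp add: diff algebra_simps)
  define c where "c = integral\<^sup>L M hp"
  have "complex_of_real (integral\<^sup>L M hp) = complex_of_real (integral\<^sup>L M hn)"
    using eqc[of 0] by simp
  then have cn: "c = integral\<^sup>L M hn" unfolding c_def by simp
  have eqD: "(LINT w|M. hp w * indicator D (Y w)) = (LINT w|M. hn w * indicator D (Y w))"
  proof (cases "c = 0")
    case True
    have "AE w in M. hp w = 0" "AE w in M. hn w = 0"
      using integral_nonneg_eq_0_iff_AE[OF ih(1)] integral_nonneg_eq_0_iff_AE[OF ih(2)] pos True cn c_def by auto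
    then have "AE w in M. hp w * indicator D (Y w) = hn w * indicator D (Y w)" by eventually_elim auto
    then show ?thesis by (intro integral_cong_AE) auto
  next
    case False
    then have c: "c > 0" using pos unfolding c_def by (simp add: less_le integral_nonneg)
    \<comment> \<open>The law of \<open>Y\<close> after reweighting by \<open>f / c\<close>. Its
      characteristic function is the Fourier integral of \<open>f\<close> divided by
      \<open>c\<close>, so the laws for \<open>hp\<close> and \<open>hn\<close> coincide.\<close>
    define mu where "mu f = distr (density M (\<lambda>w. ennreal (f w / c))) borel Y" for f
    have prb: "real_distribution (mu f)" if "integrable M f" "\<And>w. 0 \<le> f w" "integral\<^sup>L M f = c" for f
    proof -
      have [measurable]: "f \<in> borel_measurable M" using that by auto
      have "emeasure (density M (\<lambda>w. ennreal (f w / c))) (space M) = (\<integral>\<^sup>+w. ennreal (f w / c) \<partial>M)"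
        by (subst emeasure_density) (auto intro!: nn_integral_cong)
      also have "\<dots> = ennreal (LINT w|M. f w / c)"
        using that c by (intro nn_integral_eq_integral) auto
      also have "\<dots> = 1" using that c by simp
      finally have "prob_space (density M (\<lambda>w. ennreal (f w / c)))" by (intro prob_spaceI) simp
      then have "prob_space (mu f)" unfolding mu_def by (intro prob_space.prob_space_distr) auto
      then show ?thesis unfolding mu_def by (intro real_distribution.intro real_distribution_axioms.intro) auto
    qed
    have chr: "char (mu f) t = (CLINT w|M. complex_of_real (f w) * iexp (t * Y w)) / c"
      if "integrable M f" "\<And>w. 0 \<le> f w" for f t
    proof -
      have [measurable]: "f \<in> borel_measurable M" using that by auto
      have "char (mu f) t = (CLINT w|density M (\<lambda>w. ennreal (f w / c)). iexp (t * Y w))"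
        unfolding char_def mu_def by (subst integral_distr) auto
      also have "\<dots> = (CLINT w|M. (f w / c) *\<^sub>R iexp (t * Y w))"
        using that c by (subst integral_density) auto
      also have "\<dots> = (CLINT w|M. (complex_of_real (f w) * iexp (t * Y w)) / c)"
        by (intro Bochner_Integration.integral_cong) (auto simp: scaleR_conv_of_real)
      finally show ?thesis by simp
    qed
    have "mu hp = mu hn"
      by (rule Levy_uniqueness[OF prb prb])
        (use eqc in \<open>auto simp: ih pos cn[symmetric] c_def[symmetric] chr fun_eq_iff\<close>)
    then have "measure (mu hp) D = measure (mu hn) D" by simp
    moreover have "measure (mu f) D = (LINT w|M. f w * indicator D (Y w)) / c"
      if "integrable M f" "\<And>w. 0 \<le> f w" "integral\<^sup>L M f = c" for f
    proof -
      have [measurable]: "f \<in> borel_measurable M" using that by auto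
      interpret mf: real_distribution "mu f" by (rule prb[OF that])
      have "measure (mu f) D = (LINT x|mu f. indicator D x)" by simp
      also have "\<dots> = (LINT w|density M (\<lambda>w. ennreal (f w / c)). indicator D (Y w))"
        unfolding mu_def by (subst integral_distr) auto
      also have "\<dots> = (LINT w|M. (f w / c) *\<^sub>R indicator D (Y w))"
        using that c by (subst integral_density) auto
      finally show ?thesis by simp
    qed
    ultimately show ?thesis using ih pos c cn c_def by auto
  qed
  have "(LINT w|M. h w * indicator D (Y w)) = (LINT w|M. hp w * indicator D (Y w) - hn w * indicator D (Y w))"
    by (simp add: diff algebra_simps)
  then show ?thesis
    using Bochner_Integration.integral_diff[OF bint[OF ih(1)] bint[OF ih(2)]] eqD by simp
qed

text \<open>The induction over several coordinates absorbs exponentials into the weight, which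
  therefore has to be complex. Since the transform vanishes at \<open>- t\<close> as well, it
  vanishes for the conjugate of \<open>h\<close>, hence for the real and the imaginary part.\<close>

lemma integral_indicator_eq_of_char_eq_complex:
  fixes h :: "'a \<Rightarrow> complex" and Y :: "'a \<Rightarrow> real"
  assumes h: "integrable M h" and Y [measurable]: "Y \<in> borel_measurable M"
    and char0: "\<And>t. (CLINT w|M. h w * iexp (t * Y w)) = 0"
    and D [measurable]: "D \<in> sets borel"
  shows "(CLINT w|M. h w * indicator D (Y w)) = 0"
proof -
  have [measurable]: "h \<in> borel_measurable M" using h by auto
  have [measurable]: "(\<lambda>w. cnj (h w)) \<in> borel_measurable M"
    by (rule measurable_compose[OF _ borel_measurable_continuous_onI]) (auto intro!: continuous_intros)
  have ci: "integrable M (\<lambda>w. h w * iexp (t * Y w))" for t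
    by (rule Bochner_Integration.integrable_bound[OF h]) (auto simp: norm_mult)
  have ci': "integrable M (\<lambda>w. cnj (h w) * iexp (t * Y w))" for t
    by (rule Bochner_Integration.integrable_bound[OF h]) (auto simp: norm_mult)
  have cn0: "(CLINT w|M. cnj (h w) * iexp (t * Y w)) = 0" for t
  proof -
    define f where "f w = h w * iexp ((- t) * Y w)" for w
    have "(CLINT w|M. cnj (h w) * iexp (t * Y w)) = (CLINT w|M. cnj (f w))"
      by (intro Bochner_Integration.integral_cong) (auto simp: f_def exp_cnj)
    also have "\<dots> = cnj (integral\<^sup>L M f)" by simp
    also have "integral\<^sup>L M f = 0" unfolding f_def using char0[of "- t"] by simp
    finally show ?thesis by simp
  qed
  have re: "(LINT w|M. Re (h w) * indicator D (Y w)) = 0"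
  proof (rule integral_indicator_eq_of_char_eq[OF _ Y _ D])
    show "integrable M (\<lambda>w. Re (h w))" using h by simp
    fix t
    have "(CLINT w|M. complex_of_real (Re (h w)) * iexp (t * Y w))
        = (CLINT w|M. (h w * iexp (t * Y w) + cnj (h w) * iexp (t * Y w)) / 2)"
      by (intro Bochner_Integration.integral_cong)
        (auto simp: complex_eq_iff field_simps)
    then show "(CLINT w|M. complex_of_real (Re (h w)) * iexp (t * Y w)) = 0"
      using ci ci' char0 cn0 by simp
  qed
  have im: "(LINT w|M. Im (h w) * indicator D (Y w)) = 0"
  proof (rule integral_indicator_eq_of_char_eq[OF _ Y _ D])
    show "integrable M (\<lambda>w. Im (h w))" using h by simp
    fix t
    have "(CLINT w|M. complex_of_real (Im (h w)) * iexp (t * Y w))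
        = (CLINT w|M. (h w * iexp (t * Y w) - cnj (h w) * iexp (t * Y w)) / (2 * \<i>))"
      by (intro Bochner_Integration.integral_cong)
        (auto simp: complex_eq_iff field_simps Re_divide Im_divide power2_eq_square)
    then show "(CLINT w|M. complex_of_real (Im (h w)) * iexp (t * Y w)) = 0"
      using ci ci' char0 cn0 by simp
  qed
  have i2: "integrable M (\<lambda>w. h w * indicator D (Y w))"
    by (rule Bochner_Integration.integrable_bound[OF h]) (auto simp: indicator_def)
  have "Re (h w * indicator D (Y w)) = Re (h w) * indicator D (Y w)"
    "Im (h w * indicator D (Y w)) = Im (h w) * indicator D (Y w)" for w by (auto simp: indicator_def)
  then have "Re (CLINT w|M. h w * indicator D (Y w)) = 0" "Im (CLINT w|M. h w * indicator D (Y w)) = 0"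
    using re im i2 by (simp_all del: times_complex.sel add: integral_Re[symmetric] integral_Im[symmetric])
  then show ?thesis by (simp add: complex_eq_iff)
qed

text \<open>Coordinates are traded one at a time. With the exponential of \<open>Y x\<close>
  absorbed into \<open>h\<close>, the induction hypothesis treats the other coordinates; with their
  indicators absorbed instead, the one-dimensional case turns the exponentials of \<open>Y x\<close>
  into an indicator.\<close>

lemma integral_rectangle_eq_0_of_fourier:
  fixes h :: "'a \<Rightarrow> complex" and Y :: "'j \<Rightarrow> 'a \<Rightarrow> real"
  assumes "finite J" "integrable M h" "\<And>j. j \<in> J \<Longrightarrow> Y j \<in> borel_measurable M"
    and "\<And>t. (CLINT w|M. h w * iexp (\<Sum>j\<in>J. t j * Y j w)) = 0"
    and "\<And>j. j \<in> J \<Longrightarrow> D j \<in> sets borel"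
  shows "(CLINT w|M. h w * (\<Prod>j\<in>J. indicator (D j) (Y j w))) = 0"
  using assms
proof (induction J arbitrary: h rule: finite_induct)
  case empty
  then show ?case by simp
next
  case (insert x F)
  have [measurable]: "Y j \<in> borel_measurable M" "D j \<in> sets borel" if "j \<in> insert x F" for j
    using insert.prems that by auto
  have hm [measurable]: "h \<in> borel_measurable M" using insert.prems by auto
  have Yx [measurable]: "Y x \<in> borel_measurable M" by simp
  have Dx: "D x \<in> sets borel" by simp
  have prodm [measurable]: "(\<lambda>w. \<Prod>j\<in>F. indicator (D j) (Y j w) :: complex) \<in> borel_measurable M"
    by (intro borel_measurable_prod) (use insert in \<open>auto intro!: measurable_compose[OF _ borel_measurable_indicator]\<close>)
  have sum_upd: "(\<Sum>j\<in>F. (t(x := s)) j * Y j w) = (\<Sum>j\<in>F. t j * Y j w)" for t s w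
    using insert.hyps by (intro sum.cong) auto
  have prodn: "norm (\<Prod>j\<in>F. indicator (D j) (Y j w) :: complex) \<le> 1" for w
    unfolding prod_norm[symmetric] by (intro prod_le_1) (auto simp: indicator_def)
  have step: "(CLINT w|M. (h w * iexp (s * Y x w)) * (\<Prod>j\<in>F. indicator (D j) (Y j w))) = 0" for s
  proof (rule insert.IH)
    show "integrable M (\<lambda>w. h w * iexp (s * Y x w))"
      by (rule Bochner_Integration.integrable_bound[OF insert.prems(1)]) (auto simp: norm_mult)
    fix t
    have "(CLINT w|M. h w * iexp (s * Y x w) * iexp (\<Sum>j\<in>F. t j * Y j w))
        = (CLINT w|M. h w * iexp (\<Sum>j\<in>insert x F. (t(x := s)) j * Y j w))"
      using insert.hyps sum_upd[of t s]
      by (intro Bochner_Integration.integral_cong) (simp_all del: fun_upd_apply add: exp_add[symmetric] distrib_left, simp_all)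
    then show "(CLINT w|M. h w * iexp (s * Y x w) * iexp (\<Sum>j\<in>F. t j * Y j w)) = 0"
      using insert.prems(3) by simp
  qed (use insert.prems in auto)
  have "(CLINT w|M. (h w * (\<Prod>j\<in>F. indicator (D j) (Y j w))) * indicator (D x) (Y x w)) = 0"
  proof (rule integral_indicator_eq_of_char_eq_complex)
    show "integrable M (\<lambda>w. h w * (\<Prod>j\<in>F. indicator (D j) (Y j w)))"
      by (rule Bochner_Integration.integrable_bound[OF insert.prems(1)])
        (auto simp: norm_mult intro!: mult_left_le prodn)
    show "(CLINT w|M. h w * (\<Prod>j\<in>F. indicator (D j) (Y j w)) * iexp (t * Y x w)) = 0" for t
      using step[of t] by (simp add: mult_ac)
  qed (use insert.prems in auto)
  then show ?case using insert.hyps by (simp add: mult_ac)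
qed

text \<open>Rectangles form an intersection-stable generator, and the events over which
  \<open>h\<close> integrates to zero are closed under complements and countable disjoint
  unions.\<close>

lemma integral_generated_eq_0_of_fourier:
  fixes h :: "'a \<Rightarrow> real" and Y :: "'j \<Rightarrow> 'a \<Rightarrow> real"
  assumes J: "finite J" and h: "integrable M h" and Y: "\<And>j. j \<in> J \<Longrightarrow> Y j \<in> borel_measurable M"
    and F0: "\<And>t. (CLINT w|M. complex_of_real (h w) * iexp (\<Sum>j\<in>J. t j * Y j w)) = 0"
    and A: "A \<in> sigma_sets (space M) (\<Union>j\<in>J. {Y j -` D \<inter> space M | D. D \<in> sets borel})"
  shows "(LINT w|M. h w * indicator A w) = 0"
proof -
  have [measurable]: "h \<in> borel_measurable M" using h by auto
  define G where "G = {{w \<in> space M. \<forall>j\<in>J. Y j w \<in> D j} | D. \<forall>j\<in>J. D j \<in> sets borel}"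
  have GM: "G \<subseteq> sets M"
  proof -
    have "{w \<in> space M. \<forall>j\<in>J. Y j w \<in> D j} \<in> sets M" if "\<forall>j\<in>J. D j \<in> sets borel" for D
      by (rule sets.sets_Collect_finite_All[OF _ J])
        (use Y that measurable_sets[OF Y] in \<open>auto simp: vimage_def Int_def conj_commute\<close>)
    then show ?thesis unfolding G_def by auto
  qed
  have rect: "(LINT w|M. h w * indicator A w) = 0" if "A \<in> G" for A
  proof -
    obtain D where D: "A = {w \<in> space M. \<forall>j\<in>J. Y j w \<in> D j}" "\<forall>j\<in>J. D j \<in> sets borel"
      using \<open>A \<in> G\<close> unfolding G_def by auto
    have "(CLINT w|M. complex_of_real (h w) * (\<Prod>j\<in>J. indicator (D j) (Y j w))) = 0"
      by (rule integral_rectangle_eq_0_of_fourier[OF J _ Y F0]) (use h D in auto)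
    also have "(CLINT w|M. complex_of_real (h w) * (\<Prod>j\<in>J. indicator (D j) (Y j w)))
        = (CLINT w|M. complex_of_real (h w * indicator A w))"
      using J D by (intro Bochner_Integration.integral_cong)
        (auto simp: indicator_def prod.If_cases)
    finally show ?thesis by (simp only: integral_complex_of_real of_real_eq_0_iff)
  qed
  have h0: "(LINT w|M. h w) = 0"
  proof -
    have "space M \<in> G" unfolding G_def by (auto intro!: exI[of _ "\<lambda>_. UNIV"])
    then have "(LINT w|M. h w * indicator (space M) w) = 0" by (rule rect)
    moreover have "(LINT w|M. h w * indicator (space M) w) = (LINT w|M. h w)"
      by (intro Bochner_Integration.integral_cong) auto
    ultimately show ?thesis by simp
  qed
  have stable: "Int_stable G"
  proof (rule Int_stableI)
    fix a b assume "a \<in> G" "b \<in> G"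
    then obtain D E where "a = {w \<in> space M. \<forall>j\<in>J. Y j w \<in> D j}" "\<forall>j\<in>J. D j \<in> sets borel"
      "b = {w \<in> space M. \<forall>j\<in>J. Y j w \<in> E j}" "\<forall>j\<in>J. E j \<in> sets borel"
      unfolding G_def by auto
    then show "a \<inter> b \<in> G" unfolding G_def by (auto intro!: exI[of _ "\<lambda>j. D j \<inter> E j"])
  qed
  have incl: "(\<Union>j\<in>J. {Y j -` D \<inter> space M | D. D \<in> sets borel}) \<subseteq> G"
  proof safe
    fix j and D :: "real set" assume "j \<in> J" "D \<in> sets borel"
    then have "Y j -` D \<inter> space M = {w \<in> space M. \<forall>i\<in>J. Y i w \<in> (if i = j then D else UNIV)}" by auto
    then show "Y j -` D \<inter> space M \<in> G" unfolding G_def using \<open>D \<in> sets borel\<close>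
      by (auto intro!: exI[of _ "\<lambda>i. if i = j then D else UNIV"])
  qed
  have AG: "A \<in> sigma_sets (space M) G" using A sigma_sets_mono[of _ "space M" G] incl
    by (meson sigma_sets_mono' subsetD)
  have Gsp: "G \<subseteq> Pow (space M)" unfolding G_def by auto
  have sM: "sigma_sets (space M) G \<subseteq> sets M" using GM by (rule sets.sigma_sets_subset)
  show ?thesis
    using stable Gsp AG
  proof (induction A rule: sigma_sets_induct_disjoint)
    case (basic A) then show ?case by (rule rect)
  next
    case empty then show ?case by simp
  next
    case (compl A)
    then have [measurable]: "A \<in> sets M" using sM by auto
    have "(LINT w|M. h w * indicator (space M - A) w) = (LINT w|M. h w - h w * indicator A w)"
      by (intro Bochner_Integration.integral_cong) (auto simp: indicator_def)
    also have "\<dots> = 0" using compl h h0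
      by (subst Bochner_Integration.integral_diff) (auto intro: integrable_real_mult_indicator)
    finally show ?case .
  next
    case (union A)
    then have [measurable]: "A i \<in> sets M" for i using sM by auto
    have "(LINT w:(\<Union>i. A i)|M. h w) = (\<Sum>i. (LINT w:A i|M. h w))"
      by (rule lebesgue_integral_countable_add)
        (use union h in \<open>auto simp: disjoint_family_on_def set_integrable_def intro!: integrable_mult_indicator[where f = h, simplified]\<close>)
    then show ?case using union(3) by (simp add: set_lebesgue_integral_def mult.commute)
  qed
qed

end

section \<open>Measurability of vector-valued maps\<close>

lemma borel_measurable_vec_iff:
  fixes X :: "'a \<Rightarrow> real^'n"
  shows "X \<in> borel_measurable F \<longleftrightarrow> (\<forall>i. (\<lambda>w. X w $ i) \<in> borel_measurable F)"
  by (subst borel_measurable_euclidean_space) (auto simp: Basis_vec_def inner_axis)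

lemma borel_measurable_vec_nth [measurable (raw)]:
  fixes X :: "'a \<Rightarrow> real^'n"
  shows "X \<in> borel_measurable F \<Longrightarrow> (\<lambda>w. X w $ i) \<in> borel_measurable F"
  by (simp add: borel_measurable_vec_iff)

lemma borel_measurable_matrix_vector_mult [measurable (raw)]:
  fixes X :: "'a \<Rightarrow> real^'n" and A :: "real^'n^'m"
  shows "X \<in> borel_measurable F \<Longrightarrow> (\<lambda>w. A *v X w) \<in> borel_measurable F"
  by (subst borel_measurable_vec_iff)
    (auto simp: matrix_vector_mult_def intro!: borel_measurable_sum borel_measurable_times borel_measurable_vec_nth)

lemma inner_matrix_vector_mult_sum:
  fixes S :: "real^'n^'m"
  shows "x \<bullet> (S *v y) = (\<Sum>i\<in>UNIV. \<Sum>j\<in>UNIV. S $ i $ j * (x $ i * y $ j))"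
  by (simp add: inner_vec_def matrix_vector_mult_def sum_distrib_left mult_ac)

section \<open>Square integrable random vectors\<close>

definition sqint :: "'a measure \<Rightarrow> ('a \<Rightarrow> real^'n) \<Rightarrow> bool" where
  "sqint M X \<longleftrightarrow> X \<in> borel_measurable M \<and> integrable M (\<lambda>w. (norm (X w))\<^sup>2)"

lemma sqint_measurable: "sqint M X \<Longrightarrow> X \<in> borel_measurable M"
  by (simp add: sqint_def)

lemma sqint_dominated:
  assumes "sqint M X" "Y \<in> borel_measurable M" "AE w in M. norm (Y w) \<le> C * norm (X w)"
  shows "sqint M Y"
  unfolding sqint_def
proof
  have "integrable M (\<lambda>w. C\<^sup>2 * (norm (X w))\<^sup>2)" using assms by (auto simp: sqint_def)
  moreover have "AE w in M. norm ((norm (Y w))\<^sup>2) \<le> norm (C\<^sup>2 * (norm (X w))\<^sup>2)"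
    using assms(3)
  proof eventually_elim
    case (elim w)
    then have "(norm (Y w))\<^sup>2 \<le> (C * norm (X w))\<^sup>2" by (intro power_mono) auto
    then show ?case by (simp add: power_mult_distrib)
  qed
  moreover have "(\<lambda>w. (norm (Y w))\<^sup>2) \<in> borel_measurable M" using assms(2) by simp
  ultimately show "integrable M (\<lambda>w. (norm (Y w))\<^sup>2)"
    using Bochner_Integration.integrable_bound by blast
qed (use assms in auto)

lemma sqint_add:
  assumes "sqint M X" "sqint M Y" shows "sqint M (\<lambda>w. X w + Y w)"
  unfolding sqint_def
proof
  have [measurable]: "X \<in> borel_measurable M" "Y \<in> borel_measurable M" using assms by (auto simp: sqint_def)
  show "(\<lambda>w. X w + Y w) \<in> borel_measurable M" by measurable
  have i: "integrable M (\<lambda>w. 2 * (norm (X w))\<^sup>2 + 2 * (norm (Y w))\<^sup>2)" using assms by (auto simp: sqint_def)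
  have "(norm (X w + Y w))\<^sup>2 \<le> 2 * (norm (X w))\<^sup>2 + 2 * (norm (Y w))\<^sup>2" for w
  proof -
    have "(norm (X w + Y w))\<^sup>2 + (norm (X w - Y w))\<^sup>2 = 2 * (norm (X w))\<^sup>2 + 2 * (norm (Y w))\<^sup>2"
      by (simp add: power2_norm_eq_inner inner_add inner_diff inner_commute algebra_simps)
    then show ?thesis by (smt (verit) zero_le_power2)
  qed
  then have ae: "AE w in M. norm ((norm (X w + Y w))\<^sup>2) \<le> norm (2 * (norm (X w))\<^sup>2 + 2 * (norm (Y w))\<^sup>2)" by simp
  have m: "(\<lambda>w. (norm (X w + Y w))\<^sup>2) \<in> borel_measurable M" by measurable
  show "integrable M (\<lambda>w. (norm (X w + Y w))\<^sup>2)"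
    by (rule Bochner_Integration.integrable_bound[OF i m ae])
qed

lemma sqint_matrix_vector_mult: "sqint M X \<Longrightarrow> sqint M (\<lambda>w. A *v X w)"
  by (rule sqint_dominated[where C = "onorm ((*v) A)"])
    (auto simp: sqint_def intro: onorm[OF matrix_vector_mul_bounded_linear])

lemma sqint_scaleR: "sqint M X \<Longrightarrow> sqint M (\<lambda>w. c *\<^sub>R X w)"
  by (rule sqint_dominated[where C = "\<bar>c\<bar>"]) (auto simp: sqint_def)

lemma sqint_minus: "sqint M X \<Longrightarrow> sqint M (\<lambda>w. - X w)"
  using sqint_scaleR[of M X "-1"] by simp

lemma sqint_diff: "sqint M X \<Longrightarrow> sqint M Y \<Longrightarrow> sqint M (\<lambda>w. X w - Y w)"
  using sqint_add[OF _ sqint_minus] by fastforce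

text \<open>Serves for multiplication by a channel state, which lies in {0, 1} only almost
  surely.\<close>

lemma sqint_bounded_scaleR:
  assumes "sqint M X" "s \<in> borel_measurable M" "AE w in M. \<bar>s w\<bar> \<le> 1"
  shows "sqint M (\<lambda>w. s w *\<^sub>R X w)"
  by (rule sqint_dominated[where C = 1, OF assms(1)])
    (use assms in \<open>auto simp: sqint_def intro: mult_left_le_one_le elim!: eventually_mono\<close>)

lemma sqint_cong_AE:
  assumes "sqint M X" "AE w in M. Y w = X w" "Y \<in> borel_measurable M"
  shows "sqint M Y"
  by (rule sqint_dominated[where C = 1, OF assms(1,3)]) (use assms(2) in auto)

lemma sqint_0: "sqint M (\<lambda>_. 0)"
  by (simp add: sqint_def)

lemma (in finite_measure) sqint_const: "sqint M (\<lambda>_. c)"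
  by (simp add: sqint_def)

lemma sqint_integrable_inner:
  fixes X Y :: "'a \<Rightarrow> real^'n"
  assumes "sqint M X" "sqint M Y" shows "integrable M (\<lambda>w. X w \<bullet> Y w)"
proof (rule Bochner_Integration.integrable_bound)
  show "integrable M (\<lambda>w. (norm (X w))\<^sup>2 + (norm (Y w))\<^sup>2)" using assms by (auto simp: sqint_def)
  show "(\<lambda>w. X w \<bullet> Y w) \<in> borel_measurable M" using assms by (auto simp: sqint_def)
  have "\<bar>x \<bullet> y\<bar> \<le> (norm x)\<^sup>2 + (norm y)\<^sup>2" for x y :: "real^'n"
  proof -
    have "\<bar>x \<bullet> y\<bar> \<le> norm x * norm y" by (rule Cauchy_Schwarz_ineq2)
    moreover have "2 * norm x * norm y \<le> (norm x)\<^sup>2 + (norm y)\<^sup>2" by (rule sum_squares_bound)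
    moreover have "0 \<le> norm x * norm y" by simp
    ultimately show ?thesis by linarith
  qed
  then show "AE w in M. norm (X w \<bullet> Y w) \<le> norm ((norm (X w))\<^sup>2 + (norm (Y w))\<^sup>2)" by simp
qed

lemma sqint_integrable_quadratic:
  assumes "sqint M X" "sqint M Y" shows "integrable M (\<lambda>w. X w \<bullet> (S *v Y w))"
  by (intro sqint_integrable_inner sqint_matrix_vector_mult assms)

lemma sqint_integrable_components:
  fixes X :: "'a \<Rightarrow> real^'n" and Y :: "'a \<Rightarrow> real^'m"
  assumes "sqint M X" "sqint M Y" shows "integrable M (\<lambda>w. X w $ i * Y w $ j)"
proof (rule Bochner_Integration.integrable_bound)
  show "integrable M (\<lambda>w. (norm (X w))\<^sup>2 + (norm (Y w))\<^sup>2)" using assms by (auto simp: sqint_def)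
  have "X \<in> borel_measurable M" "Y \<in> borel_measurable M" using assms by (auto simp: sqint_def)
  then show "(\<lambda>w. X w $ i * Y w $ j) \<in> borel_measurable M" by measurable
  have "\<bar>x $ i * y $ j\<bar> \<le> (norm x)\<^sup>2 + (norm y)\<^sup>2" for x :: "real^'n" and y :: "real^'m"
  proof -
    have "\<bar>x $ i * y $ j\<bar> \<le> norm x * norm y"
      unfolding abs_mult by (intro mult_mono component_le_norm_cart) auto
    moreover have "2 * norm x * norm y \<le> (norm x)\<^sup>2 + (norm y)\<^sup>2" by (rule sum_squares_bound)
    moreover have "0 \<le> norm x * norm y" by simp
    ultimately show ?thesis by linarith
  qed
  then show "AE w in M. norm (X w $ i * Y w $ j) \<le> norm ((norm (X w))\<^sup>2 + (norm (Y w))\<^sup>2)" by simp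
qed

lemma (in finite_measure) sqint_integrable_nth:
  fixes X :: "'a \<Rightarrow> real^'n"
  assumes "sqint M X" shows "integrable M (\<lambda>w. X w $ i)"
  using sqint_integrable_components[OF assms sqint_const[of "1 :: real^1"], of i 1] by simp

lemma (in finite_measure) sqint_integrable:
  fixes X :: "'a \<Rightarrow> real^'n"
  assumes "sqint M X" shows "integrable M X"
proof (rule Bochner_Integration.integrable_bound)
  show "integrable M (\<lambda>w. (norm (X w))\<^sup>2 + 1)" using assms by (auto simp: sqint_def)
  have "a \<le> a\<^sup>2 + 1" for a :: real
    using sum_squares_bound[of a 1] zero_le_power2[of a] unfolding mult_1_right one_power2 by linarith
  then show "AE w in M. norm (X w) \<le> norm ((norm (X w))\<^sup>2 + 1)" by simp
qed (use assms in \<open>auto simp: sqint_def\<close>)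

lemma integral_vec_nth:
  fixes X :: "'a \<Rightarrow> real^'n"
  assumes "integrable M X" shows "integral\<^sup>L M X $ i = (LINT w|M. X w $ i)"
  using integral_inner_left[OF assms, of "axis i 1"] by (simp add: inner_axis)

lemma integral_inner_eq_0_components:
  fixes X Y :: "'a \<Rightarrow> real^'n"
  assumes "sqint M X" "sqint M Y" "\<And>i. (LINT w|M. X w $ i * Y w $ i) = 0"
  shows "(LINT w|M. X w \<bullet> Y w) = 0"
  unfolding inner_vec_def using assms
  by (subst Bochner_Integration.integral_sum) (auto intro: sqint_integrable_components)

text \<open>For integrable \<open>X\<close> this says that the conditional expectation of
  \<open>X\<close> given \<open>F\<close> is zero. Tested on events, it passes to smaller
  sigma-algebras at once.\<close>

definition ortho :: "'a measure \<Rightarrow> 'a measure \<Rightarrow> ('a \<Rightarrow> real^'n) \<Rightarrow> bool" where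
  "ortho M F X \<longleftrightarrow> (\<forall>A\<in>sets F. \<forall>i. (LINT w|M. X w $ i * indicator A w) = 0)"

lemma ortho_mono: "ortho M F X \<Longrightarrow> sets F' \<subseteq> sets F \<Longrightarrow> ortho M F' X"
  by (auto simp: ortho_def)

text \<open>Orthogonality on events says that the conditional expectation vanishes; pulling a
  measurable factor out of it extends the statement from indicators to all multipliers with an
  integrable product.\<close>

lemma (in prob_space) ortho_mult_integral:
  fixes X :: "'a \<Rightarrow> real^'n" and g :: "'a \<Rightarrow> real"
  assumes sub: "subalgebra M F" and X: "integrable M (\<lambda>w. X w $ i)" and o: "ortho M F X"
    and g: "g \<in> borel_measurable F" and gi: "integrable M (\<lambda>w. g w * X w $ i)"
  shows "(LINT w|M. g w * X w $ i) = 0"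
proof -
  interpret sf: finite_measure_subalgebra M F by (unfold_locales) (rule sub)
  have z: "AE w in M. real_cond_exp M F (\<lambda>w. X w $ i) w = 0"
    using o X by (intro sf.real_cond_exp_charact) (auto simp: ortho_def set_lebesgue_integral_def mult.commute)
  have [measurable]: "g \<in> borel_measurable M" using g sub by (rule measurable_from_subalg[rotated])
  have "(LINT w|M. g w * X w $ i) = (LINT w|M. g w * real_cond_exp M F (\<lambda>w. X w $ i) w)"
    by (rule sf.real_cond_exp_intg(2)[symmetric]) (use g gi X in auto)
  also have "\<dots> = (LINT w|M. 0)" using z by (intro integral_cong_AE) auto
  finally show ?thesis by simp
qed

lemma (in prob_space) ortho_components:
  fixes X :: "'a \<Rightarrow> real^'n" and Y :: "'a \<Rightarrow> real^'m"
  assumes sub: "subalgebra M F" and o: "ortho M F X" and X: "sqint M X" and Y: "sqint M Y" "Y \<in> borel_measurable F"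
  shows "(LINT w|M. X w $ i * Y w $ j) = 0"
  using ortho_mult_integral[OF sub sqint_integrable_nth[OF X] o, of "\<lambda>w. Y w $ j" i] Y(2)
    sqint_integrable_components[OF X Y(1), of i j] by (simp add: mult.commute)

lemma (in prob_space) ortho_add:
  assumes "ortho M F X" "ortho M F Y" "sqint M X" "sqint M Y" "subalgebra M F"
  shows "ortho M F (\<lambda>w. X w + Y w)"
  unfolding ortho_def
proof safe
  fix A i assume A: "A \<in> sets F"
  then have "A \<in> sets M" using assms by (auto simp: subalgebra_def)
  then show "(LINT w|M. (X w + Y w) $ i * indicator A w) = 0"
    using assms A by (simp add: distrib_right ortho_def integrable_real_mult_indicator sqint_integrable_nth)
qed

lemma (in prob_space) ortho_matrix_vector_mult:
  assumes "ortho M F X" "sqint M X" "subalgebra M F"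
  shows "ortho M F (\<lambda>w. A *v X w)"
  unfolding ortho_def
proof safe
  fix D i assume D: "D \<in> sets F"
  then have "D \<in> sets M" using assms by (auto simp: subalgebra_def)
  then show "(LINT w|M. (A *v X w) $ i * indicator D w) = 0"
    using assms D by (simp add: matrix_vector_mult_def sum_distrib_right mult.assoc ortho_def
      integrable_real_mult_indicator sqint_integrable_nth)
qed

section \<open>Generated sigma-algebras and conditional expectations\<close>

lemma space_generated_by [simp]: "space (generated_by M Y) = space M"
  by (simp add: generated_by_def space_measure_of_conv)

lemma sets_generated_by:
  "sets (generated_by M Y) = sigma_sets (space M) (\<Union>f\<in>Y. {f -` D \<inter> space M | D. D \<in> sets borel})"
  unfolding generated_by_def by (rule sets_measure_of) auto

lemma generated_by_subset:
  fixes Y :: "('a \<Rightarrow> real^'b) set"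
  assumes "space F = space M" "\<And>f. f \<in> Y \<Longrightarrow> f \<in> borel_measurable F"
  shows "sets (generated_by M Y) \<subseteq> sets F"
proof -
  have "(\<Union>f\<in>Y. {f -` D \<inter> space M | D. D \<in> sets borel}) \<subseteq> sets F"
  proof safe
    fix f and D :: "(real^'b) set" assume "f \<in> Y" "D \<in> sets borel"
    then show "f -` D \<inter> space M \<in> sets F" using measurable_sets[OF assms(2)] assms(1) by metis
  qed
  then show ?thesis unfolding sets_generated_by using sets.sigma_sets_subset[of _ F] assms(1) by simp
qed

lemma measurable_generated_by: "f \<in> Y \<Longrightarrow> f \<in> borel_measurable (generated_by M Y)"
  by (rule measurableI) (auto simp: sets_generated_by intro!: sigma_sets.Basic)

lemma measurable_mono_sets:
  assumes "f \<in> borel_measurable F" "sets F \<subseteq> sets F'" "space F = space F'"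
  shows "f \<in> borel_measurable F'"
  using assms by (auto simp: measurable_def)

lemma cond_exp_vec_measurable: "cond_exp_vec M F X \<in> borel_measurable F"
  by (simp add: borel_measurable_vec_iff cond_exp_vec_def)

text \<open>The way in which every estimate is computed below: propose a measurable candidate and
  check that the residual is orthogonal to the information.\<close>

lemma (in prob_space) cond_exp_vec_eqI:
  fixes X Y :: "'a \<Rightarrow> real^'n"
  assumes sub: "subalgebra M F" and X: "sqint M X" and Y: "sqint M Y" "Y \<in> borel_measurable F"
    and o: "ortho M F (\<lambda>w. X w - Y w)"
  shows "AE w in M. cond_exp_vec M F X w = Y w"
proof -
  interpret sf: finite_measure_subalgebra M F by (unfold_locales) (rule sub)
  have "AE w in M. real_cond_exp M F (\<lambda>w. X w $ i) w = Y w $ i" for i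
  proof (rule sf.real_cond_exp_charact)
    fix A assume A: "A \<in> sets F"
    then have "A \<in> sets M" using sub by (auto simp: subalgebra_def)
    then have "(LINT w|M. X w $ i * indicator A w - Y w $ i * indicator A w)
        = (LINT w|M. X w $ i * indicator A w) - (LINT w|M. Y w $ i * indicator A w)"
      using X Y by (intro Bochner_Integration.integral_diff integrable_real_mult_indicator sqint_integrable_nth)
    moreover have "(LINT w|M. X w $ i * indicator A w - Y w $ i * indicator A w) = 0"
      using o A by (simp add: ortho_def left_diff_distrib)
    ultimately show "(LINT x:A|M. X x $ i) = (LINT x:A|M. Y x $ i)"
      by (simp add: set_lebesgue_integral_def mult.commute[of "indicator A _"])
  qed (use X Y in \<open>auto intro: sqint_integrable_nth\<close>)
  then have "AE w in M. \<forall>i. real_cond_exp M F (\<lambda>w. X w $ i) w = Y w $ i" by (simp add: AE_all_countable)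
  then show ?thesis by eventually_elim (simp add: cond_exp_vec_def vec_eq_iff)
qed

lemma (in prob_space) ortho_0: "ortho M F (\<lambda>w. 0)"
  by (simp add: ortho_def)

lemma (in prob_space) ortho_cong_AE:
  assumes "ortho M F X" "AE w in M. Y w = X w" "X \<in> borel_measurable M" "Y \<in> borel_measurable M" "subalgebra M F"
  shows "ortho M F Y"
  unfolding ortho_def
proof safe
  fix A i assume A: "A \<in> sets F"
  then have [measurable]: "A \<in> sets M" using assms by (auto simp: subalgebra_def)
  note [measurable] = assms(3,4)
  have "(LINT w|M. Y w $ i * indicator A w) = (LINT w|M. X w $ i * indicator A w)"
    using assms(2) by (intro integral_cong_AE) auto
  then show "(LINT w|M. Y w $ i * indicator A w) = 0" using assms(1) A by (auto simp: ortho_def)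
qed

lemma (in prob_space) cond_exp_vec_cong_AE_measurable:
  fixes X Y :: "'a \<Rightarrow> real^'n"
  assumes "subalgebra M F" "sqint M X" "Y \<in> borel_measurable F" "AE w in M. X w = Y w"
  shows "AE w in M. cond_exp_vec M F X w = Y w"
proof (rule cond_exp_vec_eqI)
  have Ym: "Y \<in> borel_measurable M" using assms by (auto intro: measurable_from_subalg)
  show Y: "sqint M Y" by (rule sqint_cong_AE[OF assms(2)]) (use assms Ym in auto)
  show "ortho M F (\<lambda>w. X w - Y w)"
    by (rule ortho_cong_AE[OF ortho_0]) (use assms Y in \<open>auto intro: sqint_measurable borel_measurable_diff\<close>)
qed (use assms in auto)

text \<open>A substitute for completing \<open>F\<close> by null sets. Every event of the
  sigma-algebra \<open>H\<close> generated by \<open>Y\<close> and \<open>F\<close> agrees almost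
  surely with an event of \<open>F\<close>, so conditioning on \<open>H\<close> and on
  \<open>F\<close> gives the same result, and \<open>g\<close> is measurable for
  \<open>H\<close>.\<close>

lemma (in prob_space) cond_exp_vec_approx:
  fixes g :: "'a \<Rightarrow> real^'m" and Y :: "('a \<Rightarrow> real^'n) set"
  assumes sub: "subalgebra M F" and Y: "\<And>f. f \<in> Y \<Longrightarrow> f \<in> borel_measurable M"
    and approx: "\<And>f. f \<in> Y \<Longrightarrow> \<exists>f'\<in>borel_measurable F. AE w in M. f w = f' w"
    and g: "g \<in> borel_measurable (generated_by M Y)" "sqint M g"
  shows "AE w in M. cond_exp_vec M F g w = g w"
proof -
  interpret sf: finite_measure_subalgebra M F by (unfold_locales) (rule sub)
  \<comment> \<open>The events of \<open>F\<close> are included so that the conditional expectation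
    on \<open>F\<close> is measurable for \<open>H\<close> and can serve as a version of the one on
    \<open>H\<close>.\<close>
  define E where "E = (\<Union>f\<in>Y. {f -` D \<inter> space M | D. D \<in> sets borel}) \<union> sets F"
  have EM: "E \<subseteq> sets M"
  proof -
    have "f -` D \<inter> space M \<in> sets M" if "f \<in> Y" "D \<in> sets borel" for f D
      using Y that measurable_sets by blast
    then show ?thesis unfolding E_def using sub by (auto simp: subalgebra_def)
  qed
  have Esp: "E \<subseteq> Pow (space M)" using EM sets.sets_into_space by blast
  define H where "H = sigma (space M) E"
  have setsH: "sets H = sigma_sets (space M) E" unfolding H_def using Esp by (rule sets_measure_of)
  have subH: "subalgebra M H"
    unfolding subalgebra_def using sets.sigma_sets_subset[OF EM]
    by (simp add: setsH) (simp add: H_def space_measure_of_conv)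
  interpret sH: finite_measure_subalgebra M H by (unfold_locales) (rule subH)
  have spF: "space F = space M" using sub by (simp add: subalgebra_def)
  have ap: "\<exists>A'\<in>sets F. AE w in M. w \<in> A \<longleftrightarrow> w \<in> A'" if "A \<in> sigma_sets (space M) E" for A
    using that
  proof induction
    case (Basic A)
    then consider "A \<in> sets F" | f D where "f \<in> Y" "A = f -` D \<inter> space M" "D \<in> sets borel"
      unfolding E_def by auto
    then show ?case
    proof cases
      case 1 then show ?thesis by auto
    next
      case 2
      then obtain f' where f': "f' \<in> borel_measurable F" "AE w in M. f w = f' w" using approx by blast
      have "f' -` D \<inter> space F \<in> sets F" using f' 2 by (auto intro: measurable_sets)
      moreover have "AE w in M. w \<in> A \<longleftrightarrow> w \<in> f' -` D \<inter> space F"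
        using f'(2) AE_space by eventually_elim (auto simp: 2 spF)
      ultimately show ?thesis by blast
    qed
  next
    case Empty
    show ?case by (rule bexI[of _ "{}"]) auto
  next
    case (Compl A)
    then obtain A' where "A' \<in> sets F" "AE w in M. w \<in> A \<longleftrightarrow> w \<in> A'" by blast
    then have "space M - A' \<in> sets F" using spF by (metis sets.compl_sets)
    moreover have "AE w in M. w \<in> space M - A \<longleftrightarrow> w \<in> space M - A'"
      using \<open>AE w in M. w \<in> A \<longleftrightarrow> w \<in> A'\<close> by eventually_elim auto
    ultimately show ?case by blast
  next
    case (Union A)
    then obtain A' where A': "\<And>i. A' i \<in> sets F" "\<And>i. AE w in M. w \<in> A i \<longleftrightarrow> w \<in> A' i" by metis
    then have "AE w in M. \<forall>i. w \<in> A i \<longleftrightarrow> w \<in> A' i" by (simp add: AE_all_countable)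
    then have "AE w in M. w \<in> (\<Union>i. A i) \<longleftrightarrow> w \<in> (\<Union>i. A' i)" by eventually_elim auto
    moreover have "(\<Union>i. A' i) \<in> sets F" using A' by auto
    ultimately show ?case by blast
  qed
  have gH: "g \<in> borel_measurable H"
  proof (rule measurable_mono_sets[OF g(1)])
    show "sets (generated_by M Y) \<subseteq> sets H"
      unfolding setsH sets_generated_by E_def by (rule sigma_sets_mono') auto
  qed (simp add: H_def space_measure_of_conv)
  have FH: "sets F \<subseteq> sets H" unfolding setsH E_def by (auto intro: sigma_sets.Basic)
  have "AE w in M. real_cond_exp M F (\<lambda>w. g w $ i) w = g w $ i" for i
  proof -
    have gi: "integrable M (\<lambda>w. g w $ i)" by (rule sqint_integrable_nth[OF g(2)])
    have ci: "integrable M (real_cond_exp M F (\<lambda>w. g w $ i))" by (rule sf.real_cond_exp_int(1)[OF gi])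
    have "AE w in M. real_cond_exp M H (\<lambda>w. g w $ i) w = g w $ i"
      by (rule sH.real_cond_exp_F_meas[OF gi]) (use gH in measurable)
    moreover have "AE w in M. real_cond_exp M H (\<lambda>w. g w $ i) w = real_cond_exp M F (\<lambda>w. g w $ i) w"
    proof (rule sH.real_cond_exp_charact[OF _ gi ci])
      show "real_cond_exp M F (\<lambda>w. g w $ i) \<in> borel_measurable H"
        by (rule measurable_mono_sets[OF borel_measurable_cond_exp FH]) (use subH spF in \<open>simp add: subalgebra_def\<close>)
      fix A assume "A \<in> sets H"
      then obtain A' where A': "A' \<in> sets F" "AE w in M. w \<in> A \<longleftrightarrow> w \<in> A'" using ap setsH by blast
      have [measurable]: "A \<in> sets M" "A' \<in> sets M"
        using \<open>A \<in> sets H\<close> A' sub subH by (auto simp: subalgebra_def)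
      have sw: "(LINT x:A|M. f x) = (LINT x:A'|M. f x)" if [measurable]: "f \<in> borel_measurable M" for f :: "'a \<Rightarrow> real"
        unfolding set_lebesgue_integral_def
        using A'(2) by (intro integral_cong_AE) (auto elim!: eventually_mono simp: indicator_def)
      show "(LINT x:A|M. g x $ i) = (LINT x:A|M. real_cond_exp M F (\<lambda>w. g w $ i) x)"
        using sf.real_cond_exp_intA[OF gi A'(1)] sw[OF borel_measurable_integrable[OF gi]]
          sw[OF borel_measurable_integrable[OF ci]] by simp
    qed
    ultimately show ?thesis by eventually_elim auto
  qed
  then have "AE w in M. \<forall>i. real_cond_exp M F (\<lambda>w. g w $ i) w = g w $ i" by (simp add: AE_all_countable)
  then show ?thesis by eventually_elim (simp add: cond_exp_vec_def vec_eq_iff)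
qed

section \<open>Gaussian sources\<close>

lemma (in prob_space) centered_normal_moments:
  fixes f :: "'a \<Rightarrow> real"
  assumes v: "0 < v" and D: "distributed M lborel f (normal_density m (sqrt v))"
  shows "integrable M (\<lambda>w. (f w - m)\<^sup>2)" "(LINT w|M. (f w - m)\<^sup>2) = v" "(LINT w|M. f w - m) = 0"
    "(CLINT w|M. iexp (f w - m)) = exp (- v / 2)"
proof -
  have s: "0 < sqrt v" using v by simp
  have [measurable]: "f \<in> borel_measurable M" using D by (auto simp: distributed_def)
  have mean: "expectation f = m" by (rule normal_distributed_expectation[OF s D])
  have int1: "integrable M f"
    by (rule distributed_integrable_var[OF D]) (use integrable_normal_moment_nz_1[OF s] in auto)
  show "integrable M (\<lambda>w. (f w - m)\<^sup>2)"
    using distributed_integrable[OF D, of "\<lambda>x. (x - m)\<^sup>2"] integrable_normal_moment[OF s, of m 2] by simp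
  show "(LINT w|M. (f w - m)\<^sup>2) = v"
    using normal_distributed_variance[OF s D] mean v by simp
  show "(LINT w|M. f w - m) = 0" using int1 mean by (simp add: prob_space)
  have D': "distributed M lborel (\<lambda>w. (f w - m) / sqrt v) std_normal_density"
    using D normal_standard_normal_convert[OF s, of f m] by simp
  have sq: "(sqrt v)\<^sup>2 = v" using v by simp
  have "complex_of_real (exp (- v / 2)) = char std_normal_distribution (sqrt v)"
    by (simp only: char_std_normal_distribution sq)
  also have "char std_normal_distribution (sqrt v) = (CLINT w|M. iexp (sqrt v * ((f w - m) / sqrt v)))"
    unfolding char_def distributed_distr_eq_density[OF D', symmetric] by (subst integral_distr) auto
  also have "\<dots> = (CLINT w|M. iexp (f w - m))"
    using s by (intro Bochner_Integration.integral_cong) auto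
  finally show "(CLINT w|M. iexp (f w - m)) = exp (- v / 2)" by simp
qed

text \<open>A functional of variance zero is almost surely constant and obeys the same four
  formulas, so from here on singular covariances are treated together with regular ones.\<close>

lemma (in prob_space) gaussian_vec_functional:
  assumes G: "gaussian_vec M X m S"
  shows "integrable M (\<lambda>w. (a \<bullet> (X w - m))\<^sup>2)" "(LINT w|M. (a \<bullet> (X w - m))\<^sup>2) = a \<bullet> (S *v a)"
    "(LINT w|M. a \<bullet> (X w - m)) = 0"
    "(CLINT w|M. iexp (a \<bullet> (X w - m))) = exp (- (a \<bullet> (S *v a)) / 2)"
proof -
  have [measurable]: "X \<in> borel_measurable M" using G by (auto simp: gaussian_vec_def)
  have nn: "0 \<le> a \<bullet> (S *v a)" using G by (auto simp: gaussian_vec_def sym_psd_def)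
  have eq: "a \<bullet> (X w - m) = a \<bullet> X w - a \<bullet> m" for w by (simp add: inner_diff_right)
  have "integrable M (\<lambda>w. (a \<bullet> (X w - m))\<^sup>2) \<and> (LINT w|M. (a \<bullet> (X w - m))\<^sup>2) = a \<bullet> (S *v a) \<and>
    (LINT w|M. a \<bullet> (X w - m)) = 0 \<and> (CLINT w|M. iexp (a \<bullet> (X w - m))) = exp (- (a \<bullet> (S *v a)) / 2)"
  proof (cases "a \<bullet> (S *v a) = 0")
    case True
    then have z: "AE w in M. a \<bullet> (X w - m) = 0" using G by (simp add: gaussian_vec_def eq)
    have "integrable M (\<lambda>w. (a \<bullet> (X w - m))\<^sup>2) \<longleftrightarrow> integrable M (\<lambda>w. 0::real)"
      by (rule integrable_cong_AE) (use z in auto)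
    moreover have "(LINT w|M. (a \<bullet> (X w - m))\<^sup>2) = (LINT w|M. 0)"
      by (rule integral_cong_AE) (use z in auto)
    moreover have "(LINT w|M. a \<bullet> (X w - m)) = (LINT w|M. 0)"
      by (rule integral_cong_AE) (use z in auto)
    moreover have "(CLINT w|M. iexp (a \<bullet> (X w - m))) = (CLINT w|M. 1)"
      by (rule integral_cong_AE) (use z in auto)
    ultimately show ?thesis using True by (simp add: prob_space)
  next
    case False
    then have "0 < a \<bullet> (S *v a)" using nn by simp
    moreover have "distributed M lborel (\<lambda>w. a \<bullet> X w) (normal_density (a \<bullet> m) (sqrt (a \<bullet> (S *v a))))"
      using G False by (simp add: gaussian_vec_def)
    ultimately show ?thesis using centered_normal_moments unfolding eq by blast
  qed
  then show "integrable M (\<lambda>w. (a \<bullet> (X w - m))\<^sup>2)" "(LINT w|M. (a \<bullet> (X w - m))\<^sup>2) = a \<bullet> (S *v a)"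
    "(LINT w|M. a \<bullet> (X w - m)) = 0"
    "(CLINT w|M. iexp (a \<bullet> (X w - m))) = exp (- (a \<bullet> (S *v a)) / 2)" by auto
qed

lemma (in prob_space) gaussian_vec_sqint:
  fixes X :: "'a \<Rightarrow> real^'n"
  assumes G: "gaussian_vec M X m S"
  shows "sqint M (\<lambda>w. X w - m)"
proof -
  have [measurable]: "X \<in> borel_measurable M" using G by (auto simp: gaussian_vec_def)
  have "(norm (X w - m))\<^sup>2 = (\<Sum>i\<in>UNIV. (axis i 1 \<bullet> (X w - m))\<^sup>2)" for w
    unfolding power2_norm_eq_inner inner_vec_def[of "X w - m"] by (simp add: inner_axis' power2_eq_square)
  then show ?thesis using gaussian_vec_functional(1)[OF G] by (simp add: sqint_def)
qed

lemma sym_psd_inner_commute: "sym_psd S \<Longrightarrow> a \<bullet> (S *v b) = b \<bullet> (S *v a)"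
  by (metis dot_lmul_matrix inner_commute sym_psd_def transpose_matrix_vector)

text \<open>Second moments are available for single functionals, so mixed moments come from
  polarisation with \<open>a + b\<close>.\<close>

lemma (in prob_space) gaussian_vec_covariance:
  assumes G: "gaussian_vec M X m S"
  shows "(LINT w|M. (a \<bullet> (X w - m)) * (b \<bullet> (X w - m))) = a \<bullet> (S *v b)"
proof -
  note i = gaussian_vec_functional(1,2)[OF G]
  have psd: "sym_psd S" using G by (simp add: gaussian_vec_def)
  have "(LINT w|M. (a \<bullet> (X w - m)) * (b \<bullet> (X w - m)))
      = (LINT w|M. (((a + b) \<bullet> (X w - m))\<^sup>2 - (a \<bullet> (X w - m))\<^sup>2 - (b \<bullet> (X w - m))\<^sup>2) / 2)"
    by (intro Bochner_Integration.integral_cong) (auto simp: inner_add_left power2_eq_square algebra_simps)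
  also have "\<dots> = ((a + b) \<bullet> (S *v (a + b)) - a \<bullet> (S *v a) - b \<bullet> (S *v b)) / 2"
    using i[of "a + b"] i[of a] i[of b] by simp
  also have "\<dots> = a \<bullet> (S *v b)"
    using sym_psd_inner_commute[OF psd, of a b]
    by (simp add: matrix_vector_right_distrib inner_add_left inner_add_right)
  finally show ?thesis .
qed

section \<open>The model as centered Gaussian sources with an independent channel\<close>

locale flq_setting =
  fixes P :: "('w, 'n::finite, 'l::finite, 'r::finite) flq"
  assumes model: "flq_model P"
begin

sublocale prob_space "Om P" using model by (simp add: flq_model_def)

definition gsrc :: "source set" where
  "gsrc = {Init} \<union> Proc ` {..horizon P} \<union> Meas ` {..horizon P}"

definition csrc :: "source \<Rightarrow> 'w \<Rightarrow> real^'n" where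
  "csrc s w = (case s of Init \<Rightarrow> init P w - mean0 P | Proc k \<Rightarrow> procn P k w | Meas k \<Rightarrow> measn P k w | Chan k \<Rightarrow> 0)"

definition scov :: "source \<Rightarrow> real^'n^'n" where
  "scov s = (case s of Init \<Rightarrow> cov0 P | Proc k \<Rightarrow> covw P | Meas k \<Rightarrow> covv P | Chan k \<Rightarrow> 0)"

text \<open>A general element of the Gaussian space spanned by the centered sources. Encoding it by
  its coefficients turns covariances into the algebra of \<open>lcov\<close>.\<close>

definition lin :: "(source \<Rightarrow> real^'n) \<Rightarrow> 'w \<Rightarrow> real" where
  "lin a w = (\<Sum>s\<in>gsrc. a s \<bullet> csrc s w)"

definition lcov :: "(source \<Rightarrow> real^'n) \<Rightarrow> (source \<Rightarrow> real^'n) \<Rightarrow> real" where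
  "lcov a b = (\<Sum>s\<in>gsrc. a s \<bullet> (scov s *v b s))"

lemma finite_gsrc [simp]: "finite gsrc"
  by (simp add: gsrc_def)

lemma gsrc_gaussian:
  assumes "s \<in> gsrc"
  shows "\<exists>X m. gaussian_vec (Om P) X m (scov s) \<and> (csrc s = (\<lambda>w. X w - m))"
proof -
  have "csrc Init = (\<lambda>w. init P w - mean0 P)" "csrc (Proc k) = (\<lambda>w. procn P k w - 0)"
    "csrc (Meas k) = (\<lambda>w. measn P k w - 0)" for k by (auto simp: csrc_def fun_eq_iff)
  moreover have "scov Init = cov0 P" "scov (Proc k) = covw P" "scov (Meas k) = covv P" for k
    by (simp_all add: scov_def)
  moreover consider "s = Init" | k where "k \<le> horizon P" "s = Proc k" | k where "k \<le> horizon P" "s = Meas k"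
    using assms by (auto simp: gsrc_def)
  moreover have "gaussian_vec (Om P) (init P) (mean0 P) (cov0 P)"
    "k \<le> horizon P \<Longrightarrow> gaussian_vec (Om P) (procn P k) 0 (covw P)"
    "k \<le> horizon P \<Longrightarrow> gaussian_vec (Om P) (measn P k) 0 (covv P)" for k
    using model by (auto simp: flq_model_def)
  ultimately show ?thesis by metis
qed

lemma csrc_sqint: "s \<in> gsrc \<Longrightarrow> sqint (Om P) (csrc s)"
proof -
  assume "s \<in> gsrc"
  then obtain X m where G: "gaussian_vec (Om P) X m (scov s)" and eq: "csrc s = (\<lambda>w. X w - m)"
    using gsrc_gaussian by blast
  show ?thesis unfolding eq by (rule gaussian_vec_sqint[OF G])
qed

lemma csrc_measurable: "s \<in> gsrc \<Longrightarrow> csrc s \<in> borel_measurable (Om P)"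
  using csrc_sqint sqint_measurable by blast

lemma csrc_functional:
  assumes "s \<in> gsrc"
  shows "(LINT w|Om P. (a \<bullet> csrc s w) * (b \<bullet> csrc s w)) = a \<bullet> (scov s *v b)"
    "(LINT w|Om P. a \<bullet> csrc s w) = 0"
    "(CLINT w|Om P. iexp (a \<bullet> csrc s w)) = exp (- (a \<bullet> (scov s *v a)) / 2)"
  using gsrc_gaussian[OF assms] gaussian_vec_covariance gaussian_vec_functional by auto

lemma chan_measurable: "k \<le> horizon P \<Longrightarrow> chan P k \<in> borel_measurable (Om P)"
  using model by (simp add: flq_model_def)

lemma chan_prob:
  assumes "k \<le> horizon P"
  shows "measure (Om P) {w \<in> space (Om P). chan P k w = 0} = loss P"
    "measure (Om P) {w \<in> space (Om P). chan P k w = 1} = 1 - loss P"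
  using model assms by (simp_all add: flq_model_def)

lemma loss_range: "0 \<le> loss P" "loss P \<le> 1"
  using chan_prob[of 0] measure_nonneg[of "Om P"] by (metis bot_nat_0.extremum, metis bot_nat_0.extremum diff_ge_0_iff_ge)

lemma chan_01: 
  assumes k: "k \<le> horizon P" 
  shows "AE w in Om P. chan P k w = 0 \<or> chan P k w = 1"
proof -
  have [measurable]: "chan P k \<in> borel_measurable (Om P)" by (rule chan_measurable[OF k])
  have "measure (Om P) ({w \<in> space (Om P). chan P k w = 0} \<union> {w \<in> space (Om P). chan P k w = 1}) = loss P + (1 - loss P)"
    using chan_prob[OF k] by (subst finite_measure_Union) auto
  also have "\<dots> = 1" by simp
  finally have "AE w in Om P. w \<in> {w \<in> space (Om P). chan P k w = 0} \<union> {w \<in> space (Om P). chan P k w = 1}"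
    by (intro prob_eq_1[THEN iffD1]) auto
  then show ?thesis by eventually_elim auto
qed

lemma chan_abs_le: "k \<le> horizon P \<Longrightarrow> AE w in Om P. \<bar>chan P k w\<bar> \<le> 1" "k \<le> horizon P \<Longrightarrow> AE w in Om P. \<bar>1 - chan P k w\<bar> \<le> 1"
  using chan_01[of k] by (auto elim!: eventually_mono)

lemma chan_integral:
  assumes k: "k \<le> horizon P" 
  shows "integrable (Om P) (chan P k)" "(LINT w|Om P. chan P k w) = 1 - loss P"
proof -
  have [measurable]: "chan P k \<in> borel_measurable (Om P)" by (rule chan_measurable[OF k])
  show "integrable (Om P) (chan P k)"
    by (rule integrable_const_bound[where B = 1]) (use chan_abs_le[OF k] in auto)
  have "(LINT w|Om P. chan P k w) = (LINT w|Om P. indicator {w \<in> space (Om P). chan P k w = 1} w)"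
    using chan_01[OF k] AE_space by (intro integral_cong_AE) (auto simp: indicator_def elim!: eventually_mono)
  then show "(LINT w|Om P. chan P k w) = 1 - loss P" using chan_prob[OF k] by simp
qed

text \<open>One scalar family that covers the Gaussian sources and the channel states, so that the
  joint independence of all sources is used through a single \<open>indep_vars\<close>
  statement.\<close>

definition csource :: "(source \<Rightarrow> real^'n) \<Rightarrow> (nat \<Rightarrow> real) \<Rightarrow> source \<Rightarrow> 'w \<Rightarrow> real" where
  "csource a t s w = (case s of Chan j \<Rightarrow> t j * chan P j w | _ \<Rightarrow> a s \<bullet> csrc s w)"

lemma csource_chan: "csource a t (Chan j) = (\<lambda>w. t j * chan P j w)"
  by (simp add: csource_def[abs_def])

lemma csource_gsrc: "s \<in> gsrc \<Longrightarrow> csource a t s = (\<lambda>w. a s \<bullet> csrc s w)"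
  by (auto simp: csource_def[abs_def] gsrc_def)

lemma indep_csource:
  "indep_vars (\<lambda>_. borel) (csource a t) (gsrc \<union> Chan ` {..horizon P})"
proof -
  have ind: "indep_sets (source_events P) (gsrc \<union> Chan ` {..horizon P})"
    using model by (simp add: flq_model_def gsrc_def Un_assoc)
  have meas: "csource a t s \<in> borel_measurable (Om P)" if sI: "s \<in> gsrc \<union> Chan ` {..horizon P}" for s
  proof (cases "s \<in> gsrc")
    case True
    then show ?thesis using csrc_measurable[OF True] by (auto simp: csource_gsrc intro!: borel_measurable_inner)
  next
    case False
    then obtain j where "s = Chan j" "j \<le> horizon P" using sI by auto
    then show ?thesis using chan_measurable[of j] by (simp add: csource_chan)
  qed
  have "{csource a t s -` A \<inter> space (Om P) | A. A \<in> sets borel} \<subseteq> source_events P s" for s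
  proof safe
    fix A :: "real set" assume A: "A \<in> sets borel"
    have pre: "(\<lambda>w. g (X w)) -` A \<inter> space (Om P) \<in> sets (vimage_algebra (space (Om P)) X borel)"
      if g: "g \<in> borel_measurable borel" for g :: "'z::topological_space \<Rightarrow> real" and X :: "'w \<Rightarrow> 'z"
    proof -
      have "(\<lambda>w. g (X w)) -` A \<inter> space (Om P) = X -` (g -` A) \<inter> space (Om P)" by auto
      moreover have "g -` A \<in> sets borel" using measurable_sets[OF g A] by simp
      ultimately show ?thesis by (simp add: in_vimage_algebra)
    qed
    show "csource a t s -` A \<inter> space (Om P) \<in> source_events P s"
    proof (cases s)
      case Init
      then show ?thesis using pre[of "\<lambda>x. a Init \<bullet> (x - mean0 P)" "init P"] by (simp add: csource_def[abs_def] csrc_def)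
    next
      case (Proc k)
      then show ?thesis using pre[of "\<lambda>x. a (Proc k) \<bullet> x" "procn P k"] by (simp add: csource_def[abs_def] csrc_def)
    next
      case (Meas k)
      then show ?thesis using pre[of "\<lambda>x. a (Meas k) \<bullet> x" "measn P k"] by (simp add: csource_def[abs_def] csrc_def)
    next
      case (Chan k)
      then show ?thesis using pre[of "\<lambda>x. t k * x" "chan P k"] by (simp add: csource_def[abs_def])
    qed
  qed
  then have "indep_sets (\<lambda>s. {csource a t s -` A \<inter> space (Om P) | A. A \<in> sets borel}) (gsrc \<union> Chan ` {..horizon P})"
    by (rule indep_sets_mono_sets[OF ind])
  then show ?thesis unfolding indep_vars_def2 using meas by (intro conjI ballI)
qed

lemma gsrc_chan_disjoint: "gsrc \<inter> Chan ` {..horizon P} = {}" "Chan j \<notin> gsrc"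
  by (auto simp: gsrc_def)

lemma lin_measurable [measurable]: "lin a \<in> borel_measurable (Om P)"
  unfolding lin_def[abs_def] by (intro borel_measurable_sum borel_measurable_inner csrc_measurable) auto

lemma inner_csrc_integrable:
  assumes "s \<in> gsrc" "s' \<in> gsrc"
  shows "integrable (Om P) (\<lambda>w. (a \<bullet> csrc s w) * (b \<bullet> csrc s' w))"
proof -
  have "(a \<bullet> x) * (b \<bullet> y) = (\<Sum>i\<in>UNIV. \<Sum>j\<in>UNIV. (a $ i * b $ j) * (x $ i * y $ j))" for x y :: "real^'n"
    unfolding inner_vec_def sum_product by (simp add: mult_ac)
  then show ?thesis
    by (simp only:) (intro Bochner_Integration.integrable_sum integrable_mult_right
        sqint_integrable_components csrc_sqint assms)
qed

lemma inner_csrc_integrable1: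
  assumes "s \<in> gsrc" shows "integrable (Om P) (\<lambda>w. a \<bullet> csrc s w)"
  using sqint_integrable[OF csrc_sqint[OF assms]] by simp

lemma lin_moments:
  shows "integrable (Om P) (\<lambda>w. lin a w * lin b w)" "(LINT w|Om P. lin a w * lin b w) = lcov a b"
    "integrable (Om P) (lin a)" "(LINT w|Om P. lin a w) = 0"
proof -
  have pr: "(LINT w|Om P. (a s \<bullet> csrc s w) * (b s' \<bullet> csrc s' w)) = (if s = s' then a s \<bullet> (scov s *v b s) else 0)"
    if s: "s \<in> gsrc" "s' \<in> gsrc" for s s'
  proof (cases "s = s'")
    case True then show ?thesis using csrc_functional(1)[OF s(1)] by simp
  next
    case False
    \<comment> \<open>A single coefficient family equal to \<open>a\<close> at \<open>s\<close> and
      to \<open>b\<close> at \<open>s'\<close>, so that the two factors are members of one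
      independent family.\<close>
    define c where "c = b (s := a s)"
    have "(LINT w|Om P. (\<Prod>i\<in>{s, s'}. csource c t i w)) = (\<Prod>i\<in>{s, s'}. LINT w|Om P. csource c t i w)" for t
      by (rule indep_vars_lebesgue_integral)
        (use s in \<open>auto intro: indep_vars_subset[OF indep_csource] inner_csrc_integrable1 simp: csource_gsrc\<close>)
    from this[of "\<lambda>_. 0"] show ?thesis using False s by (simp add: csource_gsrc csrc_functional(2) c_def)
  qed
  show "integrable (Om P) (\<lambda>w. lin a w * lin b w)"
    unfolding lin_def sum_product by (intro Bochner_Integration.integrable_sum inner_csrc_integrable)
  show "(LINT w|Om P. lin a w * lin b w) = lcov a b"
    unfolding lin_def sum_product lcov_def
    by (simp add: Bochner_Integration.integral_sum inner_csrc_integrable Bochner_Integration.integrable_sum pr)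
  show "integrable (Om P) (lin a)"
    unfolding lin_def[abs_def] by (intro Bochner_Integration.integrable_sum inner_csrc_integrable1)
  show "(LINT w|Om P. lin a w) = 0"
    unfolding lin_def by (simp add: Bochner_Integration.integral_sum inner_csrc_integrable1 csrc_functional(2))
qed

text \<open>Independence splits the exponential. The Gaussian factors recombine into one exponential
  of \<open>lcov a a\<close>; the channel factors are left unevaluated, as they do not depend on
  \<open>a\<close>.\<close>

lemma lin_chan_char:
  "(CLINT w|Om P. iexp (lin a w + (\<Sum>j\<le>horizon P. t j * chan P j w)))
    = exp (- lcov a a / 2) * (\<Prod>j\<le>horizon P. CLINT w|Om P. iexp (t j * chan P j w))"
proof -
  let ?I = "gsrc \<union> Chan ` {..horizon P}"
  have ind: "indep_vars (\<lambda>_. borel) (\<lambda>s w. iexp (csource a t s w)) ?I"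
    by (rule indep_vars_compose2[OF indep_csource]) auto
  have meas: "csource a t s \<in> borel_measurable (Om P)" if "s \<in> ?I" for s
    using indep_csource[of a t] that by (auto simp: indep_vars_def2)
  have sum: "lin a w + (\<Sum>j\<le>horizon P. t j * chan P j w) = (\<Sum>s\<in>?I. csource a t s w)" for w
    using gsrc_chan_disjoint
    by (subst sum.union_disjoint) (auto simp: lin_def csource_gsrc sum.reindex inj_on_def csource_chan)
  have "(CLINT w|Om P. iexp (lin a w + (\<Sum>j\<le>horizon P. t j * chan P j w)))
      = (CLINT w|Om P. (\<Prod>s\<in>?I. iexp (csource a t s w)))"
    unfolding sum by (simp add: exp_sum[symmetric] sum_distrib_left)
  also have "\<dots> = (\<Prod>s\<in>?I. CLINT w|Om P. iexp (csource a t s w))"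
    using meas by (intro indep_vars_lebesgue_integral ind integrable_iexp) auto
  also have "\<dots> = (\<Prod>s\<in>gsrc. CLINT w|Om P. iexp (a s \<bullet> csrc s w)) * (\<Prod>j\<le>horizon P. CLINT w|Om P. iexp (t j * chan P j w))"
    using gsrc_chan_disjoint
    by (subst prod.union_disjoint) (auto simp: csource_gsrc prod.reindex inj_on_def csource_chan)
  also have "(\<Prod>s\<in>gsrc. CLINT w|Om P. iexp (a s \<bullet> csrc s w)) = exp (- lcov a a / 2)"
    by (simp del: of_real_prod add: of_real_prod[symmetric] csrc_functional(3) lcov_def exp_sum[symmetric] sum_negf sum_divide_distrib)
  finally show ?thesis by simp
qed

lemma lcov_symmetric: "lcov a b = lcov b a"
  by (simp flip: lin_moments(2) add: mult.commute)

lemma lin_add: "lin (\<lambda>s. a s + b s) w = lin a w + lin b w"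
  by (simp add: lin_def inner_add_left sum.distrib)

lemma lin_scaleR: "lin (\<lambda>s. c *\<^sub>R a s) w = c * lin a w"
  by (simp add: lin_def sum_distrib_left)

lemma lin_sum: "lin (\<lambda>s. \<Sum>i\<in>I. a i s) w = (\<Sum>i\<in>I. lin (a i) w)"
  unfolding lin_def by (simp add: inner_sum_left) (rule sum.swap)

lemma lcov_add: "lcov (\<lambda>s. a s + b s) c = lcov a c + lcov b c"
  by (simp add: lcov_def inner_add_left sum.distrib)

lemma lcov_scaleR: "lcov (\<lambda>s. r *\<^sub>R a s) c = r * lcov a c"
  by (simp add: lcov_def sum_distrib_left)

lemma lcov_sum: "lcov (\<lambda>s. \<Sum>i\<in>I. a i s) c = (\<Sum>i\<in>I. lcov (a i) c)"
  unfolding lcov_def by (simp add: inner_sum_left) (rule sum.swap)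

text \<open>Differentiating the joint characteristic function at zero in the direction of \<open>a\<close>.\<close>

lemma lin_fourier_0:
  assumes "lcov a b = 0"
  shows "(CLINT w|Om P. complex_of_real (lin a w) * iexp (lin b w + (\<Sum>j\<le>horizon P. t j * chan P j w))) = 0"
proof -
  define g where "g w = lin b w + (\<Sum>j\<le>horizon P. t j * chan P j w)" for w
  have gm [measurable]: "g \<in> borel_measurable (Om P)"
    unfolding g_def by (intro borel_measurable_add lin_measurable borel_measurable_sum borel_measurable_times chan_measurable) auto
  define K where "K = (\<Prod>j\<le>horizon P. CLINT w|Om P. iexp (t j * chan P j w)) * exp (- lcov b b / 2)"
  define s where "s n = 1 / real (Suc n)" for n
  have s0: "s \<longlonglongrightarrow> 0" unfolding s_def by (rule LIMSEQ_inverse_real_of_nat[unfolded inverse_eq_divide])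
  have spos: "s n \<noteq> 0" for n by (simp add: s_def)
  \<comment> \<open>As \<open>a\<close> and \<open>b\<close> are uncorrelated, the parameter
    \<open>r\<close> enters only through its square. The derivative in \<open>r\<close> at 0 is
    therefore zero, and that derivative is the integral in question up to the factor i.\<close>
  have phi: "(CLINT w|Om P. iexp (r * lin a w + g w)) = exp (- (r\<^sup>2 * lcov a a) / 2) * K" for r
  proof -
    have ba: "lcov b a = 0" using assms lcov_symmetric by simp
    have l2: "lcov x (\<lambda>s. r *\<^sub>R a s + b s) = r * lcov x a + lcov x b" for x
      by (subst lcov_symmetric) (simp add: lcov_add lcov_scaleR lcov_symmetric)
    have "r * lin a w + g w = lin (\<lambda>s. r *\<^sub>R a s + b s) w + (\<Sum>j\<le>horizon P. t j * chan P j w)" for w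
      by (simp add: lin_add lin_scaleR g_def)
    moreover have "- (r * (r * lcov a a + 0) + (r * 0 + lcov b b)) / 2 = - (r\<^sup>2 * lcov a a) / 2 + - lcov b b / 2"
      by (simp add: power2_eq_square field_simps)
    ultimately show ?thesis
      by (simp only: lin_chan_char lcov_add lcov_scaleR l2 assms ba exp_add of_real_mult) (simp add: K_def mult_ac)
  qed
  \<comment> \<open>The difference quotient in \<open>r\<close>, bounded in modulus by the absolute
    value of \<open>lin a w\<close>; this integrable bound lets the limit pass under the
    integral.\<close>
  define D where "D n w = (iexp (s n * lin a w) - 1) / complex_of_real (s n) * iexp (g w)" for n w
  have "(\<lambda>n. CLINT w|Om P. D n w) \<longlonglongrightarrow> (CLINT w|Om P. \<i> * lin a w * iexp (g w))"
  proof (rule integral_dominated_convergence[where w = "\<lambda>w. \<bar>lin a w\<bar>"])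
    show "integrable (Om P) (\<lambda>w. \<bar>lin a w\<bar>)" using lin_moments(3) by auto
    show "AE w in Om P. (\<lambda>n. D n w) \<longlonglongrightarrow> \<i> * lin a w * iexp (g w)"
    proof (rule AE_I2)
      fix w
      have "(\<lambda>n. (iexp (s n * lin a w) - 1) / complex_of_real (s n)) \<longlonglongrightarrow> \<i> * lin a w"
      proof (cases "lin a w = 0")
        case False
        define z where "z n = \<i> * complex_of_real (s n * lin a w)" for n
        have "z \<longlonglongrightarrow> \<i> * complex_of_real (0 * lin a w)"
          unfolding z_def by (intro tendsto_intros s0)
        then have "filterlim z (at 0) sequentially"
          using False spos by (auto simp: filterlim_at z_def)
        then have "(\<lambda>n. (exp (z n) - 1) / z n * (\<i> * lin a w)) \<longlonglongrightarrow> 1 * (\<i> * lin a w)"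
          by (intro tendsto_mult tendsto_const filterlim_compose[OF lim_exp_minus_1])
        moreover have "(exp (z n) - 1) / z n * (\<i> * lin a w) = (iexp (s n * lin a w) - 1) / complex_of_real (s n)" for n
          using False spos[of n] by (simp add: z_def)
        ultimately show ?thesis by simp
      qed simp
      then show "(\<lambda>n. D n w) \<longlonglongrightarrow> \<i> * lin a w * iexp (g w)"
        unfolding D_def by (intro tendsto_mult tendsto_const)
    qed
    fix n
    show "AE w in Om P. norm (D n w) \<le> \<bar>lin a w\<bar>"
    proof (rule AE_I2)
      fix w
      have "norm (iexp (s n * lin a w) - 1) \<le> \<bar>s n * lin a w\<bar>"
        using iexp_approx1[of "s n * lin a w" 0] by simp
      then show "norm (D n w) \<le> \<bar>lin a w\<bar>"
        using spos[of n] by (simp add: D_def norm_mult norm_divide abs_mult pos_divide_le_eq mult.commute)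
    qed
  qed (auto simp: D_def)
  moreover have "(CLINT w|Om P. D n w) = (exp (- ((s n)\<^sup>2 * lcov a a) / 2) - 1) / s n * K" for n
  proof -
    have i: "integrable (Om P) (\<lambda>w. iexp (r * lin a w + g w))" for r
      by (intro integrable_iexp) auto
    have "(CLINT w|Om P. D n w) = (CLINT w|Om P. (iexp (s n * lin a w + g w) - iexp (0 * lin a w + g w)) / complex_of_real (s n))"
      by (intro Bochner_Integration.integral_cong) (auto simp: D_def exp_add distrib_left field_simps)
    also have "\<dots> = ((CLINT w|Om P. iexp (s n * lin a w + g w)) - (CLINT w|Om P. iexp (0 * lin a w + g w))) / complex_of_real (s n)"
      by (simp only: integral_divide_zero Bochner_Integration.integral_diff[OF i i])
    also have "\<dots> = (exp (- ((s n)\<^sup>2 * lcov a a) / 2) - 1) / s n * K"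
      unfolding phi by (simp add: field_simps)
    finally show ?thesis .
  qed
  moreover have "(\<lambda>n. complex_of_real ((exp (- ((s n)\<^sup>2 * lcov a a) / 2) - 1) / s n) * K) \<longlonglongrightarrow> complex_of_real 0 * K"
  proof (intro tendsto_mult tendsto_const tendsto_of_real)
    have "((\<lambda>r::real. (exp (- (r\<^sup>2 * lcov a a) / 2) - 1) / r) \<longlongrightarrow> 0) (at 0)"
    proof -
      have "((\<lambda>r::real. exp (- (r\<^sup>2 * lcov a a) / 2)) has_field_derivative 0) (at 0)"
        by (auto intro!: derivative_eq_intros)
      then show ?thesis unfolding has_field_derivative_iff by simp
    qed
    then show "(\<lambda>n. (exp (- ((s n)\<^sup>2 * lcov a a) / 2) - 1) / s n) \<longlonglongrightarrow> 0"
      by (rule filterlim_compose) (use s0 spos in \<open>auto simp: filterlim_at\<close>)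
  qed
  ultimately have "(CLINT w|Om P. \<i> * lin a w * iexp (g w)) = 0"
    using LIMSEQ_unique by (fastforce simp: exp_of_real[symmetric])
  then show ?thesis by (simp add: mult.assoc g_def)
qed

text \<open>With \<open>t j0 = 0\<close> the exponential does not see channel \<open>j0\<close>, so
  the centered channel state splits off by independence and integrates to zero.\<close>

lemma chan_fourier_0:
  assumes j: "j0 \<le> horizon P" and t: "t j0 = 0"
  shows "(CLINT w|Om P. complex_of_real (chan P j0 w - (1 - loss P)) * iexp (lin b w + (\<Sum>j\<le>horizon P. t j * chan P j w))) = 0"
proof -
  let ?I = "gsrc \<union> Chan ` {..horizon P}"
  \<comment> \<open>Coefficient 1 at \<open>j0\<close> makes the member \<open>Chan j0\<close> of
    the independent family the channel state itself rather than its zero multiple.\<close>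
  define t' where "t' = t(j0 := 1)"
  define Y where "Y s = (if s = Chan j0 then (\<lambda>x. complex_of_real (x - (1 - loss P))) else iexp)" for s
  have ind: "indep_vars (\<lambda>_. borel) (\<lambda>s w. Y s (csource b t' s w)) ?I"
    by (rule indep_vars_compose2[OF indep_csource]) (auto simp: Y_def)
  have meas: "csource b t' s \<in> borel_measurable (Om P)" if "s \<in> ?I" for s
    using indep_csource[of b t'] that by (auto simp: indep_vars_def2)
  have cj: "csource b t' (Chan j0) w = chan P j0 w" for w by (simp add: csource_chan t'_def)
  have int: "integrable (Om P) (\<lambda>w. Y s (csource b t' s w))" if "s \<in> ?I" for s
  proof (cases "s = Chan j0")
    case True
    then show ?thesis using chan_integral[OF j] by (simp add: Y_def cj)
  next
    case False
    then show ?thesis using meas[OF that] by (auto simp: Y_def intro!: integrable_iexp)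
  qed
  have sum: "lin b w + (\<Sum>j\<le>horizon P. t j * chan P j w) = (\<Sum>s\<in>?I - {Chan j0}. csource b t' s w)" for w
  proof -
    have "?I - {Chan j0} = gsrc \<union> Chan ` ({..horizon P} - {j0})" using gsrc_chan_disjoint by auto
    then have "(\<Sum>s\<in>?I - {Chan j0}. csource b t' s w) = (\<Sum>s\<in>gsrc. csource b t' s w) + (\<Sum>s\<in>Chan ` ({..horizon P} - {j0}). csource b t' s w)"
      using gsrc_chan_disjoint by (simp, subst sum.union_disjoint) auto
    also have "(\<Sum>s\<in>Chan ` ({..horizon P} - {j0}). csource b t' s w) = (\<Sum>j\<in>{..horizon P} - {j0}. t j * chan P j w)"
      by (subst sum.reindex) (auto simp: inj_on_def csource_chan t'_def intro!: sum.cong)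
    also have "\<dots> = (\<Sum>j\<le>horizon P. t j * chan P j w)"
      using j t by (subst sum.remove[of _ j0]) auto
    finally show ?thesis by (simp add: lin_def csource_gsrc)
  qed
  have "(CLINT w|Om P. complex_of_real (chan P j0 w - (1 - loss P)) * iexp (lin b w + (\<Sum>j\<le>horizon P. t j * chan P j w)))
      = (CLINT w|Om P. (\<Prod>s\<in>?I. Y s (csource b t' s w)))"
  proof (rule Bochner_Integration.integral_cong[OF refl])
    fix w
    have "(\<Prod>s\<in>?I. Y s (csource b t' s w)) = Y (Chan j0) (csource b t' (Chan j0) w) * (\<Prod>s\<in>?I - {Chan j0}. Y s (csource b t' s w))"
      using j by (intro prod.remove) auto
    also have "(\<Prod>s\<in>?I - {Chan j0}. Y s (csource b t' s w)) = (\<Prod>s\<in>?I - {Chan j0}. iexp (csource b t' s w))"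
      by (intro prod.cong) (auto simp: Y_def)
    also have "\<dots> = iexp (\<Sum>s\<in>?I - {Chan j0}. csource b t' s w)"
      by (simp add: exp_sum[symmetric] sum_distrib_left)
    finally show "complex_of_real (chan P j0 w - (1 - loss P)) * iexp (lin b w + (\<Sum>j\<le>horizon P. t j * chan P j w))
       = (\<Prod>s\<in>?I. Y s (csource b t' s w))" by (simp only: sum cj) (simp add: Y_def)
  qed
  also have "\<dots> = (\<Prod>s\<in>?I. CLINT w|Om P. Y s (csource b t' s w))"
    by (intro indep_vars_lebesgue_integral ind int) auto
  also have "(CLINT w|Om P. Y (Chan j0) (csource b t' (Chan j0) w)) = 0"
    unfolding Y_def cj using chan_integral[OF j] by (simp del: of_real_diff add: prob_space)
  then have "(\<Prod>s\<in>?I. CLINT w|Om P. Y s (csource b t' s w)) = 0"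
    using j by (intro prod_zero) auto
  finally show ?thesis .
qed

section \<open>Sigma-algebras generated by Gaussian functionals and channel states\<close>

definition sig :: "(source \<Rightarrow> real^'n) set \<Rightarrow> nat set \<Rightarrow> 'w measure" where
  "sig K E = sigma (space (Om P)) ((\<Union>b\<in>K. {lin b -` D \<inter> space (Om P) | D. D \<in> sets borel})
      \<union> (\<Union>j\<in>E. {chan P j -` D \<inter> space (Om P) | D. D \<in> sets borel}))"

lemma space_sig [simp]: "space (sig K E) = space (Om P)"
  by (simp add: sig_def space_measure_of_conv)

lemma sets_sig:
  "sets (sig K E) = sigma_sets (space (Om P)) (\<Union>j\<in>Inl ` K \<union> Inr ` E.
     {(case j of Inl b \<Rightarrow> lin b | Inr j \<Rightarrow> chan P j) -` D \<inter> space (Om P) | D. D \<in> sets borel})"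
proof -
  have "sets (sig K E) = sigma_sets (space (Om P)) ((\<Union>b\<in>K. {lin b -` D \<inter> space (Om P) | D. D \<in> sets borel})
      \<union> (\<Union>j\<in>E. {chan P j -` D \<inter> space (Om P) | D. D \<in> sets borel}))"
    unfolding sig_def by (rule sets_measure_of) auto
  then show ?thesis by (simp add: UN_Un image_image)
qed

lemma sig_mono: "K \<subseteq> K' \<Longrightarrow> E \<subseteq> E' \<Longrightarrow> sets (sig K E) \<subseteq> sets (sig K' E')"
  unfolding sets_sig by (rule sigma_sets_mono') auto

lemma subalgebra_sig:
  assumes "E \<subseteq> {..horizon P}" shows "subalgebra (Om P) (sig K E)"
proof -
  have "(\<Union>j\<in>Inl ` K \<union> Inr ` E.
     {(case j of Inl b \<Rightarrow> lin b | Inr j \<Rightarrow> chan P j) -` D \<inter> space (Om P) | D. D \<in> sets borel}) \<subseteq> sets (Om P)"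
    using assms chan_measurable by (auto intro!: measurable_sets[OF lin_measurable] measurable_sets[of "chan P _" "Om P" borel])
  then show ?thesis unfolding subalgebra_def sets_sig by (simp add: sets.sigma_sets_subset)
qed

lemma sig_measurable_lin: "b \<in> K \<Longrightarrow> lin b \<in> borel_measurable (sig K E)"
  by (rule measurableI) (auto simp: sets_sig intro!: sigma_sets.Basic bexI[of _ "Inl b"])

lemma sig_measurable_chan: "j \<in> E \<Longrightarrow> chan P j \<in> borel_measurable (sig K E)"
  by (rule measurableI) (auto simp: sets_sig intro!: sigma_sets.Basic bexI[of _ "Inr j"])

text \<open>Every Fourier exponent over the generators is again one Gaussian functional plus a
  combination of channel states, the shape treated by \<open>lin_fourier_0\<close> and
  \<open>chan_fourier_0\<close>.\<close>

lemma sig_combination: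
  assumes K: "finite K" and E: "E \<subseteq> {..horizon P}"
  shows "(\<Sum>j\<in>Inl ` K \<union> Inr ` E. t j * (case j of Inl b \<Rightarrow> lin b | Inr j \<Rightarrow> chan P j) w)
    = lin (\<lambda>s. \<Sum>b\<in>K. t (Inl b) *\<^sub>R b s) w + (\<Sum>j\<le>horizon P. (if j \<in> E then t (Inr j) else 0) * chan P j w)"
proof -
  have fE: "finite E" using E finite_subset by blast
  have "(\<Sum>j\<in>Inl ` K \<union> Inr ` E. t j * (case j of Inl b \<Rightarrow> lin b | Inr j \<Rightarrow> chan P j) w)
    = (\<Sum>b\<in>K. t (Inl b) * lin b w) + (\<Sum>j\<in>E. t (Inr j) * chan P j w)"
    using K fE by (subst sum.union_disjoint) (auto simp: sum.reindex)
  also have "(\<Sum>j\<in>E. t (Inr j) * chan P j w) = (\<Sum>j\<le>horizon P. (if j \<in> E then t (Inr j) else 0) * chan P j w)"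
    using E by (intro sum.mono_neutral_cong_left) auto
  finally show ?thesis by (simp add: lin_sum lin_scaleR)
qed

text \<open>Being uncorrelated with each generator passes to the linear combination in the exponent,
  so the Fourier integral vanishes for every \<open>t\<close>. The conclusion covers nonlinear
  functions of the generators as well.\<close>

lemma lin_ortho_sig:
  assumes K: "finite K" and E: "E \<subseteq> {..horizon P}" and o: "\<And>b. b \<in> K \<Longrightarrow> lcov a b = 0" and A: "A \<in> sets (sig K E)"
  shows "(LINT w|Om P. lin a w * indicator A w) = 0"
proof (rule integral_generated_eq_0_of_fourier[OF _ lin_moments(3) _ _ A[unfolded sets_sig]])
  show "finite (Inl ` K \<union> Inr ` E)" using K E finite_subset by blast
  show "(case j of Inl b \<Rightarrow> lin b | Inr j \<Rightarrow> chan P j) \<in> borel_measurable (Om P)" if "j \<in> Inl ` K \<union> Inr ` E" for j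
    using that E chan_measurable by auto
  fix t :: "(source \<Rightarrow> real^'n) + nat \<Rightarrow> real"
  have "lcov a (\<lambda>s. \<Sum>b\<in>K. t (Inl b) *\<^sub>R b s) = 0"
    by (subst lcov_symmetric) (simp add: lcov_sum lcov_scaleR lcov_symmetric[of _ a] o)
  then show "(CLINT w|Om P. complex_of_real (lin a w) * iexp (\<Sum>j\<in>Inl ` K \<union> Inr ` E. t j * (case j of Inl b \<Rightarrow> lin b | Inr j \<Rightarrow> chan P j) w)) = 0"
    unfolding sig_combination[OF K E] by (rule lin_fourier_0)
qed

lemma chan_ortho_sig:
  assumes K: "finite K" and E: "E \<subseteq> {..horizon P}" and j: "j0 \<le> horizon P" "j0 \<notin> E" and A: "A \<in> sets (sig K E)"
  shows "(LINT w|Om P. (chan P j0 w - (1 - loss P)) * indicator A w) = 0"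
proof (rule integral_generated_eq_0_of_fourier[OF _ _ _ _ A[unfolded sets_sig]])
  show "finite (Inl ` K \<union> Inr ` E)" using K E finite_subset by blast
  show "(case j of Inl b \<Rightarrow> lin b | Inr j \<Rightarrow> chan P j) \<in> borel_measurable (Om P)" if "j \<in> Inl ` K \<union> Inr ` E" for j
    using that E chan_measurable by auto
  show "integrable (Om P) (\<lambda>w. chan P j0 w - (1 - loss P))" using chan_integral[OF j(1)] by simp
  fix t :: "(source \<Rightarrow> real^'n) + nat \<Rightarrow> real"
  show "(CLINT w|Om P. complex_of_real (chan P j0 w - (1 - loss P)) * iexp (\<Sum>j\<in>Inl ` K \<union> Inr ` E. t j * (case j of Inl b \<Rightarrow> lin b | Inr j \<Rightarrow> chan P j) w)) = 0"
    unfolding sig_combination[OF K E] by (rule chan_fourier_0) (use j in auto)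
qed

text \<open>Rescaled to unit variance, the functional has the standard normal characteristic
  function, hence a law with a density.\<close>

lemma lin_atomless:
  assumes "0 < lcov a a" shows "AE w in Om P. lin a w \<noteq> c"
proof -
  let ?s = "sqrt (lcov a a)"
  have s: "?s > 0" using assms by simp
  have [measurable]: "(\<lambda>w. lin a w / ?s) \<in> borel_measurable (Om P)" by simp
  have E: "distr (Om P) borel (\<lambda>w. lin a w / ?s) = std_normal_distribution"
  proof (rule Levy_uniqueness)
    show "real_distribution (distr (Om P) borel (\<lambda>w. lin a w / ?s))" by (rule real_distribution_distr) simp
    show "real_distribution std_normal_distribution" by (rule real_dist_normal_dist)
    show "char (distr (Om P) borel (\<lambda>w. lin a w / ?s)) = char std_normal_distribution"
    proof
      fix t
      have "char (distr (Om P) borel (\<lambda>w. lin a w / ?s)) t = (CLINT w|Om P. iexp (t * (lin a w / ?s)))"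
        unfolding char_def by (subst integral_distr) auto
      also have "\<dots> = (CLINT w|Om P. iexp (lin (\<lambda>s. (t / ?s) *\<^sub>R a s) w + (\<Sum>j\<le>horizon P. 0 * chan P j w)))"
        by (simp add: lin_scaleR)
      also have "\<dots> = exp (- lcov (\<lambda>s. (t / ?s) *\<^sub>R a s) (\<lambda>s. (t / ?s) *\<^sub>R a s) / 2)"
        by (subst lin_chan_char) (simp add: prob_space)
      also have "lcov (\<lambda>s. (t / ?s) *\<^sub>R a s) (\<lambda>s. (t / ?s) *\<^sub>R a s) = (t / ?s) * ((t / ?s) * lcov a a)"
        by (simp only: lcov_scaleR lcov_symmetric[of a "\<lambda>s. (t / ?s) *\<^sub>R a s"])
      also have "\<dots> = t\<^sup>2" using assms by (simp add: power2_eq_square field_simps real_sqrt_mult_self)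
      finally show "char (distr (Om P) borel (\<lambda>w. lin a w / ?s)) t = char std_normal_distribution t"
        by (simp add: char_std_normal_distribution exp_of_real[symmetric])
    qed
  qed
  have A: "AE x in std_normal_distribution. x \<noteq> c / ?s"
  proof -
    have "AE x in lborel. x \<noteq> c / ?s" by (rule AE_lborel_singleton)
    then show ?thesis by (subst AE_density) (auto elim: eventually_mono)
  qed
  have "AE x in distr (Om P) borel (\<lambda>w. lin a w / ?s). x \<noteq> c / ?s" unfolding E by (rule A)
  moreover have "{x \<in> space borel. x \<noteq> c / ?s} \<in> sets (borel :: real measure)" by simp
  ultimately have "AE w in Om P. lin a w / ?s \<noteq> c / ?s"
    using AE_distr_iff[of "\<lambda>w. lin a w / ?s" "Om P" borel "\<lambda>x. x \<noteq> c / ?s"] by simp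
  moreover have "lin a w / ?s \<noteq> c / ?s \<longleftrightarrow> lin a w \<noteq> c" for w using s by auto
  ultimately show ?thesis by simp
qed

end

declare transpose_matrix_vector [simp del]

section \<open>Matrix algebra\<close>

lemma matrix_mult_simps:
  fixes A A' :: "real^'n^'m" and B B' :: "real^'k^'n"
  shows "A ** (B + B') = A ** B + A ** B'" "(A + A') ** B = A ** B + A' ** B"
    "A ** (B - B') = A ** B - A ** B'" "(A - A') ** B = A ** B - A' ** B"
    "A ** (- B) = - (A ** B)" "(- A) ** B = - (A ** B)"
    "A ** (r *\<^sub>R B) = r *\<^sub>R (A ** B)" "(r *\<^sub>R A) ** B = r *\<^sub>R (A ** B)"
    "A ** 0 = (0 :: real^'k^'m)" "(0 :: real^'n^'m) ** B = 0"
  by (simp_all add: matrix_matrix_mult_def vec_eq_iff distrib_left distrib_right sum.distrib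
      left_diff_distrib right_diff_distrib sum_subtractf sum_negf sum_distrib_left mult_ac)

lemma matrix_mult_sum_right: "A ** (\<Sum>i\<in>I. B i) = (\<Sum>i\<in>I. A ** B i)" for A :: "real^'n^'m"
  by (induction I rule: infinite_finite_induct) (simp_all add: matrix_mult_simps)

lemma matrix_mult_sum_left: "(\<Sum>i\<in>I. B i) ** A = (\<Sum>i\<in>I. B i ** A)" for A :: "real^'n^'m"
  by (induction I rule: infinite_finite_induct) (simp_all add: matrix_mult_simps)

lemma matrix_vector_sum_right: "A *v (\<Sum>i\<in>I. x i) = (\<Sum>i\<in>I. A *v x i)" for A :: "real^'n^'m"
  by (induction I rule: infinite_finite_induct) (simp_all add: matrix_vector_right_distrib)

lemma matrix_vector_minus: "A *v (- x) = - (A *v x)" "(- A) *v x = - (A *v x)" for A :: "real^'n^'m"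
  by (simp_all add: vec_eq_iff matrix_vector_mult_def sum_negf)

lemma transpose_simps:
  fixes A B :: "real^'n^'m"
  shows "transpose (A + B) = transpose A + transpose B" "transpose (A - B) = transpose A - transpose B"
    "transpose (- A) = - transpose A" "transpose (r *\<^sub>R A) = r *\<^sub>R transpose A"
    "transpose (0 :: real^'n^'m) = 0"
  by (simp_all add: transpose_def vec_eq_iff)

lemma inner_transpose: "x \<bullet> (A *v y) = (transpose A *v x) \<bullet> y" for A :: "real^'n^'m"
  by (simp add: dot_lmul_matrix transpose_matrix_vector)

lemma invertible_real_inv:
  fixes A :: "real^'n^'n"
  assumes "invertible A"
  shows "A ** matrix_inv A = mat 1" "matrix_inv A ** A = mat 1"
  using assms unfolding invertible_def matrix_inv_def by (metis (mono_tags, lifting) someI_ex)+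

lemma inverse_unique_right:
  fixes A :: "real^'n^'n" and W T :: "real^'n^'m"
  assumes "invertible A" "W ** A = T" shows "W = T ** matrix_inv A"
  using assms invertible_real_inv[OF assms(1)] by (metis matrix_mul_assoc matrix_mul_rid)

lemma transpose_matrix_inv_sym:
  fixes A :: "real^'n^'n"
  assumes "invertible A" "transpose A = A" shows "transpose (matrix_inv A) = matrix_inv A"
proof -
  have "transpose (matrix_inv A) ** A = mat 1"
    using invertible_real_inv[OF assms(1)] assms(2) by (metis matrix_transpose_mul transpose_mat)
  then show ?thesis using inverse_unique_right[OF assms(1)] by fastforce
qed

lemma sym_pd_invertible:
  fixes S :: "real^'n^'n"
  assumes "sym_pd S" shows "invertible S"
proof -
  have "x = 0" if "S *v x = 0" for x using assms that by (auto simp: sym_pd_def dest: spec[of _ x])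
  then have "\<exists>B. B ** S = mat 1" unfolding matrix_left_invertible_ker by blast
  then show ?thesis unfolding invertible_left_inverse .
qed

text \<open>Moving from \<open>x\<close> in the direction \<open>y = S *v x\<close> changes the form
  by \<open>2 * t * a\<close> to first order, with \<open>a\<close> the squared length of
  \<open>y\<close>. A negative \<open>t\<close> close to 0 would make the form negative unless
  \<open>a = 0\<close>.\<close>

lemma sym_psd_kernel:
  fixes S :: "real^'n^'n"
  assumes S: "sym_psd S" and x: "x \<bullet> (S *v x) = 0" shows "S *v x = 0"
proof -
  define y a b where "y = S *v x" and "a = y \<bullet> y" and "b = y \<bullet> (S *v y)"
  have b: "0 \<le> b" using S by (simp add: sym_psd_def b_def)
  \<comment> \<open>Close to the minimiser \<open>- a / b\<close>, with \<open>b + 1\<close> in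
    place of \<open>b\<close> since \<open>b\<close> may vanish; the value is still negative for
    \<open>a\<close> different from 0.\<close>
  define t where "t = - a / (b + 1)"
  have "0 \<le> (x + t *\<^sub>R y) \<bullet> (S *v (x + t *\<^sub>R y))" using S by (simp add: sym_psd_def)
  also have "\<dots> = 2 * t * a + t\<^sup>2 * b"
    using x sym_psd_inner_commute[OF S, of x y]
    by (simp add: matrix_vector_right_distrib matrix_vector_mult_scaleR inner_add_left inner_add_right
        y_def[symmetric] a_def b_def power2_eq_square algebra_simps)
  also have "\<dots> = - (a\<^sup>2 * (b + 2)) / (b + 1)\<^sup>2"
    using b by (simp add: t_def power2_eq_square divide_simps) (simp add: algebra_simps)
  finally have "a\<^sup>2 * (b + 2) / (b + 1)\<^sup>2 \<le> 0" by simp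
  moreover have "0 \<le> a\<^sup>2 * (b + 2) / (b + 1)\<^sup>2" using b by simp
  ultimately have "a\<^sup>2 * (b + 2) / (b + 1)\<^sup>2 = 0" by linarith
  then have "a = 0" using b by auto
  then show ?thesis by (simp add: a_def y_def)
qed

lemma sym_psd_sandwich: "sym_psd S \<Longrightarrow> sym_psd (A ** S ** transpose A)" for A :: "real^'n^'m"
  unfolding sym_psd_def
  by (simp add: matrix_transpose_mul matrix_mul_assoc matrix_vector_mul_assoc[symmetric] inner_transpose[of _ A])

lemma sym_psd_add: "sym_psd S \<Longrightarrow> sym_psd T \<Longrightarrow> sym_psd (S + T)"
  unfolding sym_psd_def by (simp add: transpose_simps matrix_vector_mult_add_rdistrib inner_add_right)

text \<open>The range of the symmetric matrix \<open>H\<close> is the orthogonal complement of its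
  kernel. A kernel vector \<open>z\<close> satisfies \<open>S *v (transpose C *v z) = 0\<close>, so
  the columns of \<open>C ** S\<close> are orthogonal to the kernel and lie in the range of
  \<open>H\<close>.\<close>

lemma normal_equation_solvable:
  fixes S :: "real^'n^'n" and C :: "real^'n^'m" and V :: "real^'m^'m"
  assumes S: "sym_psd S" and V: "sym_psd V"
  shows "\<exists>W. W ** (C ** S ** transpose C + V) = S ** transpose C"
proof -
  define H where "H = C ** S ** transpose C + V"
  have H: "sym_psd H" unfolding H_def by (intro sym_psd_add sym_psd_sandwich S V)
  have ker: "S *v (transpose C *v z) = 0" if "H *v z = 0" for z
  proof -
    have "0 = z \<bullet> (H *v z)" using that by simp
    also have "\<dots> = (transpose C *v z) \<bullet> (S *v (transpose C *v z)) + z \<bullet> (V *v z)"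
      by (simp add: H_def matrix_vector_mult_add_rdistrib inner_add_right matrix_vector_mul_assoc[symmetric] inner_transpose[of _ C])
    finally have "(transpose C *v z) \<bullet> (S *v (transpose C *v z)) = 0"
      using S V unfolding sym_psd_def by (metis add_nonneg_eq_0_iff)
    then show ?thesis by (rule sym_psd_kernel[OF S])
  qed
  have "\<exists>x. H *v x = C *v (S *v axis i 1)" for i
  proof -
    define T where "T = range ((*v) H)"
    have subT: "subspace T" unfolding T_def by (intro linear_subspace_image) auto
    \<comment> \<open>The part \<open>z\<close> orthogonal to the range lies in the kernel by
      symmetry of \<open>H\<close>, and then \<open>ker\<close> shows that it is orthogonal to the
      column being decomposed. Hence \<open>z = 0\<close>.\<close>
    obtain y z where y: "y \<in> span T" and z: "\<And>w. w \<in> span T \<Longrightarrow> orthogonal z w"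
      and t: "C *v (S *v axis i 1) = y + z" by (rule orthogonal_subspace_decomp_exists[of T "C *v (S *v axis i 1)"]) blast
    have "(H *v z) \<bullet> (H *v z) = 0"
    proof -
      have "z \<bullet> (H *v (H *v z)) = 0" using z[of "H *v (H *v z)"] by (simp add: orthogonal_def T_def span_base)
      then show ?thesis using sym_psd_inner_commute[OF H] by metis
    qed
    then have Hz: "H *v z = 0" by simp
    have "z \<bullet> z = z \<bullet> (C *v (S *v axis i 1)) - z \<bullet> y" by (simp add: t inner_add_right)
    also have "z \<bullet> y = 0" using z[OF y] by (simp add: orthogonal_def)
    also have "z \<bullet> (C *v (S *v axis i 1)) = axis i 1 \<bullet> (S *v (transpose C *v z))"
      using sym_psd_inner_commute[OF S] by (metis inner_transpose)
    finally have "z = 0" using ker[OF Hz] by simp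
    then have "C *v (S *v axis i 1) \<in> T" using t y subT by (simp add: span_eq_iff[THEN iffD2])
    then show ?thesis unfolding T_def by auto
  qed
  then obtain x where x: "\<And>i. H *v x i = C *v (S *v axis i 1)" by metis
  have "H ** transpose (\<chi> i. x i) = C ** S"
  proof -
    have "(H ** transpose (\<chi> i. x i)) *v axis i 1 = (C ** S) *v axis i 1" for i
    proof -
      have "transpose (\<chi> i. x i) *v axis i 1 = x i"
        by (simp add: matrix_vector_mult_basis column_def transpose_def vec_eq_iff)
      then show ?thesis using x[of i] by (simp add: matrix_vector_mul_assoc[symmetric])
    qed
    then show ?thesis by (simp add: vec_eq_iff matrix_vector_mult_basis column_def)
  qed
  then have "transpose (H ** transpose (\<chi> i. x i)) = transpose (C ** S)" by simp
  then have "(\<chi> i. x i) ** H = S ** transpose C" using H S by (simp add: matrix_transpose_mul sym_psd_def)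
  then show ?thesis unfolding H_def by blast
qed

section \<open>The uncontrolled Kalman filter\<close>

context flq_setting
begin

definition vlin :: "(source \<Rightarrow> real^'n^'n) \<Rightarrow> 'w \<Rightarrow> real^'n" where
  "vlin a w = (\<Sum>s\<in>gsrc. a s *v csrc s w)"

definition vcov :: "(source \<Rightarrow> real^'n^'n) \<Rightarrow> (source \<Rightarrow> real^'n^'n) \<Rightarrow> real^'n^'n" where
  "vcov a b = (\<Sum>s\<in>gsrc. a s ** scov s ** transpose (b s))"

definition vrow :: "(source \<Rightarrow> real^'n^'n) \<Rightarrow> 'n \<Rightarrow> source \<Rightarrow> real^'n" where
  "vrow a i s = row i (a s)"

lemma vlin_nth: "vlin a w $ i = lin (vrow a i) w"
  by (simp add: vlin_def lin_def vrow_def row_def matrix_vector_mult_def inner_vec_def)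

lemma vlin_measurable [measurable]: "vlin a \<in> borel_measurable (Om P)"
  by (simp add: borel_measurable_vec_iff vlin_nth)

lemma vlin_sqint: "sqint (Om P) (vlin a)"
proof -
  have "(norm (vlin a w))\<^sup>2 = (\<Sum>i\<in>UNIV. lin (vrow a i) w * lin (vrow a i) w)" for w
    by (simp add: power2_norm_eq_inner inner_vec_def vlin_nth)
  then show ?thesis by (simp add: sqint_def lin_moments(1))
qed

lemma lcov_vrow: "lcov (vrow a i) (vrow b j) = vcov a b $ i $ j"
proof -
  have "row i A \<bullet> (S *v row j B) = (A ** S ** transpose B) $ i $ j" for A S B :: "real^'n^'n"
  proof -
    have "(A ** S ** transpose B) $ i $ j = (A ** (S ** transpose B)) $ i $ j" by (simp add: matrix_mul_assoc)
    then show ?thesis by (simp add: row_def inner_vec_def matrix_vector_mult_def matrix_matrix_mult_def transpose_def)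
  qed
  then show ?thesis by (simp add: lcov_def vcov_def vrow_def)
qed

lemma vlin_covariance: "(LINT w|Om P. vlin a w $ i * vlin b w $ j) = vcov a b $ i $ j"
  by (simp add: vlin_nth lin_moments(2) lcov_vrow)

lemma vlin_add: "vlin (\<lambda>s. a s + b s) w = vlin a w + vlin b w"
  by (simp add: vlin_def matrix_vector_mult_add_rdistrib sum.distrib)

lemma vlin_diff: "vlin (\<lambda>s. a s - b s) w = vlin a w - vlin b w"
  by (simp add: vlin_def matrix_vector_mult_diff_rdistrib sum_subtractf)

lemma vlin_mult: "vlin (\<lambda>s. A ** a s) w = A *v vlin a w"
  by (simp add: vlin_def matrix_vector_mul_assoc[symmetric] matrix_vector_sum_right)

lemma vlin_scaleR: "vlin (\<lambda>s. r *\<^sub>R a s) w = r *\<^sub>R vlin a w"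
  by (simp add: vlin_def scaleR_matrix_vector_assoc[symmetric] scaleR_sum_right)

lemma vcov_simps:
  "vcov (\<lambda>s. a s + a' s) b = vcov a b + vcov a' b" "vcov a (\<lambda>s. b s + b' s) = vcov a b + vcov a b'"
  "vcov (\<lambda>s. a s - a' s) b = vcov a b - vcov a' b" "vcov a (\<lambda>s. b s - b' s) = vcov a b - vcov a b'"
  "vcov (\<lambda>s. A ** a s) b = A ** vcov a b" "vcov a (\<lambda>s. A ** b s) = vcov a b ** transpose A"
  "vcov (\<lambda>s. r *\<^sub>R a s) b = r *\<^sub>R vcov a b" "vcov a (\<lambda>s. r *\<^sub>R b s) = r *\<^sub>R vcov a b"
  by (simp_all add: vcov_def matrix_mult_simps transpose_simps sum.distrib sum_subtractf matrix_mult_sum_right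
      matrix_mult_sum_left matrix_mul_assoc matrix_transpose_mul scaleR_sum_right)

lemma scov_psd: "s \<in> gsrc \<Longrightarrow> sym_psd (scov s)"
  using gsrc_gaussian by (auto simp: gaussian_vec_def)

lemma cov_psd: "sym_psd (cov0 P)" "sym_psd (covw P)" "sym_psd (covv P)"
  using scov_psd[of Init] scov_psd[of "Proc 0"] scov_psd[of "Meas 0"] by (simp_all add: scov_def gsrc_def)

lemma vcov_transpose: "transpose (vcov a b) = vcov b a"
proof -
  have "vcov a b $ i $ j = vcov b a $ j $ i" for i j
    by (metis lcov_vrow lcov_symmetric)
  then show ?thesis by (simp add: transpose_def vec_eq_iff)
qed

text \<open>Records which sources have entered a process so far. Disjoint supports give zero
  covariance, which is the form in which independence of fresh noise enters the filter.\<close>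

definition supp :: "source set \<Rightarrow> (source \<Rightarrow> real^'n^'n) \<Rightarrow> bool" where
  "supp J a \<longleftrightarrow> (\<forall>s. s \<notin> J \<longrightarrow> a s = 0)"

definition unit_src :: "source \<Rightarrow> source \<Rightarrow> real^'n^'n" where
  "unit_src s0 s = (if s = s0 then mat 1 else 0)"

lemma vcov_disjoint: "supp J a \<Longrightarrow> supp J' b \<Longrightarrow> J \<inter> J' = {} \<Longrightarrow> vcov a b = 0"
  unfolding vcov_def
proof (rule sum.neutral, rule ballI)
  fix s assume *: "supp J a" "supp J' b" "J \<inter> J' = {}"
  then have "a s = 0 \<or> b s = 0" by (auto simp: supp_def)
  then show "a s ** scov s ** transpose (b s) = 0" by (auto simp: matrix_mult_simps transpose_simps)
qed

lemma vlin_unit_src: "s \<in> gsrc \<Longrightarrow> vlin (unit_src s) w = csrc s w"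
  by (simp add: vlin_def unit_src_def if_distrib if_distribR sum.delta cong: if_cong)

lemma vcov_unit_src:
  assumes "s \<in> gsrc" shows "vcov (unit_src s) (unit_src s) = scov s"
proof -
  have "vcov (unit_src s) (unit_src s) = (\<Sum>s'\<in>gsrc. if s' = s then scov s else 0)"
    unfolding vcov_def by (rule sum.cong) (auto simp: unit_src_def matrix_mult_simps)
  then show ?thesis using assms by simp
qed

lemma supp_unit_src: "s \<in> J \<Longrightarrow> supp J (unit_src s)"
  by (auto simp: supp_def unit_src_def)

lemma supp_simps:
  "supp J a \<Longrightarrow> supp J b \<Longrightarrow> supp J (\<lambda>s. a s + b s)" "supp J a \<Longrightarrow> supp J b \<Longrightarrow> supp J (\<lambda>s. a s - b s)"
  "supp J a \<Longrightarrow> supp J (\<lambda>s. A ** a s)"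
  by (auto simp: supp_def matrix_mult_simps)

lemma supp_mono: "supp J a \<Longrightarrow> J \<subseteq> J' \<Longrightarrow> supp J' a"
  by (auto simp: supp_def)

text \<open>The innovation covariance may be singular, so the gain is any solution of the normal equation.\<close>

definition gain :: "real^'n^'n \<Rightarrow> real^'n^'n" where
  "gain S = (SOME W. W ** innov_cov P S = S ** transpose (matC P))"

lemma gain: "sym_psd S \<Longrightarrow> gain S ** innov_cov P S = S ** transpose (matC P)"
  unfolding gain_def innov_cov_def
  by (rule someI_ex) (rule normal_equation_solvable[OF _ cov_psd(3)])

text \<open>The recursion of \<open>filt_of\<close> and \<open>cov_pred\<close> with the gain taken
  from the normal equation, so that it is meaningful for a singular innovation covariance too.
  \<open>pcov_cov_pred\<close> identifies the two in the invertible case.\<close>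

definition fcov :: "real^'n^'n \<Rightarrow> real^'n^'n" where
  "fcov S = (mat 1 - gain S ** matC P) ** S ** transpose (mat 1 - gain S ** matC P)
     + gain S ** covv P ** transpose (gain S)"

primrec pcov :: "nat \<Rightarrow> real^'n^'n" where
  "pcov 0 = cov0 P"
| "pcov (Suc k) = matA P ** fcov (pcov k) ** transpose (matA P) + covw P"

definition kgain :: "nat \<Rightarrow> real^'n^'n" where
  "kgain k = gain (pcov k)"

lemma pcov_psd: "sym_psd (pcov k)"
  by (induction k) (auto intro!: sym_psd_add sym_psd_sandwich cov_psd simp: fcov_def)

lemma kgain: "kgain k ** innov_cov P (pcov k) = pcov k ** transpose (matC P)"
  unfolding kgain_def by (rule gain[OF pcov_psd])

text \<open>Coefficient processes (with respect to the centered sources) of the prediction error,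
  the innovation and the filtering error.\<close>

fun ep :: "nat \<Rightarrow> source \<Rightarrow> real^'n^'n" where
  "ep 0 = unit_src Init"
| "ep (Suc k) = (\<lambda>s. matA P ** (ep k s - kgain k ** (matC P ** ep k s + unit_src (Meas k) s)) + unit_src (Proc k) s)"

definition inn :: "nat \<Rightarrow> source \<Rightarrow> real^'n^'n" where
  "inn k = (\<lambda>s. matC P ** ep k s + unit_src (Meas k) s)"

definition ef :: "nat \<Rightarrow> source \<Rightarrow> real^'n^'n" where
  "ef k = (\<lambda>s. ep k s - kgain k ** inn k s)"

lemma ep_Suc: "ep (Suc k) = (\<lambda>s. matA P ** ef k s + unit_src (Proc k) s)"
  by (simp add: ef_def inn_def)

declare ep.simps(2) [simp del]

lemma supp_ep: "supp ({Init} \<union> Proc ` {..<k} \<union> Meas ` {..<k}) (ep k)"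
proof (induction k)
  case 0 show ?case by (simp add: supp_unit_src)
next
  case (Suc k)
  have "supp ({Init} \<union> Proc ` {..<Suc k} \<union> Meas ` {..<Suc k}) (ep k)"
    by (rule supp_mono[OF Suc]) auto
  then show ?case unfolding ep.simps by (intro supp_simps supp_unit_src) auto
qed

lemma supp_ep_meas: "supp ({Init} \<union> Proc ` {..<k} \<union> Meas ` {..k}) (ep k)"
  by (rule supp_mono[OF supp_ep]) auto

lemma supp_inn: "supp ({Init} \<union> Proc ` {..<k} \<union> Meas ` {..k}) (inn k)"
  unfolding inn_def by (intro supp_simps supp_unit_src supp_ep_meas) auto

lemma supp_ef: "supp ({Init} \<union> Proc ` {..<k} \<union> Meas ` {..k}) (ef k)"
  unfolding ef_def by (intro supp_simps supp_inn supp_ep_meas)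

lemma vcov_inn_of_ep:
  assumes "vcov (ep k) (ep k) = pcov k" "k \<le> horizon P"
  shows "vcov (inn k) (inn k) = innov_cov P (pcov k)" "vcov (ep k) (inn k) = pcov k ** transpose (matC P)"
proof -
  have z: "vcov (ep k) (unit_src (Meas k)) = 0"
    by (rule vcov_disjoint[OF supp_ep supp_unit_src[of _ "{Meas k}"]]) auto
  have z': "vcov (unit_src (Meas k)) (ep k) = 0"
    by (rule vcov_disjoint[OF supp_unit_src[of _ "{Meas k}"] supp_ep]) auto
  have v: "vcov (unit_src (Meas k)) (unit_src (Meas k)) = covv P"
    using assms(2) by (subst vcov_unit_src) (auto simp: gsrc_def scov_def)
  show "vcov (inn k) (inn k) = innov_cov P (pcov k)"
    unfolding inn_def vcov_simps assms(1) z z' v by (simp add: innov_cov_def matrix_mult_simps matrix_mul_assoc)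
  show "vcov (ep k) (inn k) = pcov k ** transpose (matC P)"
    unfolding inn_def vcov_simps assms(1) z by simp
qed

text \<open>Fresh noise has support disjoint from that of the earlier errors, so the cross terms
  drop out. The prediction error is covered one step further than the filtering error, because the
  last measurement is taken at \<open>horizon P\<close>.\<close>

lemma
  shows vcov_ep: "k \<le> Suc (horizon P) \<Longrightarrow> vcov (ep k) (ep k) = pcov k"
    and vcov_ef: "k \<le> horizon P \<Longrightarrow> vcov (ef k) (ef k) = fcov (pcov k)"
proof -
  have step: "vcov (ef k) (ef k) = fcov (pcov k)" if "vcov (ep k) (ep k) = pcov k" "k \<le> horizon P" for k
  proof -
    have ef_alt: "ef k = (\<lambda>s. (mat 1 - kgain k ** matC P) ** ep k s - kgain k ** unit_src (Meas k) s)"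
      by (simp add: ef_def inn_def matrix_mult_simps matrix_mul_assoc fun_eq_iff)
    have z: "vcov (ep k) (unit_src (Meas k)) = 0"
      by (rule vcov_disjoint[OF supp_ep supp_unit_src[of _ "{Meas k}"]]) auto
    have z': "vcov (unit_src (Meas k)) (ep k) = 0"
      by (rule vcov_disjoint[OF supp_unit_src[of _ "{Meas k}"] supp_ep]) auto
    have v: "vcov (unit_src (Meas k)) (unit_src (Meas k)) = covv P"
      using that(2) by (subst vcov_unit_src) (auto simp: gsrc_def scov_def)
    show ?thesis
      unfolding ef_alt vcov_simps that(1) z z' v
      by (simp add: fcov_def kgain_def[symmetric] matrix_mult_simps matrix_mul_assoc)
  qed
  have ep: "vcov (ep k) (ep k) = pcov k" if "k \<le> Suc (horizon P)" for k
    using that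
  proof (induction k)
    case 0 show ?case by (simp add: vcov_unit_src gsrc_def scov_def)
  next
    case (Suc k)
    have z: "vcov (ef k) (unit_src (Proc k)) = 0"
      by (rule vcov_disjoint[OF supp_ef supp_unit_src[of _ "{Proc k}"]]) auto
    have z': "vcov (unit_src (Proc k)) (ef k) = 0"
      by (rule vcov_disjoint[OF supp_unit_src[of _ "{Proc k}"] supp_ef]) auto
    have v: "vcov (unit_src (Proc k)) (unit_src (Proc k)) = covw P"
      using Suc.prems by (subst vcov_unit_src) (auto simp: gsrc_def scov_def)
    show ?case
      unfolding ep_Suc vcov_simps z z' v using Suc step[of k]
      by (simp add: matrix_mult_simps matrix_mul_assoc)
  qed
  then show "k \<le> Suc (horizon P) \<Longrightarrow> vcov (ep k) (ep k) = pcov k" .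
  show "k \<le> horizon P \<Longrightarrow> vcov (ef k) (ef k) = fcov (pcov k)" using step ep by simp
qed

lemma vcov_inn: "k \<le> horizon P \<Longrightarrow> vcov (inn k) (inn k) = innov_cov P (pcov k)"
  using vcov_inn_of_ep vcov_ep by simp

text \<open>Innovations are uncorrelated. At \<open>j = k\<close> the normal equation for
  \<open>kgain\<close> makes the filtering error uncorrelated with the current innovation; for
  earlier \<open>j\<close> the property is inherited, since each step adds only sources foreign to
  the past.\<close>

lemma
  shows vcov_ep_inn: "k \<le> Suc (horizon P) \<Longrightarrow> j < k \<Longrightarrow> vcov (ep k) (inn j) = 0"
  and vcov_ef_inn: "k \<le> horizon P \<Longrightarrow> j \<le> k \<Longrightarrow> vcov (ef k) (inn j) = 0"
  and vcov_inn_inn: "k \<le> horizon P \<Longrightarrow> j < k \<Longrightarrow> vcov (inn k) (inn j) = 0"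
proof -
  have inn: "vcov (inn k) (inn j) = 0" if "j < k" "vcov (ep k) (inn j) = 0" for j k
  proof -
    have "vcov (unit_src (Meas k)) (inn j) = 0"
      by (rule vcov_disjoint[OF supp_unit_src[of _ "{Meas k}"] supp_inn]) (use that in auto)
    then show ?thesis unfolding inn_def[of k] vcov_simps that(2) by (simp add: matrix_mult_simps)
  qed
  have ef: "vcov (ef k) (inn j) = 0" if "k \<le> horizon P" "j \<le> k" "\<And>j. j < k \<Longrightarrow> vcov (ep k) (inn j) = 0" for j k
  proof (cases "j = k")
    case True
    then show ?thesis
      unfolding ef_def vcov_simps True using vcov_inn_of_ep[of k] vcov_ep[of k] that(1) kgain[of k] by simp
  next
    case False
    then have "j < k" using that by simp
    then show ?thesis unfolding ef_def vcov_simps using that(3) inn by (simp add: matrix_mult_simps)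
  qed
  have ep: "vcov (ep k) (inn j) = 0" if "k \<le> Suc (horizon P)" "j < k" for j k
    using that
  proof (induction k arbitrary: j)
    case (Suc k)
    have "vcov (unit_src (Proc k)) (inn j) = 0"
      by (rule vcov_disjoint[OF supp_unit_src[of _ "{Proc k}"] supp_inn]) (use Suc.prems in auto)
    moreover have "vcov (ef k) (inn j) = 0" using Suc by (intro ef) auto
    ultimately show ?case unfolding ep_Suc vcov_simps by (simp add: matrix_mult_simps)
  qed simp
  show "k \<le> Suc (horizon P) \<Longrightarrow> j < k \<Longrightarrow> vcov (ep k) (inn j) = 0" using ep by blast
  show "k \<le> horizon P \<Longrightarrow> j \<le> k \<Longrightarrow> vcov (ef k) (inn j) = 0" using ef ep by simp
  show "k \<le> horizon P \<Longrightarrow> j < k \<Longrightarrow> vcov (inn k) (inn j) = 0" using inn ep by simp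
qed

section \<open>Filter processes and the control-free filtration\<close>

definition iota :: "nat \<Rightarrow> 'w \<Rightarrow> real^'n" where "iota k = vlin (inn k)"
definition err :: "nat \<Rightarrow> 'w \<Rightarrow> real^'n" where "err k = vlin (ef k)"
definition nu :: "nat \<Rightarrow> 'w \<Rightarrow> real^'n" where "nu k w = kgain k *v iota k w"

primrec xi :: "nat \<Rightarrow> 'w \<Rightarrow> real^'n" where
  "xi 0 = init P"
| "xi (Suc k) = (\<lambda>w. matA P *v xi k w + procn P k w)"

text \<open>Defined as state minus error; that it is a function of the innovations follows from the
  recursions \<open>zeta_0\<close> and \<open>zeta_Suc\<close>.\<close>

definition zeta :: "nat \<Rightarrow> 'w \<Rightarrow> real^'n" where "zeta k w = xi k w - err k w"

lemma zeta_0: "zeta 0 w = mean0 P + nu 0 w"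
  by (simp add: zeta_def err_def ef_def vlin_diff vlin_mult vlin_unit_src gsrc_def csrc_def nu_def iota_def)

lemma vlin_ep_Suc: "k \<le> horizon P \<Longrightarrow> vlin (ep (Suc k)) w = matA P *v err k w + procn P k w"
  by (simp add: ep_Suc vlin_add vlin_mult vlin_unit_src gsrc_def csrc_def err_def)

lemma zeta_Suc: "k \<le> horizon P \<Longrightarrow> zeta (Suc k) w = matA P *v zeta k w + nu (Suc k) w"
  by (simp add: zeta_def err_def[of "Suc k"] ef_def vlin_diff vlin_mult vlin_ep_Suc nu_def iota_def matrix_vector_mult_diff_distrib)

lemma iota_0: "iota 0 w = matC P *v xi 0 w + measn P 0 w - matC P *v mean0 P"
  by (simp add: iota_def inn_def vlin_add vlin_mult vlin_unit_src gsrc_def csrc_def matrix_vector_mult_diff_distrib)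

lemma iota_Suc:
  "Suc k \<le> horizon P \<Longrightarrow> iota (Suc k) w = matC P *v xi (Suc k) w + measn P (Suc k) w - matC P *v (matA P *v zeta k w)"
  by (simp add: iota_def inn_def vlin_add vlin_mult vlin_unit_src gsrc_def csrc_def vlin_ep_Suc zeta_def
      matrix_vector_mult_diff_distrib matrix_vector_right_distrib)

text \<open>The two indices are separate because the packet of time \<open>k\<close> is computed
  from innovations up to \<open>k\<close> but channel states only before \<open>k\<close>, that is,
  in \<open>GG (Suc k) k\<close>.\<close>

definition GG :: "nat \<Rightarrow> nat \<Rightarrow> 'w measure" where
  "GG a b = sig {vrow (inn j) i | i j. j < a} {..<b}"

lemma finite_GG: "finite {vrow (inn j) i | i j. j < a}"
proof -
  have "{vrow (inn j) i | i j. j < a} = (\<lambda>(i, j). vrow (inn j) i) ` (UNIV \<times> {..<a})" by auto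
  then show ?thesis by simp
qed

lemma space_GG [simp]: "space (GG a b) = space (Om P)"
  by (simp add: GG_def)

lemma GG_mono: "a \<le> a' \<Longrightarrow> b \<le> b' \<Longrightarrow> sets (GG a b) \<subseteq> sets (GG a' b')"
  unfolding GG_def by (rule sig_mono) (force)+

lemma measurable_GG_mono: "f \<in> borel_measurable (GG a b) \<Longrightarrow> a \<le> a' \<Longrightarrow> b \<le> b' \<Longrightarrow> f \<in> borel_measurable (GG a' b')"
  by (rule measurable_mono_sets[OF _ GG_mono]) auto

lemma subalgebra_GG: "b \<le> Suc (horizon P) \<Longrightarrow> subalgebra (Om P) (GG a b)"
  unfolding GG_def by (rule subalgebra_sig) auto

lemma iota_GG: "k < a \<Longrightarrow> iota k \<in> borel_measurable (GG a b)"
  unfolding borel_measurable_vec_iff iota_def vlin_nth GG_def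
  by (intro allI sig_measurable_lin[unfolded eta_contract_eq]) blast

lemma nu_GG: "k < a \<Longrightarrow> nu k \<in> borel_measurable (GG a b)"
  unfolding nu_def[abs_def] by (intro borel_measurable_matrix_vector_mult iota_GG)

lemma chan_GG: "k < b \<Longrightarrow> chan P k \<in> borel_measurable (GG a b)"
  unfolding GG_def by (rule sig_measurable_chan) simp

lemma zeta_GG: "k < a \<Longrightarrow> k \<le> horizon P \<Longrightarrow> zeta k \<in> borel_measurable (GG a b)"
proof (induction k)
  case 0
  then show ?case by (subst zeta_0[abs_def]) (intro borel_measurable_add borel_measurable_const nu_GG)
next
  case (Suc k)
  then have "zeta (Suc k) = (\<lambda>w. matA P *v zeta k w + nu (Suc k) w)" by (auto simp: zeta_Suc)
  then show ?case using Suc by (auto intro!: borel_measurable_add nu_GG borel_measurable_matrix_vector_mult)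
qed

lemma sqint_iota: "sqint (Om P) (iota k)" and sqint_err: "sqint (Om P) (err k)" and sqint_nu: "sqint (Om P) (nu k)"
  unfolding nu_def[abs_def] iota_def err_def by (intro vlin_sqint sqint_matrix_vector_mult)+

lemma sqint_zeta: "k \<le> horizon P \<Longrightarrow> sqint (Om P) (zeta k)"
proof (induction k)
  case 0
  then show ?case by (subst zeta_0[abs_def]) (intro sqint_add sqint_const sqint_nu)
next
  case (Suc k)
  then have "zeta (Suc k) = (\<lambda>w. matA P *v zeta k w + nu (Suc k) w)" by (auto simp: zeta_Suc)
  then show ?case using Suc by (auto intro!: sqint_add sqint_nu sqint_matrix_vector_mult)
qed

text \<open>Only the covariances with the innovations have to be checked; channel states of all
  times may be adjoined because they are independent of the Gaussian sources.\<close>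

lemma ortho_GG_lin:
  assumes "\<And>j. j < a \<Longrightarrow> vcov c (inn j) = 0" "b \<le> Suc (horizon P)"
  shows "ortho (Om P) (GG a b) (vlin c)"
  unfolding ortho_def vlin_nth
proof safe
  fix A i assume "A \<in> sets (GG a b)"
  then show "(LINT w|Om P. lin (vrow c i) w * indicator A w) = 0"
    unfolding GG_def using assms
    by (intro lin_ortho_sig[OF finite_GG]) (auto simp: lcov_vrow)
qed

lemma ortho_err: "k \<le> horizon P \<Longrightarrow> b \<le> Suc (horizon P) \<Longrightarrow> ortho (Om P) (GG (Suc k) b) (err k)"
  unfolding err_def by (rule ortho_GG_lin) (auto simp: vcov_ef_inn)

lemma ortho_iota: "k \<le> horizon P \<Longrightarrow> b \<le> Suc (horizon P) \<Longrightarrow> ortho (Om P) (GG k b) (iota k)"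
  unfolding iota_def by (rule ortho_GG_lin) (auto simp: vcov_inn_inn)

lemma ortho_nu: "k \<le> horizon P \<Longrightarrow> b \<le> Suc (horizon P) \<Longrightarrow> ortho (Om P) (GG k b) (nu k)"
  unfolding nu_def[abs_def] by (intro ortho_matrix_vector_mult ortho_iota sqint_iota subalgebra_GG)

lemma chan_indep_GG:
  assumes k: "k \<le> horizon P" and A: "A \<in> sets (GG a k)"
  shows "(LINT w|Om P. (chan P k w - (1 - loss P)) * indicator A w) = 0"
  using A unfolding GG_def by (rule chan_ortho_sig[OF finite_GG, rotated -1]) (use k in auto)

lemma chan_GG_integral:
  fixes g :: "'w \<Rightarrow> real"
  assumes k: "k \<le> horizon P" and g: "g \<in> borel_measurable (GG a k)" and gi: "integrable (Om P) g"
  shows "(LINT w|Om P. chan P k w * g w) = (1 - loss P) * integral\<^sup>L (Om P) g"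
    "(LINT w|Om P. (1 - chan P k w) * g w) = loss P * integral\<^sup>L (Om P) g"
    "integrable (Om P) (\<lambda>w. chan P k w * g w)"
proof -
  have sub: "subalgebra (Om P) (GG a k)" using k by (intro subalgebra_GG) auto
  have [measurable]: "chan P k \<in> borel_measurable (Om P)" by (rule chan_measurable[OF k])
  have [measurable]: "g \<in> borel_measurable (Om P)" using gi by auto
  show i: "integrable (Om P) (\<lambda>w. chan P k w * g w)"
    by (rule Bochner_Integration.integrable_bound[OF gi])
      (use chan_abs_le[OF k] in \<open>auto simp: abs_mult intro: mult_left_le_one_le elim!: eventually_mono\<close>)
  \<comment> \<open>A vector with a single component, to fit the vector-valued notion
    \<open>ortho\<close>.\<close>
  define X where "X w = (\<chi> i::1. chan P k w - (1 - loss P))" for w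
  have o: "ortho (Om P) (GG a k) X" unfolding ortho_def X_def using chan_indep_GG[OF k] by simp
  have "integrable (Om P) (\<lambda>w. g w * X w $ 1)"
    using i gi by (simp add: X_def algebra_simps)
  then have "(LINT w|Om P. g w * X w $ 1) = 0"
    by (intro ortho_mult_integral[OF sub _ o g]) (use chan_integral[OF k] in \<open>simp add: X_def\<close>)
  moreover have "(LINT w|Om P. g w * X w $ 1) = (LINT w|Om P. chan P k w * g w - (1 - loss P) * g w)"
    by (simp add: X_def algebra_simps)
  ultimately show e: "(LINT w|Om P. chan P k w * g w) = (1 - loss P) * integral\<^sup>L (Om P) g"
    using i gi by simp
  have "(LINT w|Om P. (1 - chan P k w) * g w) = (LINT w|Om P. g w - chan P k w * g w)"
    by (simp add: left_diff_distrib)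
  then show "(LINT w|Om P. (1 - chan P k w) * g w) = loss P * integral\<^sup>L (Om P) g"
    using i gi e by (simp add: left_diff_distrib)
qed

end

section \<open>Information generated by a control\<close>

lemma sets_generated_by_mono: "Y \<subseteq> Y' \<Longrightarrow> sets (generated_by M Y) \<subseteq> sets (generated_by M Y')"
  unfolding sets_generated_by by (rule sigma_sets_mono') blast

lemma measurable_generated_by_subset:
  assumes "f \<in> borel_measurable (generated_by M Y)" "Y \<subseteq> Y'"
  shows "f \<in> borel_measurable (generated_by M Y')"
  using assms(1) by (rule measurable_mono_sets) (use sets_generated_by_mono[OF assms(2)] in auto)

context flq_setting
begin

primrec cpart :: "('w, 'l, 'r) control \<Rightarrow> nat \<Rightarrow> 'w \<Rightarrow> real^'n" where
  "cpart u 0 = (\<lambda>w. 0)"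
| "cpart u (Suc k) = (\<lambda>w. matA P *v cpart u k w + matBL P *v fst u k w + matBR P *v snd u k w)"

lemma state_eq: "state P u k w = xi k w + cpart u k w"
  by (induction k) (simp_all add: matrix_vector_right_distrib)

definition preL :: "('w, 'l, 'r) control \<Rightarrow> nat \<Rightarrow> 'w measure" where
  "preL u k = generated_by (Om P) (obsL P u ` {..k} \<union> obsR P u ` {..<k})"

definition packet :: "('w, 'l, 'r) control \<Rightarrow> nat \<Rightarrow> 'w \<Rightarrow> real^'n" where
  "packet u k = cond_exp_vec (Om P) (preL u k) (state P u k)"

lemma obsR_packet: "obsR P u k = (\<lambda>w. chan P k w *\<^sub>R packet u k w)"
  by (subst obsR.simps) (simp add: packet_def preL_def)

definition y0 :: "nat \<Rightarrow> 'w \<Rightarrow> real^'n" where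
  "y0 k w = matC P *v xi k w + measn P k w"

lemma obsL_eq: "obsL P u k w = y0 k w + matC P *v cpart u k w"
  by (simp add: obsL_def state_eq y0_def matrix_vector_right_distrib)

lemma iota_y0: "iota 0 w = y0 0 w - matC P *v mean0 P"
  "Suc k \<le> horizon P \<Longrightarrow> iota (Suc k) w = y0 (Suc k) w - matC P *v (matA P *v zeta k w)"
  by (simp_all add: iota_0 iota_Suc y0_def)

text \<open>Admissibility of the controls before time \<open>k\<close>. The information at time
  \<open>k\<close> depends exactly on these, so facts about it are proved by induction on
  \<open>k\<close>.\<close>

definition adm :: "nat \<Rightarrow> ('w, 'l, 'r) control \<Rightarrow> bool" where
  "adm k u \<longleftrightarrow> (\<forall>j<k. fst u j \<in> borel_measurable (FL P u j) \<and> sqint (Om P) (fst u j)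
      \<and> snd u j \<in> borel_measurable (FR P u j) \<and> sqint (Om P) (snd u j))"

lemma adm_mono: "adm k u \<Longrightarrow> j \<le> k \<Longrightarrow> adm j u"
  by (auto simp: adm_def)

lemma y0_GG: "k \<le> horizon P \<Longrightarrow> y0 k \<in> borel_measurable (GG (Suc k) b)"
proof (cases k)
  case 0
  have "y0 0 = (\<lambda>w. iota 0 w + matC P *v mean0 P)" by (simp add: iota_y0)
  then show ?thesis using 0 by (auto intro!: borel_measurable_add iota_GG)
next
  case (Suc j)
  assume "k \<le> horizon P"
  then have "y0 k = (\<lambda>w. iota k w + matC P *v (matA P *v zeta j w))" by (simp add: Suc iota_y0)
  then show ?thesis using \<open>k \<le> horizon P\<close> Suc
    by (auto intro!: borel_measurable_add iota_GG borel_measurable_matrix_vector_mult zeta_GG)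
qed

lemma FR_sets_FL: "sets (FR P u k) \<subseteq> sets (FL P u k)"
  unfolding FR_def FL_def by (rule sets_generated_by_mono) auto

lemma space_FL [simp]: "space (FL P u k) = space (Om P)" and space_FR [simp]: "space (FR P u k) = space (Om P)"
  and space_preL [simp]: "space (preL u k) = space (Om P)"
  by (simp_all add: FL_def FR_def preL_def)

lemma preL_sets_FL: "sets (preL u k) \<subseteq> sets (FL P u k)"
  unfolding preL_def FL_def by (intro sets_generated_by_mono Un_mono image_mono) auto

text \<open>Induction step for \<open>obs_structure\<close>. The packet, a conditional expectation
  on \<open>preL u k\<close>, is known in \<open>GG (Suc k) k\<close>; only multiplication by the
  channel state of time \<open>k\<close> raises the second index.\<close>

lemma information_GG:
  assumes k: "k \<le> horizon P" and c: "cpart u k \<in> borel_measurable (GG k k)"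
    and L: "\<And>i. i < k \<Longrightarrow> obsL P u i \<in> borel_measurable (GG (Suc i) i)"
    and R: "\<And>i. i < k \<Longrightarrow> obsR P u i \<in> borel_measurable (GG (Suc i) (Suc i))"
  shows "obsL P u k \<in> borel_measurable (GG (Suc k) k)"
    "obsR P u k \<in> borel_measurable (GG (Suc k) (Suc k))"
    "sets (preL u k) \<subseteq> sets (GG (Suc k) k)"
    "sets (FL P u k) \<subseteq> sets (GG (Suc k) (Suc k))"
proof -
  show obsL: "obsL P u k \<in> borel_measurable (GG (Suc k) k)"
    unfolding obsL_eq[abs_def] using k measurable_GG_mono[OF c]
    by (intro borel_measurable_add y0_GG borel_measurable_matrix_vector_mult) auto
  show sub: "sets (preL u k) \<subseteq> sets (GG (Suc k) k)"
    unfolding preL_def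
  proof (rule generated_by_subset)
    fix f assume "f \<in> obsL P u ` {..k} \<union> obsR P u ` {..<k}"
    then consider "f = obsL P u k" | i where "i < k" "f = obsL P u i" | i where "i < k" "f = obsR P u i"
      by (auto simp: le_less)
    then show "f \<in> borel_measurable (GG (Suc k) k)"
    proof cases
      case 1 then show ?thesis using obsL by simp
    next
      case (2 i) then show ?thesis using measurable_GG_mono[OF L[of i], of "Suc k" k] by simp
    next
      case (3 i) then show ?thesis using measurable_GG_mono[OF R[of i], of "Suc k" k] by simp
    qed
  qed simp
  have "packet u k \<in> borel_measurable (GG (Suc k) k)"
    unfolding packet_def by (rule measurable_mono_sets[OF cond_exp_vec_measurable sub]) simp
  then have "packet u k \<in> borel_measurable (GG (Suc k) (Suc k))" by (rule measurable_GG_mono) simp_all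
  then show obsR: "obsR P u k \<in> borel_measurable (GG (Suc k) (Suc k))"
    unfolding obsR_packet by (intro borel_measurable_scaleR chan_GG) auto
  show "sets (FL P u k) \<subseteq> sets (GG (Suc k) (Suc k))"
    unfolding FL_def
  proof (rule generated_by_subset)
    fix f assume "f \<in> obsL P u ` {..k} \<union> obsR P u ` {..k}"
    then consider "f = obsL P u k" | "f = obsR P u k" | i where "i < k" "f = obsL P u i" | i where "i < k" "f = obsR P u i"
      by (auto simp: le_less)
    then show "f \<in> borel_measurable (GG (Suc k) (Suc k))"
    proof cases
      case 1 then show ?thesis using measurable_GG_mono[OF obsL, of "Suc k" "Suc k"] by simp
    next
      case 2 then show ?thesis using obsR by simp
    next
      case (3 i) then show ?thesis using measurable_GG_mono[OF L[of i], of "Suc k" "Suc k"] by simp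
    next
      case (4 i) then show ?thesis using measurable_GG_mono[OF R[of i], of "Suc k" "Suc k"] by simp
    qed
  qed simp
qed

lemma obs_structure:
  assumes "adm k u" "k \<le> Suc (horizon P)"
  shows "cpart u k \<in> borel_measurable (GG k k) \<and> sqint (Om P) (cpart u k) \<and>
    (\<forall>i<k. obsL P u i \<in> borel_measurable (GG (Suc i) i) \<and> obsR P u i \<in> borel_measurable (GG (Suc i) (Suc i)))"
  using assms
proof (induction k)
  case 0
  then show ?case by (simp add: sqint_0)
next
  case (Suc k)
  then have IH: "cpart u k \<in> borel_measurable (GG k k)" "sqint (Om P) (cpart u k)"
    "\<And>i. i < k \<Longrightarrow> obsL P u i \<in> borel_measurable (GG (Suc i) i)"
    "\<And>i. i < k \<Longrightarrow> obsR P u i \<in> borel_measurable (GG (Suc i) (Suc i))"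
    using adm_mono[of "Suc k" u k] by auto
  have k: "k \<le> horizon P" using Suc.prems by simp
  note info = information_GG[OF k IH(1,3,4)]
  note obsL = info(1) and obsR = info(2) and subF = info(4)
  have u: "fst u k \<in> borel_measurable (FL P u k)" "sqint (Om P) (fst u k)"
    "snd u k \<in> borel_measurable (FR P u k)" "sqint (Om P) (snd u k)"
    using Suc.prems by (auto simp: adm_def)
  have uG: "fst u k \<in> borel_measurable (GG (Suc k) (Suc k))" "snd u k \<in> borel_measurable (GG (Suc k) (Suc k))"
    using measurable_mono_sets[OF u(1) subF] measurable_mono_sets[OF u(3) order_trans[OF FR_sets_FL subF]] by auto
  have "cpart u (Suc k) \<in> borel_measurable (GG (Suc k) (Suc k))"
    unfolding cpart.simps
    by (intro borel_measurable_add borel_measurable_matrix_vector_mult uG measurable_GG_mono[OF IH(1)]) auto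
  moreover have "sqint (Om P) (cpart u (Suc k))"
    unfolding cpart.simps by (intro sqint_add sqint_matrix_vector_mult u IH)
  ultimately show ?case using IH obsL obsR by (auto simp: less_Suc_eq)
qed

lemma cpart_GG: "adm k u \<Longrightarrow> k \<le> Suc (horizon P) \<Longrightarrow> cpart u k \<in> borel_measurable (GG k k)"
  and sqint_cpart: "adm k u \<Longrightarrow> k \<le> Suc (horizon P) \<Longrightarrow> sqint (Om P) (cpart u k)"
  using obs_structure by auto

lemma
  assumes u: "adm k u" and k: "k \<le> horizon P"
  shows preL_GG: "sets (preL u k) \<subseteq> sets (GG (Suc k) k)"
    and FL_GG: "sets (FL P u k) \<subseteq> sets (GG (Suc k) (Suc k))"
  using information_GG[OF k, of u] obs_structure[OF u] k by auto

lemma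
  assumes u: "adm k u" and k: "k \<le> horizon P"
  shows subalgebra_FL: "subalgebra (Om P) (FL P u k)"
    and subalgebra_FR: "subalgebra (Om P) (FR P u k)"
proof -
  have "sets (GG (Suc k) (Suc k)) \<subseteq> sets (Om P)"
    using subalgebra_GG[of "Suc k" "Suc k"] k by (auto simp: subalgebra_def)
  then show "subalgebra (Om P) (FL P u k)" "subalgebra (Om P) (FR P u k)"
    using FL_GG[OF assms] FR_sets_FL[of u k] unfolding subalgebra_def by auto
qed

text \<open>\<open>admissible\<close> asks for integrability of the squared norms, while
  \<open>sqint\<close> includes measurability in \<open>Om P\<close>. The latter needs the
  information to be a subalgebra of \<open>Om P\<close>, which is known at time \<open>k\<close>
  once the earlier controls are square integrable; hence the induction.\<close>

lemma admissible_adm: "admissible P u \<longleftrightarrow> adm (Suc (horizon P)) u"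
proof
  assume a: "admissible P u"
  have "adm k u" if "k \<le> Suc (horizon P)" for k
    using that
  proof (induction k)
    case 0 show ?case by (simp add: adm_def)
  next
    case (Suc k)
    then have k: "k \<le> horizon P" and ak: "adm k u" by auto
    have "fst u k \<in> borel_measurable (FL P u k)" "snd u k \<in> borel_measurable (FR P u k)"
      "integrable (Om P) (\<lambda>w. (norm (fst u k w))\<^sup>2)" "integrable (Om P) (\<lambda>w. (norm (snd u k w))\<^sup>2)"
      using a k by (auto simp: admissible_def)
    moreover from this have "fst u k \<in> borel_measurable (Om P)" "snd u k \<in> borel_measurable (Om P)"
      using measurable_from_subalg[OF subalgebra_FL[OF ak k]] measurable_from_subalg[OF subalgebra_FR[OF ak k]] by auto
    ultimately show ?case using ak by (auto simp: adm_def sqint_def less_Suc_eq)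
  qed
  then show "adm (Suc (horizon P)) u" by simp
next
  assume "adm (Suc (horizon P)) u"
  then show "admissible P u" by (auto simp: admissible_def adm_def sqint_def less_Suc_eq_le)
qed

lemma adm_FL_preL:
  assumes "f \<in> borel_measurable (FL P u j)" "j < k" shows "f \<in> borel_measurable (preL u k)"
  using assms(1) unfolding preL_def FL_def
  by (rule measurable_generated_by_subset) (use assms(2) in auto)

lemma FR_FL: "f \<in> borel_measurable (FR P u j) \<Longrightarrow> f \<in> borel_measurable (FL P u j)"
  by (rule measurable_mono_sets[OF _ FR_sets_FL]) simp_all

lemma cpart_preL:
  assumes "adm k u" "j \<le> k" shows "cpart u j \<in> borel_measurable (preL u k)"
  using assms(2)
proof (induction j)
  case 0 show ?case by simp
next
  case (Suc j)
  then have "fst u j \<in> borel_measurable (FL P u j)" "snd u j \<in> borel_measurable (FR P u j)" "j < k"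
    using assms(1) by (auto simp: adm_def)
  then have "fst u j \<in> borel_measurable (preL u k)" "snd u j \<in> borel_measurable (preL u k)"
    using adm_FL_preL FR_FL by blast+
  then show ?case using Suc by (auto intro!: borel_measurable_add borel_measurable_matrix_vector_mult)
qed

lemma y0_preL:
  assumes "adm k u" "j \<le> k" shows "y0 j \<in> borel_measurable (preL u k)"
proof -
  have "obsL P u j \<in> borel_measurable (preL u k)"
    unfolding preL_def by (rule measurable_generated_by) (use assms in auto)
  moreover have "y0 j = (\<lambda>w. obsL P u j w - matC P *v cpart u j w)" by (simp add: obsL_eq)
  ultimately show ?thesis using cpart_preL[OF assms]
    by (auto intro!: borel_measurable_diff borel_measurable_matrix_vector_mult)
qed

text \<open>The local side knows all earlier controls, so it can subtract the controlled part from
  its measurements, recover \<open>y0\<close> and run the uncontrolled filter.\<close>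

lemma zeta_preL:
  assumes u: "adm k u" and k: "k \<le> horizon P" and "j \<le> k" shows "zeta j \<in> borel_measurable (preL u k)"
  using \<open>j \<le> k\<close>
proof (induction j)
  case 0
  have "zeta 0 = (\<lambda>w. mean0 P + kgain 0 *v (y0 0 w - matC P *v mean0 P))"
    by (auto simp: zeta_0 nu_def iota_y0)
  then show ?case using y0_preL[OF u, of 0]
    by (auto intro!: borel_measurable_add borel_measurable_diff borel_measurable_matrix_vector_mult)
next
  case (Suc j)
  then have "zeta (Suc j) = (\<lambda>w. matA P *v zeta j w + kgain (Suc j) *v (y0 (Suc j) w - matC P *v (matA P *v zeta j w)))"
    using k by (auto simp: zeta_Suc nu_def iota_y0)
  then show ?case using y0_preL[OF u Suc.prems] Suc
    by (auto intro!: borel_measurable_add borel_measurable_diff borel_measurable_matrix_vector_mult)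
qed

text \<open>One statement for the packet and for the local estimate: the candidate is measurable for
  the smaller sigma-algebra \<open>preL u k\<close>, and the error is orthogonal to the larger one,
  \<open>GG (Suc k) (Suc k)\<close>. Any information in between gives the same estimate; in
  particular, adding the received packet changes nothing.\<close>

lemma cond_exp_state:
  assumes u: "adm k u" and k: "k \<le> horizon P" and F: "sets (preL u k) \<subseteq> sets F" "sets F \<subseteq> sets (GG (Suc k) (Suc k))"
    "space F = space (Om P)"
  shows "AE w in Om P. cond_exp_vec (Om P) F (state P u k) w = zeta k w + cpart u k w"
proof (rule cond_exp_vec_eqI)
  have kS: "Suc k \<le> Suc (horizon P)" using k by simp
  have sG: "subalgebra (Om P) (GG (Suc k) (Suc k))" by (rule subalgebra_GG[OF kS])
  then show "subalgebra (Om P) F" using F by (auto simp: subalgebra_def)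
  have sc: "sqint (Om P) (cpart u k)" using sqint_cpart[OF u] k by simp
  show sz: "sqint (Om P) (\<lambda>w. zeta k w + cpart u k w)" by (intro sqint_add sc sqint_zeta k)
  have "state P u k = (\<lambda>w. (zeta k w + cpart u k w) + err k w)" by (auto simp: state_eq zeta_def)
  then show "sqint (Om P) (state P u k)" using sqint_add[OF sz sqint_err] by simp
  have "(\<lambda>w. zeta k w + cpart u k w) \<in> borel_measurable (preL u k)"
    by (intro borel_measurable_add zeta_preL cpart_preL u k order_refl)
  then show "(\<lambda>w. zeta k w + cpart u k w) \<in> borel_measurable F"
    by (rule measurable_mono_sets) (use F in auto)
  have "(\<lambda>w. state P u k w - (zeta k w + cpart u k w)) = err k" by (auto simp: state_eq zeta_def)
  then show "ortho (Om P) F (\<lambda>w. state P u k w - (zeta k w + cpart u k w))"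
    using ortho_mono[OF ortho_err[OF k kS] F(2)] by simp
qed

lemma packet_AE:
  assumes u: "adm k u" and k: "k \<le> horizon P"
  shows "AE w in Om P. packet u k w = zeta k w + cpart u k w"
  unfolding packet_def
  using order_trans[OF preL_GG[OF assms] GG_mono[of "Suc k" "Suc k" k "Suc k"]]
  by (intro cond_exp_state[OF assms]) auto

lemma estL_AE:
  assumes u: "adm k u" and k: "k \<le> horizon P"
  shows "AE w in Om P. estL P u k w = zeta k w + cpart u k w"
  unfolding estL_def by (intro cond_exp_state[OF assms] preL_sets_FL FL_GG[OF assms]) simp

lemma obsR_AE:
  assumes u: "adm k u" and k: "k \<le> horizon P"
  shows "AE w in Om P. obsR P u k w = chan P k w *\<^sub>R (zeta k w + cpart u k w)"
  using packet_AE[OF assms] by eventually_elim (simp add: obsR_packet)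

lemma obsL_measurable: "adm k u \<Longrightarrow> k \<le> horizon P \<Longrightarrow> obsL P u k \<in> borel_measurable (Om P)"
  by (rule measurable_from_subalg[OF subalgebra_FL]) (auto simp: FL_def intro: measurable_generated_by)

lemma obsR_measurable: "adm k u \<Longrightarrow> k \<le> horizon P \<Longrightarrow> obsR P u k \<in> borel_measurable (Om P)"
  by (rule measurable_from_subalg[OF subalgebra_FL]) (auto simp: FL_def intro: measurable_generated_by)

section \<open>Controls adapted to the information they generate\<close>

definition agree :: "nat \<Rightarrow> ('w, 'l, 'r) control \<Rightarrow> ('w, 'l, 'r) control \<Rightarrow> bool" where
  "agree k u u' \<longleftrightarrow> (\<forall>j<k. fst u j = fst u' j \<and> snd u j = snd u' j)"

lemma state_agree: "agree k u u' \<Longrightarrow> state P u k = state P u' k"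
  by (induction k) (auto simp: agree_def)

lemma obsL_agree: "agree k u u' \<Longrightarrow> obsL P u k = obsL P u' k"
  using state_agree[of k u u'] by (simp add: obsL_def[abs_def])

lemma agree_mono: "agree k u u' \<Longrightarrow> j \<le> k \<Longrightarrow> agree j u u'"
  by (auto simp: agree_def)

lemma obsR_agree: "agree k u u' \<Longrightarrow> obsR P u k = obsR P u' k"
proof (induction k rule: less_induct)
  case (less k)
  have "obsL P u ` {..k} = obsL P u' ` {..k}"
    by (intro image_cong refl obsL_agree agree_mono[OF less.prems]) simp
  moreover have "obsR P u ` {..<k} = obsR P u' ` {..<k}"
    by (intro image_cong refl less.IH agree_mono[OF less.prems]) simp_all
  ultimately show ?case
    unfolding obsR_packet[of u k] obsR_packet[of u' k] packet_def preL_def state_agree[OF less.prems] by simp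
qed

lemma FL_agree: "agree k u u' \<Longrightarrow> FL P u k = FL P u' k" and FR_agree: "agree k u u' \<Longrightarrow> FR P u k = FR P u' k"
proof -
  assume a: "agree k u u'"
  have "obsL P u ` {..k} = obsL P u' ` {..k}"
    by (intro image_cong refl obsL_agree agree_mono[OF a]) simp
  moreover have "obsR P u ` {..k} = obsR P u' ` {..k}"
    by (intro image_cong refl obsR_agree agree_mono[OF a]) simp
  ultimately show "FL P u k = FL P u' k" "FR P u k = FR P u' k" by (simp_all add: FL_def FR_def)
qed

text \<open>The rule at time \<open>k\<close> depends only on the values before \<open>k\<close>, so
  filling in one time after another, starting from the zero control, yields a fixed point.\<close>

lemma nonanticipating_fixpoint:
  fixes F :: "nat \<Rightarrow> ('w, 'l, 'r) control \<Rightarrow> ('w \<Rightarrow> real^'l) \<times> ('w \<Rightarrow> real^'r)"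
  assumes na: "\<And>k u u'. agree k u u' \<Longrightarrow> F k u = F k u'"
  shows "\<exists>u. \<forall>k. (fst u k, snd u k) = F k u"
proof -
  define bld where "bld = rec_nat ((\<lambda>_ _. 0, \<lambda>_ _. 0) :: ('w, 'l, 'r) control)
    (\<lambda>k b. ((fst b)(k := fst (F k b)), (snd b)(k := snd (F k b))))"
  have bSuc: "bld (Suc k) = ((fst (bld k))(k := fst (F k (bld k))), (snd (bld k))(k := snd (F k (bld k))))" for k
    by (simp add: bld_def)
  define u where "u = ((\<lambda>k. fst (F k (bld k))), (\<lambda>k. snd (F k (bld k))))"
  have ag: "agree k (bld k) u" for k
    by (induction k) (auto simp: agree_def bSuc u_def less_Suc_eq)
  have "(fst u k, snd u k) = F k (bld k)" for k by (simp add: u_def)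
  then have "(fst u k, snd u k) = F k u" for k using na[OF ag] by simp
  then show ?thesis by blast
qed

text \<open>Invariance under the conditional expectation expresses measurability up to null sets.\<close>

definition realizable :: "('w, 'l, 'r) control \<Rightarrow> bool" where
  "realizable U \<longleftrightarrow> (\<forall>k\<le>horizon P. sqint (Om P) (fst U k) \<and> sqint (Om P) (snd U k) \<and>
    (\<forall>u. adm k u \<longrightarrow> (\<forall>j<k. AE w in Om P. fst u j w = fst U j w \<and> snd u j w = snd U j w) \<longrightarrow>
      (AE w in Om P. cond_exp_vec (Om P) (FL P u k) (fst U k) w = fst U k w) \<and>
      (AE w in Om P. cond_exp_vec (Om P) (FR P u k) (snd U k) w = snd U k w)))"

text \<open>The control sought conditions the target on the information which it generates itself.
  This rule is non-anticipating, so a fixed point exists; once it agrees with the target almost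
  surely before \<open>k\<close>, \<open>realizable\<close> gives agreement at
  \<open>k\<close>.\<close>

lemma realizable_control:
  assumes U: "realizable U"
  shows "\<exists>u. admissible P u \<and> (\<forall>k\<le>horizon P. AE w in Om P. fst u k w = fst U k w \<and> snd u k w = snd U k w)"
proof -
  have "\<exists>u. \<forall>k. (fst u k, snd u k) = (cond_exp_vec (Om P) (FL P u k) (fst U k), cond_exp_vec (Om P) (FR P u k) (snd U k))"
    by (rule nonanticipating_fixpoint) (simp add: FL_agree FR_agree)
  then obtain u where uu: "\<forall>k. (fst u k, snd u k) = (cond_exp_vec (Om P) (FL P u k) (fst U k), cond_exp_vec (Om P) (FR P u k) (snd U k))"
    by blast
  then have u: "fst u k = cond_exp_vec (Om P) (FL P u k) (fst U k)"
    "snd u k = cond_exp_vec (Om P) (FR P u k) (snd U k)" for k by simp_all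
  have "adm k u \<and> (\<forall>j<k. AE w in Om P. fst u j w = fst U j w \<and> snd u j w = snd U j w)" if "k \<le> Suc (horizon P)" for k
    using that
  proof (induction k)
    case 0 show ?case by (simp add: adm_def)
  next
    case (Suc k)
    then have k: "k \<le> horizon P" and ak: "adm k u"
      and eq: "\<forall>j<k. AE w in Om P. fst u j w = fst U j w \<and> snd u j w = snd U j w" by auto
    have sU: "sqint (Om P) (fst U k)" "sqint (Om P) (snd U k)" using U k by (auto simp: realizable_def)
    have r: "(AE w in Om P. cond_exp_vec (Om P) (FL P u k) (fst U k) w = fst U k w) \<and>
      (AE w in Om P. cond_exp_vec (Om P) (FR P u k) (snd U k) w = snd U k w)"
      using U k ak eq unfolding realizable_def by blast
    have AEk: "AE w in Om P. fst u k w = fst U k w" "AE w in Om P. snd u k w = snd U k w"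
      using r unfolding u(1)[of k] u(2)[of k] by blast+
    have m: "fst u k \<in> borel_measurable (FL P u k)" "snd u k \<in> borel_measurable (FR P u k)"
      unfolding u(1)[of k] u(2)[of k] by (rule cond_exp_vec_measurable)+
    have "sqint (Om P) (fst u k)" "sqint (Om P) (snd u k)"
      using sqint_cong_AE[OF sU(1) AEk(1) measurable_from_subalg[OF subalgebra_FL[OF ak k] m(1)]]
        sqint_cong_AE[OF sU(2) AEk(2) measurable_from_subalg[OF subalgebra_FR[OF ak k] m(2)]] by auto
    moreover have "AE w in Om P. fst u k w = fst U k w \<and> snd u k w = snd U k w"
      using AEk by eventually_elim auto
    ultimately show ?case using ak eq m by (auto simp: adm_def less_Suc_eq)
  qed
  from this[of "Suc (horizon P)"] show ?thesis unfolding admissible_adm less_Suc_eq_le by blast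
qed

lemma cpart_cong_AE:
  assumes "\<forall>j<k. AE w in Om P. fst u j w = fst U j w \<and> snd u j w = snd U j w"
  shows "AE w in Om P. cpart u k w = cpart U k w"
  using assms
proof (induction k)
  case 0 show ?case by simp
next
  case (Suc k)
  then have "AE w in Om P. cpart u k w = cpart U k w" "AE w in Om P. fst u k w = fst U k w \<and> snd u k w = snd U k w" by auto
  then show ?case by eventually_elim simp
qed

end

section \<open>Riccati recursions and the deterministic quadratic form\<close>

definition joinv :: "real^('l::finite) \<Rightarrow> real^('r::finite) \<Rightarrow> real^('l + 'r)" where
  "joinv a b = (\<chi> i. case i of Inl i \<Rightarrow> a $ i | Inr i \<Rightarrow> b $ i)"

lemma block_joinv [simp]: "blockL (joinv a b) = a" "blockR (joinv a b) = b"
  by (simp_all add: joinv_def blockL_def blockR_def vec_eq_iff)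

lemma joinv_block [simp]: "joinv (blockL v) (blockR v) = v"
  by (auto simp: joinv_def blockL_def blockR_def vec_eq_iff split: sum.split)

lemma block_eqI: "blockL v = blockL w \<Longrightarrow> blockR v = blockR w \<Longrightarrow> v = w"
  by (metis joinv_block)

lemma block_simps:
  "blockL (v + w) = blockL v + blockL w" "blockR (v + w) = blockR v + blockR w"
  "blockL (v - w) = blockL v - blockL w" "blockR (v - w) = blockR v - blockR w"
  "blockL (- v) = - blockL v" "blockR (- v) = - blockR v"
  "blockL (c *\<^sub>R v) = c *\<^sub>R blockL v" "blockR (c *\<^sub>R v) = c *\<^sub>R blockR v"
  "blockL 0 = 0" "blockR 0 = 0"
  by (simp_all add: blockL_def blockR_def vec_eq_iff)

lemma sum_UNIV_Plus: "(\<Sum>i\<in>(UNIV :: ('l::finite + 'r::finite) set). f i) = (\<Sum>i\<in>UNIV. f (Inl i)) + (\<Sum>i\<in>UNIV. f (Inr i))"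
proof -
  have "sum f (UNIV <+> UNIV) = (\<Sum>i\<in>UNIV. f (Inl i)) + (\<Sum>i\<in>UNIV. f (Inr i))"
    by (subst sum.Plus) auto
  then show ?thesis by simp
qed

lemma inner_block: "v \<bullet> w = blockL v \<bullet> blockL w + blockR v \<bullet> blockR w"
  by (simp add: inner_vec_def sum_UNIV_Plus blockL_def blockR_def)

lemma matB_mult: "matB P *v v = matBL P *v blockL v + matBR P *v blockR v"
  by (simp add: matB_def matrix_vector_mult_def vec_eq_iff sum_UNIV_Plus blockL_def blockR_def)

lemma matR_mult: "matR P *v v = joinv (matRL P *v blockL v) (matRR P *v blockR v)"
  by (auto simp: matR_def matrix_vector_mult_def vec_eq_iff sum_UNIV_Plus blockL_def blockR_def joinv_def split: sum.split)

lemma transpose_matR: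
  assumes "transpose (matRL P) = matRL P" "transpose (matRR P) = matRR P"
  shows "transpose (matR P) = matR P"
  using assms by (auto simp: matR_def transpose_def vec_eq_iff split: sum.split)

text \<open>Stated for any \<open>K\<close> that solves the linear equation, so that one lemma
  serves the recursions of \<open>ZZ\<close>, \<open>XX\<close> and \<open>VV\<close>.\<close>

lemma complete_square:
  fixes A Y :: "real^'n^'n" and B :: "real^'m^'n" and R :: "real^'m^'m"
  assumes Y: "transpose Y = Y" and R: "transpose R = R" and H: "H = transpose B ** Y ** B + R" and inv: "invertible H"
    and K: "H ** K = transpose B ** Y ** A"
  shows "v \<bullet> (R *v v) + (A *v x + B *v v) \<bullet> (Y *v (A *v x + B *v v))
    = x \<bullet> ((transpose A ** Y ** A - transpose K ** H ** K) *v x) + (v + K *v x) \<bullet> (H *v (v + K *v x))"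
proof -
  have Hs: "transpose H = H" unfolding H by (simp add: transpose_simps matrix_transpose_mul Y R matrix_mul_assoc)
  have sym: "a \<bullet> (S *v b) = b \<bullet> (S *v a)" if "transpose S = S" for a b and S :: "real^'k^'k"
    using that by (metis inner_commute inner_transpose)
  have Hv: "a \<bullet> (H *v b) = (B *v a) \<bullet> (Y *v (B *v b)) + a \<bullet> (R *v b)" for a b
    by (simp add: H matrix_vector_mult_add_rdistrib inner_add_right matrix_vector_mul_assoc[symmetric] inner_transpose[of _ "transpose B"])
  have HK: "a \<bullet> (H *v (K *v x)) = (B *v a) \<bullet> (Y *v (A *v x))" for a
    unfolding matrix_vector_mul_assoc K
    by (simp add: matrix_vector_mul_assoc[symmetric] inner_transpose[of _ "transpose B"])
  have 1: "x \<bullet> ((transpose A ** Y ** A - transpose K ** H ** K) *v x) = (A *v x) \<bullet> (Y *v (A *v x)) - (K *v x) \<bullet> (H *v (K *v x))"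
    by (simp add: matrix_vector_mult_diff_rdistrib inner_diff_right matrix_vector_mul_assoc[symmetric] inner_transpose[of _ "transpose _"])
  have 2: "(v + K *v x) \<bullet> (H *v (v + K *v x)) = v \<bullet> (H *v v) + 2 * (v \<bullet> (H *v (K *v x))) + (K *v x) \<bullet> (H *v (K *v x))"
    using sym[OF Hs, of v "K *v x"] by (simp add: matrix_vector_right_distrib inner_add_left inner_add_right)
  have 3: "(A *v x + B *v v) \<bullet> (Y *v (A *v x + B *v v)) = (A *v x) \<bullet> (Y *v (A *v x)) + 2 * ((B *v v) \<bullet> (Y *v (A *v x))) + (B *v v) \<bullet> (Y *v (B *v v))"
    using sym[OF Y, of "A *v x" "B *v v"] by (simp add: matrix_vector_right_distrib inner_add_left inner_add_right)
  show ?thesis by (simp only: 1 3, simp only: 2, simp only: HK, simp add: Hv)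
qed

lemma sandwich_sym: "transpose Y = Y \<Longrightarrow> transpose (transpose B ** Y ** B) = transpose B ** Y ** B" for B :: "real^'m^'n"
  by (simp add: matrix_transpose_mul matrix_mul_assoc)

lemma sandwich_quadratic: "x \<bullet> ((transpose B ** Y ** B) *v x) = (B *v x) \<bullet> (Y *v (B *v x))" for B :: "real^'m^'n"
  by (simp add: matrix_vector_mul_assoc[symmetric] inner_transpose[of _ "transpose B"])

lemma sandwich_inverse:
  fixes H :: "real^'m^'m" and T :: "real^'n^'m"
  assumes "invertible H" "transpose H = H"
  shows "transpose T ** matrix_inv H ** T = transpose (matrix_inv H ** T) ** H ** (matrix_inv H ** T)"
proof -
  have "transpose (matrix_inv H ** T) = transpose T ** matrix_inv H"
    by (simp add: matrix_transpose_mul transpose_matrix_inv_sym assms)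
  moreover have "X ** matrix_inv H ** H = X" for X :: "real^'m^'n"
    by (simp add: matrix_mul_assoc[symmetric] invertible_real_inv assms)
  ultimately show ?thesis by (simp add: matrix_mul_assoc)
qed

section \<open>The three Riccati recursions and their order\<close>

locale flq_riccati = flq_setting P for P :: "('w, 'n::finite, 'l::finite, 'r::finite) flq" +
  fixes \<mu> :: real
  assumes mu: "0 \<le> \<mu>"
begin

abbreviation "ZZ \<equiv> ricZ P \<mu>"
abbreviation "XX \<equiv> ricX P \<mu>"
abbreviation "SS \<equiv> ricS P \<mu>"

text \<open>The weight of the mean. In the sum of the two recursions the terms with
  \<open>gainK\<close> cancel, so \<open>VV\<close> obeys the classical Riccati equation with
  weights \<open>matQ\<close>, \<open>matR\<close> and \<open>matG\<close>, free of \<mu>.\<close>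

definition VV :: "nat \<Rightarrow> real^'n^'n" where "VV k = ZZ k + SS k"

definition KV :: "nat \<Rightarrow> real^'n^('l + 'r)" where "KV k = matrix_inv (Mmat P \<mu> k) ** Nmat P \<mu> k"

definition KL :: "nat \<Rightarrow> real^'n^'l" where "KL k = matrix_inv (Lambda P \<mu> k) ** gainL P \<mu> k"

lemma weights: "sym_psd (matQ P)" "sym_psd (matRL P)" "sym_psd (matRR P)" "sym_psd (matG P)"
  using model by (simp_all add: flq_model_def)

lemma weights_sym: "transpose (matQ P) = matQ P" "transpose (matRL P) = matRL P" "transpose (matRR P) = matRR P"
  "transpose (matG P) = matG P" "transpose (matR P) = matR P"
  using weights transpose_matR by (auto simp: sym_psd_def)

lemma weights_nonneg: "0 \<le> x \<bullet> (matQ P *v x)" "0 \<le> x \<bullet> (matG P *v x)" "0 \<le> a \<bullet> (matRL P *v a)"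
  "0 \<le> b \<bullet> (matRR P *v b)" "0 \<le> v \<bullet> (matR P *v v)"
  using weights by (auto simp: sym_psd_def inner_block matR_mult)

lemma Qmu_quadratic: "x \<bullet> (Qmu P \<mu> *v y) = x \<bullet> (matQ P *v y) + \<mu> * (x \<bullet> (matQ P *v y))"
  "x \<bullet> (Gmu P \<mu> *v y) = x \<bullet> (matG P *v y) + \<mu> * (x \<bullet> (matQ P *v y))"
  by (simp_all add: Qmu_def Gmu_def matrix_vector_mult_add_rdistrib inner_add_right scaleR_matrix_vector_assoc[symmetric])

lemma weights_mu_sym: "transpose (Qmu P \<mu>) = Qmu P \<mu>" "transpose (Gmu P \<mu>) = Gmu P \<mu>"
  by (simp_all add: Qmu_def Gmu_def transpose_simps weights_sym)

lemma terminal: "ZZ (Suc (horizon P)) = Gmu P \<mu>" "XX (Suc (horizon P)) = Gmu P \<mu>" "SS (Suc (horizon P)) = - (\<mu> *\<^sub>R matQ P)"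
  "VV (Suc (horizon P)) = matG P"
  unfolding VV_def by (simp_all add: ricZ.simps ricX.simps ricS.simps Gmu_def)

lemma ZZ_step:
  "k \<le> horizon P \<Longrightarrow> ZZ k = transpose (matA P) ** ZZ (Suc k) ** matA P + Qmu P \<mu>
     - transpose (gainK P \<mu> k) ** Upsilon P \<mu> k ** gainK P \<mu> k"
  by (subst ricZ.simps) (simp add: Let_def gainK_def Upsilon_def)

lemma XX_step0:
  "k \<le> horizon P \<Longrightarrow> XX k = transpose (matA P) ** Theta P \<mu> (Suc k) ** matA P + Qmu P \<mu>
     - transpose (gainL P \<mu> k) ** matrix_inv (Lambda P \<mu> k) ** gainL P \<mu> k"
  by (subst ricX.simps) (simp add: Let_def gainL_def Lambda_def Theta_def)

lemma SS_step:
  "k \<le> horizon P \<Longrightarrow> SS k = transpose (matA P) ** SS (Suc k) ** matA P - \<mu> *\<^sub>R matQ P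
     + transpose (gainK P \<mu> k) ** Upsilon P \<mu> k ** gainK P \<mu> k
     - transpose (Nmat P \<mu> k) ** matrix_inv (Mmat P \<mu> k) ** Nmat P \<mu> k"
  by (subst ricS.simps) (simp add: Let_def gainK_def Upsilon_def Nmat_def Mmat_def)

lemma Mmat_VV: "Mmat P \<mu> k = transpose (matB P) ** VV (Suc k) ** matB P + matR P"
  by (simp add: Mmat_def M_of_def VV_def matrix_mult_simps)

lemma Nmat_VV: "Nmat P \<mu> k = transpose (matB P) ** VV (Suc k) ** matA P"
  by (simp add: Nmat_def N_of_def VV_def matrix_mult_simps)

lemma Upsilon_ZZ: "Upsilon P \<mu> k = transpose (matB P) ** ZZ (Suc k) ** matB P + matR P"
  by (simp add: Upsilon_def Upsilon_of_def)

lemma Lambda_Theta: "Lambda P \<mu> k = transpose (matBL P) ** Theta P \<mu> (Suc k) ** matBL P + matRL P"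
  by (simp add: Lambda_def Lambda_of_def)

lemma gains:
  shows "invertible (Upsilon P \<mu> k) \<Longrightarrow> Upsilon P \<mu> k ** gainK P \<mu> k = transpose (matB P) ** ZZ (Suc k) ** matA P"
    "invertible (Mmat P \<mu> k) \<Longrightarrow> Mmat P \<mu> k ** KV k = transpose (matB P) ** VV (Suc k) ** matA P"
    "invertible (Lambda P \<mu> k) \<Longrightarrow> Lambda P \<mu> k ** KL k = transpose (matBL P) ** Theta P \<mu> (Suc k) ** matA P"
  by (simp_all add: gainK_def K_of_def Upsilon_def[symmetric] KV_def KL_def Nmat_VV[symmetric] gainL_def L_of_def
      matrix_mul_assoc invertible_real_inv)

lemma VV_step:
  assumes "k \<le> horizon P" "invertible (Mmat P \<mu> k)" "transpose (Mmat P \<mu> k) = Mmat P \<mu> k"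
  shows "VV k = (transpose (matA P) ** VV (Suc k) ** matA P - transpose (KV k) ** Mmat P \<mu> k ** KV k) + matQ P"
  unfolding KV_def sandwich_inverse[OF assms(2,3), symmetric]
  using assms(1) by (simp add: VV_def ZZ_step SS_step matrix_mult_simps Qmu_def)

lemma XX_step:
  assumes "k \<le> horizon P" "invertible (Lambda P \<mu> k)" "transpose (Lambda P \<mu> k) = Lambda P \<mu> k"
  shows "XX k = (transpose (matA P) ** Theta P \<mu> (Suc k) ** matA P - transpose (KL k) ** Lambda P \<mu> k ** KL k) + Qmu P \<mu>"
  unfolding KL_def sandwich_inverse[OF assms(2,3), symmetric]
  using assms(1) by (simp add: XX_step0)

lemma VV_square:
  assumes "k \<le> horizon P" "transpose (VV (Suc k)) = VV (Suc k)" "sym_pd (Mmat P \<mu> k)"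
  shows "x \<bullet> (matQ P *v x) + v \<bullet> (matR P *v v) + (matA P *v x + matB P *v v) \<bullet> (VV (Suc k) *v (matA P *v x + matB P *v v))
    = x \<bullet> (VV k *v x) + (v + KV k *v x) \<bullet> (Mmat P \<mu> k *v (v + KV k *v x))"
proof -
  have inv: "invertible (Mmat P \<mu> k)" and sym: "transpose (Mmat P \<mu> k) = Mmat P \<mu> k"
    using sym_pd_invertible[OF assms(3)] assms(3) by (auto simp: sym_pd_def)
  show ?thesis
    using complete_square[OF assms(2) weights_sym(5) Mmat_VV inv gains(2)[OF inv], of v x]
    unfolding VV_step[OF assms(1) inv sym] by (simp add: matrix_vector_mult_add_rdistrib inner_add_right)
qed

lemma ZZ_square:
  assumes "k \<le> horizon P" "transpose (ZZ (Suc k)) = ZZ (Suc k)" "sym_pd (Upsilon P \<mu> k)"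
  shows "x \<bullet> (Qmu P \<mu> *v x) + v \<bullet> (matR P *v v) + (matA P *v x + matB P *v v) \<bullet> (ZZ (Suc k) *v (matA P *v x + matB P *v v))
    = x \<bullet> (ZZ k *v x) + (v + gainK P \<mu> k *v x) \<bullet> (Upsilon P \<mu> k *v (v + gainK P \<mu> k *v x))"
proof -
  have inv: "invertible (Upsilon P \<mu> k)" using sym_pd_invertible[OF assms(3)] .
  show ?thesis
    using complete_square[OF assms(2) weights_sym(5) Upsilon_ZZ inv gains(1)[OF inv], of v x]
    unfolding ZZ_step[OF assms(1)]
    by (simp add: matrix_vector_mult_add_rdistrib matrix_vector_mult_diff_rdistrib inner_add_right inner_diff_right)
qed

lemma XX_square:
  assumes "k \<le> horizon P" "transpose (Theta P \<mu> (Suc k)) = Theta P \<mu> (Suc k)" "sym_pd (Lambda P \<mu> k)"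
  shows "x \<bullet> (Qmu P \<mu> *v x) + v \<bullet> (matRL P *v v) + (matA P *v x + matBL P *v v) \<bullet> (Theta P \<mu> (Suc k) *v (matA P *v x + matBL P *v v))
    = x \<bullet> (XX k *v x) + (v + KL k *v x) \<bullet> (Lambda P \<mu> k *v (v + KL k *v x))"
proof -
  have inv: "invertible (Lambda P \<mu> k)" and sym: "transpose (Lambda P \<mu> k) = Lambda P \<mu> k"
    using sym_pd_invertible[OF assms(3)] assms(3) by (auto simp: sym_pd_def)
  show ?thesis
    using complete_square[OF assms(2) weights_sym(2) Lambda_Theta inv gains(3)[OF inv], of v x]
    unfolding XX_step[OF assms(1) inv sym] by (simp add: matrix_vector_mult_add_rdistrib inner_add_right)
qed

lemma sym_pd_nonneg: "sym_pd S \<Longrightarrow> 0 \<le> x \<bullet> (S *v x)"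
  by (cases "x = 0") (auto simp: sym_pd_def less_imp_le)

definition riccati_order :: "nat \<Rightarrow> bool" where
  "riccati_order k \<longleftrightarrow> transpose (ZZ k) = ZZ k \<and> transpose (XX k) = XX k \<and> transpose (VV k) = VV k \<and>
    (\<forall>x. 0 \<le> x \<bullet> (VV k *v x) \<and> x \<bullet> (VV k *v x) \<le> x \<bullet> (ZZ k *v x) \<and> x \<bullet> (ZZ k *v x) \<le> x \<bullet> (XX k *v x))"

lemma riccati_order_terminal: "riccati_order (Suc (horizon P))"
  using weights_nonneg mu unfolding riccati_order_def terminal
  by (simp add: weights_mu_sym weights_sym Qmu_quadratic)

lemma Theta_sym: "riccati_order k \<Longrightarrow> transpose (Theta P \<mu> k) = Theta P \<mu> k"
  by (simp add: riccati_order_def Theta_def transpose_simps)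

lemma Theta_ge: "riccati_order k \<Longrightarrow> x \<bullet> (ZZ k *v x) \<le> x \<bullet> (Theta P \<mu> k *v x)"
proof -
  assume "riccati_order k"
  then have "loss P * (x \<bullet> (ZZ k *v x)) \<le> loss P * (x \<bullet> (XX k *v x))"
    using loss_range by (intro mult_left_mono) (auto simp: riccati_order_def)
  then show ?thesis
    by (simp add: Theta_def matrix_vector_mult_add_rdistrib inner_add_right scaleR_matrix_vector_assoc[symmetric] algebra_simps)
qed

text \<open>\<open>Upsilon\<close> dominates \<open>Mmat\<close> because \<open>ZZ\<close> dominates
  \<open>VV\<close>. \<open>Lambda\<close> dominates the restriction of \<open>Upsilon\<close> to
  purely local controls \<open>joinv a 0\<close> because \<open>Theta\<close>, a mixture of
  \<open>ZZ\<close> and \<open>XX\<close>, dominates \<open>ZZ\<close>.\<close>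

lemma riccati_definite:
  assumes o: "riccati_order (Suc k)" and M: "sym_pd (Mmat P \<mu> k)"
  shows "sym_pd (Upsilon P \<mu> k)" "sym_pd (Lambda P \<mu> k)"
proof -
  show U: "sym_pd (Upsilon P \<mu> k)"
    unfolding sym_pd_def
  proof safe
    show "transpose (Upsilon P \<mu> k) = Upsilon P \<mu> k"
      using o by (simp add: Upsilon_ZZ transpose_simps sandwich_sym riccati_order_def weights_sym)
    fix v :: "real^('l + 'r)" assume "v \<noteq> 0"
    then have "0 < v \<bullet> (Mmat P \<mu> k *v v)" using M by (simp add: sym_pd_def)
    also have "\<dots> \<le> v \<bullet> (Upsilon P \<mu> k *v v)"
      using o by (simp add: Mmat_VV Upsilon_ZZ matrix_vector_mult_add_rdistrib inner_add_right sandwich_quadratic riccati_order_def)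
    finally show "0 < v \<bullet> (Upsilon P \<mu> k *v v)" .
  qed
  show "sym_pd (Lambda P \<mu> k)"
    unfolding sym_pd_def
  proof safe
    show "transpose (Lambda P \<mu> k) = Lambda P \<mu> k"
      using Theta_sym[OF o] by (simp add: Lambda_Theta transpose_simps sandwich_sym weights_sym)
    fix a :: "real^'l" assume "a \<noteq> 0"
    then have "joinv a (0 :: real^'r) \<noteq> 0" by (metis block_joinv(1) block_simps(9))
    then have "0 < joinv a 0 \<bullet> (Upsilon P \<mu> k *v joinv a 0)" using U by (simp add: sym_pd_def)
    also have "joinv a 0 \<bullet> (Upsilon P \<mu> k *v joinv a 0)
        = (matB P *v joinv a 0) \<bullet> (ZZ (Suc k) *v (matB P *v joinv a 0)) + joinv a 0 \<bullet> (matR P *v joinv a 0)"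
      by (simp add: Upsilon_ZZ matrix_vector_mult_add_rdistrib inner_add_right sandwich_quadratic)
    also have "\<dots> = (matBL P *v a) \<bullet> (ZZ (Suc k) *v (matBL P *v a)) + a \<bullet> (matRL P *v a)"
      by (simp add: matB_mult matR_mult inner_block)
    also have "\<dots> \<le> (matBL P *v a) \<bullet> (Theta P \<mu> (Suc k) *v (matBL P *v a)) + a \<bullet> (matRL P *v a)"
      using Theta_ge[OF o, of "matBL P *v a"] by simp
    also have "\<dots> = a \<bullet> (Lambda P \<mu> k *v a)"
      by (simp add: Lambda_Theta matrix_vector_mult_add_rdistrib inner_add_right sandwich_quadratic)
    finally show "0 < a \<bullet> (Lambda P \<mu> k *v a)" .
  qed
qed

text \<open>Each form is the minimum over a control of stage cost plus next form. \<open>ZZ\<close>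
  has larger stage and next weights than \<open>VV\<close>, and \<open>XX\<close> minimises over
  local controls only, with the still larger next weight \<open>Theta\<close>.\<close>

lemma riccati_order_step:
  assumes o: "riccati_order (Suc k)" and M: "sym_pd (Mmat P \<mu> k)" and k: "k \<le> horizon P"
  shows "riccati_order k"
proof -
  note UL = riccati_definite[OF o M]
  have sy: "transpose (ZZ (Suc k)) = ZZ (Suc k)" "transpose (VV (Suc k)) = VV (Suc k)"
    using o by (auto simp: riccati_order_def)
  have pd: "invertible (Mmat P \<mu> k)" "transpose (Mmat P \<mu> k) = Mmat P \<mu> k"
    "invertible (Lambda P \<mu> k)" "transpose (Lambda P \<mu> k) = Lambda P \<mu> k" "transpose (Upsilon P \<mu> k) = Upsilon P \<mu> k"
    using sym_pd_invertible M UL by (auto simp: sym_pd_def)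
  note V = VV_square[OF k sy(2) M] and Z = ZZ_square[OF k sy(1) UL(1)] and X = XX_square[OF k Theta_sym[OF o] UL(2)]
  have "0 \<le> x \<bullet> (VV k *v x) \<and> x \<bullet> (VV k *v x) \<le> x \<bullet> (ZZ k *v x) \<and> x \<bullet> (ZZ k *v x) \<le> x \<bullet> (XX k *v x)" for x
  proof (intro conjI)
    have nn: "0 \<le> y \<bullet> (VV (Suc k) *v y)" "y \<bullet> (VV (Suc k) *v y) \<le> y \<bullet> (ZZ (Suc k) *v y)" for y
      using o by (auto simp: riccati_order_def)
    show "0 \<le> x \<bullet> (VV k *v x)"
    proof -
      define v where "v = - (KV k *v x)"
      have "v + KV k *v x = 0" by (simp add: v_def)
      then show ?thesis
        using V[of x v] weights_nonneg(1)[of x] weights_nonneg(5)[of v] nn(1)[of "matA P *v x + matB P *v v"] by simp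
    qed
    have "x \<bullet> (VV k *v x) \<le> x \<bullet> (matQ P *v x) + v \<bullet> (matR P *v v) + (matA P *v x + matB P *v v) \<bullet> (VV (Suc k) *v (matA P *v x + matB P *v v))" for v
      using V[of x v] sym_pd_nonneg[OF M, of "v + KV k *v x"] by linarith
    also have "\<dots> v \<le> x \<bullet> (Qmu P \<mu> *v x) + v \<bullet> (matR P *v v) + (matA P *v x + matB P *v v) \<bullet> (ZZ (Suc k) *v (matA P *v x + matB P *v v))" for v
      using nn(2) mu weights_nonneg by (intro add_mono order_refl) (auto simp: Qmu_quadratic)
    finally show "x \<bullet> (VV k *v x) \<le> x \<bullet> (ZZ k *v x)"
      using Z[of x "- (gainK P \<mu> k *v x)"] by (metis ab_left_minus add.right_neutral inner_zero_left)
    \<comment> \<open>The minimiser for \<open>XX\<close>, extended by a zero remote part and used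
      as a competitor in the minimisation behind \<open>ZZ\<close>.\<close>
    define a where "a = - (KL k *v x)"
    have "x \<bullet> (ZZ k *v x) \<le> x \<bullet> (Qmu P \<mu> *v x) + joinv a 0 \<bullet> (matR P *v joinv a 0)
        + (matA P *v x + matB P *v joinv a 0) \<bullet> (ZZ (Suc k) *v (matA P *v x + matB P *v joinv a 0))"
      using Z[of x "joinv a 0"] sym_pd_nonneg[OF UL(1), of "joinv a 0 + gainK P \<mu> k *v x"] by linarith
    also have "\<dots> \<le> x \<bullet> (Qmu P \<mu> *v x) + a \<bullet> (matRL P *v a) + (matA P *v x + matBL P *v a) \<bullet> (Theta P \<mu> (Suc k) *v (matA P *v x + matBL P *v a))"
      using Theta_ge[OF o, of "matA P *v x + matBL P *v a"] by (simp add: matB_mult matR_mult inner_block)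
    also have "\<dots> = x \<bullet> (XX k *v x)" using X[of x a] by (simp add: a_def)
    finally show "x \<bullet> (ZZ k *v x) \<le> x \<bullet> (XX k *v x)" .
  qed
  moreover have "transpose (ZZ k) = ZZ k"
    by (simp add: ZZ_step[OF k] transpose_simps sandwich_sym sy pd weights_mu_sym)
  moreover have "transpose (VV k) = VV k"
    by (simp add: VV_step[OF k pd(1,2)] transpose_simps sandwich_sym sy pd weights_sym)
  moreover have "transpose (XX k) = XX k"
    by (simp add: XX_step[OF k pd(3,4)] transpose_simps sandwich_sym Theta_sym[OF o] pd weights_mu_sym)
  ultimately show ?thesis unfolding riccati_order_def by blast
qed

lemma riccati_order_from:
  assumes "k \<le> Suc (horizon P)" "\<And>j. k \<le> j \<Longrightarrow> j \<le> horizon P \<Longrightarrow> sym_pd (Mmat P \<mu> j)"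
  shows "riccati_order k"
  using assms
proof (induction k rule: inc_induct)
  case base show ?case by (rule riccati_order_terminal)
next
  case (step k)
  have "riccati_order (Suc k)" by (rule step.IH) (use step.prems in simp)
  then show ?case by (rule riccati_order_step) (use step in simp_all)
qed

definition pos_cond :: bool where
  "pos_cond \<longleftrightarrow> (\<forall>k\<le>horizon P. sym_pd (Mmat P \<mu> k) \<and> sym_pd (Upsilon P \<mu> k) \<and> sym_pd (Lambda P \<mu> k))"

lemma pos_cond_Mmat: "pos_cond \<longleftrightarrow> (\<forall>k\<le>horizon P. sym_pd (Mmat P \<mu> k))"
proof
  assume M: "\<forall>k\<le>horizon P. sym_pd (Mmat P \<mu> k)"
  show pos_cond
    unfolding pos_cond_def
  proof (intro allI impI)
    fix k assume k: "k \<le> horizon P"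
    have o: "riccati_order (Suc k)" using k M by (intro riccati_order_from) simp_all
    have Mk: "sym_pd (Mmat P \<mu> k)" using M k by blast
    show "sym_pd (Mmat P \<mu> k) \<and> sym_pd (Upsilon P \<mu> k) \<and> sym_pd (Lambda P \<mu> k)"
      using riccati_definite[OF o Mk] Mk by blast
  qed
qed (simp add: pos_cond_def)

section \<open>The deterministic problem with weights Q, R and G\<close>

primrec traj :: "(nat \<Rightarrow> real^('l + 'r)) \<Rightarrow> nat \<Rightarrow> real^'n" where
  "traj \<delta> 0 = 0"
| "traj \<delta> (Suc k) = matA P *v traj \<delta> k + matB P *v \<delta> k"

definition dstage :: "(nat \<Rightarrow> real^('l + 'r)) \<Rightarrow> nat \<Rightarrow> real" where
  "dstage \<delta> k = traj \<delta> k \<bullet> (matQ P *v traj \<delta> k) + \<delta> k \<bullet> (matR P *v \<delta> k)"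

definition dterm :: "(nat \<Rightarrow> real^('l + 'r)) \<Rightarrow> real" where
  "dterm \<delta> = traj \<delta> (Suc (horizon P)) \<bullet> (matG P *v traj \<delta> (Suc (horizon P)))"

definition dcost :: "(nat \<Rightarrow> real^('l + 'r)) \<Rightarrow> real" where
  "dcost \<delta> = (\<Sum>k\<le>horizon P. dstage \<delta> k) + dterm \<delta>"

lemma dstage_nonneg: "0 \<le> dstage \<delta> k" and dterm_nonneg: "0 \<le> dterm \<delta>"
  unfolding dstage_def dterm_def using weights_nonneg by (auto intro: add_nonneg_nonneg)

text \<open>Definiteness is assumed from time \<open>k\<close> on only, so that the identity is
  available just after the last time at which definiteness fails.\<close>

lemma dcost_telescope:
  assumes "k \<le> Suc (horizon P)" "\<And>j. k \<le> j \<Longrightarrow> j \<le> horizon P \<Longrightarrow> sym_pd (Mmat P \<mu> j)"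
  shows "(\<Sum>j=k..<Suc (horizon P). dstage \<delta> j) + dterm \<delta>
    = traj \<delta> k \<bullet> (VV k *v traj \<delta> k)
      + (\<Sum>j=k..<Suc (horizon P). (\<delta> j + KV j *v traj \<delta> j) \<bullet> (Mmat P \<mu> j *v (\<delta> j + KV j *v traj \<delta> j)))"
  using assms
proof (induction k rule: inc_induct)
  case base show ?case by (simp add: dterm_def terminal)
next
  case (step k)
  have "riccati_order (Suc k)" using step by (intro riccati_order_from) auto
  then have sy: "transpose (VV (Suc k)) = VV (Suc k)" by (simp add: riccati_order_def)
  have M: "sym_pd (Mmat P \<mu> k)" and k: "k \<le> horizon P" using step by auto
  have IH: "(\<Sum>j=Suc k..<Suc (horizon P). dstage \<delta> j) + dterm \<delta>
    = traj \<delta> (Suc k) \<bullet> (VV (Suc k) *v traj \<delta> (Suc k))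
      + (\<Sum>j=Suc k..<Suc (horizon P). (\<delta> j + KV j *v traj \<delta> j) \<bullet> (Mmat P \<mu> j *v (\<delta> j + KV j *v traj \<delta> j)))"
    using step.prems by (intro step.IH) auto
  have "dstage \<delta> k + traj \<delta> (Suc k) \<bullet> (VV (Suc k) *v traj \<delta> (Suc k))
      = traj \<delta> k \<bullet> (VV k *v traj \<delta> k) + (\<delta> k + KV k *v traj \<delta> k) \<bullet> (Mmat P \<mu> k *v (\<delta> k + KV k *v traj \<delta> k))"
    using VV_square[OF k sy M, of "traj \<delta> k" "\<delta> k"] by (simp add: dstage_def)
  then show ?case using IH k by (simp del: sum.op_ivl_Suc traj.simps add: sum.atLeast_Suc_lessThan)
qed

lemma dcost_eq_0_imp:
  assumes c: pos_cond and d: "dcost \<delta> = 0" and k: "k \<le> horizon P" shows "\<delta> k = 0"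
proof -
  have M: "sym_pd (Mmat P \<mu> j)" if "j \<le> horizon P" for j using c that by (simp add: pos_cond_def)
  let ?q = "\<lambda>j. (\<delta> j + KV j *v traj \<delta> j) \<bullet> (Mmat P \<mu> j *v (\<delta> j + KV j *v traj \<delta> j))"
  have "(\<Sum>j\<le>horizon P. ?q j) = 0"
    using dcost_telescope[of 0 \<delta>] M d by (simp add: dcost_def atLeast0LessThan lessThan_Suc_atMost)
  then have q: "?q j = 0" if "j \<le> horizon P" for j
    using that sym_pd_nonneg[OF M] by (subst (asm) sum_nonneg_eq_0_iff) auto
  have fb: "\<delta> j = - (KV j *v traj \<delta> j)" if "j \<le> horizon P" for j
    using q[OF that] M[OF that] by (metis add_eq_0_iff2 less_irrefl sym_pd_def)
  have "traj \<delta> j = 0" if "j \<le> Suc (horizon P)" for j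
    using that by (induction j) (auto simp: fb matrix_vector_minus)
  then show ?thesis using fb[OF k] k by simp
qed

text \<open>At the last time \<open>k\<close> at which \<open>Mmat\<close> is not definite it is
  still semidefinite, so it has a null vector \<open>v\<close>. The direction is zero before
  \<open>k\<close>, equals \<open>v\<close> at \<open>k\<close> and follows the optimal feedback
  afterwards; its cost is the form of \<open>Mmat\<close> at \<open>v\<close>.\<close>

lemma degenerate_direction:
  assumes "\<not> pos_cond"
  shows "\<exists>\<delta>. (\<exists>k\<le>horizon P. \<delta> k \<noteq> 0) \<and> dcost \<delta> = 0"
proof -
  define bad where "bad k \<longleftrightarrow> k \<le> horizon P \<and> \<not> sym_pd (Mmat P \<mu> k)" for k
  have ex: "\<exists>k. bad k" using assms by (auto simp: pos_cond_Mmat bad_def)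
  define k where "k = (GREATEST k. bad k)"
  have "bad k" unfolding k_def by (rule GreatestI_ex_nat[OF ex, of "horizon P"]) (simp add: bad_def)
  then have k: "k \<le> horizon P" and nM: "\<not> sym_pd (Mmat P \<mu> k)" by (auto simp: bad_def)
  have good: "sym_pd (Mmat P \<mu> j)" if "Suc k \<le> j" "j \<le> horizon P" for j
  proof (rule ccontr)
    assume "\<not> sym_pd (Mmat P \<mu> j)"
    then have "bad j" using that by (simp add: bad_def)
    then have "j \<le> k" unfolding k_def by (rule Greatest_le_nat[of bad j "horizon P"]) (simp add: bad_def)
    then show False using that by simp
  qed
  have o: "riccati_order (Suc k)" using good k by (intro riccati_order_from) auto
  have "transpose (Mmat P \<mu> k) = Mmat P \<mu> k"
    using o by (simp add: Mmat_VV transpose_simps sandwich_sym riccati_order_def weights_sym)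
  moreover have nn: "0 \<le> v \<bullet> (Mmat P \<mu> k *v v)" for v
    using o weights_nonneg by (simp add: Mmat_VV matrix_vector_mult_add_rdistrib inner_add_right sandwich_quadratic riccati_order_def)
  ultimately obtain v where v: "v \<noteq> 0" "v \<bullet> (Mmat P \<mu> k *v v) = 0"
    using nM unfolding sym_pd_def by (metis less_le)
  define ctl where "ctl j x = (if j < k then 0 else if j = k then v else - (KV j *v x))" for j x
  define t where "t = rec_nat 0 (\<lambda>j x. matA P *v x + matB P *v ctl j x)"
  define \<delta> where "\<delta> j = ctl j (t j)" for j
  have tr: "traj \<delta> j = t j" for j by (induction j) (simp_all add: t_def \<delta>_def)
  have t0: "traj \<delta> j = 0" if "j \<le> k" for j
    using that by (induction j) (simp_all add: \<delta>_def ctl_def)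
  have dk: "\<delta> k = v" by (simp add: \<delta>_def ctl_def)
  have s0: "dstage \<delta> j = 0" if "j < k" for j
    using that t0[of j] by (simp add: dstage_def \<delta>_def ctl_def)
  have "(\<Sum>j=Suc k..<Suc (horizon P). dstage \<delta> j) + dterm \<delta> = traj \<delta> (Suc k) \<bullet> (VV (Suc k) *v traj \<delta> (Suc k)) + 0"
    by (subst dcost_telescope) (use k good in \<open>auto simp: \<delta>_def ctl_def tr\<close>)
  moreover have "(\<Sum>j\<le>horizon P. dstage \<delta> j) = dstage \<delta> k + (\<Sum>j=Suc k..<Suc (horizon P). dstage \<delta> j)"
  proof -
    have "(\<Sum>j\<le>horizon P. dstage \<delta> j) = (\<Sum>j=k..<Suc (horizon P). dstage \<delta> j)"
      using s0 by (intro sum.mono_neutral_right) auto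
    then show ?thesis using k by (simp del: sum.op_ivl_Suc add: sum.atLeast_Suc_lessThan)
  qed
  moreover have "dstage \<delta> k + traj \<delta> (Suc k) \<bullet> (VV (Suc k) *v traj \<delta> (Suc k)) = v \<bullet> (Mmat P \<mu> k *v v)"
    by (simp add: dstage_def t0 dk Mmat_VV matrix_vector_mult_add_rdistrib inner_add_right sandwich_quadratic)
  ultimately have "dcost \<delta> = 0" using v by (simp add: dcost_def)
  then show ?thesis using v dk k by blast
qed

end

section \<open>The candidate optimal process\<close>

text \<open>All products of components have mean zero, not only the inner product; this makes the
  pairing with an arbitrary weight matrix vanish.\<close>

definition orth2 :: "'a measure \<Rightarrow> ('a \<Rightarrow> real^'n) \<Rightarrow> ('a \<Rightarrow> real^'m) \<Rightarrow> bool" where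
  "orth2 M X Y \<longleftrightarrow> (\<forall>i j. (LINT w|M. X w $ i * Y w $ j) = 0)"

lemma orth2_add_right:
  assumes "orth2 M X Y" "orth2 M X Y'" "sqint M X" "sqint M Y" "sqint M Y'"
  shows "orth2 M X (\<lambda>w. Y w + Y' w)"
  using assms by (simp add: orth2_def distrib_left sqint_integrable_components)

lemma orth2_sym: "orth2 M X Y \<Longrightarrow> orth2 M Y X"
  by (simp add: orth2_def mult.commute)

lemma orth2_mult_right:
  assumes "orth2 M X Y" "sqint M X" "sqint M Y" shows "orth2 M X (\<lambda>w. A *v Y w)"
  unfolding orth2_def
proof safe
  fix i j
  have "(LINT w|M. X w $ i * (A *v Y w) $ j) = (LINT w|M. (\<Sum>l\<in>UNIV. A $ j $ l * (X w $ i * Y w $ l)))"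
    by (simp add: matrix_vector_mult_def sum_distrib_left mult_ac)
  also have "\<dots> = (\<Sum>l\<in>UNIV. LINT w|M. A $ j $ l * (X w $ i * Y w $ l))"
    by (intro Bochner_Integration.integral_sum integrable_mult_right sqint_integrable_components assms)
  finally show "(LINT w|M. X w $ i * (A *v Y w) $ j) = 0" using assms(1) by (simp add: orth2_def)
qed

lemma orth2_mult: "orth2 M X Y \<Longrightarrow> sqint M X \<Longrightarrow> sqint M Y \<Longrightarrow> orth2 M (\<lambda>w. A *v X w) (\<lambda>w. B *v Y w)"
  by (intro orth2_mult_right orth2_sym[OF orth2_mult_right] orth2_sym[of M X Y] sqint_matrix_vector_mult)

lemma orth2_0: "orth2 M X (\<lambda>w. 0)" "orth2 M (\<lambda>w. 0) Y"
  by (simp_all add: orth2_def)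

lemma orth2_inner:
  fixes X Y :: "'a \<Rightarrow> real^'n"
  assumes "orth2 M X Y" "sqint M X" "sqint M Y" shows "(LINT w|M. X w \<bullet> Y w) = 0"
  using assms by (intro integral_inner_eq_0_components) (auto simp: orth2_def)

lemma orth2_quadratic:
  assumes "orth2 M X Y" "sqint M X" "sqint M Y" shows "(LINT w|M. X w \<bullet> (S *v Y w)) = 0"
  by (intro orth2_inner orth2_mult_right sqint_matrix_vector_mult assms)

lemma (in prob_space) ortho_orth2:
  assumes "subalgebra M F" "ortho M F X" "sqint M X" "sqint M Y" "Y \<in> borel_measurable F"
  shows "orth2 M X Y" "orth2 M Y X"
  using ortho_components[OF assms] orth2_sym by (auto simp: orth2_def mult.commute)

text \<open>The polarised form of \<open>complete_square\<close> along the feedback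
  \<open>- (K *v x)\<close>. The variation \<open>v\<close> occurs on the right but not on the left:
  this is the stationarity of the minimiser.\<close>

lemma complete_square_stationary:
  fixes A Y :: "real^'n^'n" and B :: "real^'m^'n" and R :: "real^'m^'m"
  assumes Y: "transpose Y = Y" and R: "transpose R = R" and H: "H = transpose B ** Y ** B + R"
    and K: "H ** K = transpose B ** Y ** A"
  shows "x \<bullet> ((transpose A ** Y ** A - transpose K ** H ** K) *v y)
    = ((A - B ** K) *v x) \<bullet> (Y *v (A *v y + B *v v)) - (K *v x) \<bullet> (R *v v)"
proof -
  have sym: "a \<bullet> (S *v b) = b \<bullet> (S *v a)" if "transpose S = S" for a b and S :: "real^'k^'k"
    using that by (metis inner_commute inner_transpose)
  have Hs: "transpose H = H" unfolding H by (simp add: transpose_simps sandwich_sym Y R)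
  have Hv: "a \<bullet> (H *v b) = (B *v a) \<bullet> (Y *v (B *v b)) + a \<bullet> (R *v b)" for a b
    by (simp add: H matrix_vector_mult_add_rdistrib inner_add_right sandwich_quadratic matrix_vector_mul_assoc[symmetric] inner_transpose[of _ "transpose B"])
  have HK: "a \<bullet> (H *v (K *v z)) = (B *v a) \<bullet> (Y *v (A *v z))" for a z
    unfolding matrix_vector_mul_assoc K
    by (simp add: matrix_vector_mul_assoc[symmetric] inner_transpose[of _ "transpose B"])
  have 1: "x \<bullet> ((transpose A ** Y ** A - transpose K ** H ** K) *v y) = (A *v x) \<bullet> (Y *v (A *v y)) - (K *v x) \<bullet> (H *v (K *v y))"
    by (simp add: matrix_vector_mult_diff_rdistrib inner_diff_right matrix_vector_mul_assoc[symmetric] inner_transpose[of _ "transpose _"])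
  have 2: "(A *v x) \<bullet> (Y *v (B *v v)) = (B *v (K *v x)) \<bullet> (Y *v (B *v v)) + (K *v x) \<bullet> (R *v v)"
    using HK[of v x] Hv[of "K *v x" v] sym[OF Hs, of v "K *v x"] sym[OF Y, of "A *v x" "B *v v"] by simp
  show ?thesis unfolding 1 HK
    using 2 by (simp add: matrix_vector_mult_diff_rdistrib matrix_vector_right_distrib inner_diff_left inner_add_right
        matrix_vector_mul_assoc[symmetric])
qed

section \<open>The closed loop under the candidate feedback\<close>

locale flq_optimal = flq_riccati P \<mu> for P :: "('w, 'n::finite, 'l::finite, 'r::finite) flq" and \<mu> +
  assumes pos: pos_cond
begin

lemma order: "k \<le> Suc (horizon P) \<Longrightarrow> riccati_order k"
  using pos by (intro riccati_order_from) (auto simp: pos_cond_def)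

lemma definite: "k \<le> horizon P \<Longrightarrow> sym_pd (Mmat P \<mu> k)" "k \<le> horizon P \<Longrightarrow> sym_pd (Upsilon P \<mu> k)"
  "k \<le> horizon P \<Longrightarrow> sym_pd (Lambda P \<mu> k)"
  using pos by (auto simp: pos_cond_def)

text \<open>\<open>A1\<close>, \<open>A2\<close> and \<open>A3\<close> are the closed-loop matrices
  of the centered remote estimate, of the gap and of the mean. The gap is steered by the local
  control only.\<close>

definition A1 :: "nat \<Rightarrow> real^'n^'n" where "A1 k = matA P - matB P ** gainK P \<mu> k"
definition A2 :: "nat \<Rightarrow> real^'n^'n" where "A2 k = matA P - matBL P ** KL k"
definition A3 :: "nat \<Rightarrow> real^'n^'n" where "A3 k = matA P - matB P ** KV k"

primrec mm :: "nat \<Rightarrow> real^'n" where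
  "mm 0 = mean0 P"
| "mm (Suc k) = A3 k *v mm k"

text \<open>\<open>dd\<close> is the local estimate minus the remote one, and \<open>mm + rr\<close> the remote estimate; both are
  driven by the innovations and by the switching sequence \<open>s\<close>, which is either the channel or a fixed path.\<close>

primrec dd :: "(nat \<Rightarrow> 'w \<Rightarrow> real) \<Rightarrow> nat \<Rightarrow> 'w \<Rightarrow> real^'n" where
  "dd s 0 = (\<lambda>w. (1 - s 0 w) *\<^sub>R nu 0 w)"
| "dd s (Suc k) = (\<lambda>w. (1 - s (Suc k) w) *\<^sub>R (A2 k *v dd s k w + nu (Suc k) w))"

text \<open>What the packet contains beyond the remote prediction. By \<open>dd_inc\<close> and
  \<open>rr_inc\<close> it is moved into the remote estimate on success and stays in the gap on
  failure; \<open>rpre\<close> is the centered remote prediction before the packet.\<close>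

primrec inc :: "(nat \<Rightarrow> 'w \<Rightarrow> real) \<Rightarrow> nat \<Rightarrow> 'w \<Rightarrow> real^'n" where
  "inc s 0 = nu 0"
| "inc s (Suc k) = (\<lambda>w. A2 k *v dd s k w + nu (Suc k) w)"

primrec rr :: "(nat \<Rightarrow> 'w \<Rightarrow> real) \<Rightarrow> nat \<Rightarrow> 'w \<Rightarrow> real^'n" where
  "rr s 0 = (\<lambda>w. s 0 w *\<^sub>R nu 0 w)"
| "rr s (Suc k) = (\<lambda>w. A1 k *v rr s k w + s (Suc k) w *\<^sub>R (A2 k *v dd s k w + nu (Suc k) w))"

primrec rpre :: "(nat \<Rightarrow> 'w \<Rightarrow> real) \<Rightarrow> nat \<Rightarrow> 'w \<Rightarrow> real^'n" where
  "rpre s 0 = (\<lambda>w. 0)"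
| "rpre s (Suc k) = (\<lambda>w. A1 k *v rr s k w)"

lemma dd_inc: "dd s k w = (1 - s k w) *\<^sub>R inc s k w" and rr_inc: "rr s k w = rpre s k w + s k w *\<^sub>R inc s k w"
  by (cases k; simp)+

definition UU :: "nat \<Rightarrow> 'w \<Rightarrow> real^('l + 'r)" where
  "UU k w = - (gainK P \<mu> k *v rr (chan P) k w) - KV k *v mm k"

definition UL :: "nat \<Rightarrow> 'w \<Rightarrow> real^'l" where
  "UL k w = blockL (UU k w) - KL k *v dd (chan P) k w"

definition UR :: "nat \<Rightarrow> 'w \<Rightarrow> real^'r" where
  "UR k w = blockR (UU k w)"

abbreviation "ustar \<equiv> (UL, UR)"

definition xhat :: "nat \<Rightarrow> 'w \<Rightarrow> real^'n" where
  "xhat k w = mm k + rr (chan P) k w + dd (chan P) k w"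

definition xbar :: "nat \<Rightarrow> 'w \<Rightarrow> real^'n" where
  "xbar k w = A3 k *v mm k + A1 k *v rr (chan P) k w + A2 k *v dd (chan P) k w"

lemma control_step:
  "matA P *v xhat k w + matBL P *v UL k w + matBR P *v UR k w = xbar k w"
proof -
  have "matBL P *v UL k w + matBR P *v UR k w = matB P *v UU k w - matBL P *v (KL k *v dd (chan P) k w)"
    by (simp add: UL_def UR_def matB_mult matrix_vector_mult_diff_distrib)
  moreover have "matB P *v UU k w = - (matB P *v (gainK P \<mu> k *v rr (chan P) k w)) - matB P *v (KV k *v mm k)"
    by (simp add: UU_def matrix_vector_mult_diff_distrib matrix_vector_minus)
  moreover have "matA P *v xhat k w = matA P *v mm k + matA P *v rr (chan P) k w + matA P *v dd (chan P) k w"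
    by (simp add: xhat_def matrix_vector_right_distrib)
  moreover have "xbar k w = (matA P *v mm k - matB P *v (KV k *v mm k))
      + (matA P *v rr (chan P) k w - matB P *v (gainK P \<mu> k *v rr (chan P) k w))
      + (matA P *v dd (chan P) k w - matBL P *v (KL k *v dd (chan P) k w))"
    by (simp add: xbar_def A1_def A2_def A3_def matrix_vector_mult_diff_rdistrib matrix_vector_mul_assoc[symmetric])
  ultimately show ?thesis by (simp add: add.assoc)
qed

lemma xhat_Suc: "xhat (Suc k) w = xbar k w + nu (Suc k) w"
  by (simp add: xhat_def xbar_def algebra_simps)

lemma xhat_eq: "k \<le> horizon P \<Longrightarrow> zeta k w + cpart ustar k w = xhat k w"
proof (induction k)
  case 0
  then show ?case by (simp add: zeta_0 xhat_def algebra_simps)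
next
  case (Suc k)
  then have e: "zeta k w + cpart ustar k w = xhat k w" by simp
  have "zeta (Suc k) w + cpart ustar (Suc k) w
      = matA P *v (zeta k w + cpart ustar k w) + matBL P *v UL k w + matBR P *v UR k w + nu (Suc k) w"
    using Suc.prems by (simp add: zeta_Suc matrix_vector_right_distrib)
  then show ?case by (simp only: e xhat_Suc control_step)
qed

lemma dd_GG:
  assumes s: "\<And>j. j \<le> k \<Longrightarrow> s j \<in> borel_measurable (GG (Suc k) b)"
  shows "j \<le> k \<Longrightarrow> dd s j \<in> borel_measurable (GG (Suc k) b)" "j \<le> k \<Longrightarrow> rr s j \<in> borel_measurable (GG (Suc k) b)"
proof -
  have "dd s j \<in> borel_measurable (GG (Suc k) b) \<and> rr s j \<in> borel_measurable (GG (Suc k) b)" if "j \<le> k" for j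
    using that
  proof (induction j)
    case 0
    then show ?case using s[of 0] by (auto intro!: borel_measurable_scaleR borel_measurable_diff nu_GG)
  next
    case (Suc j)
    then show ?case using s[of "Suc j"]
      by (auto intro!: borel_measurable_scaleR borel_measurable_diff borel_measurable_add nu_GG borel_measurable_matrix_vector_mult)
  qed
  then show "j \<le> k \<Longrightarrow> dd s j \<in> borel_measurable (GG (Suc k) b)" "j \<le> k \<Longrightarrow> rr s j \<in> borel_measurable (GG (Suc k) b)" by auto
qed

lemma chan_dd_GG:
  shows "dd (chan P) k \<in> borel_measurable (GG (Suc k) (Suc k))" "rr (chan P) k \<in> borel_measurable (GG (Suc k) (Suc k))"
  by (rule dd_GG(1) dd_GG(2); simp add: chan_GG)+

lemma
  assumes s: "\<And>j. j \<le> k \<Longrightarrow> s j \<in> borel_measurable (Om P) \<and> (AE w in Om P. s j w = 0 \<or> s j w = 1)"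
  shows sqint_dd: "sqint (Om P) (dd s k)" and sqint_rr: "sqint (Om P) (rr s k)"
proof -
  have "sqint (Om P) (dd s j) \<and> sqint (Om P) (rr s j)" if "j \<le> k" for j
    using that
  proof (induction j)
    case 0
    have "AE w in Om P. s 0 w = 0 \<or> s 0 w = 1" and m: "s 0 \<in> borel_measurable (Om P)" using s[of 0] 0 by auto
    then have "AE w in Om P. \<bar>1 - s 0 w\<bar> \<le> 1" "AE w in Om P. \<bar>s 0 w\<bar> \<le> 1" by (auto elim!: eventually_mono)
    then show ?case using m by (auto intro!: sqint_bounded_scaleR sqint_nu)
  next
    case (Suc j)
    have "AE w in Om P. s (Suc j) w = 0 \<or> s (Suc j) w = 1" and m: "s (Suc j) \<in> borel_measurable (Om P)" using s[of "Suc j"] Suc.prems by auto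
    then have "AE w in Om P. \<bar>1 - s (Suc j) w\<bar> \<le> 1" "AE w in Om P. \<bar>s (Suc j) w\<bar> \<le> 1" by (auto elim!: eventually_mono)
    then show ?case using m Suc
      by (auto intro!: sqint_bounded_scaleR sqint_nu sqint_add sqint_matrix_vector_mult)
  qed
  then show "sqint (Om P) (dd s k)" "sqint (Om P) (rr s k)" by auto
qed

lemma sqint_inc: 
  assumes s: "\<And>j. j < k \<Longrightarrow> s j \<in> borel_measurable (Om P) \<and> (AE w in Om P. s j w = 0 \<or> s j w = 1)"
  shows "sqint (Om P) (inc s k)" "sqint (Om P) (rpre s k)"
  using s by (cases k; auto intro!: sqint_nu sqint_add sqint_matrix_vector_mult sqint_dd sqint_rr sqint_0)+

lemma chan_switch: "j \<le> horizon P \<Longrightarrow> chan P j \<in> borel_measurable (Om P) \<and> (AE w in Om P. chan P j w = 0 \<or> chan P j w = 1)"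
  using chan_measurable chan_01 by simp

lemma chan_sqint:
  assumes "k \<le> horizon P"
  shows "sqint (Om P) (dd (chan P) k)" "sqint (Om P) (rr (chan P) k)" "sqint (Om P) (inc (chan P) k)"
  using assms by (auto intro!: sqint_dd sqint_rr sqint_inc chan_switch)

lemma blockL_measurable [measurable (raw)]: "X \<in> borel_measurable F \<Longrightarrow> (\<lambda>w. blockL (X w)) \<in> borel_measurable F"
  and blockR_measurable [measurable (raw)]: "X \<in> borel_measurable F \<Longrightarrow> (\<lambda>w. blockR (X w)) \<in> borel_measurable F"
  for X :: "'w \<Rightarrow> real^('l + 'r)"
  unfolding blockL_def blockR_def by (simp_all add: borel_measurable_vec_iff)

lemma sqint_block:
  fixes X :: "'w \<Rightarrow> real^('l + 'r)"
  assumes "sqint (Om P) X"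
  shows "sqint (Om P) (\<lambda>w. blockL (X w))" "sqint (Om P) (\<lambda>w. blockR (X w))"
proof -
  have n: "(norm x)\<^sup>2 = (norm (blockL x))\<^sup>2 + (norm (blockR x))\<^sup>2" for x :: "real^('l + 'r)"
    by (simp add: power2_norm_eq_inner inner_block)
  have "norm (blockL x) \<le> 1 * norm x" "norm (blockR x) \<le> 1 * norm x" for x :: "real^('l + 'r)"
    using n[of x] by (simp_all add: norm_le_square abs_le_square_iff[symmetric] power2_norm_eq_inner norm_le)
  then show "sqint (Om P) (\<lambda>w. blockL (X w))" "sqint (Om P) (\<lambda>w. blockR (X w))"
    using sqint_measurable[OF assms]
    by (intro sqint_dominated[OF assms, where C = 1] AE_I2 blockL_measurable blockR_measurable; blast)+
qed

lemma UU_sqint: "k \<le> horizon P \<Longrightarrow> sqint (Om P) (UU k)"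
  unfolding UU_def[abs_def] by (intro sqint_diff sqint_minus sqint_matrix_vector_mult chan_sqint sqint_const)

lemma U_sqint: "k \<le> horizon P \<Longrightarrow> sqint (Om P) (UL k)" "k \<le> horizon P \<Longrightarrow> sqint (Om P) (UR k)"
  unfolding UL_def[abs_def] UR_def[abs_def]
  by (intro sqint_diff sqint_block UU_sqint sqint_matrix_vector_mult chan_sqint; assumption)+

lemma xhat_GG: "xhat k \<in> borel_measurable (GG (Suc k) (Suc k))"
  unfolding xhat_def[abs_def] by (intro borel_measurable_add borel_measurable_const chan_dd_GG)

lemma xbar_GG: "xbar k \<in> borel_measurable (GG (Suc k) (Suc k))"
  unfolding xbar_def[abs_def] by (intro borel_measurable_add borel_measurable_const borel_measurable_matrix_vector_mult chan_dd_GG)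

lemma xhat_sqint: "k \<le> horizon P \<Longrightarrow> sqint (Om P) (xhat k)"
  unfolding xhat_def[abs_def] by (intro sqint_add sqint_const chan_sqint)

lemma xbar_sqint: "k \<le> horizon P \<Longrightarrow> sqint (Om P) (xbar k)"
  unfolding xbar_def[abs_def] by (intro sqint_add sqint_const sqint_matrix_vector_mult chan_sqint)

lemma U_GG: "UL k \<in> borel_measurable (GG (Suc k) (Suc k))" "UR k \<in> borel_measurable (GG (Suc k) (Suc k))"
  unfolding UL_def[abs_def] UR_def[abs_def] UU_def
  by (intro borel_measurable_diff blockL_measurable blockR_measurable borel_measurable_uminus
      borel_measurable_matrix_vector_mult borel_measurable_const chan_dd_GG)+

section \<open>The remote information determines the remote estimate\<close>

text \<open>Along a fixed switching path the factors are numbers, so all the processes are linear in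
  the Gaussian sources. With the random channel they are not.\<close>

lemma path_vlin:
  "\<exists>a. dd (\<lambda>j w. \<sigma> j) k = vlin a" "\<exists>a. rr (\<lambda>j w. \<sigma> j) k = vlin a" "\<exists>a. inc (\<lambda>j w. \<sigma> j) k = vlin a"
    "\<exists>a. rpre (\<lambda>j w. \<sigma> j) k = vlin a"
proof -
  have nu: "nu j = vlin (\<lambda>s. kgain j ** inn j s)" for j by (auto simp: nu_def iota_def vlin_mult)
  have z: "(\<lambda>w. 0) = vlin (\<lambda>s. 0)" by (auto simp: vlin_def)
  have *: "(\<exists>a. dd (\<lambda>j w. \<sigma> j) k = vlin a) \<and> (\<exists>a. rr (\<lambda>j w. \<sigma> j) k = vlin a)
    \<and> (\<exists>a. inc (\<lambda>j w. \<sigma> j) k = vlin a) \<and> (\<exists>a. rpre (\<lambda>j w. \<sigma> j) k = vlin a)"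
  proof (induction k)
    case 0
    show ?case
      by (simp add: nu z vlin_scaleR[symmetric]) (intro conjI exI, (rule refl)+)
  next
    case (Suc k)
    then obtain a b where a: "dd (\<lambda>j w. \<sigma> j) k = vlin a" and b: "rr (\<lambda>j w. \<sigma> j) k = vlin b" by blast
    show ?case
      by (simp add: nu a b vlin_scaleR[symmetric] vlin_add[symmetric] vlin_mult[symmetric]) (intro conjI exI, (rule refl)+)
  qed
  then show "\<exists>a. dd (\<lambda>j w. \<sigma> j) k = vlin a" "\<exists>a. rr (\<lambda>j w. \<sigma> j) k = vlin a" "\<exists>a. inc (\<lambda>j w. \<sigma> j) k = vlin a"
    "\<exists>a. rpre (\<lambda>j w. \<sigma> j) k = vlin a" by blast+
qed

text \<open>Orthogonality of prediction and increment propagates: if the packet is lost, they become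
  \<open>rr\<close> and \<open>dd\<close>; if it arrives, \<open>dd\<close> is zero. The next
  innovation is orthogonal to everything earlier.\<close>

lemma path_orthogonal:
  assumes "\<And>j. \<sigma> j = 0 \<or> \<sigma> j = (1::real)" and k: "k \<le> horizon P"
  shows "orth2 (Om P) (rpre (\<lambda>j w. \<sigma> j) k) (inc (\<lambda>j w. \<sigma> j) k)"
proof -
  let ?s = "\<lambda>j (w :: 'w). \<sigma> j"
  have sq: "sqint (Om P) (dd ?s j)" "sqint (Om P) (rr ?s j)" "sqint (Om P) (inc ?s j)" "sqint (Om P) (rpre ?s j)" for j
    using assms(1) by (auto intro!: sqint_dd sqint_rr sqint_inc)
  have m: "rr ?s j \<in> borel_measurable (GG (Suc j) 0)" for j by (rule dd_GG(2)) simp_all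
  have pre: "orth2 (Om P) (rpre ?s j) (inc ?s j) \<Longrightarrow> orth2 (Om P) (rr ?s j) (dd ?s j)" for j
  proof (cases "\<sigma> j = 0")
    case True
    assume "orth2 (Om P) (rpre ?s j) (inc ?s j)"
    then show ?thesis using True by (simp add: dd_inc[abs_def] rr_inc[abs_def])
  next
    case False
    then show ?thesis using assms(1)[of j] by (simp add: dd_inc[abs_def] orth2_0)
  qed
  show ?thesis using k
  proof (induction k)
    case 0 show ?case by (simp add: orth2_0)
  next
    case (Suc k)
    have sub: "subalgebra (Om P) (GG (Suc k) 0)" by (rule subalgebra_GG) simp
    have "orth2 (Om P) (\<lambda>w. A1 k *v rr ?s k w) (\<lambda>w. A2 k *v dd ?s k w)"
      by (rule orth2_mult[OF pre sq(2) sq(1)]) (use Suc in simp)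
    moreover have "orth2 (Om P) (\<lambda>w. A1 k *v rr ?s k w) (nu (Suc k))"
      by (rule ortho_orth2(2)[OF sub ortho_nu sqint_nu])
        (use Suc m in \<open>auto intro!: sqint_matrix_vector_mult sq borel_measurable_matrix_vector_mult\<close>)
    ultimately show ?case
      by (auto intro!: orth2_add_right sqint_matrix_vector_mult sq sqint_nu)
  qed
qed

text \<open>If some component of prediction plus increment has positive variance, it avoids the
  value in question almost surely. Otherwise every component has variance zero, and by orthogonality
  of the two summands the increment itself vanishes.\<close>

lemma path_no_atom:
  assumes "\<And>j. \<sigma> j = 0 \<or> \<sigma> j = (1::real)" and k: "k \<le> horizon P"
  shows "AE w in Om P. c + rpre (\<lambda>j w. \<sigma> j) k w + inc (\<lambda>j w. \<sigma> j) k w = 0 \<longrightarrow> inc (\<lambda>j w. \<sigma> j) k w = 0"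
proof -
  obtain a b where a: "rpre (\<lambda>j w. \<sigma> j) k = vlin a" and b: "inc (\<lambda>j w. \<sigma> j) k = vlin b" using path_vlin(3,4)[of \<sigma> k] by blast
  have o: "orth2 (Om P) (vlin a) (vlin b)" unfolding a[symmetric] b[symmetric] by (rule path_orthogonal[OF assms])
  show ?thesis
  proof (cases "\<exists>i. 0 < lcov (vrow (\<lambda>s. a s + b s) i) (vrow (\<lambda>s. a s + b s) i)")
    case True
    then obtain i where i: "0 < lcov (vrow (\<lambda>s. a s + b s) i) (vrow (\<lambda>s. a s + b s) i)" by blast
    from lin_atomless[OF i, of "- c $ i"] show ?thesis
      unfolding a b
    proof eventually_elim
      case (elim w)
      then have "(vlin a w + vlin b w) $ i \<noteq> - c $ i" unfolding vlin_nth[symmetric] vlin_add by simp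
      then have "c + vlin a w + vlin b w \<noteq> 0" by (auto simp: vec_eq_iff add_eq_0_iff algebra_simps)
      then show ?case by blast
    qed
  next
    case False
    have "AE w in Om P. vlin b w $ i = 0" for i
    proof -
      have int: "integrable (Om P) (\<lambda>w. vlin x w $ i * vlin y w $ i)" for x y
        by (intro sqint_integrable_components vlin_sqint)
      have "(LINT w|Om P. (vlin a w + vlin b w) $ i * (vlin a w + vlin b w) $ i)
          = lcov (vrow (\<lambda>s. a s + b s) i) (vrow (\<lambda>s. a s + b s) i)"
        unfolding vlin_add[symmetric] vlin_nth by (rule lin_moments(2))
      then have "(LINT w|Om P. (vlin a w + vlin b w) $ i * (vlin a w + vlin b w) $ i) \<le> 0"
        using False by (simp add: not_less)
      moreover have "(vlin a w + vlin b w) $ i * (vlin a w + vlin b w) $ i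
          = vlin a w $ i * vlin a w $ i + 2 * (vlin a w $ i * vlin b w $ i) + vlin b w $ i * vlin b w $ i" for w
        by (simp add: algebra_simps)
      moreover have "(LINT w|Om P. vlin a w $ i * vlin b w $ i) = 0" using o by (simp add: orth2_def)
      moreover have nn: "0 \<le> (LINT w|Om P. vlin x w $ i * vlin x w $ i)" for x by (intro integral_nonneg_AE AE_I2) simp
      ultimately have "(LINT w|Om P. vlin a w $ i * vlin a w $ i) + (LINT w|Om P. vlin b w $ i * vlin b w $ i) \<le> 0"
        using int by simp
      then have "(LINT w|Om P. vlin b w $ i * vlin b w $ i) = 0" using nn[of a] nn[of b] by linarith
      then have "AE w in Om P. vlin b w $ i * vlin b w $ i = 0"
        using integral_nonneg_eq_0_iff_AE[OF int[of b b]] by simp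
      then show ?thesis by simp
    qed
    then have "AE w in Om P. \<forall>i. vlin b w $ i = 0" by (simp add: AE_all_countable)
    then show ?thesis unfolding b by eventually_elim (simp add: vec_eq_iff)
  qed
qed

lemma path_cong:
  assumes "\<And>j. j \<le> N \<Longrightarrow> s j w = \<sigma> j" "k \<le> N"
  shows "dd s k w = dd (\<lambda>j w. \<sigma> j) k w" "rr s k w = rr (\<lambda>j w. \<sigma> j) k w" "inc s k w = inc (\<lambda>j w. \<sigma> j) k w"
    "rpre s k w = rpre (\<lambda>j w. \<sigma> j) k w"
proof -
  have *: "dd s k w = dd (\<lambda>j w. \<sigma> j) k w \<and> rr s k w = rr (\<lambda>j w. \<sigma> j) k w" if "k \<le> N" for k
    using that
  proof (induction k)
    case 0 then show ?case using assms(1)[of 0] by simp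
  next
    case (Suc k) then show ?case using assms(1)[of "Suc k"] by simp
  qed
  show "dd s k w = dd (\<lambda>j w. \<sigma> j) k w" "rr s k w = rr (\<lambda>j w. \<sigma> j) k w" using *[OF assms(2)] by blast+
  show "inc s k w = inc (\<lambda>j w. \<sigma> j) k w"
  proof (cases k)
    case (Suc j) then show ?thesis using *[of j] assms(2) by simp
  qed simp
  show "rpre s k w = rpre (\<lambda>j w. \<sigma> j) k w"
  proof (cases k)
    case (Suc j) then show ?thesis using *[of j] assms(2) by simp
  qed simp
qed

text \<open>There are finitely many channel paths up to the horizon, so one null set serves all of
  them; outside it the fixed-path result is applied to the path that actually occurs.\<close>

lemma no_atom:
  assumes k: "k \<le> horizon P"
  shows "AE w in Om P. c + rpre (chan P) k w + inc (chan P) k w = 0 \<longrightarrow> inc (chan P) k w = 0"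
proof -
  define path where "path A j = (if j \<in> A then 1 else 0 :: real)" for A :: "nat set" and j
  have "AE w in Om P. \<forall>A\<in>Pow {..horizon P}. c + rpre (\<lambda>j w. path A j) k w + inc (\<lambda>j w. path A j) k w = 0 \<longrightarrow> inc (\<lambda>j w. path A j) k w = 0"
    using k by (intro AE_finite_allI path_no_atom) (auto simp: path_def)
  moreover have "AE w in Om P. \<forall>j\<in>{..horizon P}. chan P j w = 0 \<or> chan P j w = 1"
    by (intro AE_finite_allI chan_01) auto
  ultimately show ?thesis
  proof eventually_elim
    case (elim w)
    define A where "A = {j. j \<le> horizon P \<and> chan P j w = 1}"
    have c: "chan P j w = path A j" if "j \<le> horizon P" for j using elim(2) that by (auto simp: A_def path_def)
    have c3: "inc (chan P) k w = inc (\<lambda>j w. path A j) k w" by (rule path_cong(3)[where s = "chan P" and w = w and \<sigma> = "path A", OF c k])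
    have c4: "rpre (chan P) k w = rpre (\<lambda>j w. path A j) k w" by (rule path_cong(4)[where s = "chan P" and w = w and \<sigma> = "path A", OF c k])
    have "A \<in> Pow {..horizon P}" by (auto simp: A_def)
    then show ?case using elim(1) unfolding c3 c4 by blast
  qed
qed

lemma remote_recover:
  assumes u: "adm k u" and k: "k \<le> horizon P"
    and eq: "\<forall>j<k. AE w in Om P. fst u j w = UL j w \<and> snd u j w = UR j w"
  shows "\<exists>g\<in>borel_measurable (FR P u k). AE w in Om P. g w = rr (chan P) k w"
proof -
  have "\<exists>g\<in>borel_measurable (FR P u j). AE w in Om P. g w = rr (chan P) j w" if "j \<le> k" for j
    using that
  proof (induction j)
    have step: "\<exists>g\<in>borel_measurable (FR P u j). AE w in Om P. g w = rr (chan P) j w"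
      if j: "j \<le> k" and h: "h \<in> borel_measurable (FR P u j)" "AE w in Om P. h w = rpre (chan P) j w" for j h
    proof
      have ym: "obsR P u j \<in> borel_measurable (FR P u j)" unfolding FR_def by (rule measurable_generated_by) simp
      \<comment> \<open>A received 0 is always read as a failure. It may instead be a delivered
        packet that equals 0, but then \<open>no_atom\<close> says that the increment is zero, so
        keeping the prediction \<open>h\<close> is correct as well.\<close>
      define g where "g w = (if obsR P u j w = 0 then h w else obsR P u j w - mm j)" for w
      have "{w \<in> space (FR P u j). obsR P u j w = 0} \<in> sets (FR P u j)"
        using measurable_sets[OF ym, of "{0}"] by (simp add: vimage_def Int_def conj_commute)
      then show "g \<in> borel_measurable (FR P u j)"
        unfolding g_def[abs_def] using ym h(1) by (intro measurable_If) auto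
      have jN: "j \<le> horizon P" using j k by simp
      have "AE w in Om P. cpart u j w = cpart ustar j w"
        by (rule cpart_cong_AE) (use eq j in auto)
      with h(2) obsR_AE[OF adm_mono[OF u j] jN] no_atom[OF jN, of "mm j"] chan_01[OF jN]
      show "AE w in Om P. g w = rr (chan P) j w"
      proof eventually_elim
        case (elim w)
        have "zeta j w + cpart u j w = mm j + rpre (chan P) j w + inc (chan P) j w"
          using xhat_eq[OF jN, of w] elim(5) by (simp add: xhat_def dd_inc rr_inc algebra_simps)
        then show ?case using elim by (auto simp: g_def rr_inc)
      qed
    qed
    {
      case 0
      show ?case by (rule step[of 0 "\<lambda>w. 0"]) (use 0 in auto)
    next
      case (Suc j)
      then obtain g where g: "g \<in> borel_measurable (FR P u j)" "AE w in Om P. g w = rr (chan P) j w" by auto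
      have "g \<in> borel_measurable (FR P u (Suc j))"
        using g(1) unfolding FR_def by (rule measurable_generated_by_subset) auto
      then show ?case
        using g(2) Suc.prems
        by (intro step[of "Suc j" "\<lambda>w. A1 j *v g w"]) (auto intro: borel_measurable_matrix_vector_mult elim!: eventually_mono)
    }
  qed
  then show ?thesis by simp
qed

lemma realizable_ustar: "realizable ustar"
  unfolding realizable_def
proof (intro allI impI conjI)
  fix k assume k: "k \<le> horizon P"
  show "sqint (Om P) (fst ustar k)" "sqint (Om P) (snd ustar k)" using U_sqint[OF k] by auto
  fix u assume u: "adm k u" and eq: "\<forall>j<k. AE w in Om P. fst u j w = fst ustar j w \<and> snd u j w = snd ustar j w"
  obtain g where g: "g \<in> borel_measurable (FR P u k)" "AE w in Om P. g w = rr (chan P) k w"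
    using remote_recover[OF u k] eq by auto
  define h where "h w = - (gainK P \<mu> k *v g w) - KV k *v mm k" for w
  have hm: "h \<in> borel_measurable (FR P u k)"
    unfolding h_def[abs_def] using g(1) by (intro borel_measurable_diff borel_measurable_uminus borel_measurable_matrix_vector_mult) auto
  have hU: "AE w in Om P. UU k w = h w" using g(2) by eventually_elim (simp add: UU_def h_def)
  show "AE w in Om P. cond_exp_vec (Om P) (FR P u k) (snd ustar k) w = snd ustar k w"
  proof -
    have e: "AE w in Om P. UR k w = blockR (h w)" using hU by eventually_elim (simp add: UR_def)
    have "AE w in Om P. cond_exp_vec (Om P) (FR P u k) (UR k) w = blockR (h w)"
      using U_sqint[OF k] hm e by (intro cond_exp_vec_cong_AE_measurable subalgebra_FR[OF u k]) (auto intro: blockR_measurable)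
    with e show ?thesis by eventually_elim simp
  qed
  show "AE w in Om P. cond_exp_vec (Om P) (FL P u k) (fst ustar k) w = fst ustar k w"
  proof -
    define f where "f w = blockL (h w) - KL k *v (zeta k w + cpart u k w - mm k - g w)" for w
    have fl: "x \<in> borel_measurable (preL u k) \<Longrightarrow> x \<in> borel_measurable (FL P u k)" for x :: "'w \<Rightarrow> real^'n"
      by (rule measurable_mono_sets[OF _ preL_sets_FL]) simp_all
    have fm: "f \<in> borel_measurable (FL P u k)"
      unfolding f_def[abs_def] using FR_FL[OF hm] FR_FL[OF g(1)] fl[OF zeta_preL[OF u k order_refl]] fl[OF cpart_preL[OF u order_refl]]
      by (intro borel_measurable_diff borel_measurable_add blockL_measurable borel_measurable_matrix_vector_mult) auto
    have "AE w in Om P. cpart u k w = cpart ustar k w"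
      by (rule cpart_cong_AE) (use eq in auto)
    with hU g(2) have e: "AE w in Om P. UL k w = f w"
    proof eventually_elim
      case (elim w)
      have "zeta k w + cpart u k w - mm k - g w = dd (chan P) k w"
        using xhat_eq[OF k, of w] elim by (simp add: xhat_def algebra_simps)
      then show ?case using elim(1) by (simp add: UL_def f_def)
    qed
    have "AE w in Om P. cond_exp_vec (Om P) (FL P u k) (UL k) w = f w"
      using U_sqint[OF k] fm e by (intro cond_exp_vec_cong_AE_measurable subalgebra_FL[OF u k]) auto
    with e show ?thesis by eventually_elim simp
  qed
qed

section \<open>Orthogonality of the estimate gap to the remote information\<close>

lemma inc_GG: "inc (chan P) k \<in> borel_measurable (GG (Suc k) k)"
proof (cases k)
  case 0 then show ?thesis by (simp add: nu_GG)
next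
  case (Suc j)
  have "dd (chan P) j \<in> borel_measurable (GG (Suc k) k)"
    by (rule measurable_GG_mono[OF chan_dd_GG(1)]) (use Suc in auto)
  then show ?thesis using Suc by (auto intro!: borel_measurable_add borel_measurable_matrix_vector_mult nu_GG)
qed

definition FRp :: "('w, 'l, 'r) control \<Rightarrow> nat \<Rightarrow> 'w measure" where
  "FRp u k = generated_by (Om P) (obsR P u ` {..<k})"

lemma FRp_Suc: "FRp u (Suc k) = FR P u k"
  by (simp add: FRp_def FR_def lessThan_Suc_atMost)

lemma space_FRp [simp]: "space (FRp u k) = space (Om P)"
  by (simp add: FRp_def)

text \<open>On a failure the observation of time \<open>k\<close> is 0, so its preimages are trivial
  there and every event agrees with one from the strictly earlier remote information.\<close>

lemma FR_failure:
  assumes "A \<in> sets (FR P u k)"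
  shows "\<exists>D\<in>sets (FRp u k). \<forall>w\<in>space (Om P). chan P k w = 0 \<longrightarrow> (w \<in> A \<longleftrightarrow> w \<in> D)"
  using assms unfolding FR_def sets_generated_by
proof induction
  case (Basic A)
  then obtain j D where j: "j \<le> k" and A: "A = obsR P u j -` D \<inter> space (Om P)" and D: "D \<in> sets borel" by auto
  show ?case
  proof (cases "j < k")
    case True
    then have "A \<in> sets (FRp u k)" unfolding A FRp_def sets_generated_by using D by (auto intro!: sigma_sets.Basic)
    then show ?thesis by blast
  next
    case False
    then have "j = k" using j by simp
    then have "\<forall>w\<in>space (Om P). chan P k w = 0 \<longrightarrow> (w \<in> A \<longleftrightarrow> w \<in> (if 0 \<in> D then space (Om P) else {}))"
      by (auto simp: A obsR_packet)
    moreover have "(if 0 \<in> D then space (Om P) else {}) \<in> sets (FRp u k)"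
      using sets.top[of "FRp u k"] by auto
    ultimately show ?thesis by blast
  qed
next
  case Empty
  show ?case by (rule bexI[of _ "{}"]) auto
next
  case (Compl A)
  then obtain D where D: "D \<in> sets (FRp u k)" "\<forall>w\<in>space (Om P). chan P k w = 0 \<longrightarrow> (w \<in> A \<longleftrightarrow> w \<in> D)" by blast
  then have "space (Om P) - D \<in> sets (FRp u k)" by (metis sets.compl_sets space_FRp)
  then show ?case using D(2) by (intro bexI[of _ "space (Om P) - D"]) auto
next
  case (Union A)
  then obtain D where D: "\<And>i. D i \<in> sets (FRp u k)" "\<And>i. \<forall>w\<in>space (Om P). chan P k w = 0 \<longrightarrow> (w \<in> A i \<longleftrightarrow> w \<in> D i)" by metis
  then have "(\<Union>i. D i) \<in> sets (FRp u k)" by auto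
  then show ?case using D(2) by (intro bexI[of _ "\<Union>i. D i"]) auto
qed

text \<open>The gap belongs to the candidate, but \<open>u\<close> is arbitrary. The factor
  \<open>1 - chan P k\<close> allows the event to be replaced by an earlier one; independence of the
  channel then pulls out \<open>loss P\<close> and leaves \<open>inc\<close>, made of the old gap
  and a fresh innovation, both orthogonal to the earlier information.\<close>

lemma dd_ortho_FR:
  assumes "adm k u" "k \<le> horizon P"
  shows "ortho (Om P) (FR P u k) (dd (chan P) k)"
  using assms
proof (induction k)
  have step: "ortho (Om P) (FR P u k) (dd (chan P) k)"
    if u: "adm k u" and k: "k \<le> horizon P" and o: "ortho (Om P) (FRp u k) (inc (chan P) k)"
      and sub: "sets (FRp u k) \<subseteq> sets (GG k k)" for k
    unfolding ortho_def
  proof safe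
    fix A i assume A: "A \<in> sets (FR P u k)"
    then have AM: "A \<in> sets (Om P)" using subalgebra_FR[OF u k] by (auto simp: subalgebra_def)
    obtain D where D: "D \<in> sets (FRp u k)" and AD: "\<forall>w\<in>space (Om P). chan P k w = 0 \<longrightarrow> (w \<in> A \<longleftrightarrow> w \<in> D)"
      using FR_failure[OF A] by blast
    have DG: "D \<in> sets (GG (Suc k) k)" using D sub GG_mono[of k "Suc k" k k] by auto
    then have DM: "D \<in> sets (Om P)" using subalgebra_GG[of k "Suc k"] k by (auto simp: subalgebra_def)
    note [measurable] = AM DM chan_measurable[OF k] sqint_measurable[OF chan_sqint(1)[OF k]] sqint_measurable[OF chan_sqint(3)[OF k]]
    have gm: "(\<lambda>w. inc (chan P) k w $ i * indicator D w) \<in> borel_measurable (GG (Suc k) k)"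
      using DG inc_GG by (intro borel_measurable_times borel_measurable_vec_nth borel_measurable_indicator)
    have "(LINT w|Om P. dd (chan P) k w $ i * indicator A w) = (LINT w|Om P. (1 - chan P k w) * (inc (chan P) k w $ i * indicator D w))"
    proof (rule integral_cong_AE)
      show "AE w in Om P. dd (chan P) k w $ i * indicator A w = (1 - chan P k w) * (inc (chan P) k w $ i * indicator D w)"
        using chan_01[OF k] AE_space by eventually_elim (use AD in \<open>auto simp: dd_inc indicator_def\<close>)
    qed (use measurable_from_subalg[OF subalgebra_GG gm] k in \<open>auto\<close>)
    also have "\<dots> = loss P * (LINT w|Om P. inc (chan P) k w $ i * indicator D w)"
      by (rule chan_GG_integral(2)[OF k gm]) (intro integrable_real_mult_indicator DM sqint_integrable_nth chan_sqint k)
    also have "\<dots> = 0" using o D by (simp add: ortho_def)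
    finally show "(LINT w|Om P. dd (chan P) k w $ i * indicator A w) = 0" .
  qed
  {
    case 0
    have "sets (FRp u 0) = {{}, space (Om P)}"
      by (simp add: FRp_def sets_generated_by sigma_sets_empty_eq)
    then have s: "sets (FRp u 0) \<subseteq> sets (GG 0 0)" using sets.top[of "GG 0 0"] by auto
    show ?case
      by (rule step[OF 0 _ s]) (use ortho_mono[OF ortho_nu[of 0 0] s] in simp)
  next
    case (Suc k)
    have u: "adm k u" and k: "k \<le> horizon P" using Suc.prems adm_mono[of "Suc k" u k] by auto
    have sub: "sets (FRp u (Suc k)) \<subseteq> sets (GG (Suc k) (Suc k))"
      unfolding FRp_Suc using FR_sets_FL FL_GG[OF u k] by blast
    have sM: "subalgebra (Om P) (FR P u k)" by (rule subalgebra_FR[OF u k])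
    have "ortho (Om P) (FR P u k) (\<lambda>w. A2 k *v dd (chan P) k w)"
      by (intro ortho_matrix_vector_mult Suc.IH u k chan_sqint sM)
    moreover have "ortho (Om P) (FR P u k) (nu (Suc k))"
      by (rule ortho_mono[OF ortho_nu sub[unfolded FRp_Suc]]) (use Suc.prems in auto)
    ultimately have "ortho (Om P) (FRp u (Suc k)) (inc (chan P) (Suc k))"
      unfolding FRp_Suc inc.simps by (intro ortho_add sqint_matrix_vector_mult chan_sqint sqint_nu sM k)
    then show ?case by (intro step Suc.prems sub)
  }
qed

end

section \<open>The cost as a bilinear form\<close>

definition qf :: "'a measure \<Rightarrow> real^'n^'m \<Rightarrow> ('a \<Rightarrow> real^'m) \<Rightarrow> ('a \<Rightarrow> real^'n) \<Rightarrow> real" where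
  "qf M S X Y = (LINT w|M. X w \<bullet> (S *v Y w))"

lemma qf_add_right: "sqint M X \<Longrightarrow> sqint M Y \<Longrightarrow> sqint M Y' \<Longrightarrow> qf M S X (\<lambda>w. Y w + Y' w) = qf M S X Y + qf M S X Y'"
  by (simp add: qf_def matrix_vector_right_distrib inner_add_right sqint_integrable_quadratic)

lemma qf_add_left: "sqint M X \<Longrightarrow> sqint M X' \<Longrightarrow> sqint M Y \<Longrightarrow> qf M S (\<lambda>w. X w + X' w) Y = qf M S X Y + qf M S X' Y"
  by (simp add: qf_def inner_add_left sqint_integrable_quadratic)

lemma qf_scaleR_right: "qf M S X (\<lambda>w. c *\<^sub>R Y w) = c * qf M S X Y"
  by (simp add: qf_def matrix_vector_mult_scaleR)

lemma qf_matrix_add: "sqint M X \<Longrightarrow> sqint M Y \<Longrightarrow> qf M (S + T) X Y = qf M S X Y + qf M T X Y"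
  by (simp add: qf_def matrix_vector_mult_add_rdistrib inner_add_right sqint_integrable_quadratic)

lemma qf_matrix_scaleR: "qf M (c *\<^sub>R S) X Y = c * qf M S X Y"
  by (simp add: qf_def scaleR_matrix_vector_assoc[symmetric])

lemma qf_sym: "transpose S = S \<Longrightarrow> qf M S X Y = qf M S Y X"
proof -
  assume S: "transpose S = S"
  have "x \<bullet> (S *v y) = y \<bullet> (S *v x)" for x y
    using inner_transpose[of x S y] S by (simp add: inner_commute)
  then show ?thesis by (simp add: qf_def)
qed

lemma qf_orth2: "orth2 M X Y \<Longrightarrow> sqint M X \<Longrightarrow> sqint M Y \<Longrightarrow> qf M S X Y = 0"
  unfolding qf_def by (rule orth2_quadratic)

lemma qf_cong_AE:
  assumes "AE w in M. X w = X' w" "AE w in M. Y w = Y' w" "sqint M X" "sqint M X'" "sqint M Y" "sqint M Y'"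
  shows "qf M S X Y = qf M S X' Y'"
  unfolding qf_def
proof (rule integral_cong_AE)
  show "AE w in M. X w \<bullet> (S *v Y w) = X' w \<bullet> (S *v Y' w)" using assms(1,2) by eventually_elim simp
qed (intro borel_measurable_integrable sqint_integrable_quadratic assms)+

lemma (in prob_space) qf_const_left:
  assumes "sqint M Y" shows "qf M S (\<lambda>_. c) Y = c \<bullet> (S *v integral\<^sup>L M Y)"
proof -
  have "(LINT w|M. S *v Y w) = S *v integral\<^sup>L M Y"
    by (rule integral_bounded_linear[OF matrix_vector_mul_bounded_linear sqint_integrable[OF assms]])
  moreover have "integrable M (\<lambda>w. S *v Y w)" by (intro sqint_integrable sqint_matrix_vector_mult assms)
  ultimately show ?thesis unfolding qf_def using integral_inner_right[of c M "\<lambda>w. S *v Y w"] by simp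
qed

lemma (in prob_space) integral_matrix_vector_mult:
  "sqint M X \<Longrightarrow> (LINT w|M. A *v X w) = A *v integral\<^sup>L M X"
  by (rule integral_bounded_linear[OF matrix_vector_mul_bounded_linear sqint_integrable])

lemma (in prob_space) integral_add_sqint:
  "sqint M X \<Longrightarrow> sqint M Y \<Longrightarrow> (LINT w|M. X w + Y w) = integral\<^sup>L M X + integral\<^sup>L M Y"
  by (rule Bochner_Integration.integral_add) (auto intro: sqint_integrable)

lemma (in prob_space) integral_diff_sqint:
  "sqint M X \<Longrightarrow> sqint M Y \<Longrightarrow> (LINT w|M. X w - Y w) = integral\<^sup>L M X - integral\<^sup>L M Y"
  by (rule Bochner_Integration.integral_diff) (auto intro: sqint_integrable)

lemma orth2_diff_right:
  assumes "orth2 M X Y" "orth2 M X Y'" "sqint M X" "sqint M Y" "sqint M Y'"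
  shows "orth2 M X (\<lambda>w. Y w - Y' w)"
  using assms by (simp add: orth2_def right_diff_distrib sqint_integrable_components)

text \<open>The difference of the two sides is the form of the centered variable, a weighted
  variance.\<close>

lemma (in prob_space) qf_mean_le:
  assumes S: "sym_psd S" and X: "sqint M X"
  shows "integral\<^sup>L M X \<bullet> (S *v integral\<^sup>L M X) \<le> qf M S X X"
proof -
  let ?m = "integral\<^sup>L M X"
  have c: "sqint M (\<lambda>w. - ?m)" by (rule sqint_const)
  have "0 \<le> qf M S (\<lambda>w. X w + - ?m) (\<lambda>w. X w + - ?m)"
    unfolding qf_def by (rule integral_nonneg_AE) (use S in \<open>auto simp: sym_psd_def\<close>)
  also have "\<dots> = qf M S X X + qf M S X (\<lambda>w. - ?m) + qf M S (\<lambda>w. - ?m) X + qf M S (\<lambda>w. - ?m) (\<lambda>w. - ?m)"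
    by (simp only: qf_add_left[OF X c sqint_add[OF X c]] qf_add_right[OF X X c] qf_add_right[OF c X c])
  also have "qf M S X (\<lambda>w. - ?m) = qf M S (\<lambda>w. - ?m) X"
    using S by (intro qf_sym) (simp add: sym_psd_def)
  also have "qf M S (\<lambda>w. - ?m) (\<lambda>w. - ?m) = ?m \<bullet> (S *v ?m)"
    by (simp add: qf_def matrix_vector_minus prob_space)
  also have "qf M S (\<lambda>w. - ?m) X = - (?m \<bullet> (S *v ?m))"
    by (subst qf_const_left[OF X]) simp
  finally show ?thesis by simp
qed

section \<open>The polarised cost and its first and second variation\<close>

context flq_riccati
begin

abbreviation (input) "mn X \<equiv> integral\<^sup>L (Om P) X"

text \<open>The mean-field term is bilinear in the two processes too, so the whole stage cost
  polarises and the cost is a quadratic function of the control.\<close>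

definition stg :: "('w \<Rightarrow> real^'n) \<Rightarrow> ('w \<Rightarrow> real^'l) \<Rightarrow> ('w \<Rightarrow> real^'r) \<Rightarrow> ('w \<Rightarrow> real^'n) \<Rightarrow> ('w \<Rightarrow> real^'l) \<Rightarrow> ('w \<Rightarrow> real^'r) \<Rightarrow> real" where
  "stg x l r y l' r' = qf (Om P) (Qmu P \<mu>) x y - \<mu> * (mn x \<bullet> (matQ P *v mn y))
     + qf (Om P) (matRL P) l l' + qf (Om P) (matRR P) r r'"

definition fin :: "('w \<Rightarrow> real^'n) \<Rightarrow> ('w \<Rightarrow> real^'n) \<Rightarrow> real" where
  "fin x y = qf (Om P) (Gmu P \<mu>) x y - \<mu> * (mn x \<bullet> (matQ P *v mn y))"

lemma sqint_csrc: "sqint (Om P) (init P)" "k \<le> horizon P \<Longrightarrow> sqint (Om P) (procn P k)"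
proof -
  have "sqint (Om P) (\<lambda>w. csrc Init w + mean0 P)" by (intro sqint_add sqint_const csrc_sqint) (simp add: gsrc_def)
  then show "sqint (Om P) (init P)" by (simp add: csrc_def)
  assume "k \<le> horizon P"
  then have "sqint (Om P) (csrc (Proc k))" by (intro csrc_sqint) (simp add: gsrc_def)
  then show "sqint (Om P) (procn P k)" by (simp add: csrc_def[abs_def])
qed

lemma sqint_xi: "k \<le> Suc (horizon P) \<Longrightarrow> sqint (Om P) (xi k)"
  by (induction k) (auto intro!: sqint_add sqint_csrc sqint_matrix_vector_mult)

lemma sqint_state: "adm k u \<Longrightarrow> k \<le> Suc (horizon P) \<Longrightarrow> sqint (Om P) (state P u k)"
  unfolding state_eq[abs_def] by (intro sqint_add sqint_xi sqint_cpart)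

lemma cost_eq:
  assumes u: "admissible P u"
  shows "cost P \<mu> u = (\<Sum>k\<le>horizon P. stg (state P u k) (fst u k) (snd u k) (state P u k) (fst u k) (snd u k))
    + fin (state P u (Suc (horizon P))) (state P u (Suc (horizon P)))"
proof -
  have a: "adm (Suc (horizon P)) u" using u by (simp add: admissible_adm)
  have x: "sqint (Om P) (state P u k)" if "k \<le> Suc (horizon P)" for k
    using sqint_state[OF adm_mono[OF a that] that] .
  have l: "sqint (Om P) (fst u k)" "sqint (Om P) (snd u k)" if "k \<le> horizon P" for k
    using a that by (auto simp: adm_def)
  note i = sqint_integrable_quadratic[OF x x] sqint_integrable_quadratic[OF l(1) l(1)] sqint_integrable_quadratic[OF l(2) l(2)]
  have st: "integrable (Om P) (\<lambda>w. state P u k w \<bullet> (Qmu P \<mu> *v state P u k w) - \<mu> * (mn (state P u k) \<bullet> (matQ P *v mn (state P u k)))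
          + fst u k w \<bullet> (matRL P *v fst u k w) + snd u k w \<bullet> (matRR P *v snd u k w))"
    "(LINT w|Om P. state P u k w \<bullet> (Qmu P \<mu> *v state P u k w) - \<mu> * (mn (state P u k) \<bullet> (matQ P *v mn (state P u k)))
          + fst u k w \<bullet> (matRL P *v fst u k w) + snd u k w \<bullet> (matRR P *v snd u k w))
      = stg (state P u k) (fst u k) (snd u k) (state P u k) (fst u k) (snd u k)" if "k \<le> horizon P" for k
    using that i[of k] by (simp_all add: stg_def qf_def prob_space del: state.simps)
  have s: "integrable (Om P) (\<lambda>w. \<Sum>k\<le>horizon P. state P u k w \<bullet> (Qmu P \<mu> *v state P u k w) - \<mu> * (mn (state P u k) \<bullet> (matQ P *v mn (state P u k)))
          + fst u k w \<bullet> (matRL P *v fst u k w) + snd u k w \<bullet> (matRR P *v snd u k w))"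
    by (intro Bochner_Integration.integrable_sum st) simp
  have "cost P \<mu> u = (LINT w|Om P. (\<Sum>k\<le>horizon P. state P u k w \<bullet> (Qmu P \<mu> *v state P u k w) - \<mu> * (mn (state P u k) \<bullet> (matQ P *v mn (state P u k)))
          + fst u k w \<bullet> (matRL P *v fst u k w) + snd u k w \<bullet> (matRR P *v snd u k w)))
      + (LINT w|Om P. state P u (Suc (horizon P)) w \<bullet> (Gmu P \<mu> *v state P u (Suc (horizon P)) w))
      - \<mu> * (mn (state P u (Suc (horizon P))) \<bullet> (matQ P *v mn (state P u (Suc (horizon P)))))"
    unfolding cost_def Let_def using s i(1)[of "Suc (horizon P)"] by (simp add: prob_space del: state.simps)
  then show ?thesis
    using st by (simp add: Bochner_Integration.integral_sum fin_def qf_def del: state.simps)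
qed

lemma stg_expand:
  assumes "sqint (Om P) x" "sqint (Om P) y" "sqint (Om P) l" "sqint (Om P) l'" "sqint (Om P) r" "sqint (Om P) r'"
  shows "stg (\<lambda>w. x w + y w) (\<lambda>w. l w + l' w) (\<lambda>w. r w + r' w) (\<lambda>w. x w + y w) (\<lambda>w. l w + l' w) (\<lambda>w. r w + r' w)
    = stg x l r x l r + 2 * stg x l r y l' r' + stg y l' r' y l' r'"
proof -
  have sq: "qf (Om P) S (\<lambda>w. X w + Y w) (\<lambda>w. X w + Y w) = qf (Om P) S X X + 2 * qf (Om P) S X Y + qf (Om P) S Y Y"
    if "transpose S = S" "sqint (Om P) X" "sqint (Om P) Y" for S :: "real^'k^'k" and X Y
    using that qf_sym[of S "Om P" Y X]
    by (simp add: qf_add_left[OF that(2,3) sqint_add[OF that(2,3)]] qf_add_right)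
  have "mn (\<lambda>w. x w + y w) = mn x + mn y" by (rule integral_add_sqint[OF assms(1,2)])
  moreover have "mn y \<bullet> (matQ P *v mn x) = mn x \<bullet> (matQ P *v mn y)"
    using sym_psd_inner_commute weights(1) by blast
  ultimately show ?thesis
    using assms by (simp add: stg_def sq weights_sym weights_mu_sym matrix_vector_right_distrib inner_add_left inner_add_right algebra_simps)
qed

lemma fin_expand:
  assumes "sqint (Om P) x" "sqint (Om P) y"
  shows "fin (\<lambda>w. x w + y w) (\<lambda>w. x w + y w) = fin x x + 2 * fin x y + fin y y"
proof -
  have "mn (\<lambda>w. x w + y w) = mn x + mn y" by (rule integral_add_sqint[OF assms])
  moreover have "mn y \<bullet> (matQ P *v mn x) = mn x \<bullet> (matQ P *v mn y)"
    using sym_psd_inner_commute weights(1) by blast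
  ultimately show ?thesis
    using assms qf_sym[OF weights_mu_sym(2), of "Om P" y x]
    by (simp add: fin_def qf_add_left[OF assms sqint_add[OF assms]] qf_add_right
        matrix_vector_right_distrib inner_add_left inner_add_right algebra_simps)
qed

definition cdiff :: "('w, 'l, 'r) control \<Rightarrow> ('w, 'l, 'r) control \<Rightarrow> ('w, 'l, 'r) control" where
  "cdiff u v = ((\<lambda>k w. fst u k w - fst v k w), (\<lambda>k w. snd u k w - snd v k w))"

lemma cdiff_simps: "fst (cdiff u v) k w = fst u k w - fst v k w" "snd (cdiff u v) k w = snd u k w - snd v k w"
  by (simp_all add: cdiff_def)

lemma cpart_cdiff: "cpart (cdiff u v) k w = cpart u k w - cpart v k w"
  by (induction k) (simp_all add: cdiff_simps matrix_vector_mult_diff_distrib)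

text \<open>Half the derivative of the cost at \<open>v\<close> in the direction \<open>e\<close>;
  see \<open>cost_expand\<close>.\<close>

definition cross :: "('w, 'l, 'r) control \<Rightarrow> ('w, 'l, 'r) control \<Rightarrow> real" where
  "cross v e = (\<Sum>k\<le>horizon P. stg (state P v k) (fst v k) (snd v k) (cpart e k) (fst e k) (snd e k))
    + fin (state P v (Suc (horizon P))) (cpart e (Suc (horizon P)))"

definition quad :: "('w, 'l, 'r) control \<Rightarrow> real" where
  "quad e = (\<Sum>k\<le>horizon P. stg (cpart e k) (fst e k) (snd e k) (cpart e k) (fst e k) (snd e k))
    + fin (cpart e (Suc (horizon P))) (cpart e (Suc (horizon P)))"

lemma cost_expand:
  assumes u: "admissible P u" and v: "admissible P v"
  shows "cost P \<mu> u = cost P \<mu> v + 2 * cross v (cdiff u v) + quad (cdiff u v)"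
proof -
  have a: "adm (Suc (horizon P)) u" "adm (Suc (horizon P)) v" using u v by (simp_all add: admissible_adm)
  have x: "sqint (Om P) (state P v k)" if "k \<le> Suc (horizon P)" for k
    using sqint_state[OF adm_mono[OF a(2) that] that] .
  have c: "sqint (Om P) (cpart (cdiff u v) k)" if "k \<le> Suc (horizon P)" for k
    unfolding cpart_cdiff[abs_def] using sqint_cpart[OF adm_mono[OF a(1) that] that] sqint_cpart[OF adm_mono[OF a(2) that] that]
    by (rule sqint_diff)
  have l: "sqint (Om P) (fst v k)" "sqint (Om P) (snd v k)" "sqint (Om P) (fst (cdiff u v) k)" "sqint (Om P) (snd (cdiff u v) k)"
    if "k \<le> horizon P" for k
    using a that by (auto simp: adm_def cdiff_def intro!: sqint_diff)
  have e: "state P u k = (\<lambda>w. state P v k w + cpart (cdiff u v) k w)" "fst u k = (\<lambda>w. fst v k w + fst (cdiff u v) k w)"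
    "snd u k = (\<lambda>w. snd v k w + snd (cdiff u v) k w)" for k
    by (simp_all add: fun_eq_iff state_eq cpart_cdiff cdiff_simps)
  have "stg (state P u k) (fst u k) (snd u k) (state P u k) (fst u k) (snd u k) =
      stg (state P v k) (fst v k) (snd v k) (state P v k) (fst v k) (snd v k)
      + 2 * stg (state P v k) (fst v k) (snd v k) (cpart (cdiff u v) k) (fst (cdiff u v) k) (snd (cdiff u v) k)
      + stg (cpart (cdiff u v) k) (fst (cdiff u v) k) (snd (cdiff u v) k) (cpart (cdiff u v) k) (fst (cdiff u v) k) (snd (cdiff u v) k)"
    if "k \<le> horizon P" for k
    unfolding e[of k] using that by (intro stg_expand x c l) auto
  moreover have "fin (state P u (Suc (horizon P))) (state P u (Suc (horizon P)))
      = fin (state P v (Suc (horizon P))) (state P v (Suc (horizon P)))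
      + 2 * fin (state P v (Suc (horizon P))) (cpart (cdiff u v) (Suc (horizon P)))
      + fin (cpart (cdiff u v) (Suc (horizon P))) (cpart (cdiff u v) (Suc (horizon P)))"
    unfolding e(1)[of "Suc (horizon P)"] by (intro fin_expand x c) auto
  ultimately show ?thesis
    unfolding cost_eq[OF u] cost_eq[OF v] cross_def quad_def
    by (simp add: sum.distrib sum_distrib_left del: state.simps cpart.simps)
qed

lemma traj_cpart: "traj (\<lambda>k. joinv (fst e k w) (snd e k w)) k = cpart e k w"
  by (induction k) (simp_all add: matB_mult add.assoc)

text \<open>In \<open>Qmu\<close> and \<open>Gmu\<close> the share with factor \<mu>, reduced by the
  mean-field term, is \<mu> times a weighted variance. Dropping it leaves the expectation of the
  deterministic cost, taken path by path.\<close>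

lemma quad_ge:
  assumes e: "\<And>k. k \<le> horizon P \<Longrightarrow> sqint (Om P) (fst e k) \<and> sqint (Om P) (snd e k)"
  shows "integrable (Om P) (\<lambda>w. dcost (\<lambda>k. joinv (fst e k w) (snd e k w)))"
    "(LINT w|Om P. dcost (\<lambda>k. joinv (fst e k w) (snd e k w))) \<le> quad e"
proof -
  have c: "sqint (Om P) (cpart e k)" if "k \<le> Suc (horizon P)" for k
    using that by (induction k) (auto intro!: sqint_add sqint_matrix_vector_mult sqint_0 simp: e)
  have d: "dcost (\<lambda>k. joinv (fst e k w) (snd e k w)) = (\<Sum>k\<le>horizon P. cpart e k w \<bullet> (matQ P *v cpart e k w)
      + fst e k w \<bullet> (matRL P *v fst e k w) + snd e k w \<bullet> (matRR P *v snd e k w))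
      + cpart e (Suc (horizon P)) w \<bullet> (matG P *v cpart e (Suc (horizon P)) w)" for w
    unfolding dcost_def dstage_def dterm_def traj_cpart by (simp add: matR_mult inner_block add.assoc)
  note i = sqint_integrable_quadratic[OF c c]
  have il: "integrable (Om P) (\<lambda>w. fst e k w \<bullet> (matRL P *v fst e k w))" "integrable (Om P) (\<lambda>w. snd e k w \<bullet> (matRR P *v snd e k w))"
    if "k \<le> horizon P" for k using e[OF that] by (auto intro: sqint_integrable_quadratic)
  have ist: "integrable (Om P) (\<lambda>w. cpart e k w \<bullet> (matQ P *v cpart e k w) + fst e k w \<bullet> (matRL P *v fst e k w) + snd e k w \<bullet> (matRR P *v snd e k w))"
    if "k \<le> horizon P" for k
    using that i[of k] il by (intro Bochner_Integration.integrable_add) auto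
  show "integrable (Om P) (\<lambda>w. dcost (\<lambda>k. joinv (fst e k w) (snd e k w)))"
    unfolding d by (intro Bochner_Integration.integrable_add Bochner_Integration.integrable_sum ist i) auto
  have "(LINT w|Om P. dcost (\<lambda>k. joinv (fst e k w) (snd e k w)))
    = (\<Sum>k\<le>horizon P. LINT w|Om P. cpart e k w \<bullet> (matQ P *v cpart e k w) + fst e k w \<bullet> (matRL P *v fst e k w) + snd e k w \<bullet> (matRR P *v snd e k w))
      + qf (Om P) (matG P) (cpart e (Suc (horizon P))) (cpart e (Suc (horizon P)))"
    unfolding d qf_def
    by (subst Bochner_Integration.integral_add) (auto simp del: cpart.simps intro!: Bochner_Integration.integrable_sum ist i Bochner_Integration.integral_sum)
  also have "(\<Sum>k\<le>horizon P. LINT w|Om P. cpart e k w \<bullet> (matQ P *v cpart e k w) + fst e k w \<bullet> (matRL P *v fst e k w) + snd e k w \<bullet> (matRR P *v snd e k w))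
     = (\<Sum>k\<le>horizon P. qf (Om P) (matQ P) (cpart e k) (cpart e k) + qf (Om P) (matRL P) (fst e k) (fst e k) + qf (Om P) (matRR P) (snd e k) (snd e k))"
    using i il by (intro sum.cong) (auto simp: qf_def)
  finally have E: "(LINT w|Om P. dcost (\<lambda>k. joinv (fst e k w) (snd e k w)))
    = (\<Sum>k\<le>horizon P. qf (Om P) (matQ P) (cpart e k) (cpart e k) + qf (Om P) (matRL P) (fst e k) (fst e k) + qf (Om P) (matRR P) (snd e k) (snd e k))
      + qf (Om P) (matG P) (cpart e (Suc (horizon P))) (cpart e (Suc (horizon P)))" .
  have var: "qf (Om P) S X X \<le> qf (Om P) (S + \<mu> *\<^sub>R matQ P) X X - \<mu> * (mn X \<bullet> (matQ P *v mn X))"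
    if "sqint (Om P) X" for S X
    using mult_left_mono[OF qf_mean_le[OF weights(1) that] mu] by (simp add: qf_matrix_add[OF that that] qf_matrix_scaleR)
  show "(LINT w|Om P. dcost (\<lambda>k. joinv (fst e k w) (snd e k w))) \<le> quad e"
    unfolding E quad_def stg_def fin_def Qmu_def Gmu_def
    by (intro add_mono sum_mono var c order_refl) auto
qed

lemma dcost_nonneg: "0 \<le> dcost \<delta>"
  unfolding dcost_def by (intro add_nonneg_nonneg sum_nonneg dstage_nonneg dterm_nonneg)

lemma quad_nonneg:
  assumes "\<And>k. k \<le> horizon P \<Longrightarrow> sqint (Om P) (fst e k) \<and> sqint (Om P) (snd e k)"
  shows "0 \<le> quad e"
proof -
  have "0 \<le> (LINT w|Om P. dcost (\<lambda>k. joinv (fst e k w) (snd e k w)))"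
    by (intro integral_nonneg_AE AE_I2 dcost_nonneg)
  then show ?thesis using quad_ge(2)[OF assms] by simp
qed

lemma quad_zero:
  assumes e: "\<And>k. k \<le> horizon P \<Longrightarrow> sqint (Om P) (fst e k) \<and> sqint (Om P) (snd e k)" and q: "quad e \<le> 0" and c: pos_cond
    and k: "k \<le> horizon P"
  shows "AE w in Om P. fst e k w = 0 \<and> snd e k w = 0"
proof -
  have "(LINT w|Om P. dcost (\<lambda>k. joinv (fst e k w) (snd e k w))) = 0"
  proof (rule order_antisym)
    show "0 \<le> (LINT w|Om P. dcost (\<lambda>k. joinv (fst e k w) (snd e k w)))"
      by (intro integral_nonneg_AE AE_I2 dcost_nonneg)
  qed (use quad_ge(2)[OF e] q in simp)
  then have "AE w in Om P. dcost (\<lambda>k. joinv (fst e k w) (snd e k w)) = 0"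
    using integral_nonneg_eq_0_iff_AE[OF quad_ge(1)[OF e]] dcost_nonneg by simp
  then show ?thesis
  proof eventually_elim
    case (elim w)
    have "joinv (fst e k w) (snd e k w) = 0" by (rule dcost_eq_0_imp[OF c elim k])
    then show ?case by (metis block_joinv block_simps(9,10))
  qed
qed

end

section \<open>Optimality\<close>

context flq_optimal
begin

abbreviation "D \<equiv> dd (chan P)"
abbreviation "Rr \<equiv> rr (chan P)"

text \<open>The pairing of a test process with the costate formed from \<open>ZZ\<close>,
  \<open>XX\<close> and \<open>VV\<close> on the three parts of the estimate. \<open>Ph'\<close> is
  the pairing after one closed-loop step, before the next innovation, with the next channel state
  already averaged into \<open>Theta\<close>.\<close>

definition Ph :: "(nat \<Rightarrow> 'w \<Rightarrow> real^'n) \<Rightarrow> nat \<Rightarrow> real" where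
  "Ph \<psi> k = qf (Om P) (ZZ k) (Rr k) (\<psi> k) + qf (Om P) (XX k) (D k) (\<psi> k) + qf (Om P) (VV k) (\<lambda>_. mm k) (\<psi> k)"

definition Ph' :: "('w \<Rightarrow> real^'n) \<Rightarrow> nat \<Rightarrow> real" where
  "Ph' \<psi>' k = qf (Om P) (ZZ (Suc k)) (\<lambda>w. A1 k *v Rr k w) \<psi>' + qf (Om P) (Theta P \<mu> (Suc k)) (\<lambda>w. A2 k *v D k w) \<psi>'
    + qf (Om P) (VV (Suc k)) (\<lambda>_. A3 k *v mm k) \<psi>'"

text \<open>Three instances of \<open>complete_square_stationary\<close>, for the remote estimate,
  the gap and the mean. The one for the gap admits only the local variation \<open>a\<close>; the
  effect of the remote variation \<open>b\<close> on it survives as the last term.\<close>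

lemma stationary_pointwise:
  assumes k: "k \<le> horizon P"
  shows "Rr k w \<bullet> (ZZ k *v \<psi>) + D k w \<bullet> (XX k *v \<psi>) + mm k \<bullet> (VV k *v \<psi>)
    = xhat k w \<bullet> (Qmu P \<mu> *v \<psi>) - \<mu> * (mm k \<bullet> (matQ P *v \<psi>)) + UL k w \<bullet> (matRL P *v a) + UR k w \<bullet> (matRR P *v b)
      + (A1 k *v Rr k w) \<bullet> (ZZ (Suc k) *v (matA P *v \<psi> + matBL P *v a + matBR P *v b))
      + (A2 k *v D k w) \<bullet> (Theta P \<mu> (Suc k) *v (matA P *v \<psi> + matBL P *v a + matBR P *v b))
      + (A3 k *v mm k) \<bullet> (VV (Suc k) *v (matA P *v \<psi> + matBL P *v a + matBR P *v b))
      - D k w \<bullet> ((transpose (A2 k) ** Theta P \<mu> (Suc k) ** matBR P) *v b)"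
proof -
  have o: "riccati_order (Suc k)" using k by (intro order) simp
  then have sy: "transpose (ZZ (Suc k)) = ZZ (Suc k)" "transpose (VV (Suc k)) = VV (Suc k)"
    by (auto simp: riccati_order_def)
  have inv: "invertible (Upsilon P \<mu> k)" "invertible (Mmat P \<mu> k)" "invertible (Lambda P \<mu> k)"
    and sym: "transpose (Mmat P \<mu> k) = Mmat P \<mu> k" "transpose (Lambda P \<mu> k) = Lambda P \<mu> k"
    using definite[OF k] sym_pd_invertible by (auto simp: sym_pd_def)
  let ?v = "joinv a b"
  have Bv: "matB P *v ?v = matBL P *v a + matBR P *v b" by (simp add: matB_mult)
  have 1: "x \<bullet> (ZZ k *v \<psi>) = x \<bullet> (Qmu P \<mu> *v \<psi>) + (A1 k *v x) \<bullet> (ZZ (Suc k) *v (matA P *v \<psi> + matB P *v ?v)) - (gainK P \<mu> k *v x) \<bullet> (matR P *v ?v)" for x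
    using complete_square_stationary[OF sy(1) weights_sym(5) Upsilon_ZZ gains(1)[OF inv(1)], of x \<psi> ?v]
    unfolding ZZ_step[OF k] A1_def
    by (simp add: matrix_vector_mult_add_rdistrib matrix_vector_mult_diff_rdistrib inner_add_right inner_diff_right)
  have 2: "x \<bullet> (VV k *v \<psi>) = x \<bullet> (matQ P *v \<psi>) + (A3 k *v x) \<bullet> (VV (Suc k) *v (matA P *v \<psi> + matB P *v ?v)) - (KV k *v x) \<bullet> (matR P *v ?v)" for x
    using complete_square_stationary[OF sy(2) weights_sym(5) Mmat_VV gains(2)[OF inv(2)], of x \<psi> ?v]
    unfolding VV_step[OF k inv(2) sym(1)] A3_def
    by (simp add: matrix_vector_mult_add_rdistrib inner_add_right)
  have 3: "x \<bullet> (XX k *v \<psi>) = x \<bullet> (Qmu P \<mu> *v \<psi>) + (A2 k *v x) \<bullet> (Theta P \<mu> (Suc k) *v (matA P *v \<psi> + matBL P *v a)) - (KL k *v x) \<bullet> (matRL P *v a)" for x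
    using complete_square_stationary[OF Theta_sym[OF o] weights_sym(2) Lambda_Theta gains(3)[OF inv(3)], of x \<psi> a]
    unfolding XX_step[OF k inv(3) sym(2)] A2_def
    by (simp add: matrix_vector_mult_add_rdistrib inner_add_right)
  have 4: "x \<bullet> ((transpose (A2 k) ** Theta P \<mu> (Suc k) ** matBR P) *v b) = (A2 k *v x) \<bullet> (Theta P \<mu> (Suc k) *v (matBR P *v b))" for x
    by (simp add: matrix_vector_mul_assoc[symmetric] inner_transpose[of _ "transpose _"])
  have 5: "UL k w \<bullet> (matRL P *v a) + UR k w \<bullet> (matRR P *v b)
      = - ((gainK P \<mu> k *v Rr k w) \<bullet> (matR P *v ?v)) - (KV k *v mm k) \<bullet> (matR P *v ?v) - (KL k *v D k w) \<bullet> (matRL P *v a)"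
    by (simp add: UL_def UR_def UU_def block_simps inner_block matR_mult inner_diff_left inner_add_left algebra_simps)
  have 6: "mm k \<bullet> (matQ P *v \<psi>) = mm k \<bullet> (Qmu P \<mu> *v \<psi>) - \<mu> * (mm k \<bullet> (matQ P *v \<psi>))"
    by (simp add: Qmu_quadratic)
  have 7: "(A2 k *v D k w) \<bullet> (Theta P \<mu> (Suc k) *v (matA P *v \<psi> + matBL P *v a + matBR P *v b))
      = (A2 k *v D k w) \<bullet> (Theta P \<mu> (Suc k) *v (matA P *v \<psi> + matBL P *v a)) + (A2 k *v D k w) \<bullet> (Theta P \<mu> (Suc k) *v (matBR P *v b))"
    by (simp add: matrix_vector_right_distrib inner_add_right)
  show ?thesis
    using 1[of "Rr k w"] 2[of "mm k"] 3[of "D k w"] 4[of "D k w"] 5 6 7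
    unfolding Bv xhat_def inner_add_left add.assoc by linarith
qed

text \<open>The surviving term of \<open>stationary_pointwise\<close> pairs the gap with
  \<open>b\<close> and has mean zero by the orthogonality assumption \<open>o\<close>.\<close>

lemma telescope_step:
  assumes k: "k \<le> horizon P" and \<psi>: "sqint (Om P) (\<psi> k)" and l: "sqint (Om P) a" and r: "sqint (Om P) b"
    and o: "orth2 (Om P) (D k) b"
  shows "Ph \<psi> k = qf (Om P) (Qmu P \<mu>) (xhat k) (\<psi> k) - \<mu> * (mm k \<bullet> (matQ P *v mn (\<psi> k)))
      + qf (Om P) (matRL P) (UL k) a + qf (Om P) (matRR P) (UR k) b
      + Ph' (\<lambda>w. matA P *v \<psi> k w + matBL P *v a w + matBR P *v b w) k"
proof -
  let ?\<psi>' = "\<lambda>w. matA P *v \<psi> k w + matBL P *v a w + matBR P *v b w"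
  have p': "sqint (Om P) ?\<psi>'" by (intro sqint_add sqint_matrix_vector_mult \<psi> l r)
  note ch = chan_sqint[OF k] U_sqint[OF k] xhat_sqint[OF k]
  note I = sqint_integrable_quadratic
  have c: "sqint (Om P) (\<lambda>_. x)" for x :: "real^'n" by (rule sqint_const)
  have z: "qf (Om P) (transpose (A2 k) ** Theta P \<mu> (Suc k) ** matBR P) (D k) b = 0"
    by (rule qf_orth2[OF o ch(1) r])
  have m: "\<mu> * (mm k \<bullet> (matQ P *v mn (\<psi> k))) = (LINT w|Om P. \<mu> * (mm k \<bullet> (matQ P *v \<psi> k w)))"
    using qf_const_left[OF \<psi>, of "matQ P" "mm k"] by (simp add: qf_def)
  have "Ph \<psi> k = (LINT w|Om P. Rr k w \<bullet> (ZZ k *v \<psi> k w) + D k w \<bullet> (XX k *v \<psi> k w) + mm k \<bullet> (VV k *v \<psi> k w))"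
    unfolding Ph_def qf_def using I[OF ch(2) \<psi>] I[OF ch(1) \<psi>] I[OF c \<psi>] by simp
  also have "\<dots> = (LINT w|Om P. xhat k w \<bullet> (Qmu P \<mu> *v \<psi> k w) - \<mu> * (mm k \<bullet> (matQ P *v \<psi> k w)) + UL k w \<bullet> (matRL P *v a w) + UR k w \<bullet> (matRR P *v b w)
      + (A1 k *v Rr k w) \<bullet> (ZZ (Suc k) *v ?\<psi>' w) + (A2 k *v D k w) \<bullet> (Theta P \<mu> (Suc k) *v ?\<psi>' w)
      + (A3 k *v mm k) \<bullet> (VV (Suc k) *v ?\<psi>' w) - D k w \<bullet> ((transpose (A2 k) ** Theta P \<mu> (Suc k) ** matBR P) *v b w))"
    by (intro Bochner_Integration.integral_cong refl stationary_pointwise k)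
  also have "\<dots> = qf (Om P) (Qmu P \<mu>) (xhat k) (\<psi> k) - (LINT w|Om P. \<mu> * (mm k \<bullet> (matQ P *v \<psi> k w)))
      + qf (Om P) (matRL P) (UL k) a + qf (Om P) (matRR P) (UR k) b
      + qf (Om P) (ZZ (Suc k)) (\<lambda>w. A1 k *v Rr k w) ?\<psi>' + qf (Om P) (Theta P \<mu> (Suc k)) (\<lambda>w. A2 k *v D k w) ?\<psi>'
      + qf (Om P) (VV (Suc k)) (\<lambda>_. A3 k *v mm k) ?\<psi>'
      - qf (Om P) (transpose (A2 k) ** Theta P \<mu> (Suc k) ** matBR P) (D k) b"
    unfolding qf_def
    using I[OF ch(6) \<psi>, of "Qmu P \<mu>"] I[OF c \<psi>, of "mm k" "matQ P"] I[OF ch(4) l, of "matRL P"] I[OF ch(5) r, of "matRR P"]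
      I[OF sqint_matrix_vector_mult[OF ch(2), of "A1 k"] p', of "ZZ (Suc k)"]
      I[OF sqint_matrix_vector_mult[OF ch(1), of "A2 k"] p', of "Theta P \<mu> (Suc k)"]
      I[OF c p', of "A3 k *v mm k" "VV (Suc k)"]
      I[OF ch(1) r, of "transpose (A2 k) ** Theta P \<mu> (Suc k) ** matBR P"]
    by (simp only: Bochner_Integration.integral_add Bochner_Integration.integral_diff Bochner_Integration.integrable_add
        Bochner_Integration.integrable_diff integrable_mult_right)
  finally show ?thesis unfolding z m Ph'_def by simp
qed

text \<open>Price of a fresh innovation: on success it enters the remote estimate, with weight
  \<open>ZZ\<close>; on failure it enters the gap, with weight \<open>XX\<close>.\<close>

definition noise :: "nat \<Rightarrow> real" where
  "noise k = (1 - loss P) * qf (Om P) (ZZ k) (nu k) (nu k) + loss P * qf (Om P) (XX k) (nu k) (nu k)"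

lemma qf_chan:
  assumes k: "k \<le> horizon P" and X: "sqint (Om P) X" "X \<in> borel_measurable (GG (Suc k) k)"
    and Y: "sqint (Om P) Y" "Y \<in> borel_measurable (GG (Suc k) k)"
  shows "qf (Om P) S (\<lambda>w. chan P k w *\<^sub>R X w) Y = (1 - loss P) * qf (Om P) S X Y"
    "qf (Om P) S (\<lambda>w. (1 - chan P k w) *\<^sub>R X w) Y = loss P * qf (Om P) S X Y"
  using chan_GG_integral(1,2)[OF k _ sqint_integrable_quadratic[OF X(1) Y(1), of S], of "Suc k"] X Y
  by (simp_all add: qf_def borel_measurable_inner borel_measurable_matrix_vector_mult)

text \<open>The factor \<open>s\<close> is 0 for a variation of the control and 1 for the optimal
  estimate itself, so the same telescoping yields the first variation and the optimal cost.
  Averaging over the channel turns \<open>ZZ\<close> and \<open>XX\<close> at the gap into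
  \<open>Theta\<close>.\<close>

lemma telescope_noise:
  assumes k: "Suc k \<le> horizon P" and p': "sqint (Om P) \<psi>'" "\<psi>' \<in> borel_measurable (GG (Suc k) (Suc k))"
    and \<psi>: "\<psi> (Suc k) = (\<lambda>w. \<psi>' w + s *\<^sub>R nu (Suc k) w)"
  shows "Ph \<psi> (Suc k) = Ph' \<psi>' k + s * noise (Suc k)"
proof -
  let ?k = "Suc k"
  have kN: "k \<le> horizon P" using k by simp
  have sub: "subalgebra (Om P) (GG ?k ?k)" using k by (intro subalgebra_GG) simp
  have on: "orth2 (Om P) (nu ?k) Y" "orth2 (Om P) Y (nu ?k)"
    if "sqint (Om P) Y" "Y \<in> borel_measurable (GG ?k ?k)" for Y :: "'w \<Rightarrow> real^'n"
    using ortho_orth2[OF sub ortho_nu sqint_nu that] k by auto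
  have sp: "sqint (Om P) (\<psi> ?k)" unfolding \<psi> by (intro sqint_add sqint_scaleR sqint_nu p')
  have pG: "\<psi> ?k \<in> borel_measurable (GG (Suc ?k) ?k)"
    unfolding \<psi> by (intro borel_measurable_add borel_measurable_scaleR borel_measurable_const nu_GG measurable_GG_mono[OF p'(2)]) auto
  have si: "sqint (Om P) (inc (chan P) ?k)" using chan_sqint(3)[OF k] .
  let ?r = "\<lambda>w. A1 k *v Rr k w" and ?d = "\<lambda>w. A2 k *v D k w"
  have sr: "sqint (Om P) ?r" "sqint (Om P) ?d" by (intro sqint_matrix_vector_mult chan_sqint kN)+
  have mr: "?r \<in> borel_measurable (GG ?k ?k)" "?d \<in> borel_measurable (GG ?k ?k)"
    by (intro borel_measurable_matrix_vector_mult chan_dd_GG)+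
  have sci: "sqint (Om P) (\<lambda>w. chan P ?k w *\<^sub>R inc (chan P) ?k w)"
    by (intro sqint_bounded_scaleR si chan_measurable chan_abs_le k)
  have split: "qf (Om P) S X (\<psi> ?k) = qf (Om P) S X \<psi>' + s * qf (Om P) S X (nu ?k)" if "sqint (Om P) X" for S X
    unfolding \<psi> qf_add_right[OF that p'(1) sqint_scaleR[OF sqint_nu]] qf_scaleR_right ..
  \<comment> \<open>The fresh innovation is orthogonal to all that is known at time
    \<open>k\<close>, so only the two unmixed pairings survive.\<close>
  have incpsi: "qf (Om P) S (inc (chan P) ?k) (\<psi> ?k) = qf (Om P) S ?d \<psi>' + s * qf (Om P) S (nu ?k) (nu ?k)" for S
  proof -
    have "qf (Om P) S (inc (chan P) ?k) (\<psi> ?k) = qf (Om P) S ?d (\<psi> ?k) + qf (Om P) S (nu ?k) (\<psi> ?k)"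
      unfolding inc.simps by (rule qf_add_left[OF sr(2) sqint_nu sp])
    also have "\<dots> = qf (Om P) S ?d \<psi>' + s * qf (Om P) S ?d (nu ?k) + (qf (Om P) S (nu ?k) \<psi>' + s * qf (Om P) S (nu ?k) (nu ?k))"
      by (simp only: split[OF sr(2)] split[OF sqint_nu])
    also have "qf (Om P) S ?d (nu ?k) = 0" by (intro qf_orth2 on sr mr sqint_nu)
    also have "qf (Om P) S (nu ?k) \<psi>' = 0" by (intro qf_orth2 on p' sqint_nu)
    finally show ?thesis by simp
  qed
  have Z: "qf (Om P) (ZZ ?k) (Rr ?k) (\<psi> ?k) = qf (Om P) (ZZ ?k) ?r \<psi>' + (1 - loss P) * (qf (Om P) (ZZ ?k) ?d \<psi>' + s * qf (Om P) (ZZ ?k) (nu ?k) (nu ?k))"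
  proof -
    have "qf (Om P) (ZZ ?k) (Rr ?k) (\<psi> ?k) = qf (Om P) (ZZ ?k) ?r (\<psi> ?k) + qf (Om P) (ZZ ?k) (\<lambda>w. chan P ?k w *\<^sub>R inc (chan P) ?k w) (\<psi> ?k)"
      using qf_add_left[OF sr(1) sci sp] by simp
    also have "qf (Om P) (ZZ ?k) ?r (\<psi> ?k) = qf (Om P) (ZZ ?k) ?r \<psi>' + s * qf (Om P) (ZZ ?k) ?r (nu ?k)" by (rule split[OF sr(1)])
    also have "qf (Om P) (ZZ ?k) ?r (nu ?k) = 0" by (intro qf_orth2 on sr mr sqint_nu)
    also have "qf (Om P) (ZZ ?k) (\<lambda>w. chan P ?k w *\<^sub>R inc (chan P) ?k w) (\<psi> ?k) = (1 - loss P) * qf (Om P) (ZZ ?k) (inc (chan P) ?k) (\<psi> ?k)"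
      by (rule qf_chan[OF k si inc_GG sp pG])
    finally show ?thesis unfolding incpsi by simp
  qed
  have X: "qf (Om P) (XX ?k) (D ?k) (\<psi> ?k) = loss P * (qf (Om P) (XX ?k) ?d \<psi>' + s * qf (Om P) (XX ?k) (nu ?k) (nu ?k))"
  proof -
    have "D ?k = (\<lambda>w. (1 - chan P ?k w) *\<^sub>R inc (chan P) ?k w)" by (simp only: fun_eq_iff dd_inc) simp
    then show ?thesis unfolding incpsi[symmetric] by (simp only: qf_chan(2)[OF k si inc_GG sp pG])
  qed
  have V: "qf (Om P) (VV ?k) (\<lambda>_. mm ?k) (\<psi> ?k) = qf (Om P) (VV ?k) (\<lambda>_. A3 k *v mm k) \<psi>'"
  proof -
    have c: "sqint (Om P) (\<lambda>_. mm ?k)" by (rule sqint_const)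
    have "qf (Om P) (VV ?k) (\<lambda>_. mm ?k) (nu ?k) = 0" by (intro qf_orth2 on c sqint_nu) simp
    then show ?thesis using split[OF c, of "VV ?k"] by simp
  qed
  have T: "qf (Om P) (Theta P \<mu> ?k) ?d \<psi>' = (1 - loss P) * qf (Om P) (ZZ ?k) ?d \<psi>' + loss P * qf (Om P) (XX ?k) ?d \<psi>'"
    unfolding Theta_def by (simp add: qf_matrix_add[OF sr(2) p'(1)] qf_matrix_scaleR)
  show ?thesis unfolding Ph_def Ph'_def noise_def Z X V T by (simp add: algebra_simps)
qed

text \<open>At the end \<open>ZZ\<close> and \<open>XX\<close> both equal \<open>Gmu\<close>, hence
  so does \<open>Theta\<close>; the mean carries the weight \<open>matG\<close>, and the difference
  from \<open>Gmu\<close> is exactly the mean-field correction.\<close>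

lemma telescope_final:
  assumes p': "sqint (Om P) \<psi>'"
  shows "Ph' \<psi>' (horizon P) = qf (Om P) (Gmu P \<mu>) (xbar (horizon P)) \<psi>'
    - \<mu> * ((A3 (horizon P) *v mm (horizon P)) \<bullet> (matQ P *v mn \<psi>'))"
proof -
  let ?N = "horizon P"
  have sr: "sqint (Om P) (\<lambda>w. A1 ?N *v Rr ?N w)" "sqint (Om P) (\<lambda>w. A2 ?N *v D ?N w)" and c: "sqint (Om P) (\<lambda>_. A3 ?N *v mm ?N)"
    by (intro sqint_matrix_vector_mult chan_sqint sqint_const order_refl)+
  have x: "xbar ?N = (\<lambda>w. (A3 ?N *v mm ?N + A1 ?N *v Rr ?N w) + A2 ?N *v D ?N w)" by (auto simp: xbar_def)
  have T: "Theta P \<mu> (Suc ?N) = Gmu P \<mu>" by (simp add: Theta_def terminal scaleR_left_diff_distrib)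
  have "qf (Om P) (Gmu P \<mu>) (\<lambda>_. A3 ?N *v mm ?N) \<psi>'
      = qf (Om P) (matG P) (\<lambda>_. A3 ?N *v mm ?N) \<psi>' + \<mu> * ((A3 ?N *v mm ?N) \<bullet> (matQ P *v mn \<psi>'))"
    unfolding Gmu_def qf_const_left[OF p']
    by (simp add: matrix_vector_mult_add_rdistrib inner_add_right scaleR_matrix_vector_assoc[symmetric])
  then show ?thesis
    unfolding Ph'_def T terminal x qf_add_left[OF sqint_add[OF c sr(1)] sr(2) p'] qf_add_left[OF c sr(1) p'] by simp
qed

text \<open>The innovation of time 0 is part of \<open>Ph \<psi> 0\<close>, so the noise sum starts
  at time 1. The last step stops at the prediction \<open>\<psi>'\<close>, without an
  innovation.\<close>

lemma telescope:
  assumes \<psi>: "\<And>k. k \<le> horizon P \<Longrightarrow> sqint (Om P) (\<psi> k) \<and> \<psi> k \<in> borel_measurable (GG (Suc k) (Suc k))"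
    and l: "\<And>k. k \<le> horizon P \<Longrightarrow> sqint (Om P) (a k) \<and> a k \<in> borel_measurable (GG (Suc k) (Suc k))"
    and r: "\<And>k. k \<le> horizon P \<Longrightarrow> sqint (Om P) (b k) \<and> b k \<in> borel_measurable (GG (Suc k) (Suc k))"
    and o: "\<And>k. k \<le> horizon P \<Longrightarrow> orth2 (Om P) (D k) (b k)"
    and dyn: "\<And>k. Suc k \<le> horizon P \<Longrightarrow> \<psi> (Suc k) = (\<lambda>w. (matA P *v \<psi> k w + matBL P *v a k w + matBR P *v b k w) + s *\<^sub>R nu (Suc k) w)"
    and p': "\<psi>' = (\<lambda>w. matA P *v \<psi> (horizon P) w + matBL P *v a (horizon P) w + matBR P *v b (horizon P) w)"
  shows "Ph \<psi> 0 + s * (\<Sum>k<horizon P. noise (Suc k)) =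
    (\<Sum>k\<le>horizon P. qf (Om P) (Qmu P \<mu>) (xhat k) (\<psi> k) - \<mu> * (mm k \<bullet> (matQ P *v mn (\<psi> k)))
      + qf (Om P) (matRL P) (UL k) (a k) + qf (Om P) (matRR P) (UR k) (b k))
    + qf (Om P) (Gmu P \<mu>) (xbar (horizon P)) \<psi>' - \<mu> * ((A3 (horizon P) *v mm (horizon P)) \<bullet> (matQ P *v mn \<psi>'))"
proof -
  define nxt where "nxt k w = matA P *v \<psi> k w + matBL P *v a k w + matBR P *v b k w" for k w
  define st where "st k = qf (Om P) (Qmu P \<mu>) (xhat k) (\<psi> k) - \<mu> * (mm k \<bullet> (matQ P *v mn (\<psi> k)))
      + qf (Om P) (matRL P) (UL k) (a k) + qf (Om P) (matRR P) (UR k) (b k)" for k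
  have 1: "Ph \<psi> k = st k + Ph' (nxt k) k" if "k \<le> horizon P" for k
    unfolding st_def nxt_def[abs_def] using \<psi> l r o that by (intro telescope_step) auto
  have 2: "Ph \<psi> (Suc k) = Ph' (nxt k) k + s * noise (Suc k)" if "Suc k \<le> horizon P" for k
  proof (rule telescope_noise[OF that])
    have k: "k \<le> horizon P" using that by simp
    show "sqint (Om P) (nxt k)" unfolding nxt_def[abs_def] using \<psi>[OF k] l[OF k] r[OF k]
      by (intro sqint_add sqint_matrix_vector_mult) auto
    show "nxt k \<in> borel_measurable (GG (Suc k) (Suc k))" unfolding nxt_def[abs_def] using \<psi>[OF k] l[OF k] r[OF k]
      by (intro borel_measurable_add borel_measurable_matrix_vector_mult) auto
    show "\<psi> (Suc k) = (\<lambda>w. nxt k w + s *\<^sub>R nu (Suc k) w)" unfolding dyn[OF that] nxt_def ..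
  qed
  have "Ph \<psi> 0 + s * (\<Sum>k<n. noise (Suc k)) = (\<Sum>k\<le>n. st k) + Ph' (nxt n) n" if "n \<le> horizon P" for n
    using that
  proof (induction n)
    case 0 then show ?case using 1[of 0] by simp
  next
    case (Suc n)
    then show ?case using 1[of "Suc n"] 2[of n] by (simp add: algebra_simps)
  qed
  from this[of "horizon P"] show ?thesis
    using telescope_final[of "nxt (horizon P)"] \<psi>[of "horizon P"] l[of "horizon P"] r[of "horizon P"]
    unfolding st_def p' nxt_def[abs_def] by (simp add: sqint_add sqint_matrix_vector_mult)
qed

section \<open>Means of the candidate process\<close>

lemma adm_zero: "adm k (\<lambda>_ _. 0, \<lambda>_ _. 0)"
  by (simp add: adm_def sqint_0)

lemma mean_nu: "k \<le> horizon P \<Longrightarrow> mn (nu k) = 0"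
  and mean_err: "k \<le> horizon P \<Longrightarrow> mn (err k) = 0"
  and mean_vlin: "mn (vlin a) = 0"
proof -
  show v: "mn (vlin a) = 0" for a
    using integral_vec_nth[OF sqint_integrable[OF vlin_sqint[of a]]] lin_moments(4)
    by (simp add: vec_eq_iff vlin_nth)
  show "mn (nu k) = 0"
    unfolding nu_def[abs_def] integral_matrix_vector_mult[OF sqint_iota] by (simp add: iota_def v)
  show "mn (err k) = 0" by (simp add: err_def v)
qed

text \<open>Orthogonality to a remote information, tested on the whole space; the zero control
  supplies such an information.\<close>

lemma mean_dd: "k \<le> horizon P \<Longrightarrow> mn (D k) = 0"
proof -
  assume k: "k \<le> horizon P"
  have "(LINT w|Om P. D k w $ i * indicator (space (Om P)) w) = 0" for i
    using dd_ortho_FR[OF adm_zero k] sets.top[of "FR P (\<lambda>_ _. 0, \<lambda>_ _. 0) k"] unfolding ortho_def by auto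
  moreover have "(LINT w|Om P. D k w $ i * indicator (space (Om P)) w) = (LINT w|Om P. D k w $ i)" for i
    by (intro Bochner_Integration.integral_cong) auto
  ultimately show ?thesis
    using integral_vec_nth[OF sqint_integrable[OF chan_sqint(1)[OF k]]] by (simp add: vec_eq_iff)
qed

text \<open>The channel factor is eliminated by writing the remote part as the full correction minus
  the gap, whose mean is already known.\<close>

lemma mean_rr: "k \<le> horizon P \<Longrightarrow> mn (Rr k) = 0"
proof (induction k)
  case 0
  have "Rr 0 = (\<lambda>w. nu 0 w - D 0 w)" by (auto simp: algebra_simps)
  then show ?case
    using integral_diff_sqint[OF sqint_nu chan_sqint(1)[of 0], of 0] mean_nu[of 0] mean_dd[of 0]
    by (simp del: dd.simps rr.simps)
next
  case (Suc k)
  then have k: "k \<le> horizon P" "Suc k \<le> horizon P" by auto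
  have e: "Rr (Suc k) = (\<lambda>w. (A1 k *v Rr k w + A2 k *v D k w) + (nu (Suc k) w - D (Suc k) w))"
    by (auto simp: algebra_simps)
  have s: "sqint (Om P) (\<lambda>w. A1 k *v Rr k w)" "sqint (Om P) (\<lambda>w. A2 k *v D k w)"
    by (intro sqint_matrix_vector_mult chan_sqint k)+
  have "mn (\<lambda>w. A1 k *v Rr k w) = 0" "mn (\<lambda>w. A2 k *v D k w) = 0"
    using Suc.IH k mean_dd by (simp_all add: integral_matrix_vector_mult chan_sqint)
  then show ?case
    unfolding e integral_add_sqint[OF sqint_add[OF s] sqint_diff[OF sqint_nu chan_sqint(1)[OF k(2)]]]
      integral_add_sqint[OF s] integral_diff_sqint[OF sqint_nu chan_sqint(1)[OF k(2)]]
    using mean_nu[OF k(2)] mean_dd[OF k(2)] by (simp del: dd.simps)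
qed

lemma mean_xhat: "k \<le> horizon P \<Longrightarrow> mn (xhat k) = mm k"
  unfolding xhat_def[abs_def]
  by (simp add: integral_add_sqint sqint_add sqint_const chan_sqint mean_rr mean_dd prob_space)

lemma mean_xbar: "k \<le> horizon P \<Longrightarrow> mn (xbar k) = A3 k *v mm k"
  unfolding xbar_def[abs_def]
  by (simp add: integral_add_sqint sqint_add sqint_const sqint_matrix_vector_mult integral_matrix_vector_mult chan_sqint mean_rr mean_dd prob_space)

text \<open>\<open>ustar\<close> is given by formulas in innovations and channel states and need not
  be measurable for the uncompleted information. Optimality is therefore stated for its admissible
  versions.\<close>

definition star_like :: "('w, 'l, 'r) control \<Rightarrow> bool" where
  "star_like v \<longleftrightarrow> admissible P v \<and> (\<forall>k\<le>horizon P. AE w in Om P. fst v k w = UL k w \<and> snd v k w = UR k w)"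

lemma star_like_exists: "\<exists>v. star_like v"
  using realizable_control[OF realizable_ustar] by (simp add: star_like_def)

text \<open>The prediction error one step after the horizon, where no further measurement corrects
  it.\<close>

definition eterm :: "'w \<Rightarrow> real^'n" where "eterm = vlin (ep (Suc (horizon P)))"

lemma star_state:
  assumes v: "star_like v"
  shows "k \<le> horizon P \<Longrightarrow> AE w in Om P. state P v k w = xhat k w + err k w"
    "AE w in Om P. state P v (Suc (horizon P)) w = xbar (horizon P) w + eterm w"
proof -
  have c: "AE w in Om P. cpart v k w = cpart ustar k w" if "k \<le> horizon P" for k
    by (rule cpart_cong_AE) (use v that in \<open>auto simp: star_like_def\<close>)
  have st: "AE w in Om P. state P v k w = xhat k w + err k w" if k: "k \<le> horizon P" for k
    using c[OF k]
  proof eventually_elim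
    case (elim w)
    then show ?case using xhat_eq[OF k, of w] by (simp add: state_eq zeta_def algebra_simps)
  qed
  then show "k \<le> horizon P \<Longrightarrow> AE w in Om P. state P v k w = xhat k w + err k w" .
  have "AE w in Om P. fst v (horizon P) w = UL (horizon P) w \<and> snd v (horizon P) w = UR (horizon P) w"
    using v by (simp add: star_like_def)
  with st[OF order_refl] show "AE w in Om P. state P v (Suc (horizon P)) w = xbar (horizon P) w + eterm w"
  proof eventually_elim
    case (elim w)
    then show ?case
      using control_step[of "horizon P" w] vlin_ep_Suc[of "horizon P" w] by (simp add: eterm_def matrix_vector_right_distrib algebra_simps)
  qed
qed

lemma eterm_orth:
  assumes "sqint (Om P) Y" "Y \<in> borel_measurable (GG (Suc (horizon P)) (Suc (horizon P)))"
  shows "orth2 (Om P) eterm Y"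
  unfolding eterm_def
  by (rule ortho_orth2(1)[OF subalgebra_GG ortho_GG_lin vlin_sqint assms]) (auto simp: vcov_ep_inn)

lemma err_orth:
  assumes "k \<le> horizon P" "sqint (Om P) Y" "Y \<in> borel_measurable (GG (Suc k) (Suc k))"
  shows "orth2 (Om P) (err k) Y"
  by (rule ortho_orth2(1)[OF subalgebra_GG ortho_err sqint_err assms(2,3)]) (use assms in auto)

lemma star_mean:
  assumes v: "star_like v"
  shows "k \<le> horizon P \<Longrightarrow> mn (state P v k) = mm k"
    "mn (state P v (Suc (horizon P))) = A3 (horizon P) *v mm (horizon P)"
proof -
  have a: "adm (Suc (horizon P)) v" using v by (simp add: star_like_def admissible_adm)
  have sv: "sqint (Om P) (state P v k)" if "k \<le> Suc (horizon P)" for k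
    using sqint_state[OF adm_mono[OF a that] that] .
  show "mn (state P v k) = mm k" if k: "k \<le> horizon P"
  proof -
    have s: "sqint (Om P) (\<lambda>w. xhat k w + err k w)" by (intro sqint_add xhat_sqint sqint_err k)
    have "mn (state P v k) = mn (\<lambda>w. xhat k w + err k w)"
      by (intro integral_cong_AE star_state(1)[OF v k] sqint_measurable[OF s] sqint_measurable[OF sv]) (use k in simp)
    then show ?thesis using integral_add_sqint[OF xhat_sqint[OF k] sqint_err] mean_xhat[OF k] mean_err[OF k] by simp
  qed
  have s: "sqint (Om P) (\<lambda>w. xbar (horizon P) w + eterm w)" unfolding eterm_def by (intro sqint_add xbar_sqint vlin_sqint) simp
  have "mn (state P v (Suc (horizon P))) = mn (\<lambda>w. xbar (horizon P) w + eterm w)"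
    by (intro integral_cong_AE star_state(2)[OF v] sqint_measurable[OF s] sqint_measurable[OF sv] order_refl)
  then show "mn (state P v (Suc (horizon P))) = A3 (horizon P) *v mm (horizon P)"
    using integral_add_sqint[OF xbar_sqint vlin_sqint, of "horizon P"] mean_xbar[of "horizon P"] mean_vlin by (simp add: eterm_def)
qed

text \<open>Local errors are orthogonal to the variation, so the state may be replaced by its
  estimate. Telescoping with \<open>s = 0\<close> along the controlled difference, which starts at
  0, then gives zero.\<close>

lemma cross_star:
  assumes v: "star_like v" and u: "admissible P u"
  shows "cross v (cdiff u v) = 0"
proof -
  let ?N = "horizon P" and ?e = "cdiff u v"
  have a: "adm (Suc ?N) u" "adm (Suc ?N) v" using u v by (simp_all add: star_like_def admissible_adm)
  have ak: "adm k u" "adm k v" if "k \<le> Suc ?N" for k using a adm_mono that by blast+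
  have sv: "sqint (Om P) (state P v k)" if "k \<le> Suc ?N" for k using sqint_state[OF ak(2)[OF that] that] .
  have c: "sqint (Om P) (cpart ?e k)" "cpart ?e k \<in> borel_measurable (GG k k)" if "k \<le> Suc ?N" for k
    unfolding cpart_cdiff[abs_def] using sqint_cpart[OF ak(1)[OF that] that] sqint_cpart[OF ak(2)[OF that] that]
      cpart_GG[OF ak(1)[OF that] that] cpart_GG[OF ak(2)[OF that] that]
    by (auto intro: sqint_diff borel_measurable_diff)
  have c': "cpart ?e k \<in> borel_measurable (GG (Suc k) (Suc k))" if "k \<le> Suc ?N" for k
    by (rule measurable_GG_mono[OF c(2)[OF that]]) auto
  have ctl: "sqint (Om P) (fst w k)" "sqint (Om P) (snd w k)" "fst w k \<in> borel_measurable (GG (Suc k) (Suc k))"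
    "snd w k \<in> borel_measurable (GG (Suc k) (Suc k))" "orth2 (Om P) (D k) (snd w k)"
    if k: "k \<le> ?N" and w: "adm (Suc ?N) w" for w k
  proof -
    have wk: "adm k w" using adm_mono[OF w] k by simp
    have F: "fst w k \<in> borel_measurable (FL P w k)" "snd w k \<in> borel_measurable (FR P w k)" and S: "sqint (Om P) (fst w k)" "sqint (Om P) (snd w k)"
      using w k by (auto simp: adm_def)
    show "sqint (Om P) (fst w k)" "sqint (Om P) (snd w k)" using S .
    show "fst w k \<in> borel_measurable (GG (Suc k) (Suc k))" "snd w k \<in> borel_measurable (GG (Suc k) (Suc k))"
      using measurable_mono_sets[OF F(1) FL_GG[OF wk k]] measurable_mono_sets[OF FR_FL[OF F(2)] FL_GG[OF wk k]] by auto
    show "orth2 (Om P) (D k) (snd w k)"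
      by (rule ortho_orth2(1)[OF subalgebra_FR[OF wk k] dd_ortho_FR[OF wk k] chan_sqint(1)[OF k] S(2) F(2)])
  qed
  \<comment> \<open>The remote parts of \<open>u\<close> and \<open>v\<close> are measurable for
    different informations. \<open>ctl\<close> gives orthogonality of the gap to each separately,
    and their difference inherits it.\<close>
  have e: "fst ?e k = (\<lambda>w. fst u k w - fst v k w)" "snd ?e k = (\<lambda>w. snd u k w - snd v k w)" for k
    by (simp_all add: cdiff_def)
  have es: "sqint (Om P) (fst ?e k)" "sqint (Om P) (snd ?e k)" "fst ?e k \<in> borel_measurable (GG (Suc k) (Suc k))"
    "snd ?e k \<in> borel_measurable (GG (Suc k) (Suc k))" "orth2 (Om P) (D k) (snd ?e k)" if k: "k \<le> ?N" for k
    unfolding e using ctl[OF k a(1)] ctl[OF k a(2)]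
    by (auto intro!: sqint_diff borel_measurable_diff orth2_diff_right chan_sqint k)
  have st: "stg (state P v k) (fst v k) (snd v k) (cpart ?e k) (fst ?e k) (snd ?e k)
      = qf (Om P) (Qmu P \<mu>) (xhat k) (cpart ?e k) - \<mu> * (mm k \<bullet> (matQ P *v mn (cpart ?e k)))
      + qf (Om P) (matRL P) (UL k) (fst ?e k) + qf (Om P) (matRR P) (UR k) (snd ?e k)" if k: "k \<le> ?N" for k
  proof -
    have kS: "k \<le> Suc ?N" using k by simp
    have "qf (Om P) (Qmu P \<mu>) (state P v k) (cpart ?e k) = qf (Om P) (Qmu P \<mu>) (\<lambda>w. xhat k w + err k w) (cpart ?e k)"
      by (intro qf_cong_AE star_state(1)[OF v k] AE_I2 refl sv c kS sqint_add xhat_sqint sqint_err k)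
    also have "\<dots> = qf (Om P) (Qmu P \<mu>) (xhat k) (cpart ?e k) + qf (Om P) (Qmu P \<mu>) (err k) (cpart ?e k)"
      by (intro qf_add_left xhat_sqint sqint_err c k kS)
    also have "qf (Om P) (Qmu P \<mu>) (err k) (cpart ?e k) = 0"
      by (intro qf_orth2 err_orth sqint_err c c' k kS)
    finally have 1: "qf (Om P) (Qmu P \<mu>) (state P v k) (cpart ?e k) = qf (Om P) (Qmu P \<mu>) (xhat k) (cpart ?e k)" by simp
    have AEv: "AE w in Om P. fst v k w = UL k w" "AE w in Om P. snd v k w = UR k w"
      using v k by (auto simp: star_like_def)
    have 2: "qf (Om P) (matRL P) (fst v k) (fst ?e k) = qf (Om P) (matRL P) (UL k) (fst ?e k)"
      by (intro qf_cong_AE AEv AE_I2 refl ctl(1)[OF k a(2)] U_sqint es k)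
    have 3: "qf (Om P) (matRR P) (snd v k) (snd ?e k) = qf (Om P) (matRR P) (UR k) (snd ?e k)"
      by (intro qf_cong_AE AEv AE_I2 refl ctl(2)[OF k a(2)] U_sqint es k)
    show ?thesis unfolding stg_def 1 2 3 star_mean(1)[OF v k] ..
  qed
  have fn: "fin (state P v (Suc ?N)) (cpart ?e (Suc ?N)) = qf (Om P) (Gmu P \<mu>) (xbar ?N) (cpart ?e (Suc ?N))
      - \<mu> * ((A3 ?N *v mm ?N) \<bullet> (matQ P *v mn (cpart ?e (Suc ?N))))"
  proof -
    have se: "sqint (Om P) eterm" unfolding eterm_def by (rule vlin_sqint)
    have "qf (Om P) (Gmu P \<mu>) (state P v (Suc ?N)) (cpart ?e (Suc ?N)) = qf (Om P) (Gmu P \<mu>) (\<lambda>w. xbar ?N w + eterm w) (cpart ?e (Suc ?N))"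
      by (intro qf_cong_AE star_state(2)[OF v] AE_I2 refl sv c order_refl sqint_add xbar_sqint se)
    also have "\<dots> = qf (Om P) (Gmu P \<mu>) (xbar ?N) (cpart ?e (Suc ?N)) + qf (Om P) (Gmu P \<mu>) eterm (cpart ?e (Suc ?N))"
      by (intro qf_add_left xbar_sqint se c order_refl)
    also have "qf (Om P) (Gmu P \<mu>) eterm (cpart ?e (Suc ?N)) = 0"
      by (intro qf_orth2 eterm_orth se c order_refl)
    finally show ?thesis unfolding fin_def star_mean(2)[OF v] by simp
  qed
  have "Ph (cpart ?e) 0 + 0 * (\<Sum>k<?N. noise (Suc k)) =
    (\<Sum>k\<le>?N. qf (Om P) (Qmu P \<mu>) (xhat k) (cpart ?e k) - \<mu> * (mm k \<bullet> (matQ P *v mn (cpart ?e k)))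
      + qf (Om P) (matRL P) (UL k) (fst ?e k) + qf (Om P) (matRR P) (UR k) (snd ?e k))
    + qf (Om P) (Gmu P \<mu>) (xbar ?N) (cpart ?e (Suc ?N)) - \<mu> * ((A3 ?N *v mm ?N) \<bullet> (matQ P *v mn (cpart ?e (Suc ?N))))"
    by (rule telescope) (use c c' es in auto)
  moreover have "Ph (cpart ?e) 0 = 0" by (simp add: Ph_def qf_def)
  ultimately show ?thesis unfolding cross_def fn using st by (simp del: cpart.simps)
qed

lemma star_optimal:
  assumes v: "star_like v" shows "is_solution P \<mu> v"
    and "is_solution P \<mu> u \<Longrightarrow> star_like u"
proof -
  have av: "admissible P v" using v by (simp add: star_like_def)
  have sq: "sqint (Om P) (fst (cdiff u v) k) \<and> sqint (Om P) (snd (cdiff u v) k)" if "admissible P u" "k \<le> horizon P" for u k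
  proof -
    have "sqint (Om P) (fst u k)" "sqint (Om P) (snd u k)" "sqint (Om P) (fst v k)" "sqint (Om P) (snd v k)"
      using that av by (simp_all add: admissible_adm adm_def)
    then show ?thesis by (simp add: cdiff_def sqint_diff)
  qed
  have exp: "cost P \<mu> u = cost P \<mu> v + quad (cdiff u v)" if "admissible P u" for u
    using cost_expand[OF that av] cross_star[OF v that] by simp
  show "is_solution P \<mu> v"
    unfolding is_solution_def
  proof (intro conjI av allI impI)
    fix u' assume "admissible P u'"
    then show "cost P \<mu> v \<le> cost P \<mu> u'" using exp[of u'] quad_nonneg[OF sq[of u']] by linarith
  qed
  assume s: "is_solution P \<mu> u"
  then have au: "admissible P u" and "cost P \<mu> u \<le> cost P \<mu> v" using av unfolding is_solution_def by blast+
  then have q: "quad (cdiff u v) \<le> 0" using exp[OF au] by simp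
  show "star_like u"
    unfolding star_like_def
  proof (intro conjI au allI impI)
    fix k assume k: "k \<le> horizon P"
    have "AE w in Om P. fst (cdiff u v) k w = 0 \<and> snd (cdiff u v) k w = 0"
      by (rule quad_zero[OF _ q pos k]) (rule sq[OF au])
    moreover have "AE w in Om P. fst v k w = UL k w \<and> snd v k w = UR k w" using v k by (simp add: star_like_def)
    ultimately show "AE w in Om P. fst u k w = UL k w \<and> snd u k w = UR k w"
      by eventually_elim (auto simp: cdiff_def)
  qed
qed

lemma unique_solution: "has_unique_solution P \<mu>"
proof -
  obtain v where v: "star_like v" using star_like_exists by blast
  have "AE w in Om P. fst u k w = fst v k w \<and> snd u k w = snd v k w" if "is_solution P \<mu> u" "k \<le> horizon P" for u k
  proof -
    have "AE w in Om P. fst u k w = UL k w \<and> snd u k w = UR k w" "AE w in Om P. fst v k w = UL k w \<and> snd v k w = UR k w"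
      using star_optimal(2)[OF v that(1)] v that(2) by (auto simp: star_like_def)
    then show ?thesis by eventually_elim auto
  qed
  then show ?thesis unfolding has_unique_solution_def using star_optimal(1)[OF v] by blast
qed

end

section \<open>Degenerate directions destroy uniqueness\<close>

lemma (in prob_space) qf_const_AE:
  fixes X :: "'a \<Rightarrow> real^'n"
  assumes X: "sqint M X" and Y: "sqint M Y" and c: "AE w in M. Y w = c"
  shows "qf M S X Y = integral\<^sup>L M X \<bullet> (S *v c)"
proof -
  have "qf M S X Y = qf M S X (\<lambda>_. c)" by (intro qf_cong_AE c AE_I2 refl X Y sqint_const)
  then show ?thesis using integral_inner_left[of "S *v c" M X] sqint_integrable[OF X] by (simp add: qf_def)
qed

lemma (in prob_space) integral_const_AE:
  fixes c :: "real^'n"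
  assumes Y: "sqint M Y" and c: "AE w in M. Y w = c" shows "integral\<^sup>L M Y = c"
proof -
  have "integral\<^sup>L M Y = (LINT w|M. c)" by (rule integral_cong_AE) (use sqint_measurable[OF Y] c in auto)
  then show ?thesis by (simp add: prob_space)
qed

text \<open>A law has at most countably many atoms, and distinct amplitudes \<epsilon> give distinct
  points because \<open>t\<close> is not zero.\<close>

lemma (in prob_space) countable_line_atoms:
  fixes X :: "'a \<Rightarrow> real^'n"
  assumes X: "X \<in> borel_measurable M" and t: "t \<noteq> 0"
  shows "countable {\<epsilon>. \<not> (AE w in M. X w \<noteq> - (\<epsilon> *\<^sub>R t))}"
proof -
  interpret d: prob_space "distr M borel X" using X by (rule prob_space_distr)
  have "{\<epsilon>. \<not> (AE w in M. X w \<noteq> - (\<epsilon> *\<^sub>R t))} \<subseteq> (\<lambda>\<epsilon>. - (\<epsilon> *\<^sub>R t)) -` {x. measure (distr M borel X) {x} \<noteq> 0}"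
  proof (rule subsetI, rule ccontr)
    fix \<epsilon> assume "\<epsilon> \<in> {\<epsilon>. \<not> (AE w in M. X w \<noteq> - (\<epsilon> *\<^sub>R t))}"
      and "\<epsilon> \<notin> (\<lambda>\<epsilon>. - (\<epsilon> *\<^sub>R t)) -` {x. measure (distr M borel X) {x} \<noteq> 0}"
    then have n: "\<not> (AE w in M. X w \<noteq> - (\<epsilon> *\<^sub>R t))" and z: "measure (distr M borel X) {- (\<epsilon> *\<^sub>R t)} = 0" by auto
    have "measure (distr M borel X) {- (\<epsilon> *\<^sub>R t)} = measure M {w \<in> space M. X w = - (\<epsilon> *\<^sub>R t)}"
      using X by (subst measure_distr) (auto intro!: arg_cong[where f = "measure M"])
    then have "measure M {w \<in> space M. X w = - (\<epsilon> *\<^sub>R t)} = 0" using z by simp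
    moreover have "{w \<in> space M. X w = - (\<epsilon> *\<^sub>R t)} \<in> sets M"
      using measurable_sets[OF X, of "{- (\<epsilon> *\<^sub>R t)}"] by (simp add: vimage_def Int_def conj_commute)
    ultimately have "AE w in M. w \<notin> {w \<in> space M. X w = - (\<epsilon> *\<^sub>R t)}"
      by (intro AE_not_in) (auto simp: null_sets_def emeasure_eq_measure)
    then have "AE w in M. X w \<noteq> - (\<epsilon> *\<^sub>R t)" using AE_space by eventually_elim auto
    then show False using n by simp
  qed
  moreover have "countable (UNIV \<inter> (\<lambda>\<epsilon>. - (\<epsilon> *\<^sub>R t)) -` {x. measure (distr M borel X) {x} \<noteq> 0})"
    by (rule countable_image_inj_Int_vimage[OF _ d.countable_support]) (use t in \<open>auto simp: inj_on_def\<close>)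
  then have "countable ((\<lambda>\<epsilon>. - (\<epsilon> *\<^sub>R t)) -` {x. measure (distr M borel X) {x} \<noteq> 0})" by simp
  ultimately show ?thesis by (rule countable_subset)
qed

context flq_riccati
begin

definition shift :: "('w, 'l, 'r) control \<Rightarrow> real \<Rightarrow> (nat \<Rightarrow> real^('l + 'r)) \<Rightarrow> ('w, 'l, 'r) control" where
  "shift u \<epsilon> \<delta> = ((\<lambda>k w. fst u k w + \<epsilon> *\<^sub>R blockL (\<delta> k)), (\<lambda>k w. snd u k w + \<epsilon> *\<^sub>R blockR (\<delta> k)))"

lemma shift_simps: "fst (shift u \<epsilon> \<delta>) k w = fst u k w + \<epsilon> *\<^sub>R blockL (\<delta> k)" "snd (shift u \<epsilon> \<delta>) k w = snd u k w + \<epsilon> *\<^sub>R blockR (\<delta> k)"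
  by (simp_all add: shift_def)

lemma cpart_shift: "cpart (shift u \<epsilon> \<delta>) k w = cpart u k w + \<epsilon> *\<^sub>R traj \<delta> k"
  by (induction k) (simp_all add: shift_simps matB_mult matrix_vector_right_distrib matrix_vector_mult_scaleR scaleR_right_distrib)

text \<open>Shifting a control by a deterministic sequence keeps the information unless the shifted packet
  vanishes, since \<open>0\<close> is also what is received after a channel failure.\<close>

lemma realizable_shift:
  assumes u: "admissible P u"
    and \<epsilon>: "\<And>k. k \<le> horizon P \<Longrightarrow> traj \<delta> k \<noteq> 0 \<Longrightarrow> AE w in Om P. zeta k w + cpart u k w \<noteq> - (\<epsilon> *\<^sub>R traj \<delta> k)"
  shows "realizable (shift u \<epsilon> \<delta>)"
  unfolding realizable_def
proof (intro allI impI conjI)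
  let ?U = "shift u \<epsilon> \<delta>"
  fix k assume k: "k \<le> horizon P"
  have a: "adm (Suc (horizon P)) u" using u by (simp add: admissible_adm)
  have uk: "fst u k \<in> borel_measurable (FL P u k)" "snd u k \<in> borel_measurable (FR P u k)" "sqint (Om P) (fst u k)" "sqint (Om P) (snd u k)"
    using a k by (auto simp: adm_def)
  show s: "sqint (Om P) (fst ?U k)" "sqint (Om P) (snd ?U k)"
    using uk by (simp_all add: shift_def sqint_add sqint_const)
  have m: "fst ?U k \<in> borel_measurable (FL P u k)" "snd ?U k \<in> borel_measurable (FR P u k)"
    using uk by (simp_all add: shift_def borel_measurable_add)
  fix u' assume u': "adm k u'" and eq: "\<forall>j<k. AE w in Om P. fst u' j w = fst ?U j w \<and> snd u' j w = snd ?U j w"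
  have aj: "adm j u" if "j \<le> k" for j using adm_mono[OF a] that k by simp
  have c: "AE w in Om P. cpart u' j w = cpart u j w + \<epsilon> *\<^sub>R traj \<delta> j" if "j \<le> k" for j
    using cpart_cong_AE[of j u' ?U] eq that by (simp add: cpart_shift)
  \<comment> \<open>The information of \<open>u\<close> is recovered from that of \<open>u'\<close>
    up to null sets, one observation at a time; \<open>cond_exp_vec_approx\<close> carries this over
    to the generated sigma-algebras.\<close>
  have apL: "\<exists>f\<in>borel_measurable (FL P u' k). AE w in Om P. obsL P u j w = f w" if j: "j \<le> k" for j
  proof
    have "obsL P u' j \<in> borel_measurable (FL P u' k)" unfolding FL_def by (rule measurable_generated_by) (use j in auto)
    then show "(\<lambda>w. obsL P u' j w - matC P *v (\<epsilon> *\<^sub>R traj \<delta> j)) \<in> borel_measurable (FL P u' k)" by simp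
    show "AE w in Om P. obsL P u j w = obsL P u' j w - matC P *v (\<epsilon> *\<^sub>R traj \<delta> j)"
      using c[OF j] by eventually_elim (simp add: obsL_eq matrix_vector_right_distrib)
  qed
  have apR: "\<exists>f\<in>borel_measurable (FR P u' k). AE w in Om P. obsR P u j w = f w" if j: "j \<le> k" for j
  proof (cases "traj \<delta> j = 0")
    case True
    have jN: "j \<le> horizon P" using j k by simp
    have ym: "obsR P u' j \<in> borel_measurable (FR P u' k)" unfolding FR_def by (rule measurable_generated_by) (use j in auto)
    moreover have "AE w in Om P. obsR P u j w = obsR P u' j w"
      using c[OF j] obsR_AE[OF aj[OF j] jN] obsR_AE[OF adm_mono[OF u' j] jN] by eventually_elim (simp add: True)
    ultimately show ?thesis by blast
  next
    case False
    have jN: "j \<le> horizon P" using j k by simp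
    have ym: "obsR P u' j \<in> borel_measurable (FR P u' k)" unfolding FR_def by (rule measurable_generated_by) (use j in auto)
    \<comment> \<open>A received 0 is read as a failure, which is right almost surely since the
      shifted packet is almost never 0; otherwise the known displacement is subtracted.\<close>
    define f where "f w = (if obsR P u' j w = 0 then 0 else obsR P u' j w - \<epsilon> *\<^sub>R traj \<delta> j)" for w
    have "{w \<in> space (FR P u' k). obsR P u' j w = 0} \<in> sets (FR P u' k)"
      using measurable_sets[OF ym, of "{0}"] by (simp add: vimage_def Int_def conj_commute)
    then have "f \<in> borel_measurable (FR P u' k)"
      unfolding f_def[abs_def] using ym by (intro measurable_If borel_measurable_diff borel_measurable_const) auto
    moreover have "AE w in Om P. obsR P u j w = f w"
      using c[OF j] obsR_AE[OF aj[OF j] jN] obsR_AE[OF adm_mono[OF u' j] jN] \<epsilon>[OF jN False] chan_01[OF jN]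
    proof eventually_elim
      case (elim w)
      have e: "zeta j w + cpart u' j w = (zeta j w + cpart u j w) + \<epsilon> *\<^sub>R traj \<delta> j" using elim(1) by simp
      have "(zeta j w + cpart u j w) + \<epsilon> *\<^sub>R traj \<delta> j \<noteq> 0" using elim(4) by (simp add: eq_neg_iff_add_eq_0)
      then show ?case using elim(5) unfolding f_def elim(2) elim(3) e by auto
    qed
    ultimately show ?thesis by blast
  qed
  have RL: "f \<in> borel_measurable (FR P u' k) \<Longrightarrow> f \<in> borel_measurable (FL P u' k)" for f :: "'w \<Rightarrow> real^'n"
    by (rule FR_FL)
  show "AE w in Om P. cond_exp_vec (Om P) (FL P u' k) (fst ?U k) w = fst ?U k w"
  proof (rule cond_exp_vec_approx[OF subalgebra_FL[OF u' k] _ _ m(1)[unfolded FL_def] s(1)])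
    fix f assume "f \<in> obsL P u ` {..k} \<union> obsR P u ` {..k}"
    then obtain j where j: "j \<le> k" and f: "f = obsL P u j \<or> f = obsR P u j" by auto
    show "f \<in> borel_measurable (Om P)"
      using f obsL_measurable[OF aj[OF j]] obsR_measurable[OF aj[OF j]] j k by auto
    show "\<exists>f'\<in>borel_measurable (FL P u' k). AE w in Om P. f w = f' w"
      using f apL[OF j] apR[OF j] RL by blast
  qed
  show "AE w in Om P. cond_exp_vec (Om P) (FR P u' k) (snd ?U k) w = snd ?U k w"
  proof (rule cond_exp_vec_approx[OF subalgebra_FR[OF u' k] _ _ m(2)[unfolded FR_def] s(2)])
    fix f assume "f \<in> obsR P u ` {..k}"
    then obtain j where j: "j \<le> k" "f = obsR P u j" by auto
    show "f \<in> borel_measurable (Om P)"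
      unfolding j(2) using obsR_measurable[OF aj[OF j(1)]] j(1) k by simp
    show "\<exists>f'\<in>borel_measurable (FR P u' k). AE w in Om P. f w = f' w"
      unfolding j(2) by (rule apR[OF j(1)])
  qed
qed

text \<open>Zero cost puts the direction into the kernel of each semidefinite weight along its
  trajectory. As the difference of the controls is almost surely deterministic, the terms with
  expectations and those with means vanish together, in the first and in the second
  variation.\<close>

lemma cost_shift:
  assumes u: "admissible P u" and u': "admissible P u'"
    and eq: "\<And>k. k \<le> horizon P \<Longrightarrow> AE w in Om P. fst u' k w = fst (shift u \<epsilon> \<delta>) k w \<and> snd u' k w = snd (shift u \<epsilon> \<delta>) k w"
    and d: "dcost \<delta> = 0"
  shows "cost P \<mu> u' = cost P \<mu> u"
proof -
  let ?N = "horizon P" and ?e = "cdiff u' u"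
  have a: "adm (Suc ?N) u" "adm (Suc ?N) u'" using u u' by (simp_all add: admissible_adm)
  have ak: "adm k u" "adm k u'" if "k \<le> Suc ?N" for k using a adm_mono that by blast+
  have dn: "dstage \<delta> k = 0" if "k \<le> ?N" for k
    using d dstage_nonneg[of \<delta>] dterm_nonneg[of \<delta>] that sum_nonneg[of "{..?N}" "dstage \<delta>"]
    by (auto simp: dcost_def add_nonneg_eq_0_iff sum_nonneg_eq_0_iff)
  have dt: "dterm \<delta> = 0"
    using d dstage_nonneg[of \<delta>] dterm_nonneg[of \<delta>] sum_nonneg[of "{..?N}" "dstage \<delta>"]
    by (simp add: dcost_def add_nonneg_eq_0_iff)
  have ker: "matQ P *v traj \<delta> k = 0" "matRL P *v blockL (\<delta> k) = 0" "matRR P *v blockR (\<delta> k) = 0" if "k \<le> ?N" for k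
  proof -
    have "traj \<delta> k \<bullet> (matQ P *v traj \<delta> k) + (blockL (\<delta> k) \<bullet> (matRL P *v blockL (\<delta> k)) + blockR (\<delta> k) \<bullet> (matRR P *v blockR (\<delta> k))) = 0"
      using dn[OF that] by (simp add: dstage_def matR_mult inner_block)
    then have "traj \<delta> k \<bullet> (matQ P *v traj \<delta> k) = 0" "blockL (\<delta> k) \<bullet> (matRL P *v blockL (\<delta> k)) = 0"
      "blockR (\<delta> k) \<bullet> (matRR P *v blockR (\<delta> k)) = 0"
      using weights_nonneg(1)[of "traj \<delta> k"] weights_nonneg(3)[of "blockL (\<delta> k)"] weights_nonneg(4)[of "blockR (\<delta> k)"] by linarith+
    then show "matQ P *v traj \<delta> k = 0" "matRL P *v blockL (\<delta> k) = 0" "matRR P *v blockR (\<delta> k) = 0"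
      using sym_psd_kernel weights by blast+
  qed
  have kerG: "matG P *v traj \<delta> (Suc ?N) = 0"
    using dt sym_psd_kernel[OF weights(4)] by (simp add: dterm_def del: traj.simps)
  have cAE: "AE w in Om P. cpart ?e k w = \<epsilon> *\<^sub>R traj \<delta> k" if "k \<le> Suc ?N" for k
  proof -
    have "AE w in Om P. cpart u' k w = cpart (shift u \<epsilon> \<delta>) k w"
      by (rule cpart_cong_AE) (use eq that in auto)
    then show ?thesis by eventually_elim (simp add: cpart_cdiff cpart_shift)
  qed
  have lAE: "AE w in Om P. fst ?e k w = \<epsilon> *\<^sub>R blockL (\<delta> k)" "AE w in Om P. snd ?e k w = \<epsilon> *\<^sub>R blockR (\<delta> k)" if "k \<le> ?N" for k
    using eq[OF that] by (eventually_elim, simp add: cdiff_simps shift_simps)+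
  have x: "sqint (Om P) (state P u k)" "sqint (Om P) (cpart ?e k)" if "k \<le> Suc ?N" for k
    using sqint_state[OF ak(1)[OF that] that] sqint_diff[OF sqint_cpart[OF ak(2)[OF that] that] sqint_cpart[OF ak(1)[OF that] that]]
    by (simp_all add: cpart_cdiff[abs_def])
  have l: "sqint (Om P) (fst u k)" "sqint (Om P) (snd u k)" "sqint (Om P) (fst ?e k)" "sqint (Om P) (snd ?e k)" if "k \<le> ?N" for k
    using a that by (auto simp: adm_def cdiff_def intro!: sqint_diff)
  have st: "stg X L R (cpart ?e k) (fst ?e k) (snd ?e k) = 0"
    if k: "k \<le> ?N" and s: "sqint (Om P) X" "sqint (Om P) L" "sqint (Om P) R" for X L R k
  proof -
    have kS: "k \<le> Suc ?N" using k by simp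
    show ?thesis
      unfolding stg_def qf_const_AE[OF s(1) x(2)[OF kS] cAE[OF kS]] qf_const_AE[OF s(2) l(3)[OF k] lAE(1)[OF k]]
        qf_const_AE[OF s(3) l(4)[OF k] lAE(2)[OF k]] integral_const_AE[OF x(2)[OF kS] cAE[OF kS]]
      using ker[OF k] by (simp add: Qmu_quadratic matrix_vector_mult_scaleR)
  qed
  have fn: "fin X (cpart ?e (Suc ?N)) = 0" if s: "sqint (Om P) X" for X
    unfolding fin_def qf_const_AE[OF s x(2)[OF order_refl] cAE[OF order_refl]] integral_const_AE[OF x(2)[OF order_refl] cAE[OF order_refl]]
    using kerG by (simp add: Qmu_quadratic matrix_vector_mult_scaleR del: traj.simps)
  have "cross u ?e = 0" unfolding cross_def using st x l fn by (simp del: state.simps cpart.simps)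
  moreover have "quad ?e = 0" unfolding quad_def using st x l fn by (simp del: state.simps cpart.simps)
  ultimately show ?thesis using cost_expand[OF u' u] by simp
qed

lemma unique_imp_pos_cond:
  assumes uniq: "has_unique_solution P \<mu>" shows pos_cond
proof (rule ccontr)
  assume "\<not> pos_cond"
  then obtain \<delta> k0 where k0: "k0 \<le> horizon P" "\<delta> k0 \<noteq> 0" and d: "dcost \<delta> = 0"
    using degenerate_direction by blast
  obtain u where u: "is_solution P \<mu> u"
    and un: "\<And>u' k. is_solution P \<mu> u' \<Longrightarrow> k \<le> horizon P \<Longrightarrow> AE w in Om P. fst u' k w = fst u k w \<and> snd u' k w = snd u k w"
    using uniq unfolding has_unique_solution_def by blast
  have au: "admissible P u" using u by (simp add: is_solution_def)
  then have a: "adm (Suc (horizon P)) u" by (simp add: admissible_adm)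
  define bad where "bad k = {\<epsilon>. \<not> (AE w in Om P. zeta k w + cpart u k w \<noteq> - (\<epsilon> *\<^sub>R traj \<delta> k))}" for k
  \<comment> \<open>Amplitude 0 is excluded as well, since it would reproduce
    \<open>u\<close>.\<close>
  have "countable (insert 0 (\<Union>k\<in>{k. k \<le> horizon P \<and> traj \<delta> k \<noteq> 0}. bad k))"
  proof (intro countable_insert countable_UN)
    fix k assume k: "k \<in> {k. k \<le> horizon P \<and> traj \<delta> k \<noteq> 0}"
    have "(\<lambda>w. zeta k w + cpart u k w) \<in> borel_measurable (Om P)"
      using k by (intro borel_measurable_add sqint_measurable[OF sqint_zeta] sqint_measurable[OF sqint_cpart] adm_mono[OF a]) auto
    then show "countable (bad k)" unfolding bad_def by (rule countable_line_atoms) (use k in simp)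
  qed simp
  then have "insert 0 (\<Union>k\<in>{k. k \<le> horizon P \<and> traj \<delta> k \<noteq> 0}. bad k) \<noteq> UNIV"
    using uncountable_UNIV_real by metis
  then obtain \<epsilon> where "\<epsilon> \<notin> insert 0 (\<Union>k\<in>{k. k \<le> horizon P \<and> traj \<delta> k \<noteq> 0}. bad k)" by blast
  then have e0: "\<epsilon> \<noteq> 0" and e: "\<And>k. k \<le> horizon P \<Longrightarrow> traj \<delta> k \<noteq> 0 \<Longrightarrow> AE w in Om P. zeta k w + cpart u k w \<noteq> - (\<epsilon> *\<^sub>R traj \<delta> k)"
    by (auto simp: bad_def)
  obtain u' where u': "admissible P u'"
    and eq: "\<And>k. k \<le> horizon P \<Longrightarrow> AE w in Om P. fst u' k w = fst (shift u \<epsilon> \<delta>) k w \<and> snd u' k w = snd (shift u \<epsilon> \<delta>) k w"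
    using realizable_control[OF realizable_shift[OF au e]] by blast
  have "is_solution P \<mu> u'"
    using u u' cost_shift[OF au u' eq d] by (simp add: is_solution_def)
  from un[OF this k0(1)] eq[OF k0(1)]
  have "AE w in Om P. blockL (\<delta> k0) = 0 \<and> blockR (\<delta> k0) = 0"
    by eventually_elim (use e0 in \<open>auto simp: shift_simps\<close>)
  then have "blockL (\<delta> k0) = 0 \<and> blockR (\<delta> k0) = 0" by simp
  then have "\<delta> k0 = 0" by (intro block_eqI) (simp_all add: block_simps)
  then show False using k0 by simp
qed

end

section \<open>The optimal cost\<close>

lemma orth2_cong_AE:
  assumes "orth2 M X Y" "AE w in M. Y' w = Y w" "sqint M X" "sqint M Y" "sqint M Y'"
  shows "orth2 M X Y'"
  unfolding orth2_def
proof safe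
  fix i j
  have "(LINT w|M. X w $ i * Y' w $ j) = (LINT w|M. X w $ i * Y w $ j)"
  proof (rule integral_cong_AE)
    show "AE w in M. X w $ i * Y' w $ j = X w $ i * Y w $ j" using assms(2) by eventually_elim simp
  qed (use sqint_integrable_components[OF assms(3,4)] sqint_integrable_components[OF assms(3,5)] in auto)
  then show "(LINT w|M. X w $ i * Y' w $ j) = 0" using assms(1) by (simp add: orth2_def)
qed

section \<open>Covariance of the filter corrections and the trace formula\<close>

context flq_setting
begin

lemma qf_vlin: "qf (Om P) S (vlin a) (vlin a) = trace (S ** vcov a a)"
proof -
  have sy: "vcov a a $ i $ j = vcov a a $ j $ i" for i j
    using vcov_transpose[of a a] by (metis lcov_symmetric lcov_vrow)
  have "qf (Om P) S (vlin a) (vlin a) = (\<Sum>i\<in>UNIV. \<Sum>j\<in>UNIV. S $ i $ j * vcov a a $ i $ j)"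
    unfolding qf_def inner_matrix_vector_mult_sum
    by (simp add: Bochner_Integration.integral_sum Bochner_Integration.integrable_sum
        sqint_integrable_components vlin_sqint vlin_covariance)
  also have "\<dots> = trace (S ** vcov a a)"
    unfolding trace_def matrix_matrix_mult_def by (simp add: sy)
  finally show ?thesis .
qed

text \<open>For times up to the horizon this is the covariance of the correction
  \<open>nu k\<close>.\<close>

definition ncov :: "nat \<Rightarrow> real^'n^'n" where
  "ncov k = kgain k ** innov_cov P (pcov k) ** transpose (kgain k)"

lemma nu_vlin: "nu k = vlin (\<lambda>s. kgain k ** inn k s)"
  by (auto simp: nu_def iota_def vlin_mult)

lemma qf_nu: "k \<le> horizon P \<Longrightarrow> qf (Om P) S (nu k) (nu k) = trace (S ** ncov k)"
  unfolding nu_vlin qf_vlin vcov_simps vcov_inn by (simp add: ncov_def vcov_inn matrix_mul_assoc)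

lemma innov_cov_sym: "transpose (innov_cov P (pcov k)) = innov_cov P (pcov k)"
  using sym_psd_add[OF sym_psd_sandwich[OF pcov_psd] cov_psd(3)] by (simp add: innov_cov_def sym_psd_def)

lemma pcov_sym: "transpose (pcov k) = pcov k"
  using pcov_psd[of k] by (simp add: sym_psd_def)

lemma ncov_eq: "ncov k = pcov k ** transpose (matC P) ** transpose (kgain k)" "ncov k = kgain k ** matC P ** pcov k"
proof -
  show 1: "ncov k = pcov k ** transpose (matC P) ** transpose (kgain k)" by (simp add: ncov_def kgain)
  have "transpose (ncov k) = ncov k"
    by (simp add: ncov_def matrix_transpose_mul innov_cov_sym matrix_mul_assoc)
  then have "ncov k = transpose (pcov k ** transpose (matC P) ** transpose (kgain k))" using 1 by simp
  then show "ncov k = kgain k ** matC P ** pcov k"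
    by (simp add: matrix_transpose_mul pcov_sym matrix_mul_assoc)
qed

text \<open>The prediction error is the filtering error plus an uncorrelated correction. The proof
  is purely algebraic and so holds at \<open>Suc (horizon P)\<close> too, where no measurement
  source exists.\<close>

lemma fcov_ncov: "fcov (pcov k) + ncov k = pcov k"
proof -
  let ?W = "kgain k" and ?C = "matC P" and ?S = "pcov k"
  have "fcov ?S = ?S - ?W ** ?C ** ?S - ?S ** transpose ?C ** transpose ?W
      + ?W ** (?C ** ?S ** transpose ?C + covv P) ** transpose ?W"
    by (simp add: fcov_def kgain_def[symmetric] matrix_mult_simps transpose_simps matrix_transpose_mul matrix_mul_assoc algebra_simps)
  also have "?W ** (?C ** ?S ** transpose ?C + covv P) ** transpose ?W = ncov k" by (simp add: ncov_def innov_cov_def)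
  finally show ?thesis by (simp add: ncov_eq[symmetric])
qed

text \<open>Invertibility makes the solution of the normal equation unique, so the chosen gain is
  the one with the explicit inverse. The range includes \<open>Suc (horizon P)\<close>, since the
  last \<open>cost_term\<close> contains the gain of that time.\<close>

lemma pcov_cov_pred:
  assumes inv: "\<forall>k\<le>Suc (horizon P). invertible (innov_cov P (cov_pred P k))" and k: "k \<le> Suc (horizon P)"
  shows "pcov k = cov_pred P k" "kgain k = gainW P k" "fcov (pcov k) = cov_filt P k"
proof -
  have g: "gain (pcov k) = W_of P (pcov k)" if "pcov k = cov_pred P k" "k \<le> Suc (horizon P)" for k
    unfolding W_of_def
    by (rule inverse_unique_right) (use inv that gain[OF pcov_psd, of k] in auto)
  have f: "fcov (pcov k) = filt_of P (pcov k)" if "pcov k = cov_pred P k" "k \<le> Suc (horizon P)" for k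
    unfolding fcov_def filt_of_def g[OF that] ..
  have p: "pcov k = cov_pred P k" if "k \<le> Suc (horizon P)" for k
    using that
  proof (induction k)
    case (Suc k)
    then have "pcov k = cov_pred P k" by simp
    then show ?case using f[of k] Suc.prems by simp
  qed simp
  show "pcov k = cov_pred P k" by (rule p[OF k])
  show "kgain k = gainW P k" using g[OF p[OF k] k] p[OF k] by (simp add: kgain_def gainW_def)
  show "fcov (pcov k) = cov_filt P k" using f[OF p[OF k] k] p[OF k] by (simp add: cov_filt_def)
qed

text \<open>By cyclicity of the trace and the prediction recursion for \<open>pcov (Suc k)\<close>,
  the two terms with factor 1 - p collapse to \<open>ZZ\<close> against \<open>ncov\<close>, and the
  three with factor p to \<open>XX\<close> against \<open>ncov\<close>.\<close>

lemma cost_term_eq: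
  assumes inv: "\<forall>k\<le>Suc (horizon P). invertible (innov_cov P (cov_pred P k))" and k: "k \<le> horizon P"
  shows "cost_term P \<mu> k = (1 - loss P) * trace (ricZ P \<mu> (Suc k) ** ncov (Suc k)) + loss P * trace (ricX P \<mu> (Suc k) ** ncov (Suc k))
    + trace (Qmu P \<mu> ** fcov (pcov k))"
proof -
  let ?A = "matA P" and ?C = "matC P" and ?S = "fcov (pcov k)" and ?W = "kgain (Suc k)"
  let ?Z = "ricZ P \<mu> (Suc k)" and ?X = "ricX P \<mu> (Suc k)"
  have e: "cov_filt P k = ?S" "gainW P (Suc k) = ?W"
    using pcov_cov_pred(3)[OF inv, of k] pcov_cov_pred(2)[OF inv, of "Suc k"] k by auto
  have tr: "trace (c *\<^sub>R T) = c * trace T" for c and T :: "real^'n^'n"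
    by (simp add: trace_def sum_distrib_left)
  have cyc: "trace (U ** ?A) = trace (?A ** U)" for U by (rule trace_mul_sym)
  have Z: "trace (?S ** transpose ?A ** ?Z ** ?W ** ?C ** ?A) + trace (covw P ** ?Z ** ?W ** ?C) = trace (?Z ** ncov (Suc k))"
  proof -
    have "trace (?S ** transpose ?A ** ?Z ** ?W ** ?C ** ?A) + trace (covw P ** ?Z ** ?W ** ?C)
        = trace (pcov (Suc k) ** (?Z ** ?W ** ?C))"
      unfolding cyc by (simp add: matrix_mult_simps trace_add matrix_mul_assoc)
    also have "\<dots> = trace ((?Z ** ?W ** ?C) ** pcov (Suc k))" by (rule trace_mul_sym)
    also have "\<dots> = trace (?Z ** ncov (Suc k))" by (simp only: ncov_eq(2) matrix_mul_assoc)
    finally show ?thesis .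
  qed
  have X: "trace (?S ** transpose ?A ** transpose ?C ** transpose ?W ** ?X ** ?W ** ?C ** ?A)
      + trace (covw P ** transpose ?C ** transpose ?W ** ?X ** ?W ** ?C) + trace (covv P ** transpose ?W ** ?X ** ?W) = trace (?X ** ncov (Suc k))"
  proof -
    have "trace (?S ** transpose ?A ** transpose ?C ** transpose ?W ** ?X ** ?W ** ?C ** ?A)
        + trace (covw P ** transpose ?C ** transpose ?W ** ?X ** ?W ** ?C)
        = trace ((pcov (Suc k) ** transpose ?C ** transpose ?W ** ?X ** ?W) ** ?C)"
      unfolding cyc by (simp add: matrix_mult_simps trace_add matrix_mul_assoc)
    also have "\<dots> = trace (?C ** (pcov (Suc k) ** transpose ?C ** transpose ?W ** ?X ** ?W))" by (rule trace_mul_sym)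
    also have "\<dots> + trace (covv P ** transpose ?W ** ?X ** ?W) = trace ((innov_cov P (pcov (Suc k)) ** transpose ?W) ** (?X ** ?W))"
      by (simp add: innov_cov_def matrix_mult_simps trace_add matrix_mul_assoc del: pcov.simps)
    also have "\<dots> = trace ((?X ** ?W) ** (innov_cov P (pcov (Suc k)) ** transpose ?W))" by (rule trace_mul_sym)
    also have "\<dots> = trace (?X ** ncov (Suc k))" by (simp only: ncov_def matrix_mul_assoc)
    finally show ?thesis .
  qed
  show ?thesis
    unfolding cost_term_def Let_def e trace_add tr Z[symmetric] X[symmetric] by (simp add: algebra_simps)
qed

end

section \<open>Cost and estimates of the optimal control\<close>

context flq_optimal
begin

text \<open>Errors and estimates are orthogonal, so the cost splits. The errors contribute traces of
  their covariances; the estimates are evaluated by telescoping \<open>xhat\<close> against itself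
  with \<open>s = 1\<close>.\<close>

lemma star_cost:
  assumes v: "star_like v"
  shows "cost P \<mu> v = Ph xhat 0 + (\<Sum>k<horizon P. noise (Suc k))
    + (\<Sum>k\<le>horizon P. trace (Qmu P \<mu> ** fcov (pcov k))) + trace (Gmu P \<mu> ** pcov (Suc (horizon P)))"
proof -
  let ?N = "horizon P"
  have av: "admissible P v" using v by (simp add: star_like_def)
  then have a: "adm (Suc ?N) v" by (simp add: admissible_adm)
  have ak: "adm k v" if "k \<le> Suc ?N" for k using a adm_mono that by blast
  have sv: "sqint (Om P) (state P v k)" if "k \<le> Suc ?N" for k using sqint_state[OF ak[OF that] that] .
  have ctl: "sqint (Om P) (fst v k)" "sqint (Om P) (snd v k)" "snd v k \<in> borel_measurable (FR P v k)" if "k \<le> ?N" for k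
    using a that by (auto simp: adm_def)
  have AEv: "AE w in Om P. fst v k w = UL k w" "AE w in Om P. snd v k w = UR k w" if "k \<le> ?N" for k
    using v that by (auto simp: star_like_def)
  have oU: "orth2 (Om P) (D k) (UR k)" if k: "k \<le> ?N" for k
  proof -
    have kS: "k \<le> Suc ?N" using k by simp
    have "orth2 (Om P) (D k) (snd v k)"
      by (rule ortho_orth2(1)[OF subalgebra_FR[OF ak[OF kS] k] dd_ortho_FR[OF ak[OF kS] k] chan_sqint(1)[OF k] ctl(2,3)[OF k]])
    moreover have "AE w in Om P. UR k w = snd v k w" using AEv(2)[OF k] by eventually_elim simp
    ultimately show ?thesis by (rule orth2_cong_AE[OF _ _ chan_sqint(1)[OF k] ctl(2)[OF k] U_sqint(2)[OF k]])
  qed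
  have cross_free: "qf (Om P) S (\<lambda>w. X w + E w) (\<lambda>w. X w + E w) = qf (Om P) S X X + qf (Om P) S E E"
    if "sqint (Om P) X" "sqint (Om P) E" "orth2 (Om P) E X" for S :: "real^'n^'n" and X E
  proof -
    have "qf (Om P) S X E = 0" "qf (Om P) S E X = 0"
      using qf_orth2[OF orth2_sym[OF that(3)] that(1,2)] qf_orth2[OF that(3) that(2,1)] by auto
    then show ?thesis by (simp add: qf_add_left[OF that(1,2) sqint_add[OF that(1,2)]] qf_add_right that)
  qed
  have st: "stg (state P v k) (fst v k) (snd v k) (state P v k) (fst v k) (snd v k)
      = (qf (Om P) (Qmu P \<mu>) (xhat k) (xhat k) - \<mu> * (mm k \<bullet> (matQ P *v mn (xhat k)))
      + qf (Om P) (matRL P) (UL k) (UL k) + qf (Om P) (matRR P) (UR k) (UR k)) + trace (Qmu P \<mu> ** fcov (pcov k))" if k: "k \<le> ?N" for k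
  proof -
    have kS: "k \<le> Suc ?N" using k by simp
    have "qf (Om P) (Qmu P \<mu>) (state P v k) (state P v k) = qf (Om P) (Qmu P \<mu>) (\<lambda>w. xhat k w + err k w) (\<lambda>w. xhat k w + err k w)"
      by (intro qf_cong_AE star_state(1)[OF v k] sv kS sqint_add xhat_sqint sqint_err k)
    also have "\<dots> = qf (Om P) (Qmu P \<mu>) (xhat k) (xhat k) + qf (Om P) (Qmu P \<mu>) (err k) (err k)"
      by (intro cross_free xhat_sqint sqint_err k err_orth xhat_GG)
    also have "qf (Om P) (Qmu P \<mu>) (err k) (err k) = trace (Qmu P \<mu> ** fcov (pcov k))"
      unfolding err_def qf_vlin vcov_ef[OF k] ..
    finally have 1: "qf (Om P) (Qmu P \<mu>) (state P v k) (state P v k) = qf (Om P) (Qmu P \<mu>) (xhat k) (xhat k) + trace (Qmu P \<mu> ** fcov (pcov k))" .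
    have 2: "qf (Om P) (matRL P) (fst v k) (fst v k) = qf (Om P) (matRL P) (UL k) (UL k)"
      by (intro qf_cong_AE AEv ctl U_sqint k)
    have 3: "qf (Om P) (matRR P) (snd v k) (snd v k) = qf (Om P) (matRR P) (UR k) (UR k)"
      by (intro qf_cong_AE AEv ctl U_sqint k)
    show ?thesis unfolding stg_def 1 2 3 star_mean(1)[OF v k] mean_xhat[OF k] by simp
  qed
  have fn: "fin (state P v (Suc ?N)) (state P v (Suc ?N)) = qf (Om P) (Gmu P \<mu>) (xbar ?N) (xbar ?N)
      - \<mu> * ((A3 ?N *v mm ?N) \<bullet> (matQ P *v mn (xbar ?N))) + trace (Gmu P \<mu> ** pcov (Suc ?N))"
  proof -
    have se: "sqint (Om P) eterm" unfolding eterm_def by (rule vlin_sqint)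
    have xb: "xbar ?N \<in> borel_measurable (GG (Suc ?N) (Suc ?N))" by (rule xbar_GG)
    have "qf (Om P) (Gmu P \<mu>) (state P v (Suc ?N)) (state P v (Suc ?N)) = qf (Om P) (Gmu P \<mu>) (\<lambda>w. xbar ?N w + eterm w) (\<lambda>w. xbar ?N w + eterm w)"
      by (intro qf_cong_AE star_state(2)[OF v] sv order_refl sqint_add xbar_sqint se)
    also have "\<dots> = qf (Om P) (Gmu P \<mu>) (xbar ?N) (xbar ?N) + qf (Om P) (Gmu P \<mu>) eterm eterm"
      by (intro cross_free xbar_sqint se eterm_orth xb order_refl)
    also have "qf (Om P) (Gmu P \<mu>) eterm eterm = trace (Gmu P \<mu> ** pcov (Suc ?N))"
      unfolding eterm_def qf_vlin vcov_ep[OF order_refl] ..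
    finally show ?thesis unfolding fin_def star_mean(2)[OF v] mean_xbar[OF order_refl] by simp
  qed
  have "Ph xhat 0 + 1 * (\<Sum>k<?N. noise (Suc k)) =
    (\<Sum>k\<le>?N. qf (Om P) (Qmu P \<mu>) (xhat k) (xhat k) - \<mu> * (mm k \<bullet> (matQ P *v mn (xhat k)))
      + qf (Om P) (matRL P) (UL k) (UL k) + qf (Om P) (matRR P) (UR k) (UR k))
    + qf (Om P) (Gmu P \<mu>) (xbar ?N) (xbar ?N) - \<mu> * ((A3 ?N *v mm ?N) \<bullet> (matQ P *v mn (xbar ?N)))"
    by (rule telescope) (auto simp: control_step xhat_Suc xhat_sqint xhat_GG U_sqint U_GG oU)
  then show ?thesis
    unfolding cost_eq[OF av] fn using st by (simp add: sum.distrib del: state.simps pcov.simps)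
qed

lemma star_cost_formula:
  assumes v: "star_like v" and inv: "\<forall>k\<le>Suc (horizon P). invertible (innov_cov P (cov_pred P k))"
  shows "cost P \<mu> v = Ph xhat 0 + (\<Sum>k\<le>horizon P. cost_term P \<mu> k) + terminal_term P \<mu>"
proof -
  let ?N = "horizon P"
  \<comment> \<open>At the last stage the next weights \<open>ZZ\<close> and \<open>XX\<close> both
    equal \<open>Gmu\<close>, so the channel probabilities add up to 1 and a single trace is
    left.\<close>
  have ct: "cost_term P \<mu> k = (if k = ?N then trace (Gmu P \<mu> ** ncov (Suc ?N)) else noise (Suc k)) + trace (Qmu P \<mu> ** fcov (pcov k))"
    if k: "k \<le> ?N" for k
  proof (cases "k = ?N")
    case True
    then show ?thesis by (simp add: cost_term_eq[OF inv] terminal algebra_simps)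
  next
    case False
    then have "Suc k \<le> ?N" using k by simp
    then show ?thesis using False by (simp add: cost_term_eq[OF inv k] noise_def qf_nu)
  qed
  have "(\<Sum>k\<le>?N. cost_term P \<mu> k) = (\<Sum>k\<le>?N. if k = ?N then trace (Gmu P \<mu> ** ncov (Suc ?N)) else noise (Suc k))
      + (\<Sum>k\<le>?N. trace (Qmu P \<mu> ** fcov (pcov k)))"
    using ct by (simp add: sum.distrib)
  also have "(\<Sum>k\<le>?N. if k = ?N then trace (Gmu P \<mu> ** ncov (Suc ?N)) else noise (Suc k))
      = (\<Sum>k<?N. noise (Suc k)) + trace (Gmu P \<mu> ** ncov (Suc ?N))"
    unfolding lessThan_Suc_atMost[symmetric] by simp
  \<comment> \<open>The last \<open>cost_term\<close> charges only the correction by a fictitious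
    measurement after the horizon, whereas the true terminal error has the full prediction
    covariance. By \<open>fcov_ncov\<close> the difference is \<open>terminal_term\<close>.\<close>
  also have "trace (Gmu P \<mu> ** ncov (Suc ?N)) = trace (Gmu P \<mu> ** pcov (Suc ?N)) - terminal_term P \<mu>"
  proof -
    have "terminal_term P \<mu> = trace (Gmu P \<mu> ** fcov (pcov (Suc ?N)))"
      using pcov_cov_pred(3)[OF inv, of "Suc ?N"] by (simp add: terminal_term_def)
    moreover have "trace (Gmu P \<mu> ** pcov (Suc ?N)) = trace (Gmu P \<mu> ** (fcov (pcov (Suc ?N)) + ncov (Suc ?N)))"
      by (simp only: fcov_ncov)
    ultimately show ?thesis by (simp add: matrix_mult_simps trace_add del: pcov.simps)
  qed
  finally show ?thesis using star_cost[OF v] by simp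
qed

text \<open>The state minus the proposed remote estimate is the gap plus the local error, and both
  are orthogonal to the remote information.\<close>

lemma star_estimates:
  assumes v: "star_like v" and k: "k \<le> horizon P"
  shows "AE w in Om P. estL P v k w = xhat k w" "AE w in Om P. estR P v k w = mm k + Rr k w" "mn (estR P v k) = mm k"
    "sqint (Om P) (estR P v k)" "sqint (Om P) (estL P v k)"
proof -
  have a: "adm (Suc (horizon P)) v" using v by (simp add: star_like_def admissible_adm)
  have ak: "adm k v" using adm_mono[OF a] k by simp
  have eq: "\<forall>j<k. AE w in Om P. fst v j w = UL j w \<and> snd v j w = UR j w" using v k by (auto simp: star_like_def)
  have "AE w in Om P. cpart v k w = cpart ustar k w" by (rule cpart_cong_AE) (use eq in simp)
  with estL_AE[OF ak k] show L: "AE w in Om P. estL P v k w = xhat k w"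
    by eventually_elim (simp add: xhat_eq[OF k])
  obtain g where g: "g \<in> borel_measurable (FR P v k)" "AE w in Om P. g w = Rr k w"
    using remote_recover[OF ak k eq] by blast
  have sub: "subalgebra (Om P) (FR P v k)" by (rule subalgebra_FR[OF ak k])
  have gM: "g \<in> borel_measurable (Om P)" by (rule measurable_from_subalg[OF sub g(1)])
  have sg: "sqint (Om P) g" by (rule sqint_cong_AE[OF chan_sqint(2)[OF k] g(2) gM])
  have sx: "sqint (Om P) (state P v k)" using sqint_state[OF ak] k by simp
  have sy: "sqint (Om P) (\<lambda>w. mm k + g w)" by (intro sqint_add sqint_const sg)
  have "AE w in Om P. estR P v k w = mm k + g w"
    unfolding estR_def
  proof (rule cond_exp_vec_eqI[OF sub sx sy])
    show "(\<lambda>w. mm k + g w) \<in> borel_measurable (FR P v k)" using g(1) by simp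
    have "ortho (Om P) (FR P v k) (\<lambda>w. D k w + err k w)"
      by (intro ortho_add dd_ortho_FR ak k chan_sqint sqint_err sub
          ortho_mono[OF ortho_err[of k "Suc k"] order_trans[OF FR_sets_FL FL_GG[OF ak k]]]) (use k in simp)
    moreover have "AE w in Om P. state P v k w - (mm k + g w) = D k w + err k w"
      using star_state(1)[OF v k] g(2) by eventually_elim (simp add: xhat_def)
    ultimately show "ortho (Om P) (FR P v k) (\<lambda>w. state P v k w - (mm k + g w))"
      by (rule ortho_cong_AE) (intro sqint_measurable[OF sqint_add[OF chan_sqint(1)[OF k] sqint_err]] sqint_measurable[OF sqint_diff[OF sx sy]] sub)+
  qed
  with g(2) show R: "AE w in Om P. estR P v k w = mm k + Rr k w" by eventually_elim simp
  have "estR P v k \<in> borel_measurable (FR P v k)" "estL P v k \<in> borel_measurable (FL P v k)"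
    unfolding estR_def estL_def by (rule cond_exp_vec_measurable)+
  then have m: "estR P v k \<in> borel_measurable (Om P)" "estL P v k \<in> borel_measurable (Om P)"
    using measurable_from_subalg[OF sub] measurable_from_subalg[OF subalgebra_FL[OF ak k]] by auto
  have sR: "sqint (Om P) (\<lambda>w. mm k + Rr k w)" by (intro sqint_add sqint_const chan_sqint k)
  show "sqint (Om P) (estR P v k)" by (rule sqint_cong_AE[OF sR R m(1)])
  show "sqint (Om P) (estL P v k)" by (rule sqint_cong_AE[OF xhat_sqint[OF k] L m(2)])
  have "mn (estR P v k) = mn (\<lambda>w. mm k + Rr k w)" by (rule integral_cong_AE[OF m(1) sqint_measurable[OF sR] R])
  then show "mn (estR P v k) = mm k"
    using integral_add_sqint[OF sqint_const chan_sqint(2)[OF k], of "mm k"] mean_rr[OF k] by (simp add: prob_space)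
qed

lemma gainKbar_eq: "gainKbar P \<mu> k = KV k - gainK P \<mu> k"
  by (simp add: gainKbar_def KV_def gainK_def K_of_def Upsilon_def)

lemma star_controls:
  assumes v: "star_like v" and k: "k \<le> horizon P"
  shows "AE w in Om P. snd v k w = - blockR (gainK P \<mu> k *v estR P v k w + gainKbar P \<mu> k *v mn (estR P v k)) \<and>
    fst v k w = - blockL (gainK P \<mu> k *v estR P v k w + gainKbar P \<mu> k *v mn (estR P v k))
      - (matrix_inv (Lambda P \<mu> k) ** gainL P \<mu> k) *v (estL P v k w - estR P v k w)"
proof -
  have "AE w in Om P. fst v k w = UL k w \<and> snd v k w = UR k w" using v k by (simp add: star_like_def)
  with star_estimates(1,2)[OF v k] show ?thesis
  proof eventually_elim
    case (elim w)
    have "gainK P \<mu> k *v estR P v k w + gainKbar P \<mu> k *v mn (estR P v k) = - UU k w"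
      unfolding elim(2) star_estimates(3)[OF v k] gainKbar_eq
      by (simp add: UU_def matrix_vector_right_distrib matrix_vector_mult_diff_rdistrib)
    moreover have "estL P v k w - estR P v k w = D k w" unfolding elim(1,2) by (simp add: xhat_def)
    ultimately show ?case using elim(3) by (simp add: UL_def UR_def block_simps KL_def)
  qed
qed

text \<open>The local error at time 0 is orthogonal to the bracket, and at the mean the weights
  \<open>ZZ\<close> and \<open>SS\<close> combine to \<open>VV\<close>; symmetry of the three
  weights then gives \<open>Ph xhat 0\<close>.\<close>

lemma star_initial_cost:
  assumes v: "star_like v"
  shows "integral\<^sup>L (Om P) (\<lambda>w. state P v 0 w \<bullet>
      (ZZ 0 *v estR P v 0 w + XX 0 *v (estL P v 0 w - estR P v 0 w) + SS 0 *v mn (estR P v 0))) = Ph xhat 0"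
proof -
  note e = star_estimates[OF v le0] and st = star_state(1)[OF v le0] and s = xhat_sqint[OF le0] and ch = chan_sqint[OF le0]
  have sy: "transpose (ZZ 0) = ZZ 0" "transpose (XX 0) = XX 0" "transpose (VV 0) = VV 0"
    using order[of 0] by (auto simp: riccati_order_def)
  define Y where "Y w = ZZ 0 *v Rr 0 w + XX 0 *v D 0 w + VV 0 *v mm 0" for w
  have sY: "sqint (Om P) Y" unfolding Y_def[abs_def] by (intro sqint_add sqint_matrix_vector_mult ch sqint_const)
  have mY: "Y \<in> borel_measurable (GG (Suc 0) (Suc 0))"
    unfolding Y_def[abs_def] by (intro borel_measurable_add borel_measurable_matrix_vector_mult chan_dd_GG borel_measurable_const)
  have a: "adm (Suc (horizon P)) v" using v by (simp add: star_like_def admissible_adm)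
  have s0: "sqint (Om P) (state P v 0)" by (rule sqint_state[OF adm_mono[OF a le0] le0])
  have AEY: "AE w in Om P. ZZ 0 *v estR P v 0 w + XX 0 *v (estL P v 0 w - estR P v 0 w) + SS 0 *v mn (estR P v 0) = Y w"
    using e(1,2)
  proof eventually_elim
    case (elim w)
    have "estL P v 0 w - estR P v 0 w = D 0 w" unfolding elim by (simp add: xhat_def)
    then show ?case unfolding elim(2) e(3) by (simp add: Y_def VV_def matrix_vector_right_distrib matrix_vector_mult_add_rdistrib)
  qed
  have sE: "sqint (Om P) (\<lambda>w. ZZ 0 *v estR P v 0 w + XX 0 *v (estL P v 0 w - estR P v 0 w) + SS 0 *v mn (estR P v 0))"
    by (intro sqint_add sqint_matrix_vector_mult sqint_diff e(4,5) sqint_const)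
  have sxe: "sqint (Om P) (\<lambda>w. xhat 0 w + err 0 w)" by (intro sqint_add s sqint_err)
  have "integral\<^sup>L (Om P) (\<lambda>w. state P v 0 w \<bullet>
      (ZZ 0 *v estR P v 0 w + XX 0 *v (estL P v 0 w - estR P v 0 w) + SS 0 *v mn (estR P v 0))) = (LINT w|Om P. (xhat 0 w + err 0 w) \<bullet> Y w)"
  proof (rule integral_cong_AE)
    show "AE w in Om P. state P v 0 w \<bullet> (ZZ 0 *v estR P v 0 w + XX 0 *v (estL P v 0 w - estR P v 0 w) + SS 0 *v mn (estR P v 0)) = (xhat 0 w + err 0 w) \<bullet> Y w"
      using st AEY by eventually_elim simp
  qed (intro borel_measurable_integrable sqint_integrable_inner s0 sE sxe sY)+
  also have "\<dots> = (LINT w|Om P. xhat 0 w \<bullet> Y w) + (LINT w|Om P. err 0 w \<bullet> Y w)"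
    by (simp add: inner_add_left sqint_integrable_inner s sqint_err sY)
  also have "(LINT w|Om P. err 0 w \<bullet> Y w) = 0"
    by (intro orth2_inner err_orth sqint_err sY mY le0)
  also have "(LINT w|Om P. xhat 0 w \<bullet> Y w) = qf (Om P) (ZZ 0) (xhat 0) (Rr 0) + qf (Om P) (XX 0) (xhat 0) (D 0) + qf (Om P) (VV 0) (xhat 0) (\<lambda>_. mm 0)"
    unfolding Y_def qf_def inner_add_right
    using sqint_integrable_quadratic[OF s ch(2), of "ZZ 0"] sqint_integrable_quadratic[OF s ch(1), of "XX 0"] sqint_integrable_quadratic[OF s sqint_const[of "mm 0"], of "VV 0"]
    by (simp only: Bochner_Integration.integral_add Bochner_Integration.integrable_add)
  also have "\<dots> = Ph xhat 0"
    unfolding Ph_def using qf_sym[OF sy(1)] qf_sym[OF sy(2)] qf_sym[OF sy(3)] by metis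
  finally show ?thesis by simp
qed

end

theorem theorem2:
  fixes P :: "('w, 'n::finite, 'l::finite, 'r::finite) flq" and \<mu> :: real
  assumes "flq_model P" and "0 \<le> \<mu>"
  shows "(has_unique_solution P \<mu> \<longleftrightarrow>
            (\<forall>k\<le>horizon P. sym_pd (Mmat P \<mu> k) \<and> sym_pd (Upsilon P \<mu> k) \<and> sym_pd (Lambda P \<mu> k))) \<and>
         ((\<forall>k\<le>horizon P. sym_pd (Mmat P \<mu> k) \<and> sym_pd (Upsilon P \<mu> k) \<and> sym_pd (Lambda P \<mu> k)) \<longrightarrow>
            (\<forall>u. is_solution P \<mu> u \<longrightarrow>
               (\<forall>k\<le>horizon P. AE w in Om P.
                  snd u k w =
                    - blockR (gainK P \<mu> k *v estR P u k w
                              + gainKbar P \<mu> k *v integral\<^sup>L (Om P) (estR P u k)) \<and>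
                  fst u k w =
                    - blockL (gainK P \<mu> k *v estR P u k w
                              + gainKbar P \<mu> k *v integral\<^sup>L (Om P) (estR P u k))
                    - (matrix_inv (Lambda P \<mu> k) ** gainL P \<mu> k)
                        *v (estL P u k w - estR P u k w)) \<and>
               ((\<forall>k\<le>Suc (horizon P). invertible (innov_cov P (cov_pred P k))) \<longrightarrow>
                  cost P \<mu> u =
                    integral\<^sup>L (Om P) (\<lambda>w. state P u 0 w \<bullet>
                       (ricZ P \<mu> 0 *v estR P u 0 w
                        + ricX P \<mu> 0 *v (estL P u 0 w - estR P u 0 w)
                        + ricS P \<mu> 0 *v integral\<^sup>L (Om P) (estR P u 0)))
                    + (\<Sum>k\<le>horizon P. cost_term P \<mu> k) + terminal_term P \<mu>)))"
proof -
  interpret flq_riccati P \<mu> using assms by unfold_locales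
  show ?thesis
    unfolding pos_cond_def[symmetric]
  proof (intro conjI iffI impI allI)
    show "pos_cond" if "has_unique_solution P \<mu>" using that by (rule unique_imp_pos_cond)
  next
    assume pos_cond
    then interpret flq_optimal P \<mu> by unfold_locales
    show "has_unique_solution P \<mu>" by (rule unique_solution)
  next
    fix u k
    assume pc: pos_cond and u: "is_solution P \<mu> u" and k: "k \<le> horizon P"
    interpret flq_optimal P \<mu> using pc by unfold_locales
    obtain v where "star_like v" using star_like_exists by blast
    then have "star_like u" using star_optimal(2) u by blast
    from star_controls[OF this k]
    show "AE w in Om P.
                  snd u k w =
                    - blockR (gainK P \<mu> k *v estR P u k w
                              + gainKbar P \<mu> k *v integral\<^sup>L (Om P) (estR P u k)) \<and>
                  fst u k w =
                    - blockL (gainK P \<mu> k *v estR P u k w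
                              + gainKbar P \<mu> k *v integral\<^sup>L (Om P) (estR P u k))
                    - (matrix_inv (Lambda P \<mu> k) ** gainL P \<mu> k)
                        *v (estL P u k w - estR P u k w)" .
  next
    fix u
    assume pc: pos_cond and u: "is_solution P \<mu> u"
      and inv: "\<forall>k\<le>Suc (horizon P). invertible (innov_cov P (cov_pred P k))"
    interpret flq_optimal P \<mu> using pc by unfold_locales
    obtain v where "star_like v" using star_like_exists by blast
    then have s: "star_like u" using star_optimal(2) u by blast
    show "cost P \<mu> u =
                    integral\<^sup>L (Om P) (\<lambda>w. state P u 0 w \<bullet>
                       (ricZ P \<mu> 0 *v estR P u 0 w
                        + ricX P \<mu> 0 *v (estL P u 0 w - estR P u 0 w)
                        + ricS P \<mu> 0 *v integral\<^sup>L (Om P) (estR P u 0)))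
                    + (\<Sum>k\<le>horizon P. cost_term P \<mu> k) + terminal_term P \<mu>"
      unfolding star_initial_cost[OF s] by (rule star_cost_formula[OF s inv])
  qed
qed

end
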